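(* Let $a>1$ be a fixed real number such that $a^x \notin \mathbb{Q}$ for every positive integer $x$, and let $N>0$ be a fixed real number. For $A \in [0,N]$ and $n \geq 1$, let $\lambda_n = \lambda_n(A)$ be the Kolmogorov stochasticity parameter of the $n$ numbers $aA, a^2A, \dots, a^nA$ reduced modulo $N$, calculated with respect to the uniform distribution on $[0,N]$. Then $$\lim_{n\to\infty} \mathbb{P}\bigl(A \in [0,N] :\ \lambda_n(A) \leq X\bigr) = \Phi(X) \qquad \text{for all } X \in \mathbb{R},$$ where $\mathbb{P}$ denotes the normalized Lebesgue measure on $[0,N]$ (i.e. Lebesgue measure divided by $N$) and $\Phi$ is the distribution function of the Kolmogorov distribution.
   Context: For a real number $y$, "$y$ reduced modulo $N$" means $y - N\lfloor y/N\rfloor \in [0,N)$. For $A\in[0,N]$ and $n\ge 1$, let $y_x = a^xA - N\lfloor a^xA/N\rfloor$ for $x=1,\dots,n$, and let the empirical counting function be $C_n(X) = \#\{1\le x\le n : y_x \le X\}$ for $X\in\mathbb{R}$. The theoretical counting function for the uniform distribution on $[0,N]$ is $C_0(X) = n\,\mathbb{P}(U\le X)$ where $U$ is uniform on $[0,N]$, i.e. $C_0(X)=0$ for $X<0$, $C_0(X)=nX/N$ for $0\le X\le N$, and $C_0(X)=n$ for $X>N$. The Kolmogorov stochasticity parameter is $\lambda_n = \frac{1}{\sqrt{n}}\sup_{X\in\mathbb{R}} |C_n(X)-C_0(X)|$. The Kolmogorov distribution function is $\Phi(X) = \sum_{k=-\infty}^{\infty} (-1)^k e^{-2k^2X^2}$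 for $X>0$ (and $\Phi(X)=0$ for $X\le 0$); equivalently it is the distribution function of $\sup_{t\in[0,1]}|B(t)|$ for a standard Brownian bridge $B$ on $[0,1]$. *)

theory Defs
  imports "HOL-Probability.Probability"
begin

definition reduce_mod :: "real \<Rightarrow> real \<Rightarrow> real" where
  "reduce_mod N y = y - N * real_of_int \<lfloor>y / N\<rfloor>"

text \<open>Normalized Lebesgue measure on \<open>[0, N]\<close>, as a measure on the whole line. The events
  measured below are Borel, so nothing depends on the choice of \<open>lebesgue\<close> over \<open>lborel\<close>.\<close>

definition uniform_on :: "real \<Rightarrow> real measure" where
  "uniform_on N = uniform_measure lebesgue {0..N}"

definition empirical_count :: "(nat \<Rightarrow> real) \<Rightarrow> nat \<Rightarrow> real \<Rightarrow> nat" where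
  "empirical_count y n X = card {x \<in> {1..n}. y x \<le> X}"

definition theoretical_count :: "real measure \<Rightarrow> nat \<Rightarrow> real \<Rightarrow> real" where
  "theoretical_count M n X = real n * cdf M X"

definition stochasticity_parameter :: "real measure \<Rightarrow> (nat \<Rightarrow> real) \<Rightarrow> nat \<Rightarrow> real" where
  "stochasticity_parameter M y n =
     (SUP X. \<bar>real (empirical_count y n X) - theoretical_count M n X\<bar>) / sqrt (real n)"

definition geometric_lambda :: "real \<Rightarrow> real \<Rightarrow> nat \<Rightarrow> real \<Rightarrow> real" where
  "geometric_lambda a N n A =
     stochasticity_parameter (uniform_on N) (\<lambda>x. reduce_mod N (a ^ x * A)) n"

definition kolmogorov_cdf :: "real \<Rightarrow> real" where
  "kolmogorov_cdf X =
     (if X > 0 then \<Sum>\<^sub>\<infinity>k::int. (- 1) powi k * exp (- 2 * (real_of_int k)\<^sup>2 * X\<^sup>2) else 0)"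

lemma cdf_uniform_on:
  assumes "N > 0"
  shows "cdf (uniform_on N) X = (if X < 0 then 0 else if X \<le> N then X / N else 1)"
proof -
  have "{0..N} \<inter> {..X} = {0..min N X}" by auto
  then have "cdf (uniform_on N) X = measure lebesgue {0..min N X} / N"
    using assms unfolding cdf_def uniform_on_def
    by (subst measure_uniform_measure) (auto simp: emeasure_lborel_Icc)
  then show ?thesis using assms by (auto simp: min_def)
qed

lemma theoretical_count_uniform_on:
  assumes "N > 0"
  shows "theoretical_count (uniform_on N) n X =
    (if X < 0 then 0 else if X \<le> N then real n * X / N else real n)"
  using assms by (simp add: theoretical_count_def cdf_uniform_on)

text \<open>The supremum in the stochasticity parameter is over a bounded set, so the total operator
  \<open>Sup\<close> on the reals is the true supremum.\<close>

lemma bdd_above_count_diff: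
  assumes "N > 0"
  shows "bdd_above (range (\<lambda>X.
    \<bar>real (empirical_count y n X) - theoretical_count (uniform_on N) n X\<bar>))"
proof (rule bdd_aboveI2)
  fix X
  have "empirical_count y n X \<le> card {1..n}"
    unfolding empirical_count_def by (intro card_mono) auto
  moreover have "0 \<le> cdf (uniform_on N) X" "cdf (uniform_on N) X \<le> 1"
    using assms by (auto simp: cdf_uniform_on)
  then have "0 \<le> theoretical_count (uniform_on N) n X"
    "theoretical_count (uniform_on N) n X \<le> real n"
    by (auto simp: theoretical_count_def mult_left_le)
  ultimately show "\<bar>real (empirical_count y n X) - theoretical_count (uniform_on N) n X\<bar> \<le> real n"
    by auto
qed

end

theory Submission
  imports Defs "HOL-Real_Asymp.Real_Asymp"
begin

text \<open>With \<open>u = A / N\<close> uniform on \<open>[0, 1]\<close>, on an interval where the earlier terms \<open>f (a ^ k * u)\<close> are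
  constant the later ones average out, so sums over blocks separated by logarithmic gaps behave like
  martingale differences. Irrationality of \<open>a ^ d\<close> makes rotations equidistribute, which kills the pair
  correlations; characteristic functions of the increments of the empirical process on a dyadic grid then
  converge to those of the Brownian bridge, and fourth moments with dyadic chaining control the process
  between grid points. Brownian motion itself is never needed: the limit is compared with the bridge of
  the simple random walk, which has the same limiting characteristic functions and chaining bounds and
  whose maximum is computed exactly by reflection.\<close>

section \<open>Oscillating integrals\<close>

text \<open>Two length scales shape the proof. A weight built from terms up to index k jumps about
  a^k times, while a term of index l integrates to at most about a^(-l) over any interval, so a gap
  of 10 ln n / ln a indices makes the total coupling polynomially small. The fourth moment of an
  increment over a cell of length h is comparable with h^2 only for h >= n^(-3/5), because the error
  terms linear in h carry the squared logarithmic gap divided by n. Chaining therefore stops at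
  cells of that size, and monotonicity of the counting function covers the rest at cost sqrt n /
  n^(3/5), which tends to 0; any exponent strictly between 1/2 and 1 would serve. The events
  compared are symmetric in each partial sum, so their indicators are approximated by polynomials in
  cosines, whose expectations are combinations of real parts of characteristic functions. The two
  processes are compared with each other by one-sided inequalities with slack, and continuity of the
  limit function removes the slack at the end.\<close>

definition bdd_borel :: "(real \<Rightarrow> 'a::{banach, second_countable_topology}) \<Rightarrow> bool" where
  "bdd_borel f \<longleftrightarrow> f \<in> borel_measurable borel \<and> (\<exists>B. \<forall>x. norm (f x) \<le> B)"

named_theorems bdd_borel_intros

lemma bdd_borelI: "f \<in> borel_measurable borel \<Longrightarrow> (\<And>x. norm (f x) \<le> B) \<Longrightarrow> bdd_borel f"
  by (auto simp: bdd_borel_def)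

lemma bdd_borel_meas [measurable_dest]: "bdd_borel f \<Longrightarrow> f \<in> borel_measurable borel"
  by (simp add: bdd_borel_def)

lemma bdd_borel_const [bdd_borel_intros]: "bdd_borel (\<lambda>_. c)"
  by (auto simp: bdd_borel_def)

lemma bdd_borel_add [bdd_borel_intros]:
  assumes "bdd_borel f" "bdd_borel g" shows "bdd_borel (\<lambda>x. f x + g x)"
proof -
  obtain B C where "\<forall>x. norm (f x) \<le> B" "\<forall>x. norm (g x) \<le> C" using assms by (auto simp: bdd_borel_def)
  then have "norm (f x + g x) \<le> B + C" for x by (meson add_mono norm_triangle_le)
  then show ?thesis using assms by (auto simp: bdd_borel_def)
qed

lemma bdd_borel_scaleR [bdd_borel_intros]:
  assumes "bdd_borel f" "bdd_borel g" shows "bdd_borel (\<lambda>x. f x *\<^sub>R g x)"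
proof -
  obtain B C where B: "\<forall>x. norm (f x) \<le> B" "\<forall>x. norm (g x) \<le> C" using assms by (auto simp: bdd_borel_def)
  then have "0 \<le> B" using norm_ge_zero order_trans by blast
  then have "norm (f x *\<^sub>R g x) \<le> B * C" for x using B by (auto intro!: mult_mono)
  then show ?thesis using assms by (auto simp: bdd_borel_def)
qed

lemma bdd_borel_mult [bdd_borel_intros]:
  fixes f g :: "real \<Rightarrow> 'a::{banach, second_countable_topology, real_normed_algebra}"
  assumes "bdd_borel f" "bdd_borel g" shows "bdd_borel (\<lambda>x. f x * g x)"
proof -
  obtain B C where B: "\<forall>x. norm (f x) \<le> B" "\<forall>x. norm (g x) \<le> C" using assms by (auto simp: bdd_borel_def)
  then have "0 \<le> B" using norm_ge_zero order_trans by blast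
  then have "norm (f x * g x) \<le> B * C" for x using B by (meson mult_mono norm_ge_zero norm_mult_ineq order_trans)
  then show ?thesis using assms by (auto simp: bdd_borel_def)
qed

lemma bdd_borel_power [bdd_borel_intros]:
  fixes f :: "real \<Rightarrow> real"
  assumes "bdd_borel f" shows "bdd_borel (\<lambda>x. f x ^ n)"
  by (induction n) (auto intro!: bdd_borel_intros assms)

lemma bdd_borel_uminus [bdd_borel_intros]:
  assumes "bdd_borel f" shows "bdd_borel (\<lambda>x. - f x)"
  using bdd_borel_scaleR[OF bdd_borel_const[of "-1::real"] assms] by simp

lemma bdd_borel_diff [bdd_borel_intros]:
  assumes "bdd_borel f" "bdd_borel g" shows "bdd_borel (\<lambda>x. f x - g x)"
  using bdd_borel_add[OF assms(1) bdd_borel_uminus[OF assms(2)]] by simp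

lemma bdd_borel_sum [bdd_borel_intros]:
  assumes "\<And>i. i \<in> I \<Longrightarrow> bdd_borel (f i)" shows "bdd_borel (\<lambda>x. \<Sum>i\<in>I. f i x)"
  using assms by (induction I rule: infinite_finite_induct) (auto intro!: bdd_borel_intros)

lemma bdd_borel_norm [bdd_borel_intros]:
  assumes "bdd_borel f" shows "bdd_borel (\<lambda>x. norm (f x))"
  using assms by (auto simp: bdd_borel_def)

lemma bdd_borel_abs [bdd_borel_intros]:
  assumes "bdd_borel f" shows "bdd_borel (\<lambda>x. \<bar>f x :: real\<bar>)"
  using assms by (auto simp: bdd_borel_def)

lemma bdd_borel_cis [bdd_borel_intros]:
  assumes "bdd_borel f" shows "bdd_borel (\<lambda>x. cis (f x))"
  using assms by (intro bdd_borelI[of _ 1]) (auto dest!: bdd_borel_meas simp: cis_conv_exp)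

lemma bdd_borel_affine:
  assumes "bdd_borel f" shows "bdd_borel (\<lambda>x. f (c * x))" "bdd_borel (\<lambda>x. f (t + c * x))" "bdd_borel (\<lambda>x. f (t + x))"
  using assms by (auto simp: bdd_borel_def)

lemma bdd_borel_of_real [bdd_borel_intros]:
  assumes "bdd_borel f" shows "bdd_borel (\<lambda>x. complex_of_real (f x))"
  using assms by (auto simp: bdd_borel_def)

section \<open>Integration of bounded Borel functions over compact intervals\<close>

lemma set_integrable_bdd_borel [intro]:
  assumes "bdd_borel f" shows "set_integrable lborel {c..d} f"
proof -
  obtain B where "\<forall>x. norm (f x) \<le> B" using assms by (auto simp: bdd_borel_def)
  moreover have "set_integrable lborel {c..d} (\<lambda>_. B)"
    by (rule borel_integrable_atLeastAtMost') auto
  ultimately show ?thesis 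
    by (elim set_integrable_bound) (use assms in \<open>auto simp: bdd_borel_def set_borel_measurable_def intro!: AE_I2 order.trans[OF _ abs_ge_self]\<close>)
qed

lemma set_integral_split:
  assumes "bdd_borel f" "a \<le> b" "b \<le> c"
  shows "(LINT u:{a..c}|lborel. f u) = (LINT u:{a..b}|lborel. f u) + (LINT u:{b..c}|lborel. f u)"
proof -
  have "{a..c} = {a..b} \<union> {b..c}" using assms by auto
  moreover have "AE x in lborel. \<not> (x \<in> {a..b} \<and> x \<in> {b..c})"
    using AE_lborel_singleton[of b] by eventually_elim auto
  ultimately show ?thesis using assms(1) by (simp add: set_integral_Un_AE set_integrable_bdd_borel)
qed

text \<open>The endpoints form a null set; a weight can thus be treated as constant between two
  consecutive jumps, whatever its values at the jumps.\<close>

lemma set_integral_cong_open: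
  assumes "bdd_borel f" "bdd_borel g" "\<And>u. u \<in> {c<..<d} \<Longrightarrow> f u = g u"
  shows "(LINT u:{c..d}|lborel. f u) = (LINT u:{c..d}|lborel. g u)"
proof (rule set_lebesgue_integral_cong_AE)
  show "AE x\<in>{c..d} in lborel. f x = g x"
    using AE_lborel_singleton[of c] AE_lborel_singleton[of d] by eventually_elim (use assms in auto)
qed (use assms in \<open>auto simp: bdd_borel_def\<close>)

lemma set_integral_const_Icc: "c \<le> d \<Longrightarrow> (LINT u:{c..d}|lborel. (v::'a::{banach,second_countable_topology})) = (d - c) *\<^sub>R v"
  by (subst set_integral_const) auto

lemma norm_set_integral_le:
  assumes "bdd_borel f" shows "norm (LINT u:{c..d}|lborel. f u) \<le> (LINT u:{c..d}|lborel. norm (f u))"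
  using set_integral_norm_bound[OF set_integrable_bdd_borel[OF assms]] .

lemma set_integral_le:
  fixes f g :: "real \<Rightarrow> real"
  assumes "bdd_borel f" "bdd_borel g" "\<And>u. u \<in> {c..d} \<Longrightarrow> f u \<le> g u"
  shows "(LINT u:{c..d}|lborel. f u) \<le> (LINT u:{c..d}|lborel. g u)"
  by (rule set_integral_mono) (use assms in auto)

lemma set_integral_nonneg':
  fixes f :: "real \<Rightarrow> real"
  assumes "\<And>u. u \<in> {c..d} \<Longrightarrow> 0 \<le> f u"
  shows "0 \<le> (LINT u:{c..d}|lborel. f u)"
  unfolding set_lebesgue_integral_def using assms by (intro integral_nonneg_AE) (auto simp: indicator_def)

lemma norm_set_integral_le_const:
  assumes "bdd_borel f" "c \<le> d" "\<And>u. norm (f u) \<le> B" shows "norm (LINT u:{c..d}|lborel. f u) \<le> B * (d - c)"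
proof -
  have "norm (LINT u:{c..d}|lborel. f u) \<le> (LINT u:{c..d}|lborel. norm (f u))" by (rule norm_set_integral_le[OF assms(1)])
  also have "\<dots> \<le> (LINT u:{c..d}|lborel. B)" by (rule set_integral_le) (use assms in \<open>auto intro!: bdd_borel_intros\<close>)
  finally show ?thesis using assms by (simp add: set_integral_const_Icc mult.commute)
qed

text \<open>\<open>P\<close> is any set containing the jumps, possibly more, and closed intervals
  are tested, so the value at a point of \<open>P\<close> is unconstrained. The notion survives
  composition with any function and becomes a union for sums, which is how functions of a whole
  family of past terms are controlled.\<close>

definition piecewise_const :: "real set \<Rightarrow> (real \<Rightarrow> 'a) \<Rightarrow> bool" where
  "piecewise_const P g \<longleftrightarrow> (\<forall>x y. x \<le> y \<longrightarrow> {x..y} \<inter> P = {} \<longrightarrow> g x = g y)"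

text \<open>Decoupling of a fast factor \<open>H\<close> from a slow weight \<open>g\<close>.
  Between consecutive points of \<open>P\<close> the weight is a constant that leaves the integral,
  and the hypothesis on \<open>H\<close> applies to that piece. The contributions
  \<open>\<epsilon> * (y - x)\<close> reassemble to the integral of \<open>norm (g u)\<close>, and
  each of the \<open>card + 1\<close> pieces costs at most \<open>\<eta> * B\<close>.\<close>

lemma piecewise_pairing:
  fixes g :: "real \<Rightarrow> 'a::{banach,second_countable_topology}" and H :: "real \<Rightarrow> real"
  assumes pc: "piecewise_const P g" and g: "bdd_borel g" and H: "bdd_borel H"
    and B: "\<And>u. norm (g u) \<le> B" and \<eta>: "\<eta> \<ge> 0"
  shows "c \<le> d \<Longrightarrow> finite (P \<inter> {c<..<d}) \<Longrightarrow>
    (\<And>x y. c \<le> x \<Longrightarrow> x \<le> y \<Longrightarrow> y \<le> d \<Longrightarrow> \<bar>LINT u:{x..y}|lborel. H u\<bar> \<le> \<epsilon> * (y - x) + \<eta>) \<Longrightarrow>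
    norm (LINT u:{c..d}|lborel. H u *\<^sub>R g u)
      \<le> \<epsilon> * (LINT u:{c..d}|lborel. norm (g u)) + \<eta> * B * (real (card (P \<inter> {c<..<d})) + 1)"
proof (induction "card (P \<inter> {c<..<d})" arbitrary: c d rule: less_induct)
  case less
  have B0: "B \<ge> 0" using B[of 0] norm_ge_zero[of "g 0"] by linarith
  show ?case
  proof (cases "P \<inter> {c<..<d} = {}")
    case True
    define v where "v = g ((c + d) / 2)"
    have v: "g u = v" if "u \<in> {c<..<d}" for u
    proof -
      let ?m = "(c + d) / 2"
      have m: "c < ?m" "?m < d" using that by auto
      have "{min u ?m..max u ?m} \<inter> P = {}" using True that m by (auto simp: min_def max_def split: if_splits)
      then have "g (min u ?m) = g (max u ?m)" using pc unfolding piecewise_const_def by (metis max.cobounded1 min.coboundedI1)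
      then show ?thesis by (auto simp: v_def min_def max_def split: if_splits)
    qed
    have "(LINT u:{c..d}|lborel. H u *\<^sub>R g u) = (LINT u:{c..d}|lborel. H u *\<^sub>R v)"
      by (rule set_integral_cong_open) (auto intro!: bdd_borel_intros g H simp: v)
    also have "\<dots> = (LINT u:{c..d}|lborel. H u) *\<^sub>R v"
      using set_integrable_bdd_borel[OF H, of c d] unfolding set_lebesgue_integral_def set_integrable_def
      by (subst integral_scaleR_left[symmetric]) simp_all
    finally have "norm (LINT u:{c..d}|lborel. H u *\<^sub>R g u) = \<bar>LINT u:{c..d}|lborel. H u\<bar> * norm v" by simp
    also have "\<dots> \<le> (\<epsilon> * (d - c) + \<eta>) * norm v" using less.prems by (intro mult_right_mono) auto
    also have "\<dots> = \<epsilon> * ((d - c) * norm v) + \<eta> * norm v" by (simp add: algebra_simps)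
    also have "(d - c) * norm v = (LINT u:{c..d}|lborel. norm v)" using less.prems by (simp add: set_integral_const_Icc)
    also have "\<dots> = (LINT u:{c..d}|lborel. norm (g u))"
      by (rule set_integral_cong_open) (auto intro!: bdd_borel_intros g simp: v)
    also have "\<eta> * norm v \<le> \<eta> * B" using B \<eta> by (auto simp: v_def intro!: mult_left_mono)
    finally show ?thesis using True by simp
  next
    case False
    then obtain p where p: "p \<in> P" "c < p" "p < d" by auto
    let ?A = "P \<inter> {c<..<p}" and ?B = "P \<inter> {p<..<d}"
    \<comment> \<open>The splitting point belongs to neither open half, so both counts drop and
      \<open>card + 1\<close> is additive over the two halves.\<close>
    have eq: "P \<inter> {c<..<d} = insert p (?A \<union> ?B)" using p by auto
    have fin: "finite ?A" "finite ?B" using less.prems(2) unfolding eq by auto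
    have card: "card (P \<inter> {c<..<d}) = Suc (card ?A + card ?B)"
      unfolding eq using fin by (subst card_insert_disjoint) (auto intro!: card_Un_disjoint)
    have "norm (LINT u:{c..d}|lborel. H u *\<^sub>R g u) \<le> norm (LINT u:{c..p}|lborel. H u *\<^sub>R g u) + norm (LINT u:{p..d}|lborel. H u *\<^sub>R g u)"
      using p by (subst set_integral_split[of _ c p d]) (auto intro!: bdd_borel_intros g H norm_triangle_ineq)
    also have "norm (LINT u:{c..p}|lborel. H u *\<^sub>R g u) \<le> \<epsilon> * (LINT u:{c..p}|lborel. norm (g u)) + \<eta> * B * (real (card ?A) + 1)"
      using p card fin less.prems by (intro less.hyps) auto
    also have "norm (LINT u:{p..d}|lborel. H u *\<^sub>R g u) \<le> \<epsilon> * (LINT u:{p..d}|lborel. norm (g u)) + \<eta> * B * (real (card ?B) + 1)"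
      using p card fin less.prems by (intro less.hyps) auto
    finally show ?thesis
      using p by (subst set_integral_split[of _ c p d]) (auto intro!: bdd_borel_intros g simp: card algebra_simps)
  qed
qed

lemma set_integral_affine:
  fixes f :: "real \<Rightarrow> real"
  assumes "l > 0"
  shows "(LINT v:{t + l * c..t + l * d}|lborel. f v) = l * (LINT u:{c..d}|lborel. f (t + l * u))"
proof -
  have "indicator {t + l * c..t + l * d} (t + l * x) = (indicator {c..d} x :: real)" for x
    using assms by (auto simp: indicator_def)
  then show ?thesis unfolding set_lebesgue_integral_def using assms
    by (subst lborel_integral_real_affine[of l _ t]) auto
qed

section \<open>Integrals of functions of period one\<close>

locale periodic_fun =
  fixes f :: "real \<Rightarrow> real"
  assumes bdd [bdd_borel_intros]: "bdd_borel f" and per: "\<And>x. f (x + 1) = f x"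
begin

lemma per_nat: "f (x + real n) = f x"
proof (induction n)
  case (Suc n)
  have "f (x + real (Suc n)) = f ((x + real n) + 1)" by (simp add: add_ac)
  then show ?case using per Suc by metis
qed simp

lemma per_int: "f (x + of_int k) = f x"
proof (cases "k \<ge> 0")
  case True then show ?thesis using per_nat[of x "nat k"] by simp
next
  case False then show ?thesis using per_nat[of "x + of_int k" "nat (-k)"] by simp
qed

lemma integral_shift_int: "(LINT u:{c + of_int k..d + of_int k}|lborel. f u) = (LINT u:{c..d}|lborel. f u)"
  using set_integral_affine[of 1 "of_int k" c d f] per_int by (simp add: add.commute)

lemma integral_period: "(LINT u:{c..c+1}|lborel. f u) = (LINT u:{0..1}|lborel. f u)"
proof -
  define k where "k = \<lceil>c\<rceil>"
  have k: "c \<le> k" "k \<le> c + 1" unfolding k_def by linarith+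
  have "(LINT u:{c..c+1}|lborel. f u) = (LINT u:{c..k}|lborel. f u) + (LINT u:{k..c+1}|lborel. f u)"
    using k by (intro set_integral_split bdd) auto
  also have "(LINT u:{c..k}|lborel. f u) = (LINT u:{c+1..of_int k+1}|lborel. f u)"
    using integral_shift_int[of c 1 k] by simp
  also have "\<dots> + (LINT u:{k..c+1}|lborel. f u) = (LINT u:{of_int k..of_int k+1}|lborel. f u)"
    using k by (subst set_integral_split[OF bdd, of "of_int k" "c+1" "of_int k + 1"]) auto
  also have "\<dots> = (LINT u:{0..1}|lborel. f u)"
    using integral_shift_int[of 0 k 1] by (simp add: add.commute)
  finally show ?thesis .
qed

lemma integral_periods: "(LINT u:{c..c+real n}|lborel. f u) = n * (LINT u:{0..1}|lborel. f u)"
proof (induction n)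
  case 0
  show ?case using set_integral_split[OF bdd, of c c c] by simp
next
  case (Suc n)
  then show ?case using integral_period[of "c + n"] 
    by (subst set_integral_split[OF bdd, of _ "c + n"]) (auto simp: algebra_simps)
qed

end

lemma (in periodic_fun) periodic_fun_abs: "periodic_fun (\<lambda>x. \<bar>f x\<bar>)"
  by unfold_locales (auto intro!: bdd_borel_intros simp: per)

lemma (in periodic_fun) integral_nonneg_le:
  assumes nn: "\<And>x. f x \<ge> 0" and "c \<le> d"
  shows "(LINT u:{c..d}|lborel. f u) \<le> (d - c + 1) * (LINT u:{0..1}|lborel. f u)"
proof -
  define n where "n = nat \<lceil>d - c\<rceil>"
  have n: "d \<le> c + n" "n \<le> d - c + 1" using assms(2) unfolding n_def by linarith+
  have "(LINT u:{c..d}|lborel. f u) \<le> (LINT u:{c..d}|lborel. f u) + (LINT u:{d..c+n}|lborel. f u)"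
    using nn by (simp add: set_integral_nonneg')
  also have "\<dots> = n * (LINT u:{0..1}|lborel. f u)"
    using n assms by (subst set_integral_split[symmetric, OF bdd]) (auto simp: integral_periods)
  also have "\<dots> \<le> (d - c + 1) * (LINT u:{0..1}|lborel. f u)"
    using n nn by (intro mult_right_mono set_integral_nonneg') auto
  finally show ?thesis .
qed

text \<open>Whole periods contribute exactly their mean, and the leftover piece, at most one period
  long, contributes at most the integral of \<open>\<bar>f\<bar>\<close>. The bound does not grow
  with the interval, which after rescaling becomes a factor \<open>1 / a ^ k\<close>.\<close>

lemma (in periodic_fun) integral_near_mean:
  assumes "c \<le> d"
  shows "\<bar>(LINT u:{c..d}|lborel. f u) - (d - c) * (LINT u:{0..1}|lborel. f u)\<bar> \<le> 2 * (LINT u:{0..1}|lborel. \<bar>f u\<bar>)"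
    and "(LINT u:{0..1}|lborel. f u) = 0 \<Longrightarrow> \<bar>LINT u:{c..d}|lborel. f u\<bar> \<le> (LINT u:{0..1}|lborel. \<bar>f u\<bar>)"
proof -
  interpret A: periodic_fun "\<lambda>x. \<bar>f x\<bar>" by (rule periodic_fun_abs)
  define n where "n = nat \<lfloor>d - c\<rfloor>"
  define e where "e = c + n"
  have n: "c + n \<le> d" "d \<le> c + n + 1" using assms(1) unfolding n_def by linarith+
  have eq: "(LINT u:{c..d}|lborel. f u) = n * (LINT u:{0..1}|lborel. f u) + (LINT u:{e..d}|lborel. f u)"
    using n by (subst set_integral_split[OF bdd, of c e d]) (auto simp: e_def integral_periods)
  have "\<bar>LINT u:{e..d}|lborel. f u\<bar> \<le> (LINT u:{e..d}|lborel. \<bar>f u\<bar>)"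
    using norm_set_integral_le[OF bdd, of e d] by simp
  also have "\<dots> \<le> (LINT u:{e..d}|lborel. \<bar>f u\<bar>) + (LINT u:{d..e+1}|lborel. \<bar>f u\<bar>)"
    by (simp add: set_integral_nonneg')
  also have "\<dots> = (LINT u:{e..e+1}|lborel. \<bar>f u\<bar>)"
    using n by (subst set_integral_split[symmetric, OF A.bdd]) (auto simp: e_def)
  also have "\<dots> = (LINT u:{0..1}|lborel. \<bar>f u\<bar>)" by (rule A.integral_period)
  finally have le: "\<bar>LINT u:{e..d}|lborel. f u\<bar> \<le> (LINT u:{0..1}|lborel. \<bar>f u\<bar>)" .
  then show "(LINT u:{0..1}|lborel. f u) = 0 \<Longrightarrow> \<bar>LINT u:{c..d}|lborel. f u\<bar> \<le> (LINT u:{0..1}|lborel. \<bar>f u\<bar>)"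
    using eq by simp
  have m: "\<bar>LINT u:{0..1}|lborel. f u\<bar> \<le> (LINT u:{0..1}|lborel. \<bar>f u\<bar>)"
    using norm_set_integral_le[OF bdd, of 0 1] by simp
  have "(LINT u:{c..d}|lborel. f u) - (d - c) * (LINT u:{0..1}|lborel. f u)
     = (LINT u:{e..d}|lborel. f u) - (d - c - n) * (LINT u:{0..1}|lborel. f u)" using eq by (simp add: algebra_simps)
  also have "\<bar>\<dots>\<bar> \<le> \<bar>LINT u:{e..d}|lborel. f u\<bar> + \<bar>d - c - n\<bar> * \<bar>LINT u:{0..1}|lborel. f u\<bar>"
    by (metis abs_mult abs_triangle_ineq4)
  also have "\<bar>d - c - n\<bar> * \<bar>LINT u:{0..1}|lborel. f u\<bar> \<le> 1 * (LINT u:{0..1}|lborel. \<bar>f u\<bar>)"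
    using n m by (intro mult_mono) auto
  finally show "\<bar>(LINT u:{c..d}|lborel. f u) - (d - c) * (LINT u:{0..1}|lborel. f u)\<bar> \<le> 2 * (LINT u:{0..1}|lborel. \<bar>f u\<bar>)"
    using le by simp
qed

section \<open>Dilates of a mean-zero function: scaling, correlations, second moments\<close>

lemma set_integral_scale:
  fixes f :: "real \<Rightarrow> real"
  assumes "l > 0"
  shows "(LINT u:{c..d}|lborel. f (l * u)) = (LINT v:{l * c..l * d}|lborel. f v) / l"
  using set_integral_affine[OF assms, of 0 c d f] assms by simp

lemma set_integral_sum':
  assumes "\<And>i. i \<in> I \<Longrightarrow> bdd_borel (g i)"
  shows "(LINT u:{c..d}|lborel. (\<Sum>i\<in>I. g i u)) = (\<Sum>i\<in>I. LINT u:{c..d}|lborel. g i u :: real)"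
  using assms
proof (induction I rule: infinite_finite_induct)
  case (insert x F)
  then show ?case by (simp add: set_integral_add(2) set_integrable_bdd_borel bdd_borel_sum)
qed (auto simp: set_lebesgue_integral_def)

lemma piecewise_const_comp: "piecewise_const P g \<Longrightarrow> piecewise_const P (\<lambda>u. h (g u))"
  unfolding piecewise_const_def by metis

lemma piecewise_const_sum:
  fixes g :: "'i \<Rightarrow> real \<Rightarrow> 'a::comm_monoid_add"
  assumes "\<And>i. i \<in> I \<Longrightarrow> piecewise_const (P i) (g i)"
  shows "piecewise_const (\<Union>i\<in>I. P i) (\<lambda>u. \<Sum>i\<in>I. g i u)"
  using assms unfolding piecewise_const_def by (intro allI impI sum.cong) blast+

lemma sum_power_le:
  fixes \<rho> :: real
  assumes "finite K" "\<And>k. k \<in> K \<Longrightarrow> k0 \<le> k" "0 < \<rho>" "\<rho> < 1"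
  shows "(\<Sum>k\<in>K. \<rho> ^ k) \<le> \<rho> ^ k0 / (1 - \<rho>)"
proof -
  have inj: "inj_on (\<lambda>k. k - k0) K" using assms(2) by (auto simp: inj_on_def) (metis eq_diff_iff)
  have "\<rho> ^ k0 * \<rho> ^ (k - k0) = \<rho> ^ k" if "k \<in> K" for k
    using assms(2)[OF that] by (simp flip: power_add)
  then have "(\<Sum>k\<in>K. \<rho> ^ k) = (\<Sum>j\<in>(\<lambda>k. k - k0) ` K. \<rho> ^ k0 * \<rho> ^ j)"
    by (subst sum.reindex[OF inj]) simp
  also have "\<dots> = \<rho> ^ k0 * (\<Sum>j\<in>(\<lambda>k. k - k0) ` K. \<rho> ^ j)" by (simp add: sum_distrib_left)
  also have "\<dots> \<le> \<rho> ^ k0 * (\<Sum>j. \<rho> ^ j)"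
    using assms by (intro mult_left_mono sum_le_suminf summable_geometric) auto
  finally show ?thesis using assms by (simp add: suminf_geometric)
qed

text \<open>\<open>V\<close> bounds the mean of \<open>\<bar>f\<bar>\<close>, \<open>B\<close> its
  supremum, and \<open>r\<close> the number of possible jumps per unit length. \<open>V\<close> is
  kept apart from \<open>B\<close> because the fourth moment has to become small with the length of
  a cell, and that length enters through \<open>V\<close> alone.\<close>

locale geom_osc = periodic_fun f for f :: "real \<Rightarrow> real" +
  fixes a V r B :: real and P :: "real set"
  assumes a: "a > 1" and V: "(LINT u:{0..1}|lborel. \<bar>f u\<bar>) \<le> V"
    and zero: "(LINT u:{0..1}|lborel. f u) = 0" and B: "\<And>u. \<bar>f u\<bar> \<le> B"
    and pc: "piecewise_const P f" and r: "r \<ge> 0"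
    and card: "\<And>c d. c \<le> d \<Longrightarrow> finite (P \<inter> {c..d}) \<and> card (P \<inter> {c..d}) \<le> r * (d - c + 1)"
begin

definition \<rho> where "\<rho> = 1 / a"
definition fk :: "nat \<Rightarrow> real \<Rightarrow> real" where "fk k u = f (a ^ k * u)"
definition Pk :: "nat \<Rightarrow> real set" where "Pk k = {u. a ^ k * u \<in> P}"

lemma rho: "0 < \<rho>" "\<rho> < 1" using a by (auto simp: \<rho>_def)
lemma a_pow: "a ^ k > 0" "a ^ k \<ge> 1" using a by auto
lemma rho_pow: "1 / a ^ k = \<rho> ^ k" by (simp add: \<rho>_def power_one_over)

lemma V0: "V \<ge> 0" using V set_integral_nonneg'[of 0 1 "\<lambda>u. \<bar>f u\<bar>"] by simp
lemma B0: "B \<ge> 0" using B[of 0] by linarith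

lemma fk_bdd [bdd_borel_intros]: "bdd_borel (fk k)"
  unfolding fk_def by (intro bdd_borel_affine bdd)

lemma fk_B: "\<bar>fk k u\<bar> \<le> B" by (simp add: fk_def B)

lemma integral_fk: 
  assumes "c \<le> d" shows "\<bar>LINT u:{c..d}|lborel. fk k u\<bar> \<le> V * \<rho> ^ k"
proof -
  have "\<bar>LINT u:{c..d}|lborel. fk k u\<bar> = \<bar>LINT v:{a^k * c..a^k * d}|lborel. f v\<bar> / a ^ k"
    unfolding fk_def using a_pow[of k] by (subst set_integral_scale) auto
  also have "\<dots> \<le> V / a ^ k"
    using a_pow[of k] assms integral_near_mean(2)[of "a^k*c" "a^k*d", OF _ zero] V by (intro divide_right_mono) auto
  finally show ?thesis by (simp add: rho_pow[symmetric])
qed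

text \<open>Bounding one factor of the square by \<open>B\<close> leaves the integral of
  \<open>\<bar>f\<bar>\<close>, so the estimate stays linear in \<open>V\<close>.\<close>

lemma integral_fk_sq: 
  assumes "c \<le> d" shows "(LINT u:{c..d}|lborel. (fk k u)\<^sup>2) \<le> B * V * ((d - c) + \<rho> ^ k)"
proof -
  interpret A: periodic_fun "\<lambda>x. \<bar>f x\<bar>" by (rule periodic_fun_abs)
  have "(LINT u:{c..d}|lborel. (fk k u)\<^sup>2) \<le> (LINT u:{c..d}|lborel. B * \<bar>fk k u\<bar>)"
  proof (rule set_integral_le)
    fix u
    have "(fk k u)\<^sup>2 = \<bar>fk k u\<bar> * \<bar>fk k u\<bar>" by (simp add: power2_eq_square)
    also have "\<dots> \<le> B * \<bar>fk k u\<bar>" by (rule mult_right_mono[OF fk_B]) simp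
    finally show "(fk k u)\<^sup>2 \<le> B * \<bar>fk k u\<bar>" .
  qed (intro bdd_borel_intros)+
  also have "\<dots> = B * (LINT u:{c..d}|lborel. \<bar>fk k u\<bar>)" by simp
  also have "(LINT u:{c..d}|lborel. \<bar>fk k u\<bar>) = (LINT v:{a^k * c..a^k * d}|lborel. \<bar>f v\<bar>) / a ^ k"
    unfolding fk_def using a_pow[of k] by (subst set_integral_scale) auto
  also have "\<dots> \<le> ((a^k * d - a^k * c + 1) * V) / a ^ k"
    using a_pow[of k] assms 
    by (intro divide_right_mono order.trans[OF A.integral_nonneg_le] mult_left_mono V) auto
  also have "\<dots> = V * ((d - c) + \<rho> ^ k)"
  proof -
    have "a ^ k \<noteq> 0" using a by simp
    then show ?thesis by (simp add: rho_pow[symmetric] field_simps)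
  qed
  finally show ?thesis using B0 by (simp add: mult_left_mono mult.assoc)
qed

lemma pc_fk: "piecewise_const (Pk k) (fk k)"
  unfolding piecewise_const_def
proof (intro allI impI)
  fix x y assume xy: "x \<le> y" "{x..y} \<inter> Pk k = {}"
  have "{a^k * x..a^k * y} \<inter> P = {}"
  proof (rule ccontr)
    assume "\<not> ?thesis" then obtain v where v: "v \<in> P" "a^k * x \<le> v" "v \<le> a^k * y" by auto
    then have "v / a^k \<in> {x..y} \<inter> Pk k" using a a_pow[of k] by (auto simp: Pk_def field_simps)
    then show False using xy by auto
  qed
  moreover have "a^k * x \<le> a^k * y" using xy a_pow[of k] by auto
  ultimately show "fk k x = fk k y" using pc unfolding piecewise_const_def fk_def by blast
qed

lemma card_Pk: 
  assumes "c \<le> d" shows "finite (Pk k \<inter> {c..d})" "card (Pk k \<inter> {c..d}) \<le> r * (a ^ k * (d - c) + 1)"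
proof -
  let ?h = "\<lambda>u. a ^ k * u"
  have inj: "inj_on ?h A" for A using a by (auto simp: inj_on_def)
  have im: "?h ` (Pk k \<inter> {c..d}) \<subseteq> P \<inter> {?h c..?h d}" using a_pow[of k] by (auto simp: Pk_def)
  have c: "?h c \<le> ?h d" using assms a_pow[of k] by auto
  have f: "finite (?h ` (Pk k \<inter> {c..d}))" using card[OF c] im finite_subset by blast
  then show "finite (Pk k \<inter> {c..d})" using inj finite_image_iff by blast
  have "card (Pk k \<inter> {c..d}) = card (?h ` (Pk k \<inter> {c..d}))" by (rule card_image[symmetric, OF inj])
  also have "\<dots> \<le> card (P \<inter> {?h c..?h d})" using card[OF c] im by (intro card_mono) auto
  finally show "card (Pk k \<inter> {c..d}) \<le> r * (a ^ k * (d - c) + 1)" using card[OF c] by (simp add: right_diff_distrib)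
qed

definition "C1 = (r + 1) * B * V"

lemma C1: "C1 \<ge> 0" using r B0 V0 by (simp add: C1_def)

text \<open>The slower factor has at most \<open>r * (a ^ k * (d - c) + 1)\<close> jumps, and on
  each piece the faster one integrates to at most \<open>V * \<rho> ^ l\<close>. Multiplying out
  gives decay in \<open>l - k\<close> for the bulk and a boundary term \<open>\<rho> ^ l\<close>;
  \<open>C1\<close> collects \<open>r + 1\<close>, the bound of the slow factor and
  \<open>V\<close>.\<close>

lemma integral_fk_fl_less:
  assumes "c \<le> d" "k < l"
  shows "\<bar>LINT u:{c..d}|lborel. fk k u * fk l u\<bar> \<le> C1 * (\<rho> ^ (l - k) * (d - c) + \<rho> ^ l)"
proof -
  have fin: "finite (Pk k \<inter> {c<..<d})" by (rule finite_subset[OF _ card_Pk(1)[OF assms(1)]]) auto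
  have "card (Pk k \<inter> {c<..<d}) \<le> card (Pk k \<inter> {c..d})" by (intro card_mono card_Pk assms) auto
  then have cd: "card (Pk k \<inter> {c<..<d}) \<le> r * (a ^ k * (d - c) + 1)" using card_Pk(2)[OF assms(1), of k] by linarith
  have "\<bar>LINT u:{c..d}|lborel. fk k u * fk l u\<bar> = norm (LINT u:{c..d}|lborel. fk l u *\<^sub>R fk k u)" by (simp add: mult.commute)
  also have "\<dots> \<le> 0 * (LINT u:{c..d}|lborel. norm (fk k u)) + (V * \<rho>^l) * B * (real (card (Pk k \<inter> {c<..<d})) + 1)"
    using integral_fk V0 rho fk_B by (intro piecewise_pairing[OF pc_fk] bdd_borel_intros assms fin) auto
  also have "\<dots> = (B * V * \<rho>^l) * (real (card (Pk k \<inter> {c<..<d})) + 1)" by simp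
  also have "\<dots> \<le> (B * V * \<rho>^l) * (r * (a ^ k * (d - c) + 1) + 1)"
    using cd V0 B0 rho by (intro mult_left_mono) auto
  also have "\<dots> \<le> (B * V * \<rho>^l) * ((r + 1) * (a ^ k * (d - c) + 1))"
    using V0 B0 rho a_pow[of k] assms by (intro mult_left_mono) (auto simp: algebra_simps)
  also have "\<dots> = C1 * (\<rho> ^ l * a ^ k * (d - c) + \<rho> ^ l)" by (simp add: C1_def algebra_simps)
  also have "\<rho> ^ l * a ^ k = \<rho> ^ (l - k)"
    using assms a by (simp add: \<rho>_def power_one_over field_simps flip: power_add)
  finally show ?thesis .
qed

text \<open>With truncated subtraction \<open>\<rho> ^ (l - k) * \<rho> ^ (k - l)\<close> is the
  power of \<open>\<rho>\<close> at the distance of \<open>k\<close> and \<open>l\<close>; the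
  diagonal case is the second moment of a single term.\<close>

lemma integral_fk_fl:
  assumes "c \<le> d"
  shows "\<bar>LINT u:{c..d}|lborel. fk k u * fk l u\<bar> \<le> C1 * ((\<rho> ^ (l - k) * \<rho> ^ (k - l)) * (d - c) + \<rho> ^ max k l)"
proof (cases k l rule: linorder_cases)
  case less then show ?thesis using integral_fk_fl_less[OF assms less] by (simp add: max_def)
next
  case greater then show ?thesis using integral_fk_fl_less[OF assms greater] by (simp add: max_def mult.commute)
next
  case equal
  have "\<bar>LINT u:{c..d}|lborel. fk k u * fk l u\<bar> = (LINT u:{c..d}|lborel. (fk k u)\<^sup>2)"
    using equal by (simp add: power2_eq_square set_integral_nonneg' abs_of_nonneg)
  also have "\<dots> \<le> (B * V) * ((d - c) + \<rho> ^ k)" by (rule integral_fk_sq[OF assms])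
  also have "\<dots> \<le> C1 * ((d - c) + \<rho> ^ k)"
  proof (rule mult_right_mono)
    show "B * V \<le> C1" using r B0 V0 by (simp add: C1_def algebra_simps)
    show "0 \<le> d - c + \<rho> ^ k" using assms rho by (simp add: add_nonneg_nonneg)
  qed
  finally show ?thesis using equal by simp
qed

definition T :: "nat set \<Rightarrow> real \<Rightarrow> real" where "T K u = (\<Sum>k\<in>K. fk k u)"

lemma T_bdd [bdd_borel_intros]: "bdd_borel (T K)"
  unfolding T_def by (intro bdd_borel_intros)

lemma T_le: "\<bar>T K u\<bar> \<le> card K * B"
  unfolding T_def using sum_bounded_above[of K "\<lambda>k. \<bar>fk k u\<bar>" B] fk_B by (intro order.trans[OF sum_abs]) auto

lemma integral_T:
  assumes "c \<le> d" "finite K" "\<And>k. k \<in> K \<Longrightarrow> k0 \<le> k"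
  shows "\<bar>LINT u:{c..d}|lborel. T K u\<bar> \<le> card K * V * \<rho> ^ k0"
proof -
  have "\<bar>LINT u:{c..d}|lborel. T K u\<bar> \<le> (\<Sum>k\<in>K. \<bar>LINT u:{c..d}|lborel. fk k u\<bar>)"
    unfolding T_def by (subst set_integral_sum') (auto intro!: bdd_borel_intros)
  also have "\<dots> \<le> (\<Sum>k\<in>K. V * \<rho> ^ k0)"
    using assms V0 rho
    by (intro sum_mono order.trans[OF integral_fk[OF assms(1)]] mult_left_mono power_decreasing) auto
  finally show ?thesis by simp
qed

text \<open>The factor \<open>2 / (1 - \<rho>)\<close> bounds the geometric series over the distance
  of two indices, taken on both sides.\<close>

definition "C2 = C1 * 2 / (1 - \<rho>)"

lemma C2: "C2 \<ge> 0" using C1 rho by (simp add: C2_def)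

lemma integral_T_sq_expand:
  shows "(LINT u:{c..d}|lborel. (T K u)\<^sup>2) = (\<Sum>k\<in>K. \<Sum>l\<in>K. LINT u:{c..d}|lborel. fk k u * fk l u)"
proof -
  have "(LINT u:{c..d}|lborel. (T K u)\<^sup>2) = (LINT u:{c..d}|lborel. (\<Sum>k\<in>K. \<Sum>l\<in>K. fk k u * fk l u))"
    by (simp add: T_def power2_eq_square sum_product)
  also have "\<dots> = (\<Sum>k\<in>K. \<Sum>l\<in>K. LINT u:{c..d}|lborel. fk k u * fk l u)"
    by (simp add: set_integral_sum' bdd_borel_intros)
  finally show ?thesis .
qed

lemma integral_T_sq:
  assumes "c \<le> d" "finite K" "\<And>k. k \<in> K \<Longrightarrow> k0 \<le> k"
  shows "(LINT u:{c..d}|lborel. (T K u)\<^sup>2) \<le> C2 * card K * ((d - c) + \<rho> ^ k0)"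
proof -
  have inner: "(\<Sum>l\<in>K. C1 * ((\<rho> ^ (l - k) * \<rho> ^ (k - l)) * (d - c) + \<rho> ^ max k l)) \<le> C2 * ((d - c) + \<rho> ^ k0)" if "k \<in> K" for k
  proof -
    have "(\<Sum>l\<in>K. \<rho> ^ (l - k) * \<rho> ^ (k - l)) \<le> (\<Sum>l\<in>{l\<in>K. l \<ge> k} \<union> {l\<in>K. l < k}. \<rho> ^ (l - k) * \<rho> ^ (k - l))"
      by (rule eq_refl, rule sum.cong) auto
    also have "\<dots> = (\<Sum>l\<in>{l\<in>K. l \<ge> k}. \<rho> ^ (l - k) * \<rho> ^ (k - l)) + (\<Sum>l\<in>{l\<in>K. l < k}. \<rho> ^ (l - k) * \<rho> ^ (k - l))"
      using assms(2) by (intro sum.union_disjoint) auto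
    also have "(\<Sum>l\<in>{l\<in>K. l \<ge> k}. \<rho> ^ (l - k) * \<rho> ^ (k - l)) = (\<Sum>j\<in>(\<lambda>l. l - k) ` {l\<in>K. l \<ge> k}. \<rho> ^ j)"
      by (subst sum.reindex) (auto simp: inj_on_def)
    also have "\<dots> \<le> \<rho> ^ 0 / (1 - \<rho>)" using assms(2) rho by (intro sum_power_le) auto
    also have "(\<Sum>l\<in>{l\<in>K. l < k}. \<rho> ^ (l - k) * \<rho> ^ (k - l)) = (\<Sum>j\<in>(\<lambda>l. k - l) ` {l\<in>K. l < k}. \<rho> ^ j)"
      by (subst sum.reindex) (auto simp: inj_on_def)
    also have "\<dots> \<le> \<rho> ^ 0 / (1 - \<rho>)" using assms(2) rho by (intro sum_power_le) auto
    finally have 1: "(\<Sum>l\<in>K. \<rho> ^ (l - k) * \<rho> ^ (k - l)) \<le> 2 / (1 - \<rho>)" by simp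
    have "(\<Sum>l\<in>K. \<rho> ^ max k l) \<le> (\<Sum>l\<in>K. \<rho> ^ l)" using rho by (intro sum_mono power_decreasing) auto
    also have "\<dots> \<le> \<rho> ^ k0 / (1 - \<rho>)" using assms rho by (intro sum_power_le) auto
    also have "\<dots> \<le> 2 / (1 - \<rho>) * \<rho> ^ k0" using rho by (simp add: field_simps)
    finally have 2: "(\<Sum>l\<in>K. \<rho> ^ max k l) \<le> 2 / (1 - \<rho>) * \<rho> ^ k0" .
    have "(\<Sum>l\<in>K. C1 * ((\<rho> ^ (l - k) * \<rho> ^ (k - l)) * (d - c) + \<rho> ^ max k l)) =
       C1 * ((\<Sum>l\<in>K. \<rho> ^ (l - k) * \<rho> ^ (k - l)) * (d - c) + (\<Sum>l\<in>K. \<rho> ^ max k l))"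
      by (simp add: sum_distrib_left sum_distrib_right sum.distrib distrib_left)
    also have "\<dots> \<le> C1 * (2 / (1 - \<rho>) * (d - c) + 2 / (1 - \<rho>) * \<rho> ^ k0)"
      using 1 2 C1 assms by (intro mult_left_mono add_mono mult_right_mono) auto
    also have "\<dots> = C2 * ((d - c) + \<rho> ^ k0)" by (simp add: C2_def divide_inverse algebra_simps)
    finally show ?thesis .
  qed
  have "(LINT u:{c..d}|lborel. (T K u)\<^sup>2) \<le> (\<Sum>k\<in>K. \<Sum>l\<in>K. C1 * ((\<rho> ^ (l - k) * \<rho> ^ (k - l)) * (d - c) + \<rho> ^ max k l))"
    unfolding integral_T_sq_expand
    by (intro sum_mono order.trans[OF _ integral_fk_fl[OF assms(1)]]) auto
  also have "\<dots> \<le> (\<Sum>k\<in>K. C2 * ((d - c) + \<rho> ^ k0))" by (intro sum_mono inner)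
  finally show ?thesis by (simp add: mult_ac)
qed

end

section \<open>Blocks separated by gaps\<close>

text \<open>Index blocks \<open>K j\<close> lie in windows of length \<open>p\<close>, with a gap
  \<open>q\<close> between consecutive windows and before the first. Blocks may be shorter than
  their window or empty, so the same structure describes windows cut off at \<open>n\<close> and
  families that end after finitely many blocks.\<close>

locale blocks =
  fixes K :: "nat \<Rightarrow> nat set" and s :: "nat \<Rightarrow> nat" and p q n :: nat
  assumes K_sub: "K j \<subseteq> {s j<..s j + p} \<inter> {1..n}" and s_gap: "s j + p + q \<le> s (Suc j)" and q_s0: "q \<le> s 0"
begin

lemma s_mono: "i \<le> j \<Longrightarrow> s i \<le> s j"
  by (rule lift_Suc_mono_le[of s]) (use s_gap add_leD1 in blast)

lemma q_s: "q \<le> s j" using q_s0 s_mono[of 0 j] by simp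

lemma finite_K [simp]: "finite (K j)" by (rule finite_subset[OF K_sub]) auto

lemma card_K: "card (K j) \<le> p"
proof -
  have "card (K j) \<le> card {s j<..s j + p}" using K_sub by (intro card_mono) auto
  then show ?thesis by simp
qed

definition U :: "nat \<Rightarrow> nat set" where "U J = (\<Union>j<J. K j)"

lemma U_Suc: "U (Suc J) = U J \<union> K J" by (auto simp: U_def lessThan_Suc)
lemma U_0 [simp]: "U 0 = {}" by (simp add: U_def)

lemma finite_U [simp]: "finite (U J)" by (simp add: U_def)

lemma U_sep: "k \<in> U J \<Longrightarrow> k + q \<le> s J"
proof -
  assume "k \<in> U J"
  then obtain j where j: "j < J" "k \<in> K j" by (auto simp: U_def)
  then have "k \<le> s j + p" using K_sub[of j] by auto
  then have "k + q \<le> s (Suc j)" using s_gap[of j] by simp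
  then show ?thesis using s_mono[of "Suc j" J] j by simp
qed

lemma U_disj: "U J \<inter> K J = {}"
proof -
  have "k \<notin> K J" if "k \<in> U J" for k
    using U_sep[OF that] K_sub[of J] by auto
  then show ?thesis by auto
qed

lemma U_sub: "U J \<subseteq> {1..n}" using K_sub by (auto simp: U_def)

lemma card_U: "card (U J) \<le> n" using card_mono[OF _ U_sub, of J] by simp

end

section \<open>Near independence of a block from the blocks before it\<close>

context geom_osc begin

text \<open>A past term of index \<open>k\<close> has at most \<open>2 * r * a ^ k\<close> jumps in
  the unit interval, and the gap turns \<open>\<rho> ^ k0 * a ^ k\<close> into at most
  \<open>\<rho> ^ q\<close>. Hence all past jumps together, weighted with the size of a future
  integral, are exponentially small in the gap.\<close>

lemma finite_card_Un_Pk: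
  assumes "finite K0" "K0 \<subseteq> {1..n}" "\<And>k. k \<in> K0 \<Longrightarrow> k + q \<le> k0"
  shows "finite ((\<Union>k\<in>K0. Pk k) \<inter> {0<..<1})"
    and "\<rho> ^ k0 * card ((\<Union>k\<in>K0. Pk k) \<inter> {0<..<1}) \<le> \<rho> ^ q * (2 * r * n)"
proof -
  have sub: "(\<Union>k\<in>K0. Pk k) \<inter> {0<..<1} \<subseteq> (\<Union>k\<in>K0. Pk k \<inter> {0..1})" by auto
  have fin: "finite (\<Union>k\<in>K0. Pk k \<inter> {0..1})" using assms(1) card_Pk(1)[of 0 1] by (intro finite_UN_I) auto
  show "finite ((\<Union>k\<in>K0. Pk k) \<inter> {0<..<1})" using finite_subset[OF sub fin] .
  have "card ((\<Union>k\<in>K0. Pk k) \<inter> {0<..<1}) \<le> card (\<Union>k\<in>K0. Pk k \<inter> {0..1})" by (rule card_mono[OF fin sub])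
  also have "\<dots> \<le> (\<Sum>k\<in>K0. card (Pk k \<inter> {0..1}))" by (rule card_UN_le[OF assms(1)])
  finally have "real (card ((\<Union>k\<in>K0. Pk k) \<inter> {0<..<1})) \<le> (\<Sum>k\<in>K0. real (card (Pk k \<inter> {0..1})))"
    by (metis of_nat_le_iff of_nat_sum)
  then have "\<rho> ^ k0 * card ((\<Union>k\<in>K0. Pk k) \<inter> {0<..<1}) \<le> \<rho> ^ k0 * (\<Sum>k\<in>K0. real (card (Pk k \<inter> {0..1})))"
    using rho by (intro mult_left_mono) auto
  also have "\<dots> = (\<Sum>k\<in>K0. \<rho> ^ k0 * real (card (Pk k \<inter> {0..1})))" by (rule sum_distrib_left)
  also have "\<dots> \<le> (\<Sum>k\<in>K0. \<rho> ^ q * (2 * r))"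
  proof (rule sum_mono)
    fix k assume k: "k \<in> K0"
    have "real (card (Pk k \<inter> {0..1})) \<le> r * (a ^ k + 1)" using card_Pk(2)[of 0 1 k] by simp
    also have "\<dots> \<le> r * (a ^ k + a ^ k)" using a_pow(2)[of k] r by (intro mult_left_mono) auto
    finally have "\<rho> ^ k0 * real (card (Pk k \<inter> {0..1})) \<le> \<rho> ^ k0 * (2 * r * a ^ k)" using rho by (intro mult_left_mono) auto
    also have "\<dots> = (\<rho> ^ k0 * a ^ k) * (2 * r)" by simp
    also have "\<rho> ^ k0 * a ^ k = \<rho> ^ (k0 - k)" using assms(3)[OF k] a
      by (simp add: \<rho>_def power_one_over field_simps flip: power_add)
    also have "\<rho> ^ (k0 - k) * (2 * r) \<le> \<rho> ^ q * (2 * r)" using assms(3)[OF k] rho r by (intro mult_right_mono power_decreasing) auto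
    finally show "\<rho> ^ k0 * real (card (Pk k \<inter> {0..1})) \<le> \<rho> ^ q * (2 * r)" .
  qed
  also have "\<dots> = real (card K0) * (\<rho> ^ q * (2 * r))" by simp
  also have "\<dots> \<le> real n * (\<rho> ^ q * (2 * r))"
    using card_mono[OF _ assms(2)] rho r by (intro mult_right_mono) auto
  finally show "\<rho> ^ k0 * card ((\<Union>k\<in>K0. Pk k) \<inter> {0<..<1}) \<le> \<rho> ^ q * (2 * r * n)" by (simp add: mult_ac)
qed

text \<open>The coupling between a block and its past: \<open>2 * r * n\<close> accounts for the
  jumps of at most \<open>n\<close> past terms, the summand 1 for there being one more piece than
  there are jumps.\<close>

definition "\<tau> n q = \<rho> ^ q * (2 * r * real n + 1)"

lemma tau0: "\<tau> n q \<ge> 0" using rho r by (simp add: \<tau>_def)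

text \<open>A substitute for conditioning: a function \<open>w\<close> of the past terms sees the
  future \<open>H\<close> only through its mean rate \<open>\<epsilon>\<close>, up to
  \<open>\<tau>\<close>. Choosing \<open>H\<close> as a block sum gives near orthogonality to the
  past, choosing its square gives control of the conditional variance.\<close>

lemma weighted_integral:
  fixes w :: "real \<Rightarrow> 'a::{banach,second_countable_topology}"
  assumes K0: "finite K0" "K0 \<subseteq> {1..n}" "\<And>k. k \<in> K0 \<Longrightarrow> k + q \<le> k0" and q: "q \<le> k0"
    and w: "piecewise_const (\<Union>k\<in>K0. Pk k) w" "bdd_borel w" "\<And>u. norm (w u) \<le> W"
    and H: "bdd_borel H" "\<And>x y. 0 \<le> x \<Longrightarrow> x \<le> y \<Longrightarrow> y \<le> 1 \<Longrightarrow> \<bar>LINT u:{x..y}|lborel. H u\<bar> \<le> \<epsilon> * (y - x) + \<eta> * \<rho> ^ k0"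
    and \<eta>: "\<eta> \<ge> 0"
  shows "norm (LINT u:{0..1}|lborel. H u *\<^sub>R w u) \<le> \<epsilon> * (LINT u:{0..1}|lborel. norm (w u)) + \<eta> * W * \<tau> n q"
proof -
  have W: "W \<ge> 0" using w(3)[of 0] norm_ge_zero order_trans by blast
  note c = finite_card_Un_Pk[OF K0]
  have "norm (LINT u:{0..1}|lborel. H u *\<^sub>R w u) \<le> \<epsilon> * (LINT u:{0..1}|lborel. norm (w u)) 
      + (\<eta> * \<rho> ^ k0) * W * (real (card ((\<Union>k\<in>K0. Pk k) \<inter> {0<..<1})) + 1)"
    by (rule piecewise_pairing[OF w(1,2) H(1) w(3)]) (use \<eta> rho c H in auto)
  also have "(\<eta> * \<rho> ^ k0) * W * (real (card ((\<Union>k\<in>K0. Pk k) \<inter> {0<..<1})) + 1)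
     = (\<eta> * W) * (\<rho> ^ k0 * real (card ((\<Union>k\<in>K0. Pk k) \<inter> {0<..<1})) + \<rho> ^ k0)" by (simp add: algebra_simps)
  also have "\<dots> \<le> (\<eta> * W) * (\<rho> ^ q * (2 * r * n) + \<rho> ^ q)"
    using c(2) \<eta> W rho q by (intro mult_left_mono add_mono power_decreasing) auto
  finally show ?thesis by (simp add: \<tau>_def algebra_simps)
qed

lemma pc_T: "piecewise_const (\<Union>k\<in>K. Pk k) (T K)"
  unfolding T_def by (rule piecewise_const_sum) (rule pc_fk)

lemma T_Un: "finite A \<Longrightarrow> finite C \<Longrightarrow> A \<inter> C = {} \<Longrightarrow> T (A \<union> C) u = T A u + T C u"
  unfolding T_def by (rule sum.union_disjoint)

lemma integral_T_sq_unit: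
  assumes "finite K" shows "(LINT u:{0..1}|lborel. (T K u)\<^sup>2) \<le> 2 * C2 * card K"
  using integral_T_sq[of 0 1 K 0] assms by simp

text \<open>Induction over the blocks, with \<open>x\<close> the past sum and \<open>t\<close> the
  new block. The term \<open>t * x ^ 3\<close> is nearly orthogonal,
  \<open>t\<^sup>2 * x\<^sup>2\<close> is bounded by a product of second moments, and the two higher
  powers of \<open>t\<close> are absorbed using \<open>\<bar>t\<bar> \<le> p\<close>, which produces
  the term cubic in \<open>p\<close>.\<close>

lemma fourth_moment_blocks:
  assumes "blocks K s p q n" and B1: "B = 1"
  shows "(LINT u:{0..1}|lborel. (T (blocks.U K J) u) ^ 4)
    \<le> J * (4 * (p * V * real n ^ 3 * \<tau> n q) + 8 * (C2 * p * (2 * C2 * n + real n ^ 2 * \<tau> n q)) + 6 * (real p ^ 3 * C2))"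
proof -
  interpret blocks K s p q n by fact
  show ?thesis
  proof (induction J)
    case 0 then show ?case by (simp add: T_def)
  next
    case (Suc J)
    define x where "x = T (U J)"
    define t where "t = T (K J)"
    have bd [bdd_borel_intros]: "bdd_borel x" "bdd_borel t" by (auto simp: x_def t_def intro!: bdd_borel_intros)
    have t_le: "\<bar>t u\<bar> \<le> p" for u using T_le[of "K J" u] card_K[of J] B1 by (simp add: t_def)
    have x_le: "\<bar>x u\<bar> \<le> n" for u using T_le[of "U J" u] card_U[of J] B1 by (simp add: x_def)
    have sep: "\<And>k. k \<in> U J \<Longrightarrow> k + q \<le> s J" by (rule U_sep)
    have ge: "\<And>k. k \<in> K J \<Longrightarrow> s J \<le> k" using K_sub[of J] by force
    \<comment> \<open>In the expansion the term with \<open>t ^ 3\<close> is split by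
      \<open>2 * x * t \<le> x\<^sup>2 + t\<^sup>2\<close>, which raises the coefficient of
      \<open>t\<^sup>2 * x\<^sup>2\<close> from 6 to 8 and that of \<open>t ^ 4\<close> from 1 to
      3.\<close>
    have pt: "(x u + t u) ^ 4 \<le> x u ^ 4 + 4 * (t u * x u ^ 3) + 8 * ((t u)\<^sup>2 * (x u)\<^sup>2) + 3 * (real p)\<^sup>2 * (t u)\<^sup>2" for u
    proof -
      have 1: "(t u)\<^sup>2 \<le> (real p)\<^sup>2" using t_le[of u] by (metis abs_le_square_iff abs_of_nat)
      have "0 \<le> (x u - t u)\<^sup>2" by simp
      then have "2 * x u * t u \<le> (x u)\<^sup>2 + (t u)\<^sup>2" by (simp add: power2_diff)
      then have "(2 * x u * t u) * (t u)\<^sup>2 \<le> ((x u)\<^sup>2 + (t u)\<^sup>2) * (t u)\<^sup>2" by (rule mult_right_mono) simp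
      moreover have "(t u)\<^sup>2 * (t u)\<^sup>2 \<le> (real p)\<^sup>2 * (t u)\<^sup>2" using 1 by (rule mult_right_mono) simp
      moreover have "(x u + t u) ^ 4 = x u ^ 4 + 4 * (t u * x u ^ 3) + 6 * ((t u)\<^sup>2 * (x u)\<^sup>2) + 2 * ((2 * x u * t u) * (t u)\<^sup>2) + (t u)\<^sup>2 * (t u)\<^sup>2"
        by (simp add: power4_eq_xxxx power3_eq_cube power2_eq_square algebra_simps)
      ultimately show ?thesis by (simp add: algebra_simps)
    qed
    have "(LINT u:{0..1}|lborel. (T (U (Suc J)) u) ^ 4) = (LINT u:{0..1}|lborel. (x u + t u) ^ 4)"
      unfolding U_Suc x_def t_def using U_disj by (simp add: T_Un)
    also have "\<dots> \<le> (LINT u:{0..1}|lborel. x u ^ 4 + 4 * (t u * x u ^ 3) + 8 * ((t u)\<^sup>2 * (x u)\<^sup>2) + 3 * (real p)\<^sup>2 * (t u)\<^sup>2)"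
      using pt by (intro set_integral_le bdd_borel_intros)
    also have "\<dots> = (LINT u:{0..1}|lborel. x u ^ 4) + 4 * (LINT u:{0..1}|lborel. t u * x u ^ 3)
       + 8 * (LINT u:{0..1}|lborel. (t u)\<^sup>2 * (x u)\<^sup>2) + 3 * (real p)\<^sup>2 * (LINT u:{0..1}|lborel. (t u)\<^sup>2)"
      by (simp add: set_integral_add(2) set_integrable_bdd_borel bdd_borel_intros)
    also have "(LINT u:{0..1}|lborel. t u * x u ^ 3) \<le> p * V * real n ^ 3 * \<tau> n q"
    proof -
      have "norm (LINT u:{0..1}|lborel. t u *\<^sub>R x u ^ 3) \<le> 0 * (LINT u:{0..1}|lborel. norm (x u ^ 3)) + (card (K J) * V) * real n ^ 3 * \<tau> n q"
      proof (rule weighted_integral[OF finite_U U_sub sep q_s])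
        show "piecewise_const (\<Union> (Pk ` U J)) (\<lambda>a. x a ^ 3)"
          unfolding x_def by (rule piecewise_const_comp[OF pc_T, where h = "\<lambda>x. x ^ 3"])
        show "norm (x u ^ 3) \<le> real n ^ 3" for u using power_mono[OF x_le[of u], of 3] by (simp add: power_abs)
        show "\<bar>LINT u:{a..b}|lborel. t u\<bar> \<le> 0 * (b - a) + real (card (K J)) * V * \<rho> ^ s J" if "a \<le> b" for a b
          using integral_T[OF that finite_K ge] by (simp add: t_def)
      qed (auto intro!: bdd_borel_intros simp: V0)
      also have "\<dots> = card (K J) * (V * real n ^ 3 * \<tau> n q)" by simp
      also have "\<dots> \<le> p * (V * real n ^ 3 * \<tau> n q)" using card_K V0 tau0 by (intro mult_right_mono) auto
      finally show ?thesis by simp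
    qed
    also have "(LINT u:{0..1}|lborel. (t u)\<^sup>2 * (x u)\<^sup>2) \<le> C2 * p * (2 * C2 * n + real n ^ 2 * \<tau> n q)"
    proof -
      have "norm (LINT u:{0..1}|lborel. (t u)\<^sup>2 *\<^sub>R (x u)\<^sup>2) \<le> (C2 * card (K J)) * (LINT u:{0..1}|lborel. norm ((x u)\<^sup>2)) + (C2 * card (K J)) * real n ^ 2 * \<tau> n q"
      proof (rule weighted_integral[OF finite_U U_sub sep q_s])
        show "piecewise_const (\<Union> (Pk ` U J)) (\<lambda>a. (x a)\<^sup>2)"
          unfolding x_def by (rule piecewise_const_comp[OF pc_T, where h = "\<lambda>x. x\<^sup>2"])
        show "norm ((x u)\<^sup>2) \<le> real n ^ 2" for u using power_mono[OF x_le[of u], of 2] by simp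
        show "\<bar>LINT u:{a..b}|lborel. (t u)\<^sup>2\<bar> \<le> C2 * card (K J) * (b - a) + C2 * card (K J) * \<rho> ^ s J" if "a \<le> b" for a b
          using integral_T_sq[OF that finite_K ge] by (simp add: t_def set_integral_nonneg' algebra_simps)
      qed (auto intro!: bdd_borel_intros simp: C2)
      also have "\<dots> = card (K J) * (C2 * ((LINT u:{0..1}|lborel. (x u)\<^sup>2) + real n ^ 2 * \<tau> n q))" by (simp add: algebra_simps)
      also have "\<dots> \<le> p * (C2 * ((LINT u:{0..1}|lborel. (x u)\<^sup>2) + real n ^ 2 * \<tau> n q))" 
        using card_K C2 tau0 by (intro mult_right_mono mult_nonneg_nonneg add_nonneg_nonneg set_integral_nonneg') auto
      also have "(LINT u:{0..1}|lborel. (x u)\<^sup>2) \<le> 2 * C2 * n"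
        unfolding x_def using C2 card_U[of J] by (intro order.trans[OF integral_T_sq_unit] mult_left_mono) auto
      finally show ?thesis using C2 by (simp add: mult_left_mono mult_ac)
    qed
    also have "(LINT u:{0..1}|lborel. (t u)\<^sup>2) \<le> 2 * C2 * p"
      unfolding t_def using C2 card_K[of J] by (intro order.trans[OF integral_T_sq_unit] mult_left_mono) auto
    finally have "(LINT u:{0..1}|lborel. (T (U (Suc J)) u) ^ 4) \<le> (LINT u:{0..1}|lborel. x u ^ 4)
       + 4 * (p * V * real n ^ 3 * \<tau> n q) + 8 * (C2 * p * (2 * C2 * n + real n ^ 2 * \<tau> n q)) + 3 * (real p)\<^sup>2 * (2 * C2 * p)"
      by (simp add: mult_left_mono)
    then show ?case using Suc unfolding x_def by (simp add: algebra_simps power3_eq_cube power2_eq_square)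
  qed
qed

end

section \<open>Taylor estimates and sums over distances\<close>

lemma cis_taylor: "cmod (cis x - (1 + \<i> * x - x\<^sup>2 / 2)) \<le> \<bar>x\<bar> ^ 3 / 6"
  using iexp_approx1[of x 2] by (simp add: cis_conv_exp numeral_eq_Suc fact_numeral algebra_simps)

text \<open>The upper half follows by multiplying with \<open>exp x\<close>: already its quadratic
  Taylor polynomial times \<open>1 - x + x\<^sup>2 / 2\<close> equals
  \<open>1 + x ^ 4 / 4\<close>.\<close>

lemma exp_minus_approx: "0 \<le> x \<Longrightarrow> \<bar>exp (- x) - (1 - x)\<bar> \<le> x\<^sup>2 / (2::real)"
proof -
  assume x: "0 \<le> x"
  have "1 \<le> (1 - x + x\<^sup>2 / 2) * (1 + x + x\<^sup>2 / 2)"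
  proof -
    have "(1 - x + x\<^sup>2 / 2) * (1 + x + x\<^sup>2 / 2) = 1 + (x\<^sup>2)\<^sup>2 / 4" by (simp add: power2_eq_square algebra_simps)
    then show ?thesis by simp
  qed
  also have "\<dots> \<le> (1 - x + x\<^sup>2 / 2) * exp x"
  proof (rule mult_left_mono[OF exp_lower_Taylor_quadratic[OF x]])
    have "0 \<le> (1 - x)\<^sup>2 / 2 + 1 / 2" by simp
    then show "0 \<le> 1 - x + x\<^sup>2 / 2" by (simp add: power2_diff field_simps)
  qed
  finally have "exp (- x) \<le> 1 - x + x\<^sup>2 / 2" by (simp add: exp_minus field_simps)
  then show ?thesis using exp_ge_add_one_self[of "-x"] by simp
qed

text \<open>\<open>(l - k) + (k - l)\<close> is the distance of two naturals, and every distance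
  occurs at most once on each side of \<open>k\<close>.\<close>

lemma sum_dist_le:
  fixes \<beta> :: "nat \<Rightarrow> real"
  assumes "finite K" "\<And>E. finite E \<Longrightarrow> sum \<beta> E \<le> S"
  shows "(\<Sum>l\<in>K. \<beta> ((l - k) + (k - l))) \<le> 2 * S"
proof -
  have "(\<Sum>l\<in>K. \<beta> ((l - k) + (k - l))) = (\<Sum>l\<in>{l\<in>K. l \<ge> k} \<union> {l\<in>K. l < k}. \<beta> ((l - k) + (k - l)))"
    by (rule sum.cong) auto
  also have "\<dots> = (\<Sum>l\<in>{l\<in>K. l \<ge> k}. \<beta> ((l - k) + (k - l))) + (\<Sum>l\<in>{l\<in>K. l < k}. \<beta> ((l - k) + (k - l)))"
    using assms(1) by (intro sum.union_disjoint) auto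
  also have "(\<Sum>l\<in>{l\<in>K. l \<ge> k}. \<beta> ((l - k) + (k - l))) = (\<Sum>j\<in>(\<lambda>l. l - k) ` {l\<in>K. l \<ge> k}. \<beta> j)"
    by (subst sum.reindex) (auto simp: inj_on_def)
  also have "\<dots> \<le> S" using assms by auto
  also have "(\<Sum>l\<in>{l\<in>K. l < k}. \<beta> ((l - k) + (k - l))) = (\<Sum>j\<in>(\<lambda>l. k - l) ` {l\<in>K. l < k}. \<beta> j)"
    by (subst sum.reindex) (auto simp: inj_on_def)
  also have "\<dots> \<le> S" using assms by auto
  finally show ?thesis by simp
qed

section \<open>Characteristic functions\<close>

text \<open>The hypothesis \<open>pair\<close> says that two terms at distance \<open>d\<close> are
  uncorrelated on average over long intervals, with an additive constant uniform in the interval. It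
  is the channel through which irrationality of the powers of \<open>a\<close> reaches the limit
  theorem.\<close>

locale geom_osc_mixing = geom_osc +
  assumes pair: "\<And>d \<epsilon>. d \<ge> 1 \<Longrightarrow> \<epsilon> > 0 \<Longrightarrow>
    \<exists>C. \<forall>x y. x \<le> y \<longrightarrow> \<bar>LINT v:{x..y}|lborel. f v * f (a ^ d * v)\<bar> \<le> \<epsilon> * (y - x) + C"
begin

definition "\<sigma>2 = (LINT u:{0..1}|lborel. (f u)\<^sup>2)"

lemma sigma2: "\<sigma>2 \<ge> 0" by (simp add: \<sigma>2_def set_integral_nonneg')

lemma integral_fk_sq_mean:
  assumes "c \<le> d" shows "\<bar>(LINT u:{c..d}|lborel. fk k u * fk k u) - \<sigma>2 * (d - c)\<bar> \<le> 2 * \<sigma>2 * \<rho> ^ k"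
proof -
  interpret F: periodic_fun "\<lambda>x. (f x)\<^sup>2" by unfold_locales (auto intro!: bdd_borel_intros simp: per)
  have "(LINT u:{c..d}|lborel. fk k u * fk k u) = (LINT v:{a^k * c..a^k * d}|lborel. (f v)\<^sup>2) / a ^ k"
    unfolding fk_def power2_eq_square using a_pow[of k] by (subst set_integral_scale) auto
  moreover have "\<bar>(LINT v:{a^k * c..a^k * d}|lborel. (f v)\<^sup>2) - (a^k * d - a^k * c) * \<sigma>2\<bar> \<le> 2 * \<sigma>2"
    using F.integral_near_mean(1)[of "a^k * c" "a^k * d"] assms a_pow[of k] by (simp add: \<sigma>2_def)
  moreover have "X / a^k - \<sigma>2 * (d - c) = (X - (a^k * d - a^k * c) * \<sigma>2) / a ^ k" for X
    using a by (simp add: diff_divide_distrib left_diff_distrib) (simp add: algebra_simps)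
  ultimately show ?thesis using a_pow(1)[of k] by (simp add: rho_pow[symmetric] abs_divide divide_right_mono)
qed

lemma integral_fk_fl_near:
  assumes "d \<ge> 1" "\<epsilon> > 0"
  shows "\<exists>C\<ge>0. \<forall>k x y. x \<le> y \<longrightarrow> \<bar>LINT u:{x..y}|lborel. fk k u * fk (k + d) u\<bar> \<le> \<epsilon> * (y - x) + C * \<rho> ^ k"
proof -
  obtain C where C: "\<And>x y. x \<le> y \<Longrightarrow> \<bar>LINT v:{x..y}|lborel. f v * f (a ^ d * v)\<bar> \<le> \<epsilon> * (y - x) + C"
    using pair[OF assms] by blast
  have "\<bar>LINT u:{x..y}|lborel. fk k u * fk (k + d) u\<bar> \<le> \<epsilon> * (y - x) + C * \<rho> ^ k" if "x \<le> y" for k x y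
  proof -
    have "(LINT u:{x..y}|lborel. fk k u * fk (k + d) u) = (LINT v:{a^k * x..a^k * y}|lborel. f v * f (a ^ d * v)) / a ^ k"
      using a_pow[of k] set_integral_scale[of "a^k" x y "\<lambda>v. f v * f (a ^ d * v)"] unfolding fk_def
      by (simp add: power_add mult_ac)
    also have "\<bar>\<dots>\<bar> \<le> (\<epsilon> * (a^k * y - a^k * x) + C) / a ^ k"
      using C[of "a^k * x" "a^k * y"] that a_pow[of k] by (simp add: abs_divide divide_right_mono)
    also have "\<dots> = \<epsilon> * (y - x) + C * (1 / a ^ k)"
    proof -
      have "a ^ k \<noteq> 0" using a by simp
      then show ?thesis by (simp add: field_simps)
    qed
    finally show ?thesis by (simp add: rho_pow)
  qed
  moreover have "C \<ge> 0" using C[of 0 0] by simp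
  ultimately show ?thesis by blast
qed

text \<open>A variance estimate on arbitrary intervals. The diagonal gives \<open>\<sigma>2\<close>
  per term; pairs at distance at least \<open>D\<close> are controlled by geometric decay, the
  finitely many smaller distances by \<open>pair\<close>. Each of the
  \<open>(card K)\<^sup>2\<close> pairs leaves a boundary error \<open>C * \<rho> ^ k0\<close>, and
  \<open>C\<close> depends neither on \<open>K\<close> nor on the interval.\<close>

lemma integral_T_sq_mean:
  fixes \<epsilon> :: real
  assumes e: "\<epsilon> > 0"
  shows "\<exists>C\<ge>0. \<forall>K k0 (c::real) d. finite K \<longrightarrow> (\<forall>k\<in>K. k0 \<le> k) \<longrightarrow> c \<le> d \<longrightarrow>
     \<bar>(LINT u:{c..d}|lborel. (T K u)\<^sup>2) - card K * \<sigma>2 * (d - c)\<bar> \<le> \<epsilon> * card K * (d - c) + C * (real (card K))\<^sup>2 * \<rho> ^ k0"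
proof -
  have "(\<lambda>D. 2 * C1 / (1 - \<rho>) * \<rho> ^ D) \<longlonglongrightarrow> 2 * C1 / (1 - \<rho>) * 0"
    using rho by (intro tendsto_intros LIMSEQ_power_zero) auto
  then have "eventually (\<lambda>D. 2 * C1 / (1 - \<rho>) * \<rho> ^ D < \<epsilon> / 2) sequentially"
    using e by (intro order_tendstoD(2)) auto
  then obtain D where D: "2 * C1 / (1 - \<rho>) * \<rho> ^ D < \<epsilon> / 2" by (auto simp: eventually_sequentially)
  \<comment> \<open>Distances of at least \<open>D\<close> cost at most half of
    \<open>\<epsilon>\<close>; now \<open>\<epsilon>'\<close> is chosen so that \<open>D\<close>
    near distances on either side cost at most the other half.\<close>
  define \<epsilon>' where "\<epsilon>' = \<epsilon> / (4 * (real D + 1))"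
  have e': "\<epsilon>' > 0" "2 * (real D * \<epsilon>') \<le> \<epsilon> / 2" using e by (auto simp: \<epsilon>'_def field_simps)
  have "\<forall>d\<in>{1..<D}. \<exists>C\<ge>0. \<forall>k x y. x \<le> y \<longrightarrow> \<bar>LINT u:{x..y}|lborel. fk k u * fk (k + d) u\<bar> \<le> \<epsilon>' * (y - x) + C * \<rho> ^ k"
    using integral_fk_fl_near e' by auto
  then obtain Cd where Cd: "\<And>d. d \<in> {1..<D} \<Longrightarrow> Cd d \<ge> 0"
     "\<And>d k x y. d \<in> {1..<D} \<Longrightarrow> x \<le> y \<Longrightarrow> \<bar>LINT u:{x..y}|lborel. fk k u * fk (k + d) u\<bar> \<le> \<epsilon>' * (y - x) + Cd d * \<rho> ^ k"
    by metis
  define C where "C = 2 * \<sigma>2 + C1 + (\<Sum>d\<in>{1..<D}. Cd d)"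
  have "(\<Sum>d\<in>{1..<D}. Cd d) \<ge> 0" using Cd(1) by (intro sum_nonneg) auto
  then have C0: "C \<ge> 0" and C_ge: "2 * \<sigma>2 \<le> C" "C1 \<le> C" using sigma2 C1 by (auto simp: C_def)
  have Cd_le: "Cd d \<le> C" if "d \<in> {1..<D}" for d
    using member_le_sum[of d "{1..<D}" Cd] that Cd sigma2 C1 by (simp add: C_def)
  define \<beta> where "\<beta> e = (if e < D then \<epsilon>' else C1 * \<rho> ^ e)" for e
  have \<beta>_sum: "sum \<beta> E \<le> D * \<epsilon>' + C1 * \<rho> ^ D / (1 - \<rho>)" if "finite E" for E
  proof -
    have "sum \<beta> E = sum \<beta> (E \<inter> {..<D} \<union> E \<inter> {D..})" by (rule sum.cong) auto
    also have "\<dots> = sum \<beta> (E \<inter> {..<D}) + sum \<beta> (E \<inter> {D..})" using that by (intro sum.union_disjoint) auto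
    also have "sum \<beta> (E \<inter> {..<D}) = card (E \<inter> {..<D}) * \<epsilon>'" by (simp add: \<beta>_def)
    also have "\<dots> \<le> D * \<epsilon>'" using e' card_mono[of "{..<D}" "E \<inter> {..<D}"] by (intro mult_right_mono) auto
    also have "sum \<beta> (E \<inter> {D..}) = C1 * (\<Sum>e\<in>E \<inter> {D..}. \<rho> ^ e)"
      unfolding sum_distrib_left by (rule sum.cong) (auto simp: \<beta>_def)
    also have "\<dots> \<le> C1 * (\<rho> ^ D / (1 - \<rho>))" using that C1 rho by (intro mult_left_mono sum_power_le) auto
    finally show ?thesis by simp
  qed
  have \<beta>0: "\<beta> e \<ge> 0" for e using e' C1 rho by (simp add: \<beta>_def)
  have off: "\<bar>LINT u:{c..d}|lborel. fk k u * fk l u\<bar> \<le> \<beta> ((l - k) + (k - l)) * (d - c) + C * \<rho> ^ k0"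
    if "c \<le> d" "k < l" "k0 \<le> k" for c d k l k0
  proof (cases "l - k < D")
    case True
    then have ed: "l - k \<in> {1..<D}" using that by auto
    have "\<bar>LINT u:{c..d}|lborel. fk k u * fk l u\<bar> \<le> \<epsilon>' * (d - c) + Cd (l - k) * \<rho> ^ k"
      using Cd(2)[OF ed that(1), of k] that by simp
    also have "Cd (l - k) * \<rho> ^ k \<le> C * \<rho> ^ k0" using that rho Cd_le[OF ed] C0 by (intro mult_mono power_decreasing) auto
    finally show ?thesis using True that by (simp add: \<beta>_def)
  next
    case False
    have "\<bar>LINT u:{c..d}|lborel. fk k u * fk l u\<bar> \<le> C1 * \<rho> ^ (l - k) * (d - c) + C1 * \<rho> ^ l"
      using integral_fk_fl_less[OF that(1,2)] by (simp add: algebra_simps)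
    also have "C1 * \<rho> ^ l \<le> C * \<rho> ^ k0" using that rho C_ge C0 by (intro mult_mono power_decreasing) auto
    finally show ?thesis using False that by (simp add: \<beta>_def)
  qed
  have all: "\<bar>(LINT u:{c..d}|lborel. fk k u * fk l u) - (if l = k then \<sigma>2 * (d - c) else 0)\<bar> \<le> \<beta> ((l - k) + (k - l)) * (d - c) + C * \<rho> ^ k0"
    if "c \<le> d" "k0 \<le> k" "k0 \<le> l" for c d k l k0
  proof (cases k l rule: linorder_cases)
    case less then show ?thesis using off[OF that(1) less that(2)] by simp
  next
    case greater then show ?thesis using off[OF that(1) greater that(3)] by (simp add: mult.commute add.commute)
  next
    case equal
    have "\<bar>(LINT u:{c..d}|lborel. fk k u * fk k u) - \<sigma>2 * (d - c)\<bar> \<le> 2 * \<sigma>2 * \<rho> ^ k" by (rule integral_fk_sq_mean[OF that(1)])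
    also have "\<dots> \<le> C * \<rho> ^ k0" using that rho C_ge C0 by (intro mult_mono power_decreasing) auto
    also have "\<dots> \<le> \<beta> 0 * (d - c) + C * \<rho> ^ k0" using \<beta>0[of 0] that by simp
    finally show ?thesis using equal by simp
  qed
  have "\<bar>(LINT u:{c..d}|lborel. (T K u)\<^sup>2) - card K * \<sigma>2 * (d - c)\<bar> \<le> \<epsilon> * card K * (d - c) + C * (real (card K))\<^sup>2 * \<rho> ^ k0"
    if K: "finite K" "\<forall>k\<in>K. k0 \<le> k" and cd: "c \<le> d" for K k0 and c d :: real
  proof -
    have "\<bar>(LINT u:{c..d}|lborel. (T K u)\<^sup>2) - card K * \<sigma>2 * (d - c)\<bar>
       = \<bar>\<Sum>k\<in>K. \<Sum>l\<in>K. (LINT u:{c..d}|lborel. fk k u * fk l u) - (if l = k then \<sigma>2 * (d - c) else 0)\<bar>"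
      unfolding integral_T_sq_expand using K(1) by (simp add: sum_subtractf)
    also have "\<dots> \<le> (\<Sum>k\<in>K. \<Sum>l\<in>K. \<beta> ((l - k) + (k - l)) * (d - c) + C * \<rho> ^ k0)"
      by (rule order.trans[OF sum_abs], rule sum_mono, rule order.trans[OF sum_abs], rule sum_mono, rule all[OF cd])
        (use K in auto)
    also have "\<dots> \<le> (\<Sum>k\<in>K. \<epsilon> * (d - c) + card K * (C * \<rho> ^ k0))"
    proof (rule sum_mono)
      fix k
      have "(\<Sum>l\<in>K. \<beta> ((l - k) + (k - l))) \<le> 2 * (D * \<epsilon>' + C1 * \<rho> ^ D / (1 - \<rho>))"
        by (rule sum_dist_le[OF K(1) \<beta>_sum])
      also have "\<dots> \<le> \<epsilon>" using e'(2) D by simp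
      finally have "(\<Sum>l\<in>K. \<beta> ((l - k) + (k - l))) * (d - c) \<le> \<epsilon> * (d - c)" using cd by (intro mult_right_mono) auto
      then show "(\<Sum>l\<in>K. \<beta> ((l - k) + (k - l)) * (d - c) + C * \<rho> ^ k0) \<le> \<epsilon> * (d - c) + card K * (C * \<rho> ^ k0)"
        by (simp add: sum.distrib flip: sum_distrib_right)
    qed
    also have "\<dots> = \<epsilon> * card K * (d - c) + C * (real (card K))\<^sup>2 * \<rho> ^ k0" by (simp add: algebra_simps power2_eq_square)
    finally show ?thesis .
  qed
  then show ?thesis using C0 by blast
qed

end

context geom_osc_mixing begin

text \<open>Adding one block multiplies the characteristic function by \<open>exp (- x)\<close> up
  to an error that does not depend on the block. In the second order expansion of \<open>cis\<close>
  the linear term pairs to almost zero with the past, the quadratic one to its mean, and the cubic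
  remainder is bounded through the block length. As \<open>exp (- x) \<le> 1\<close>, the
  \<open>J\<close> errors merely add up.\<close>

lemma charfun_blocks:
  fixes \<epsilon> :: real
  assumes e: "\<epsilon> > 0"
  shows "\<exists>C\<ge>0. \<forall>K s p q n J. blocks K s p q n \<longrightarrow> (\<forall>j<J. card (K j) = p) \<longrightarrow> n > 0 \<longrightarrow>
     cmod ((LINT u:{0..1}|lborel. cis (T (blocks.U K J) u / sqrt n)) - exp (- (\<sigma>2 * p / (2 * n))) ^ J)
       \<le> J * (p * V * \<tau> n q / sqrt n + (\<epsilon> * p + C * (real p)\<^sup>2 * \<tau> n q) / (2 * n) + (p * B) ^ 3 / (6 * n * sqrt n) + (\<sigma>2 * p / (2 * n))\<^sup>2)"
proof -
  obtain C where C0: "C \<ge> 0" and C: "\<And>K k0 (c::real) d. finite K \<Longrightarrow> (\<forall>k\<in>K. k0 \<le> k) \<Longrightarrow> c \<le> d \<Longrightarrow>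
     \<bar>(LINT u:{c..d}|lborel. (T K u)\<^sup>2) - card K * \<sigma>2 * (d - c)\<bar> \<le> \<epsilon> * card K * (d - c) + C * (real (card K))\<^sup>2 * \<rho> ^ k0"
    using integral_T_sq_mean[OF e] by blast
  have "cmod ((LINT u:{0..1}|lborel. cis (T (blocks.U K J) u / sqrt n)) - exp (- (\<sigma>2 * p / (2 * n))) ^ J)
       \<le> J * (p * V * \<tau> n q / sqrt n + (\<epsilon> * p + C * (real p)\<^sup>2 * \<tau> n q) / (2 * n) + (p * B) ^ 3 / (6 * n * sqrt n) + (\<sigma>2 * p / (2 * n))\<^sup>2)"
    if "blocks K s p q n" "\<forall>j<J. card (K j) = p" and n: "n > 0" for K s p q n J
  proof -
    interpret blocks K s p q n by fact
    define \<theta> where "\<theta> = 1 / sqrt (real n)"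
    have th: "\<theta> > 0" "\<theta>\<^sup>2 = 1 / n" "\<theta> ^ 3 = 1 / (n * sqrt n)" using n 
      by (auto simp: \<theta>_def power_divide power3_eq_cube)
    define x where "x = \<sigma>2 * p / (2 * n)"
    have x0: "x \<ge> 0" using sigma2 by (simp add: x_def)
    define w where "w J u = cis (T (U J) u * \<theta>)" for J u
    define z where "z J = (LINT u:{0..1}|lborel. w J u)" for J
    have wb [bdd_borel_intros]: "bdd_borel (w J)" for J unfolding w_def by (intro bdd_borel_intros)
    have nw: "norm (w J u) = 1" for J u by (simp add: w_def)
    have nz: "cmod (z J) \<le> 1" for J
      using norm_set_integral_le_const[OF wb, of 0 1 J 1] nw by (simp add: z_def)
    define e1 where "e1 = p * V * \<tau> n q"
    define e2 where "e2 = \<epsilon> * p + C * (real p)\<^sup>2 * \<tau> n q"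
    define e3 where "e3 = (p * B) ^ 3"
    define E where "E = \<theta> * e1 + \<theta>\<^sup>2 / 2 * e2 + \<theta> ^ 3 / 6 * e3 + x\<^sup>2"
    have E_eq: "E = p * V * \<tau> n q / sqrt n + (\<epsilon> * p + C * (real p)\<^sup>2 * \<tau> n q) / (2 * n) + (p * B) ^ 3 / (6 * n * sqrt n) + (\<sigma>2 * p / (2 * n))\<^sup>2"
      unfolding E_def th e1_def e2_def e3_def x_def by (simp add: \<theta>_def)
    have step: "cmod (z (Suc J) - exp (- x) * z J) \<le> E" if cJ: "card (K J) = p" for J
    proof -
      define t where "t = T (K J)"
      have tb [bdd_borel_intros]: "bdd_borel t" by (simp add: t_def T_bdd)
      have t_le: "\<bar>t u\<bar> \<le> p * B" for u using T_le[of "K J" u] cJ by (simp add: t_def)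
      have sep: "\<And>k. k \<in> U J \<Longrightarrow> k + q \<le> s J" by (rule U_sep)
      have ge: "\<And>k. k \<in> K J \<Longrightarrow> s J \<le> k" using K_sub[of J] by force
      have wS: "w (Suc J) u = cis (t u * \<theta>) * w J u" for u
        unfolding w_def U_Suc t_def using U_disj by (simp add: T_Un cis_mult distrib_right add.commute)
      \<comment> \<open>The centred square: subtracting its approximate mean
        \<open>p * \<sigma>2\<close> moves the main part into the factor \<open>1 - x\<close>, and
        what remains is small when paired with the past.\<close>
      define h where "h u = (t u)\<^sup>2 - p * \<sigma>2" for u
      have hb [bdd_borel_intros]: "bdd_borel h" unfolding h_def by (intro bdd_borel_intros)
      define R where "R u = w (Suc J) u - (1 - x) *\<^sub>R w J u - (\<i> * \<theta>) * (t u *\<^sub>R w J u) + (\<theta>\<^sup>2 / 2) *\<^sub>R (h u *\<^sub>R w J u)" for u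
      have Rb [bdd_borel_intros]: "bdd_borel R" unfolding R_def by (intro bdd_borel_intros)
      have xth: "x = \<theta>\<^sup>2 / 2 * (p * \<sigma>2)" using n by (simp add: x_def th field_simps)
      have R_le: "norm (R u) \<le> \<theta> ^ 3 / 6 * e3" for u
      proof -
        have "R u = (cis (t u * \<theta>) - (1 + \<i> * (t u * \<theta>) - (t u * \<theta>)\<^sup>2 / 2)) * w J u"
          unfolding R_def wS h_def xth scaleR_conv_of_real by (simp add: algebra_simps power_mult_distrib)
        then have "norm (R u) = cmod (cis (t u * \<theta>) - (1 + \<i> * (t u * \<theta>) - (t u * \<theta>)\<^sup>2 / 2))" using nw by (simp add: norm_mult)
        also have "\<dots> \<le> \<bar>t u * \<theta>\<bar> ^ 3 / 6" using cis_taylor[of "t u * \<theta>"] by simp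
        also have "\<dots> = \<theta> ^ 3 / 6 * \<bar>t u\<bar> ^ 3" using th by (simp add: abs_mult power_mult_distrib)
        also have "\<dots> \<le> \<theta> ^ 3 / 6 * e3" unfolding e3_def using th t_le by (intro mult_left_mono power_mono) auto
        finally show ?thesis .
      qed
      have I1: "cmod (LINT u:{0..1}|lborel. t u *\<^sub>R w J u) \<le> e1"
      proof -
        have "norm (LINT u:{0..1}|lborel. t u *\<^sub>R w J u) \<le> 0 * (LINT u:{0..1}|lborel. norm (w J u)) + (card (K J) * V) * 1 * \<tau> n q"
        proof (rule weighted_integral[OF finite_U U_sub sep q_s])
          show "piecewise_const (\<Union> (Pk ` U J)) (w J)"
            unfolding w_def by (rule piecewise_const_comp[OF pc_T, where h = "\<lambda>x. cis (x * \<theta>)"])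
          show "\<bar>LINT u:{a..b}|lborel. t u\<bar> \<le> 0 * (b - a) + real (card (K J)) * V * \<rho> ^ s J" if "a \<le> b" for a b
            using integral_T[OF that finite_K ge] by (simp add: t_def)
        qed (auto intro!: bdd_borel_intros simp: V0 nw)
        then show ?thesis by (simp add: e1_def cJ)
      qed
      have I2: "cmod (LINT u:{0..1}|lborel. h u *\<^sub>R w J u) \<le> e2"
      proof -
        have "norm (LINT u:{0..1}|lborel. h u *\<^sub>R w J u) \<le> (\<epsilon> * p) * (LINT u:{0..1}|lborel. norm (w J u)) + (C * (real p)\<^sup>2) * 1 * \<tau> n q"
        proof (rule weighted_integral[OF finite_U U_sub sep q_s])
          show "piecewise_const (\<Union> (Pk ` U J)) (w J)"
            unfolding w_def by (rule piecewise_const_comp[OF pc_T, where h = "\<lambda>x. cis (x * \<theta>)"])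
          show "\<bar>LINT u:{a..b}|lborel. h u\<bar> \<le> \<epsilon> * p * (b - a) + C * (real p)\<^sup>2 * \<rho> ^ s J" if "a \<le> b" for a b
          proof -
            have "(LINT u:{a..b}|lborel. h u) = (LINT u:{a..b}|lborel. (t u)\<^sup>2) - p * \<sigma>2 * (b - a)"
              unfolding h_def using that
              by (subst set_integral_diff(2)) (auto simp: set_integral_const_Icc mult.commute intro!: set_integrable_bdd_borel bdd_borel_intros)
            then show ?thesis using C[OF finite_K, of J "s J" a b] ge that by (simp add: t_def cJ)
          qed
        qed (auto intro!: bdd_borel_intros simp: C0 nw)
        then show ?thesis by (simp add: e2_def nw set_integral_const_Icc)
      qed
      have I3: "cmod (LINT u:{0..1}|lborel. R u) \<le> \<theta> ^ 3 / 6 * e3"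
        using norm_set_integral_le_const[OF Rb _ R_le, of 0 1] by simp
      have "z (Suc J) = (LINT u:{0..1}|lborel. R u + (1 - x) *\<^sub>R w J u + (\<i> * \<theta>) * (t u *\<^sub>R w J u) - (\<theta>\<^sup>2 / 2) *\<^sub>R (h u *\<^sub>R w J u))"
        unfolding z_def R_def by simp
      also have "\<dots> = (LINT u:{0..1}|lborel. R u) + (1 - x) *\<^sub>R z J + (\<i> * \<theta>) * (LINT u:{0..1}|lborel. t u *\<^sub>R w J u) - (\<theta>\<^sup>2 / 2) *\<^sub>R (LINT u:{0..1}|lborel. h u *\<^sub>R w J u)"
        unfolding z_def by (simp only: set_integral_add(2) set_integral_diff(2) set_integrable_bdd_borel bdd_borel_intros
            set_integral_scaleR_right set_integral_mult_right)
      finally have "z (Suc J) - exp (- x) * z J = (LINT u:{0..1}|lborel. R u) + (1 - x - exp (- x)) *\<^sub>R z J + (\<i> * \<theta>) * (LINT u:{0..1}|lborel. t u *\<^sub>R w J u) - (\<theta>\<^sup>2 / 2) *\<^sub>R (LINT u:{0..1}|lborel. h u *\<^sub>R w J u)"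
        by (simp add: scaleR_conv_of_real algebra_simps exp_of_real)
      also have "cmod \<dots> \<le> cmod (LINT u:{0..1}|lborel. R u) + cmod ((1 - x - exp (- x)) *\<^sub>R z J) + cmod ((\<i> * \<theta>) * (LINT u:{0..1}|lborel. t u *\<^sub>R w J u)) + cmod ((\<theta>\<^sup>2 / 2) *\<^sub>R (LINT u:{0..1}|lborel. h u *\<^sub>R w J u))"
        by (intro norm_triangle_le_diff norm_triangle_le add_mono order_refl)
      also have "cmod ((1 - x - exp (- x)) *\<^sub>R z J) \<le> x\<^sup>2"
      proof -
        have "\<bar>1 - x - exp (- x)\<bar> \<le> x\<^sup>2" using exp_minus_approx[OF x0] by (simp add: abs_minus_commute) (smt (verit) zero_le_power2)
        then have "\<bar>1 - x - exp (- x)\<bar> * cmod (z J) \<le> x\<^sup>2 * 1" using nz by (intro mult_mono) auto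
        then show ?thesis by simp
      qed
      also have "cmod ((\<i> * \<theta>) * (LINT u:{0..1}|lborel. t u *\<^sub>R w J u)) \<le> \<theta> * e1"
        using I1 th by (simp add: norm_mult)
      also have "cmod ((\<theta>\<^sup>2 / 2) *\<^sub>R (LINT u:{0..1}|lborel. h u *\<^sub>R w J u)) \<le> \<theta>\<^sup>2 / 2 * e2"
        using mult_left_mono[OF I2, of "\<theta>\<^sup>2 / 2"] by simp
      also note I3
      finally show ?thesis by (simp add: E_def)
    qed
    have "(\<forall>j<J. card (K j) = p) \<Longrightarrow> cmod (z J - exp (- x) ^ J) \<le> J * E"
    proof (induction J)
      case 0
      then show ?case by (simp add: z_def w_def T_def set_integral_const_Icc)
    next
      case (Suc J)
      have "z (Suc J) - exp (- x) ^ Suc J = (z (Suc J) - exp (- x) * z J) + exp (- x) * (z J - exp (- x) ^ J)"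
        by (simp add: algebra_simps)
      also have "cmod \<dots> \<le> E + exp (-x) * cmod (z J - exp (- x) ^ J)"
        using step[of J] Suc.prems by (intro norm_triangle_le add_mono) (auto simp: norm_mult)
      also have "\<dots> \<le> E + 1 * cmod (z J - exp (- x) ^ J)" using x0 by (intro add_left_mono mult_right_mono) auto
      also have "\<dots> \<le> E + J * E" using Suc by simp
      finally show ?case by (simp add: algebra_simps)
    qed
    from this[OF that(2)] show ?thesis unfolding E_eq z_def w_def x_def \<theta>_def by (simp add: exp_of_real)
  qed
  then show ?thesis using C0 by blast
qed

end

section \<open>Fourth moment of the full lacunary sum\<close>

lemma sum3_power4_le: "(x + y + z) ^ 4 \<le> 27 * (x ^ 4 + y ^ 4 + z ^ 4 :: real)"
proof -
  have sq: "(x + y + z)\<^sup>2 \<le> 3 * (x\<^sup>2 + y\<^sup>2 + z\<^sup>2)" for x y z :: real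
  proof -
    have "0 \<le> (x - y)\<^sup>2 + (y - z)\<^sup>2 + (x - z)\<^sup>2" by simp
    then show ?thesis by (simp add: power2_eq_square algebra_simps)
  qed
  have "((x + y + z)\<^sup>2)\<^sup>2 \<le> (3 * (x\<^sup>2 + y\<^sup>2 + z\<^sup>2))\<^sup>2" by (rule power_mono[OF sq]) simp
  also have "\<dots> = 9 * (x\<^sup>2 + y\<^sup>2 + z\<^sup>2)\<^sup>2" unfolding power_mult_distrib by (simp only: power2_eq_square)
  also have "\<dots> \<le> 9 * (3 * ((x\<^sup>2)\<^sup>2 + (y\<^sup>2)\<^sup>2 + (z\<^sup>2)\<^sup>2))" by (rule mult_left_mono[OF sq]) simp
  finally show ?thesis by (simp flip: power_mult)
qed

text \<open>The indices split into the first \<open>q\<close> ones and two interleaved families of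
  blocks of length \<open>q\<close>, each family using the blocks of the other as gaps. The linear
  dependence of the last two terms on \<open>V\<close> is what limits the estimate to cells that are
  not too short.\<close>

lemma (in geom_osc) fourth_moment:
  assumes B1: "B = 1" and q: "1 \<le> q" "q \<le> n" and \<kappa>: "\<kappa> = 2 * (r + 1) / (1 - \<rho>)"
  shows "(LINT u:{0..1}|lborel. (T {1..n} u) ^ 4)
    \<le> 27 * (64 * \<kappa>\<^sup>2 + 58 * \<kappa> + 16) * (V\<^sup>2 * (real n)\<^sup>2 + V * n * (real q)\<^sup>2 + V * real n ^ 4 * \<tau> n q)"
proof -
  have C2: "C2 = \<kappa> * V" unfolding C2_def C1_def \<kappa> using B1 by simp
  have k0: "\<kappa> \<ge> 0" using r rho by (auto simp: \<kappa>)
  have dist: "27 * (G * x + G * y + G * z) = 27 * G * (x + y + z)" for G x y z :: real by (simp add: algebra_simps)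
  define s1 where "s1 j = q + 2 * j * q" for j
  define s2 where "s2 j = 2 * q + 2 * j * q" for j
  define K1 where "K1 j = {s1 j<..s1 j + q} \<inter> {1..n}" for j
  define K2 where "K2 j = {s2 j<..s2 j + q} \<inter> {1..n}" for j
  interpret b1: blocks K1 s1 q q n by unfold_locales (auto simp: K1_def s1_def)
  interpret b2: blocks K2 s2 q q n by unfold_locales (auto simp: K2_def s2_def)
  \<comment> \<open>Enough blocks in each family to reach \<open>n\<close>, with total length still
    at most \<open>2 * n\<close>.\<close>
  define J where "J = n div (2 * q) + 1"
  have Jq: "real J * real q \<le> 2 * n"
  proof -
    have "n div (2 * q) * (2 * q) \<le> n" by (rule div_times_less_eq_dividend)
    then have "J * q \<le> 2 * n" using q by (simp add: J_def algebra_simps)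
    then show ?thesis by (metis of_nat_le_iff of_nat_mult of_nat_numeral)
  qed
  define x where "x = T {1..q}"
  define y where "y = T (b1.U J)"
  define z where "z = T (b2.U J)"
  have bd [bdd_borel_intros]: "bdd_borel x" "bdd_borel y" "bdd_borel z"
    by (auto simp: x_def y_def z_def intro!: bdd_borel_intros)
  have cover: "{1..n} = {1..q} \<union> (b1.U J \<union> b2.U J)"
  proof (intro equalityI subsetI)
    fix k assume k: "k \<in> {1..n}"
    show "k \<in> {1..q} \<union> (b1.U J \<union> b2.U J)"
    proof (cases "k \<le> q")
      case False
      define j where "j = (k - q - 1) div (2 * q)"
      define i where "i = (k - q - 1) mod (2 * q)"
      have ki: "k = q + 1 + (2 * q * j + i)" using False by (simp add: i_def j_def)
      have i2: "i < 2 * q" using q by (simp add: i_def)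
      have "j \<le> n div (2 * q)" unfolding j_def using k by (intro div_le_mono) auto
      then have j: "j < J" by (simp add: J_def)
      show ?thesis
      proof (cases "i < q")
        case True
        then have "k \<in> K1 j" using k ki by (auto simp: K1_def s1_def algebra_simps)
        then show ?thesis using j by (auto simp: b1.U_def)
      next
        case False
        then have "k \<in> K2 j" using k ki i2 by (auto simp: K2_def s2_def algebra_simps)
        then show ?thesis using j by (auto simp: b2.U_def)
      qed
    qed (use k in auto)
  qed (use q b1.U_sub[of J] b2.U_sub[of J] in auto)
  have disj1: "{1..q} \<inter> (b1.U J \<union> b2.U J) = {}"
    by (auto simp: b1.U_def b2.U_def K1_def K2_def s1_def s2_def)
  have disj2: "b1.U J \<inter> b2.U J = {}"
  proof -
    have "\<not> (k \<in> K1 i \<and> k \<in> K2 j)" for k i j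
    proof
      assume kk: "k \<in> K1 i \<and> k \<in> K2 j"
      then have "q + 2 * i * q < k" "k \<le> q + 2 * i * q + q" "2 * q + 2 * j * q < k" "k \<le> 2 * q + 2 * j * q + q"
        by (auto simp: K1_def K2_def s1_def s2_def)
      then have "2 * q + 2 * j * q < q + 2 * i * q + q" "q + 2 * i * q < 2 * q + 2 * j * q + q" by linarith+
      then have "(2 * j) * q < (2 * i) * q" and "(2 * i) * q < (2 * j + 2) * q"
        unfolding distrib_right by linarith+
      then have "2 * j < 2 * i" "2 * i < 2 * j + 2" by (simp_all only: mult_less_cancel2)
      then show False by arith
    qed
    then show ?thesis by (auto simp: b1.U_def b2.U_def)
  qed
  have S: "T {1..n} u = x u + y u + z u" for u
    unfolding cover x_def y_def z_def using disj1 disj2 by (subst T_Un) (auto simp: T_Un)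
  have "(LINT u:{0..1}|lborel. (T {1..n} u) ^ 4) \<le> (LINT u:{0..1}|lborel. 27 * (x u ^ 4 + y u ^ 4 + z u ^ 4))"
    unfolding S by (intro set_integral_le bdd_borel_intros sum3_power4_le)
  also have "\<dots> = 27 * ((LINT u:{0..1}|lborel. x u ^ 4) + (LINT u:{0..1}|lborel. y u ^ 4) + (LINT u:{0..1}|lborel. z u ^ 4))"
    by (simp add: set_integral_add(2) set_integrable_bdd_borel bdd_borel_intros)
  also have "\<dots> \<le> 27 * (2 * \<kappa> * V * n * (real q)\<^sup>2 
     + 2 * (8 * V * real n ^ 4 * \<tau> n q + 32 * (\<kappa> * V)\<^sup>2 * (real n)\<^sup>2 + 16 * \<kappa> * V * real n ^ 4 * \<tau> n q + 12 * \<kappa> * V * n * (real q)\<^sup>2))"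
  proof -
    have X: "(LINT u:{0..1}|lborel. x u ^ 4) \<le> 2 * \<kappa> * V * n * (real q)\<^sup>2"
    proof -
      have "x u ^ 4 \<le> (real q)\<^sup>2 * (x u)\<^sup>2" for u
      proof -
        have "\<bar>x u\<bar> \<le> q" using T_le[of "{1..q}" u] B1 by (simp add: x_def)
        then have "(x u)\<^sup>2 \<le> (real q)\<^sup>2" by (metis abs_le_square_iff abs_of_nat)
        then have "(x u)\<^sup>2 * (x u)\<^sup>2 \<le> (real q)\<^sup>2 * (x u)\<^sup>2" by (intro mult_right_mono) auto
        then show ?thesis by (simp flip: power_add)
      qed
      then have "(LINT u:{0..1}|lborel. x u ^ 4) \<le> (LINT u:{0..1}|lborel. (real q)\<^sup>2 * (x u)\<^sup>2)"
        by (intro set_integral_le bdd_borel_intros)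
      also have "\<dots> = (real q)\<^sup>2 * (LINT u:{0..1}|lborel. (x u)\<^sup>2)" by simp
      also have "\<dots> \<le> (real q)\<^sup>2 * (2 * C2 * n)"
      proof (rule mult_left_mono)
        have "(LINT u:{0..1}|lborel. (x u)\<^sup>2) \<le> 2 * C2 * q" using integral_T_sq_unit[of "{1..q}"] by (simp add: x_def)
        also have "\<dots> \<le> 2 * C2 * n" using q C2 k0 V0 by (intro mult_left_mono) auto
        finally show "(LINT u:{0..1}|lborel. (x u)\<^sup>2) \<le> 2 * C2 * n" .
      qed auto
      finally show ?thesis by (simp add: C2 mult_ac)
    qed
    have main: "real J * (4 * (q * V * real n ^ 3 * \<tau> n q) + 8 * (C2 * q * (2 * C2 * n + real n ^ 2 * \<tau> n q)) + 6 * (real q ^ 3 * C2))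
      \<le> 8 * V * real n ^ 4 * \<tau> n q + 32 * (\<kappa> * V)\<^sup>2 * (real n)\<^sup>2 + 16 * \<kappa> * V * real n ^ 4 * \<tau> n q + 12 * \<kappa> * V * n * (real q)\<^sup>2"
    proof -
      have "real J * (4 * (q * V * real n ^ 3 * \<tau> n q) + 8 * (C2 * q * (2 * C2 * n + real n ^ 2 * \<tau> n q)) + 6 * (real q ^ 3 * C2))
        = (real J * real q) * (4 * V * real n ^ 3 * \<tau> n q + 8 * C2 * (2 * C2 * n + real n ^ 2 * \<tau> n q) + 6 * (real q)\<^sup>2 * C2)"
        by (simp add: algebra_simps power3_eq_cube power2_eq_square)
      also have "\<dots> \<le> (2 * n) * (4 * V * real n ^ 3 * \<tau> n q + 8 * C2 * (2 * C2 * n + real n ^ 2 * \<tau> n q) + 6 * (real q)\<^sup>2 * C2)"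
        using Jq V0 C2 k0 tau0 by (intro mult_right_mono) auto
      also have "\<dots> = 8 * V * real n ^ 4 * \<tau> n q + 32 * C2\<^sup>2 * (real n)\<^sup>2 + 16 * C2 * real n ^ 3 * \<tau> n q + 12 * C2 * n * (real q)\<^sup>2"
        by (simp add: algebra_simps power3_eq_cube power2_eq_square power4_eq_xxxx)
      also have "16 * C2 * real n ^ 3 * \<tau> n q \<le> 16 * C2 * real n ^ 4 * \<tau> n q"
        using C2 k0 V0 tau0 q by (intro mult_right_mono mult_left_mono power_increasing) auto
      finally show ?thesis by (simp add: C2 mult_ac)
    qed
    have "27 * (a + b + c) \<le> 27 * (A + 2 * D)" if "a \<le> A" "b \<le> D" "c \<le> D" for a b c A D :: real
      using add_mono[OF add_mono[OF that(1,2)] that(3)] by simp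
    from this[OF X order.trans[OF fourth_moment_blocks[OF b1.blocks_axioms B1, of J] main]
      order.trans[OF fourth_moment_blocks[OF b2.blocks_axioms B1, of J] main]]
    show ?thesis unfolding y_def z_def .
  qed
  also have "\<dots> = 27 * (64 * \<kappa>\<^sup>2 * (V\<^sup>2 * (real n)\<^sup>2) + 26 * \<kappa> * (V * n * (real q)\<^sup>2) + (16 + 32 * \<kappa>) * (V * real n ^ 4 * \<tau> n q))"
    by (simp add: algebra_simps power_mult_distrib)
  also have "\<dots> \<le> 27 * ((64 * \<kappa>\<^sup>2 + 58 * \<kappa> + 16) * (V\<^sup>2 * (real n)\<^sup>2) + (64 * \<kappa>\<^sup>2 + 58 * \<kappa> + 16) * (V * n * (real q)\<^sup>2) + (64 * \<kappa>\<^sup>2 + 58 * \<kappa> + 16) * (V * real n ^ 4 * \<tau> n q))"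
  proof -
    have "64 * \<kappa>\<^sup>2 \<le> 64 * \<kappa>\<^sup>2 + 58 * \<kappa> + 16" "26 * \<kappa> \<le> 64 * \<kappa>\<^sup>2 + 58 * \<kappa> + 16" "16 + 32 * \<kappa> \<le> 64 * \<kappa>\<^sup>2 + 58 * \<kappa> + 16"
      using k0 by auto
    moreover have "0 \<le> V\<^sup>2 * (real n)\<^sup>2" "0 \<le> V * n * (real q)\<^sup>2" "0 \<le> V * real n ^ 4 * \<tau> n q" using V0 tau0 by auto
    ultimately show ?thesis by (simp only: mult_right_mono add_mono mult_le_cancel_left_pos zero_less_numeral)
  qed
  also have "\<dots> = 27 * (64 * \<kappa>\<^sup>2 + 58 * \<kappa> + 16) * (V\<^sup>2 * (real n)\<^sup>2 + V * n * (real q)\<^sup>2 + V * real n ^ 4 * \<tau> n q)"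
    using dist .
  finally show ?thesis .
qed

section \<open>Central limit theorem for the full lacunary sum\<close>

context geom_osc_mixing begin

lemma charfun_limit: "(\<lambda>n. LINT u:{0..1}|lborel. cis (T {1..n} u / sqrt n)) \<longlonglongrightarrow> exp (- (\<sigma>2 / 2))"
proof -
  \<comment> \<open>With a gap of \<open>c * ln n\<close> indices this constant makes
    \<open>\<rho> ^ q\<close> at most \<open>n powr (-10)\<close>, far below every polynomial factor
    that it meets.\<close>
  define c where "c = 10 / ln a"
  have c: "c > 0" using a by (simp add: c_def)
  \<comment> \<open>Blocks of length \<open>n powr (1/5)\<close> dominate the logarithmic gaps, so
    the discarded indices are a vanishing fraction, while the summed Taylor remainders are of order
    \<open>p\<^sup>2 / sqrt n\<close> and vanish as well.\<close>
  define p where "p n = nat \<lfloor>real n powr (1/5)\<rfloor>" for n :: nat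
  define q where "q n = nat \<lceil>c * ln (real n)\<rceil>" for n :: nat
  define J where "J n = (n - q n) div (p n + q n)" for n
  define s where "s n j = q n + j * (p n + q n)" for n j
  \<comment> \<open>Empty beyond the last block that fits below \<open>n\<close>, because the block
    structure quantifies over all \<open>j\<close>.\<close>
  define K where "K n j = (if j < J n then {s n j<..s n j + p n} else {})" for n j
  have JJ: "J n * (p n + q n) \<le> n - q n" for n unfolding J_def by (rule div_times_less_eq_dividend)
  have bl: "blocks (K n) (s n) (p n) (q n) n" for n
  proof
    fix j
    show "K n j \<subseteq> {s n j<..s n j + p n} \<inter> {1..n}"
    proof (cases "j < J n")
      case True
      have "0 < J n" using True by simp
      then have qn: "q n \<le> n" using JJ[of n] unfolding J_def by (metis bot_nat_0.not_eq_extremum div_0 diff_is_0_eq nat_le_linear)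
      have "(j + 1) * (p n + q n) \<le> J n * (p n + q n)" using True by (intro mult_right_mono) auto
      then have "s n j + p n \<le> n" using JJ[of n] qn unfolding s_def by simp
      then show ?thesis using True by (auto simp: K_def)
    qed (simp add: K_def)
  qed (auto simp: s_def)
  have cK: "\<forall>j<J n. card (K n j) = p n" for n by (simp add: K_def)
  define UU where "UU n = blocks.U (K n) (J n)" for n
  define R where "R n = {1..n} - UU n" for n
  have cU: "card (UU n) = J n * p n" for n
  proof -
    interpret blocks "K n" "s n" "p n" "q n" n by (rule bl)
    have "i \<le> J n \<Longrightarrow> card (blocks.U (K n) i) = i * p n" for i
    proof (induction i)
      case (Suc i)
      then show ?case using U_disj[of i] cK[of n] unfolding U_Suc by (subst card_Un_disjoint) auto
    qed simp
    then show ?thesis by (simp add: UU_def)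
  qed
  have Us: "UU n \<subseteq> {1..n}" and fU: "finite (UU n)" for n
    using blocks.U_sub[OF bl] blocks.finite_U[OF bl] by (auto simp: UU_def)
  have cR: "real (card (R n)) = n - real (J n) * p n" and Jpn: "real (J n) * p n \<le> n" for n
  proof -
    have "card (R n) = n - card (UU n)" unfolding R_def by (subst card_Diff_subset[OF fU Us]) simp
    moreover have le: "card (UU n) \<le> n" using card_mono[OF _ Us] by simp
    ultimately show "real (card (R n)) = n - real (J n) * p n" using cU by (simp add: of_nat_diff)
    show "real (J n) * p n \<le> n" using le unfolding cU by (metis of_nat_le_iff of_nat_mult)
  qed
  have q_le: "q n \<le> c * ln n + 1" and q_ge: "c * ln n \<le> q n" if "n \<ge> 1" for n
  proof -
    have "c * ln n \<ge> 0" using c that by simp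
    then show "q n \<le> c * ln n + 1" "c * ln n \<le> q n" unfolding q_def by linarith+
  qed
  have p_le: "p n \<le> real n powr (1/5)" and p_ge: "real n powr (1/5) - 1 \<le> p n" for n
    unfolding p_def by (simp_all add: of_nat_nat)
  have tau_le: "\<tau> n (q n) \<le> real n powr (-10) * (2 * r * n + 1)" if "n \<ge> 1" for n
  proof -
    have "\<rho> ^ q n = \<rho> powr (q n)" using rho by (simp add: powr_realpow)
    also have "\<dots> \<le> \<rho> powr (c * ln n)" using q_ge[OF that] rho by (intro powr_mono') auto
    also have "\<dots> = real n powr (-10)" using that a by (simp add: powr_def \<rho>_def ln_div c_def)
    finally show ?thesis unfolding \<tau>_def using r by (intro mult_right_mono) auto
  qed
  define g1 where "g1 x = (2 * (c * ln x + 1) + x powr (1/5)) / x + (c * ln x + 1) / (x powr (1/5) - 1)" for x :: real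
  have g1: "(g1 \<longlongrightarrow> 0) at_top" unfolding g1_def using c by real_asymp
  have R_le: "eventually (\<lambda>n. card (R n) / n \<le> g1 n) sequentially"
  proof -
    have e1: "eventually (\<lambda>n. real n powr (1/5) > 1) sequentially" by real_asymp
    have e2: "eventually (\<lambda>n. c * ln n + 1 \<le> real n) sequentially" using c by real_asymp
    show ?thesis
      using e1 e2 eventually_ge_at_top[of 1]
    proof eventually_elim
      case (elim n)
      have p0: "p n > 0" using elim(1) unfolding p_def by (simp add: zero_less_nat_eq)
      have qn: "q n \<le> n" using q_le[OF elim(3)] elim(2) by linarith
      have "n - q n < (J n + 1) * (p n + q n)" unfolding J_def using p0
        by (metis add.commute add_gr_0 dividend_less_div_times mult.commute mult_Suc plus_1_eq_Suc)
      then have "n < q n + (J n + 1) * (p n + q n)" using qn by linarith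
      then have "real n \<le> real (q n + (J n + 1) * (p n + q n))" unfolding of_nat_le_iff by (rule less_imp_le)
      then have "card (R n) \<le> 2 * real (q n) + p n + real (J n) * q n" unfolding cR by (simp add: algebra_simps)
      also have "real (J n) * q n \<le> real n * (q n / p n)"
      proof -
        have "real (J n) \<le> n / p n" using Jpn[of n] p0 by (simp add: field_simps)
        then have "real (J n) * q n \<le> n / p n * q n" by (intro mult_right_mono) auto
        then show ?thesis by simp
      qed
      finally have "card (R n) / n \<le> (2 * real (q n) + p n + real n * (q n / p n)) / n" using elim(3) by (intro divide_right_mono) auto
      also have "\<dots> = (2 * real (q n) + p n) / n + q n / p n" using elim(3) by (simp add: add_divide_distrib)
      also have "\<dots> \<le> g1 n" unfolding g1_def
        using q_le[OF elim(3)] p_le[of n] p_ge[of n] elim p0 by (intro add_mono divide_right_mono frac_le) auto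
      finally show ?case .
    qed
  qed
  have R0: "(\<lambda>n. card (R n) / n) \<longlonglongrightarrow> 0"
    by (rule tendsto_sandwich[OF _ R_le tendsto_const filterlim_compose[OF g1 filterlim_real_sequentially]]) auto
  have Jp: "(\<lambda>n. real (J n) * p n / n) \<longlonglongrightarrow> 1"
  proof (rule Lim_transform_eventually)
    show "(\<lambda>n. 1 - card (R n) / n) \<longlonglongrightarrow> 1" using tendsto_diff[OF tendsto_const R0, of 1] by simp
    show "eventually (\<lambda>n. 1 - card (R n) / n = real (J n) * p n / n) sequentially"
      using eventually_gt_at_top[of 0] by eventually_elim (simp add: cR field_simps)
  qed
  have ex: "(\<lambda>n. exp (- (\<sigma>2 * p n / (2 * n))) ^ J n) \<longlonglongrightarrow> exp (- (\<sigma>2 / 2))"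
  proof -
    have "(\<lambda>n. exp (- (\<sigma>2 / 2 * (real (J n) * p n / n)))) \<longlonglongrightarrow> exp (- (\<sigma>2 / 2 * 1))" by (intro tendsto_intros Jp)
    moreover have "exp (- (\<sigma>2 * p n / (2 * n))) ^ J n = exp (- (\<sigma>2 / 2 * (real (J n) * p n / n)))" for n
      by (simp add: exp_of_nat_mult[symmetric] mult_ac)
    ultimately show ?thesis by simp
  qed
  define z where "z n = (LINT u:{0..1}|lborel. cis (T (UU n) u / sqrt n))" for n
  define y where "y n = (LINT u:{0..1}|lborel. cis (T {1..n} u / sqrt n))" for n
  have diff1: "cmod (y n - z n) \<le> \<epsilon> + 2 * C2 / \<epsilon> * (card (R n) / n)" if "\<epsilon> > 0" "n > 0" for \<epsilon> :: real and n
  proof -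
    have TT: "T {1..n} u = T (UU n) u + T (R n) u" for u
      using T_Un[of "UU n" "R n" u] fU[of n] Us[of n] by (simp add: R_def Un_absorb1)
    \<comment> \<open>From \<open>\<bar>t\<bar> \<le> \<epsilon> + t\<^sup>2 / \<epsilon>\<close>:
      the second moment of the discarded part, bounded linearly in the number of its indices, then
      controls the change of the characteristic function.\<close>
    have pt: "cmod (cis (T {1..n} u / sqrt n) - cis (T (UU n) u / sqrt n)) \<le> \<epsilon> + 1 / (\<epsilon> * n) * (T (R n) u)\<^sup>2" for u
    proof -
      define t where "t = T (R n) u / sqrt n"
      have "cis (T {1..n} u / sqrt n) - cis (T (UU n) u / sqrt n) = cis (T (UU n) u / sqrt n) * (cis t - 1)"
        by (simp only: TT t_def add_divide_distrib cis_mult right_diff_distrib mult_1_right)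
      then have "cmod (cis (T {1..n} u / sqrt n) - cis (T (UU n) u / sqrt n)) = cmod (cis t - 1)" by (simp add: norm_mult)
      also have "\<dots> \<le> \<bar>t\<bar>" using iexp_approx1[of t 0] by (simp add: cis_conv_exp)
      also have "\<dots> \<le> \<epsilon> + t\<^sup>2 / \<epsilon>"
      proof -
        have "0 \<le> (\<bar>t\<bar> - \<epsilon>)\<^sup>2 + \<bar>t\<bar> * \<epsilon>" using that by (intro add_nonneg_nonneg) auto
        then have "\<bar>t\<bar> * \<epsilon> \<le> (\<epsilon> + t\<^sup>2 / \<epsilon>) * \<epsilon>" using that(1) by (simp add: power2_eq_square algebra_simps)
        then show ?thesis using that(1) by simp
      qed
      also have "t\<^sup>2 / \<epsilon> = 1 / (\<epsilon> * n) * (T (R n) u)\<^sup>2" by (simp add: t_def power_divide)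
      finally show ?thesis .
    qed
    have yz: "y n - z n = (LINT u:{0..1}|lborel. cis (T {1..n} u / sqrt n) - cis (T (UU n) u / sqrt n))"
      unfolding y_def z_def by (intro set_integral_diff(2)[symmetric] set_integrable_bdd_borel bdd_borel_cis)
        (auto intro!: bdd_borel_intros simp: divide_inverse)
    have "cmod (y n - z n) \<le> (LINT u:{0..1}|lborel. cmod (cis (T {1..n} u / sqrt n) - cis (T (UU n) u / sqrt n)))"
      unfolding yz by (rule norm_set_integral_le) (auto intro!: bdd_borel_intros simp: divide_inverse)
    also have "\<dots> \<le> (LINT u:{0..1}|lborel. \<epsilon> + 1 / (\<epsilon> * n) * (T (R n) u)\<^sup>2)"
      by (rule set_integral_le[OF _ _ pt]) (auto intro!: bdd_borel_intros simp: divide_inverse)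
    also have "\<dots> = \<epsilon> + 1 / (\<epsilon> * n) * (LINT u:{0..1}|lborel. (T (R n) u)\<^sup>2)"
    proof -
      have bd: "bdd_borel (\<lambda>u. 1 / (\<epsilon> * n) * (T (R n) u)\<^sup>2)" by (intro bdd_borel_intros)
      show ?thesis
        by (subst set_integral_add(2)[OF set_integrable_bdd_borel[OF bdd_borel_const] set_integrable_bdd_borel[OF bd]])
          (simp add: set_integral_const_Icc)
    qed
    also have "\<dots> \<le> \<epsilon> + 1 / (\<epsilon> * n) * (2 * C2 * card (R n))"
      using that integral_T_sq_unit[of "R n"] by (intro add_left_mono mult_left_mono) (auto simp: R_def)
    finally show ?thesis by (simp add: mult_ac)
  qed
  have diff2: "eventually (\<lambda>n. cmod (z n - exp (- (\<sigma>2 * p n / (2 * n))) ^ J n) \<le> 2 * \<epsilon>) sequentially" if e: "\<epsilon> > 0" for \<epsilon> :: real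
  proof -
    obtain C where C0: "C \<ge> 0" and C: "\<And>K s p q n J. blocks K s p q n \<Longrightarrow> (\<forall>j<J. card (K j) = p) \<Longrightarrow> n > 0 \<Longrightarrow>
     cmod ((LINT u:{0..1}|lborel. cis (T (blocks.U K J) u / sqrt n)) - exp (- (\<sigma>2 * p / (2 * n))) ^ J)
       \<le> J * (p * V * \<tau> n q / sqrt n + (\<epsilon> * p + C * (real p)\<^sup>2 * \<tau> n q) / (2 * n) + (p * B) ^ 3 / (6 * n * sqrt n) + (\<sigma>2 * p / (2 * n))\<^sup>2)"
      using charfun_blocks[OF e] by blast
    define g2 where "g2 x = V * (x powr (-10) * (2 * r * x + 1)) * sqrt x + C * x * (x powr (-10) * (2 * r * x + 1)) + B ^ 3 * (x powr (2/5)) / sqrt x + \<sigma>2\<^sup>2 * (x powr (1/5)) / x" for x :: real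
    have g2: "(g2 \<longlongrightarrow> 0) at_top"
    proof -
      have l: "((\<lambda>x::real. x powr (-10) * x * sqrt x) \<longlongrightarrow> 0) at_top" "((\<lambda>x::real. x powr (-10) * sqrt x) \<longlongrightarrow> 0) at_top"
        "((\<lambda>x::real. x powr (-10) * x * x) \<longlongrightarrow> 0) at_top" "((\<lambda>x::real. x powr (-10) * x) \<longlongrightarrow> 0) at_top"
        "((\<lambda>x::real. x powr (2/5) / sqrt x) \<longlongrightarrow> 0) at_top" "((\<lambda>x::real. x powr (1/5) / x) \<longlongrightarrow> 0) at_top"
        by real_asymp+
      have "((\<lambda>x. V * (2 * r * (x powr (-10) * x * sqrt x) + x powr (-10) * sqrt x) + C * (2 * r * (x powr (-10) * x * x) + x powr (-10) * x)
          + B ^ 3 * (x powr (2/5) / sqrt x) + \<sigma>2\<^sup>2 * (x powr (1/5) / x)) \<longlongrightarrow> V * (2 * r * 0 + 0) + C * (2 * r * 0 + 0) + B ^ 3 * 0 + \<sigma>2\<^sup>2 * 0) at_top"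
        by (intro tendsto_intros l)
      then show ?thesis by (simp add: g2_def[abs_def] algebra_simps)
    qed
    have "eventually (\<lambda>n. g2 (real n) < \<epsilon>) sequentially"
      by (rule order_tendstoD(2)[OF filterlim_compose[OF g2 filterlim_real_sequentially] e])
    then show ?thesis using eventually_gt_at_top[of 0]
    proof eventually_elim
      case (elim n)
      define t where "t = \<tau> n (q n)"
      define t' where "t' = real n powr (-10) * (2 * r * n + 1)"
      have t: "0 \<le> t" "t \<le> t'" using tau0 tau_le[of n] elim by (auto simp: t_def t'_def)
      have n: "real n > 0" "sqrt n > 0" using elim by auto
      have pn: "p n \<le> real n" using p_le[of n] powr_mono[of "1/5" 1 "real n"] elim by simp
      have "cmod (z n - exp (- (\<sigma>2 * p n / (2 * n))) ^ J n) \<le> J n * (p n * V * t / sqrt n + (\<epsilon> * p n + C * (real (p n))\<^sup>2 * t) / (2 * n) + (p n * B) ^ 3 / (6 * n * sqrt n) + (\<sigma>2 * p n / (2 * n))\<^sup>2)"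
        using C[OF bl cK elim(2)] unfolding z_def UU_def t_def by simp
      also have "\<dots> = (real (J n) * p n / n) * (V * t * (n / sqrt n) + \<epsilon> / 2 + C * p n * t / 2 + B ^ 3 * (real (p n))\<^sup>2 / (6 * sqrt n) + \<sigma>2\<^sup>2 * p n / (4 * n))"
        using n by (simp add: field_simps power2_eq_square power3_eq_cube)
      also have "\<dots> \<le> 1 * (V * t * (n / sqrt n) + \<epsilon> / 2 + C * p n * t / 2 + B ^ 3 * (real (p n))\<^sup>2 / (6 * sqrt n) + \<sigma>2\<^sup>2 * p n / (4 * n))"
        using Jpn[of n] n V0 C0 B0 e t by (intro mult_right_mono) auto
      also have "\<dots> \<le> V * t' * sqrt n + \<epsilon> + C * n * t' + B ^ 3 * (real n powr (2/5)) / sqrt n + \<sigma>2\<^sup>2 * (real n powr (1/5)) / n"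
      proof -
        have 1: "V * t * (n / sqrt n) \<le> V * t' * sqrt n" using t V0 by (simp add: real_div_sqrt mult_left_mono mult_right_mono)
        have 2: "C * p n * t / 2 \<le> C * n * t'"
        proof -
          have "C * p n * t \<le> C * n * t'" using t C0 pn by (intro mult_mono) auto
          moreover have "C * p n * t \<ge> 0" using t C0 by auto
          ultimately show ?thesis by linarith
        qed
        have 3: "B ^ 3 * (real (p n))\<^sup>2 / (6 * sqrt n) \<le> B ^ 3 * (real n powr (2/5)) / sqrt n"
        proof -
          have "(real (p n))\<^sup>2 \<le> (real n powr (1/5))\<^sup>2" using p_le by (intro power_mono) auto
          also have "\<dots> = real n powr (2/5)" using n by (simp add: powr_power)
          finally show ?thesis using n B0 by (intro frac_le mult_left_mono) auto
        qed
        have 4: "\<sigma>2\<^sup>2 * p n / (4 * n) \<le> \<sigma>2\<^sup>2 * (real n powr (1/5)) / n"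
          using n p_le by (intro frac_le mult_left_mono) auto
        show ?thesis unfolding mult_1_left by (intro add_mono 1 2 3 4) (use e in simp)
      qed
      also have "\<dots> = \<epsilon> + g2 n" by (simp add: g2_def t'_def)
      finally show ?case using elim by linarith
    qed
  qed
  have "y \<longlonglongrightarrow> complex_of_real (exp (- (\<sigma>2 / 2)))"
  proof (rule tendstoI)
    fix e :: real assume e: "e > 0"
    define \<epsilon> where "\<epsilon> = e / 5"
    have eps: "\<epsilon> > 0" using e by (simp add: \<epsilon>_def)
    have "(\<lambda>n. 2 * C2 / \<epsilon> * (card (R n) / n)) \<longlonglongrightarrow> 2 * C2 / \<epsilon> * 0" by (intro tendsto_intros R0)
    then have ev1: "eventually (\<lambda>n. 2 * C2 / \<epsilon> * (card (R n) / n) < \<epsilon>) sequentially" using eps by (intro order_tendstoD(2)) auto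
    have ev2: "eventually (\<lambda>n. dist (exp (- (\<sigma>2 * p n / (2 * n))) ^ J n) (exp (- (\<sigma>2 / 2))) < \<epsilon>) sequentially" using ex eps by (rule tendstoD)
    show "eventually (\<lambda>n. dist (y n) (complex_of_real (exp (- (\<sigma>2 / 2)))) < e) sequentially"
      using ev1 ev2 diff2[OF eps] eventually_gt_at_top[of 0]
    proof eventually_elim
      case (elim n)
      define E where "E = exp (- (\<sigma>2 * p n / (2 * n))) ^ J n"
      have "cmod (y n - exp (- (\<sigma>2 / 2))) \<le> cmod (y n - z n) + cmod (z n - E) + cmod (complex_of_real E - exp (- (\<sigma>2 / 2)))"
        using norm_triangle_ineq[of "y n - z n + (z n - E)" "E - exp (- (\<sigma>2 / 2))"] norm_triangle_ineq[of "y n - z n" "z n - E"] by simp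
      also have "cmod (complex_of_real E - exp (- (\<sigma>2 / 2))) = \<bar>E - exp (- (\<sigma>2 / 2))\<bar>" by (metis norm_of_real of_real_diff)
      finally show ?case using diff1[OF eps elim(4)] elim(1-3) e unfolding E_def[symmetric] \<epsilon>_def dist_norm dist_real_def
        by (simp add: E_def)
    qed
  qed
  then show ?thesis by (simp add: y_def[abs_def])
qed

end

section \<open>Equidistribution of irrational rotations\<close>

text \<open>Raising \<open>n\<close> by one adds exactly one, since the difference telescopes to
  \<open>(n + q) div q - n div q\<close>. Negative \<open>n\<close> is reached by running the same
  step backwards.\<close>

lemma sum_floor_shift_div: 
  assumes "q > 0"
  shows "(\<Sum>r<q. (n + int r) div int q) = n"
proof -
  have step: "(\<Sum>r<q. (n + 1 + int r) div int q) = (\<Sum>r<q. (n + int r) div int q) + 1" for n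
  proof -
    have "(\<Sum>r<q. (n + 1 + int r) div int q) + (n div int q) = (\<Sum>r<Suc q. (n + int r) div int q)"
      by (subst sum.lessThan_Suc_shift) (simp add: add_ac)
    also have "\<dots> = (\<Sum>r<q. (n + int r) div int q) + (n div int q + 1)"
      using assms by simp
    finally show ?thesis by simp
  qed
  have 0: "(\<Sum>r<q. (0 + int r) div int q) = 0" by simp
  show ?thesis
  proof (induction n rule: int_induct[where k = 0])
    case base then show ?case using 0 by simp
  next
    case (step1 i) then show ?case using step[of i] by simp
  next
    case (step2 i) then show ?case using step[of "i - 1"] by simp
  qed
qed

text \<open>Hermite's identity; it evaluates a sum of floors over a full grid of residues
  exactly.\<close>

lemma sum_floor_shift:
  fixes x :: real assumes "q > 0"
  shows "(\<Sum>r<q. \<lfloor>x + real r / real q\<rfloor>) = \<lfloor>real q * x\<rfloor>"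
proof -
  have "\<lfloor>x + real r / real q\<rfloor> = (\<lfloor>real q * x\<rfloor> + int r) div int q" for r
  proof -
    have "(\<lfloor>real q * x\<rfloor> + int r) = \<lfloor>real q * x + real r\<rfloor>" by simp
    moreover have "\<lfloor>(real q * x + real r) / real_of_int (int q)\<rfloor> = \<lfloor>real q * x + real r\<rfloor> div int q"
      by (rule floor_divide_real_eq_div) simp
    ultimately show ?thesis using assms by (simp add: field_simps)
  qed
  then show ?thesis using sum_floor_shift_div[OF assms] by simp
qed

text \<open>Modulo 1 the points \<open>x + \<beta> * m\<close> with \<open>m < q\<close> lie within
  \<open>1 / q\<close> of a translated grid of spacing \<open>1 / q\<close>, because multiplication
  by \<open>p\<close> permutes the residues. Monotonicity squeezes the sum of floors between
  Hermite's identity at \<open>x - 1/q\<close> and at \<open>x + 1/q\<close>, so the bound is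
  independent of \<open>q\<close>.\<close>

lemma frac_sum_near_rational:
  fixes x \<beta> :: real and p :: int
  assumes q: "q > 0" and cop: "coprime p (int q)" and near: "\<bar>\<beta> - p / q\<bar> \<le> 1 / (real q)\<^sup>2"
  shows "\<bar>\<Sum>m<q. (frac (x + \<beta> * real m) - 1/2)\<bar> \<le> 4"
proof -
  define \<delta> where "\<delta> m = \<beta> * m - p * m / q" for m :: nat
  have d: "\<bar>\<delta> m\<bar> \<le> 1 / q" if "m < q" for m
  proof -
    have "\<delta> m = (\<beta> - p / q) * m" by (simp add: \<delta>_def left_diff_distrib)
    then have "\<bar>\<delta> m\<bar> = \<bar>\<beta> - p / q\<bar> * m" by (simp add: abs_mult)
    also have "\<dots> \<le> 1 / (real q)\<^sup>2 * q" using that near by (intro mult_mono) auto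
    finally show ?thesis using q by (simp add: power2_eq_square)
  qed
  define \<sigma> where "\<sigma> m = nat ((p * int m) mod int q)" for m
  have bij: "bij_betw \<sigma> {..<q} {..<q}"
  proof -
    have "inj_on \<sigma> {..<q}"
    proof (rule inj_onI)
      fix i j assume ij: "i \<in> {..<q}" "j \<in> {..<q}" "\<sigma> i = \<sigma> j"
      then have "(p * int i) mod int q = (p * int j) mod int q" using q by (simp add: \<sigma>_def eq_nat_nat_iff)
      then have "int q dvd p * (int i - int j)" by (simp add: mod_eq_dvd_iff right_diff_distrib)
      then have "int q dvd int i - int j" using cop by (simp add: coprime_dvd_mult_right_iff coprime_commute)
      moreover have "\<bar>int i - int j\<bar> < int q" using ij by auto
      ultimately show "i = j" by (metis dvd_imp_le_int eq_iff_diff_eq_0 abs_of_nat linorder_not_le of_nat_eq_iff)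
    qed
    moreover have "\<sigma> ` {..<q} \<subseteq> {..<q}" using q by (auto simp: \<sigma>_def nat_less_iff)
    ultimately show ?thesis by (simp add: bij_betw_def endo_inj_surj)
  qed
  have fr: "frac (x + \<beta> * m) = (x + real (\<sigma> m) / q + \<delta> m) - \<lfloor>x + real (\<sigma> m) / q + \<delta> m\<rfloor>" for m
  proof -
    have "p * int m = (p * int m) div int q * int q + int (\<sigma> m)" using q by (simp add: \<sigma>_def)
    then have "real_of_int (p * int m) = real_of_int ((p * int m) div int q * int q + int (\<sigma> m))" by (rule arg_cong)
    then have "p * m / q = real_of_int ((p * int m) div int q) + real (\<sigma> m) / q" using q by (simp add: field_simps)
    then have "x + \<beta> * m = (x + real (\<sigma> m) / q + \<delta> m) + real_of_int ((p * int m) div int q)" by (simp add: \<delta>_def)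
    then show ?thesis by (simp only: frac_add_of_int_right) (simp add: frac_def)
  qed
  have re: "(\<Sum>m<q. g (\<sigma> m)) = (\<Sum>m<q. g m)" for g :: "nat \<Rightarrow> int" using sum.reindex_bij_betw[OF bij] .
  have re': "(\<Sum>m<q. g (\<sigma> m)) = (\<Sum>m<q. g m)" for g :: "nat \<Rightarrow> real" using sum.reindex_bij_betw[OF bij] .
  define F where "F = (\<Sum>m<q. \<lfloor>x + real (\<sigma> m) / q + \<delta> m\<rfloor>)"
  have up: "F \<le> \<lfloor>real q * x\<rfloor> + 1"
  proof -
    have "F \<le> (\<Sum>m<q. \<lfloor>(x + 1/q) + real (\<sigma> m) / q\<rfloor>)"
      unfolding F_def using d by (intro sum_mono floor_mono) (auto simp: abs_le_iff)
    also have "\<dots> = \<lfloor>real q * (x + 1/q)\<rfloor>" by (simp only: re[of "\<lambda>m. \<lfloor>(x + 1/q) + real m / q\<rfloor>"] sum_floor_shift[OF q])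
    also have "real q * (x + 1/q) = real q * x + 1" using q by (simp add: algebra_simps)
    finally show ?thesis by simp
  qed
  have lo: "F \<ge> \<lfloor>real q * x\<rfloor> - 1"
  proof -
    have "F \<ge> (\<Sum>m<q. \<lfloor>(x - 1/q) + real (\<sigma> m) / q\<rfloor>)"
      unfolding F_def
    proof (intro sum_mono floor_mono)
      fix m assume "m \<in> {..<q}" then show "x - 1 / q + real (\<sigma> m) / q \<le> x + real (\<sigma> m) / q + \<delta> m"
        using d[of m] by (auto simp: abs_le_iff)
    qed
    also have "(\<Sum>m<q. \<lfloor>(x - 1/q) + real (\<sigma> m) / q\<rfloor>) = \<lfloor>real q * (x - 1/q)\<rfloor>" by (simp only: re[of "\<lambda>m. \<lfloor>(x - 1/q) + real m / q\<rfloor>"] sum_floor_shift[OF q])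
    also have "real q * (x - 1/q) = real q * x - 1" using q by (simp add: algebra_simps)
    finally show ?thesis by simp
  qed
  have "(\<Sum>r<q. real r) = real q * (real q - 1) / 2" by (induction q) (auto simp: field_simps)
  then have G: "(\<Sum>r<q. real r / q) = (real q - 1) / 2" using q by (simp flip: sum_divide_distrib)
  have "(\<Sum>m<q. (frac (x + \<beta> * real m) - 1/2)) = (\<Sum>m<q. (x + real (\<sigma> m) / q + \<delta> m) - \<lfloor>x + real (\<sigma> m) / q + \<delta> m\<rfloor> - 1/2)"
    by (simp only: fr)
  also have "\<dots> = q * x + (\<Sum>m<q. real (\<sigma> m) / q) + (\<Sum>m<q. \<delta> m) - F - q / 2"
    by (simp add: sum.distrib sum_subtractf F_def)
  also have "(\<Sum>m<q. real (\<sigma> m) / q) = (real q - 1) / 2" using re'[of "\<lambda>m. real m / q"] G by simp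
  finally have e: "(\<Sum>m<q. (frac (x + \<beta> * real m) - 1/2)) = q * x - 1/2 + (\<Sum>m<q. \<delta> m) - F" by (simp add: field_simps)
  have "\<bar>\<Sum>m<q. \<delta> m\<bar> \<le> (\<Sum>m<q. 1 / q)" using d by (intro order.trans[OF sum_abs] sum_mono) auto
  also have "\<dots> = 1" using q by simp
  finally have "\<bar>\<Sum>m<q. \<delta> m\<bar> \<le> 1" .
  moreover have "real_of_int F \<le> q * x + 1" using up by linarith
  moreover have "real_of_int F \<ge> q * x - 2" using lo by linarith
  ultimately show ?thesis unfolding e by (auto simp: abs_le_iff)
qed

text \<open>Dirichlet's approximation theorem: an irrational number has infinitely many reduced
  approximations of this quality, so their denominators are unbounded.\<close>

lemma exists_good_approx:
  fixes \<beta> :: real assumes "\<beta> \<notin> \<rat>"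
  shows "\<exists>p q. q > Q \<and> coprime p (int q) \<and> \<bar>\<beta> - real_of_int p / real q\<bar> \<le> 1 / (real q)\<^sup>2"
proof -
  have "infinite (approx_set \<beta>)" using assms rational_iff_finite_approx_set by blast
  then obtain h k where hk: "(h,k) \<in> approx_set \<beta>" "k > int Q" using infinite_approx_set by metis
  then show ?thesis by (intro exI[of _ h] exI[of _ "nat k"]) (auto simp: approx_set_def)
qed

text \<open>One denominator \<open>q > 4 / \<epsilon>\<close> suffices: each run of \<open>q\<close>
  consecutive points costs at most 4, hence at most \<open>\<epsilon> * q\<close>, and the
  incomplete run costs at most \<open>q\<close>. The base point \<open>x\<close> is arbitrary
  throughout, so the constant is uniform in it.\<close>

lemma rotation_equidistributed:
  fixes \<beta> :: real assumes irr: "\<beta> \<notin> \<rat>" and e: "\<epsilon> > 0"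
  shows "\<exists>C. \<forall>x M. \<bar>\<Sum>m<M. (frac (x + \<beta> * real m) - 1/2)\<bar> \<le> \<epsilon> * real M + C"
proof -
  define Q where "Q = nat \<lceil>4 / \<epsilon>\<rceil>"
  obtain p q where pq: "q > Q" "coprime p (int q)" "\<bar>\<beta> - real_of_int p / real q\<bar> \<le> 1 / (real q)\<^sup>2"
    using exists_good_approx[OF irr] by blast
  have Q4: "4 / \<epsilon> \<le> real Q" unfolding Q_def by linarith
  then have qe: "4 \<le> \<epsilon> * q" using pq(1) e by (simp add: field_simps) (smt (verit) mult_left_mono of_nat_less_iff)
  have q0: "q > 0" using pq by simp
  have "\<bar>\<Sum>m<M. (frac (x + \<beta> * real m) - 1/2)\<bar> \<le> \<epsilon> * real M + q" for x M
  proof (induction M arbitrary: x rule: less_induct)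
    case (less M)
    show ?case
    proof (cases "M < q")
      case True
      have "\<bar>\<Sum>m<M. (frac (x + \<beta> * real m) - 1/2)\<bar> \<le> (\<Sum>m<M. 1)"
      proof (intro order.trans[OF sum_abs] sum_mono)
        fix m show "\<bar>frac (x + \<beta> * real m) - 1/2\<bar> \<le> 1" using frac_ge_0[of "x + \<beta> * real m"] frac_lt_1[of "x + \<beta> * real m"] by linarith
      qed
      also have "\<dots> \<le> q" using True by simp
      finally show ?thesis using e by (smt (verit) mult_nonneg_nonneg of_nat_0_le_iff)
    next
      case False
      then obtain M' where M': "M = q + M'" by (metis le_Suc_ex not_less)
      have "(\<Sum>m<M. (frac (x + \<beta> * real m) - 1/2)) = (\<Sum>m<q. (frac (x + \<beta> * real m) - 1/2)) + (\<Sum>m<M'. (frac (x + \<beta> * real (m + q)) - 1/2))"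
        unfolding M' by (induction M') (simp_all add: add_ac)
      moreover have "(\<Sum>m<M'. (frac (x + \<beta> * real (m + q)) - 1/2)) = (\<Sum>m<M'. (frac ((x + \<beta> * q) + \<beta> * real m) - 1/2))"
        by (simp add: algebra_simps)
      moreover have "\<bar>\<Sum>m<M'. (frac ((x + \<beta> * q) + \<beta> * real m) - 1/2)\<bar> \<le> \<epsilon> * M' + q"
        by (rule less.IH) (use M' q0 in auto)
      moreover note frac_sum_near_rational[OF q0 pq(2,3), of x]
      ultimately show ?thesis using qe unfolding M' by (simp add: algebra_simps abs_le_iff)
    qed
  qed
  then show ?thesis by blast
qed

section \<open>Random walk bridges\<close>

text \<open>A path is encoded by the set of its up-steps.\<close>

definition walk :: "nat \<Rightarrow> nat set \<Rightarrow> int" where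
  "walk k A = (\<Sum>i<k. if i \<in> A then 1 else - 1)"

lemma walk_0 [simp]: "walk 0 A = 0" by (simp add: walk_def)
lemma walk_Suc: "walk (Suc k) A = walk k A + (if k \<in> A then 1 else - 1)" by (simp add: walk_def)
lemma walk_insert: "k \<le> m \<Longrightarrow> walk k (insert m A) = walk k A"
  unfolding walk_def by (intro sum.cong) auto

lemma walk_card: "A \<subseteq> {..<m} \<Longrightarrow> walk m A = 2 * int (card A) - int m"
proof (induction m arbitrary: A)
  case (Suc m)
  have fin: "finite A" using Suc.prems finite_subset by blast
  have "walk m A = walk m (A - {m})" unfolding walk_def by (intro sum.cong) auto
  also have "\<dots> = 2 * int (card (A - {m})) - int m" using Suc.prems by (intro Suc.IH) (auto simp: lessThan_Suc)
  finally have w: "walk m A = 2 * int (card (A - {m})) - int m" .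
  show ?case
  proof (cases "m \<in> A")
    case True
    then have "card A > 0" using fin by (auto simp: card_gt_0_iff)
    then show ?thesis using True w by (simp add: walk_Suc of_nat_diff)
  next
    case False then show ?thesis using w by (simp add: walk_Suc)
  qed
qed simp

section \<open>The reflection principle for walks in a strip\<close>

lemma inj_on_insert_Pow: "inj_on (insert m) (Pow {..<m::nat})"
proof (rule inj_onI)
  fix A C assume "A \<in> Pow {..<m}" "C \<in> Pow {..<m}" "insert m A = insert m C"
  moreover from this have "m \<notin> A" "m \<notin> C" by auto
  ultimately show "A = C" by (simp add: insert_ident)
qed

lemma sum_Pow_Suc:
  "(\<Sum>A\<in>Pow {..<Suc m}. h A) = (\<Sum>A\<in>Pow {..<m}. h (insert m A) + (h A :: 'a::comm_monoid_add))"
proof -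
  have "Pow {..<Suc m} = Pow {..<m} \<union> insert m ` Pow {..<m}" by (simp add: lessThan_Suc Pow_insert)
  moreover have "Pow {..<m} \<inter> insert m ` Pow {..<m} = {}" by auto
  moreover note inj_on_insert_Pow[of m]
  ultimately show ?thesis by (simp add: sum.union_disjoint sum.reindex sum.distrib add.commute)
qed

text \<open>Signed images of \<open>x\<close> under the reflections in the barriers \<open>c\<close>
  and \<open>- c\<close>: even compositions carry it to \<open>x + 4 * c * k\<close>, counted
  positively, and odd ones to \<open>2 * c - x + 4 * c * k\<close>, counted negatively.\<close>

definition reflect :: "int \<Rightarrow> int \<Rightarrow> int \<Rightarrow> int" where
  "reflect c x y = of_bool (4 * c dvd y - x) - of_bool (4 * c dvd y + x - 2 * c)"

definition confined :: "int \<Rightarrow> nat \<Rightarrow> int \<Rightarrow> nat set set" where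
  "confined c m x = {A \<in> Pow {..<m}. walk m A = x \<and> (\<forall>k\<le>m. \<bar>walk k A\<bar> < c)}"

text \<open>Reflection principle: both sides satisfy the same recursion in \<open>m\<close> for \<open>\<bar>x\<bar> < c\<close>,
  and the signed count on the right vanishes on the barriers \<open>x = \<plusminus>c\<close>.\<close>

lemma card_confined:
  assumes c: "c > 0" and x: "\<bar>x\<bar> \<le> c"
  shows "int (card (confined c m x)) = (\<Sum>A\<in>Pow {..<m}. reflect c x (walk m A))"
  using x
proof (induction m arbitrary: x)
  case 0
  have "int (card (confined c 0 x)) = of_bool (x = 0)" using c by (auto simp: confined_def)
  moreover have "reflect c x 0 = of_bool (x = 0)"
  proof (cases "x = 0")
    case True
    then show ?thesis using c by (auto simp: reflect_def dest: zdvd_imp_le)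
  next
    case False
    have 1: "\<not> 4 * c dvd - x" using False 0 c by (auto dest: zdvd_imp_le dvd_imp_le_int)
    have 2: "\<not> 4 * c dvd x - 2 * c"
    proof
      assume "4 * c dvd x - 2 * c"
      moreover have "x - 2 * c \<noteq> 0" using 0 c by linarith
      ultimately have "\<bar>4 * c\<bar> \<le> \<bar>x - 2 * c\<bar>" by (intro dvd_imp_le_int)
      then show False using 0 c by linarith
    qed
    show ?thesis using 1 2 False by (simp add: reflect_def)
  qed
  ultimately show ?case by simp
next
  case (Suc m)
  have rec: "(\<Sum>A\<in>Pow {..<Suc m}. reflect c x (walk (Suc m) A)) = (\<Sum>A\<in>Pow {..<m}. reflect c (x - 1) (walk m A)) + (\<Sum>A\<in>Pow {..<m}. reflect c (x + 1) (walk m A))"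
  proof -
    have "reflect c x (walk (Suc m) (insert m A)) + reflect c x (walk (Suc m) A) = reflect c (x - 1) (walk m A) + reflect c (x + 1) (walk m A)"
      if "A \<in> Pow {..<m}" for A
    proof -
      have "m \<notin> A" using that by auto
      then show ?thesis by (simp add: walk_Suc walk_insert reflect_def algebra_simps)
    qed
    then show ?thesis by (simp add: sum_Pow_Suc sum.distrib[symmetric])
  qed
  show ?case
  proof (cases "\<bar>x\<bar> = c")
    case True
    have "confined c (Suc m) x = {}" using True by (force simp: confined_def)
    moreover have "reflect c x y = 0" for y
    proof (cases "x = c")
      case True then show ?thesis by (simp add: reflect_def)
    next
      case False
      then have "x = - c" using \<open>\<bar>x\<bar> = c\<close> by linarith
      moreover have "4 * c dvd y + c \<longleftrightarrow> 4 * c dvd y - c - 2 * c"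
      proof -
        have "y + c = (y - c - 2 * c) + 4 * c" by simp
        then show ?thesis by (metis dvd_add_triv_right_iff)
      qed
      ultimately show ?thesis by (simp add: reflect_def)
    qed
    ultimately show ?thesis by simp
  next
    case False
    then have xc: "\<bar>x\<bar> < c" using Suc.prems by simp
    have eq: "confined c (Suc m) x = insert m ` confined c m (x - 1) \<union> confined c m (x + 1)"
    proof (intro equalityI subsetI)
      fix A assume A: "A \<in> confined c (Suc m) x"
      show "A \<in> insert m ` confined c m (x - 1) \<union> confined c m (x + 1)"
      proof (cases "m \<in> A")
        case True
        have w: "walk k (A - {m}) = walk k A" if "k \<le> m" for k
          using that walk_insert[of k m "A - {m}"] True by (simp add: insert_absorb)
        have "A - {m} \<in> confined c m (x - 1)" using A True w by (auto simp: confined_def walk_Suc lessThan_Suc)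
        then show ?thesis using True by (auto simp: image_iff intro!: bexI[of _ "A - {m}"])
      next
        case False
        then have "A \<in> confined c m (x + 1)" using A by (auto simp: confined_def walk_Suc lessThan_Suc)
        then show ?thesis by simp
      qed
    next
      fix A assume "A \<in> insert m ` confined c m (x - 1) \<union> confined c m (x + 1)"
      then consider B where "A = insert m B" "B \<in> confined c m (x - 1)" | "A \<in> confined c m (x + 1)" by auto
      then show "A \<in> confined c (Suc m) x"
      proof cases
        case 1
        then show ?thesis using xc by (auto simp: confined_def walk_Suc walk_insert le_Suc_eq)
      next
        case 2
        then have "m \<notin> A" by (auto simp: confined_def)
        then show ?thesis using 2 xc by (auto simp: confined_def walk_Suc le_Suc_eq lessThan_Suc)
      qed
    qed
    have fin: "finite (confined c m y)" for y unfolding confined_def by (rule finite_subset[of _ "Pow {..<m}"]) auto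
    have "insert m ` confined c m (x - 1) \<inter> confined c m (x + 1) = {}" by (auto simp: confined_def)
    moreover have "inj_on (insert m) (confined c m (x - 1))"
      by (rule inj_on_subset[OF inj_on_insert_Pow]) (auto simp: confined_def)
    ultimately have "card (confined c (Suc m) x) = card (confined c m (x - 1)) + card (confined c m (x + 1))"
      unfolding eq by (simp add: card_Un_disjoint fin card_image)
    then show ?thesis using Suc.IH[of "x - 1"] Suc.IH[of "x + 1"] xc rec by simp
  qed
qed

lemma sum_Pow_card:
  "(\<Sum>A\<in>Pow {..<m}. h (card A)) = (\<Sum>j\<le>m. (m choose j) * (h j :: int))"
proof -
  have "(\<Sum>A\<in>Pow {..<m}. h (card A)) = (\<Sum>j\<le>m. \<Sum>A\<in>{A \<in> Pow {..<m}. card A = j}. h (card A))"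
    by (rule sum.group[symmetric]) (auto simp: card_mono subset_eq_atLeast0_lessThan_card intro: order.trans[OF card_mono[of "{..<m}"]])
  also have "\<dots> = (\<Sum>j\<le>m. (m choose j) * h j)"
  proof (rule sum.cong)
    fix j
    have "card {A \<in> Pow {..<m}. card A = j} = m choose j" using n_subsets[of "{..<m}" j] by simp
    then show "(\<Sum>A\<in>{A \<in> Pow {..<m}. card A = j}. h (card A)) = (m choose j) * h j" by simp
  qed simp
  finally show ?thesis .
qed

text \<open>The end point of a walk of length \<open>2 * n\<close> is even, so after halving the
  images of 0 are the multiples of \<open>c\<close>, with a sign alternating in the multiple.
  Grouping the up-step sets by cardinality gives binomial coefficients, whose symmetry folds the
  negative multiples onto the positive ones.\<close>

lemma card_confined_bridge:
  assumes c: "c > (0::nat)"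
  shows "int (card (confined (int c) (2 * n) 0)) = int (2 * n choose n) + 2 * (\<Sum>k=1..n. (- 1) ^ k * int (2 * n choose (n + k * c)))"
proof -
  define e :: "int \<Rightarrow> int" where "e i = of_bool (2 * int c dvd i) - of_bool (2 * int c dvd i - int c)" for i
  have dv: "4 * int c dvd 2 * i \<longleftrightarrow> 2 * int c dvd i" for i :: int
    using dvd_times_left_cancel_iff[of 2 "2 * int c" i] by (simp add: mult.assoc[symmetric])
  have e_neg: "e (- i) = e i" for i
  proof -
    have "- i - int c = - ((i - int c) + 2 * int c)" by simp
    then have "2 * int c dvd - i - int c \<longleftrightarrow> 2 * int c dvd i - int c" by (metis dvd_add_triv_right_iff dvd_minus_iff)
    then show ?thesis by (simp add: e_def)
  qed
  have refle: "reflect (int c) 0 (2 * int j - int (2 * n)) = e (int j - int n)" for j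
  proof -
    have "2 * int j - int (2 * n) = 2 * (int j - int n)" "2 * int j - int (2 * n) - 2 * int c = 2 * (int j - int n - int c)" by simp_all
    then show ?thesis unfolding reflect_def e_def by (simp only: add_0_right diff_zero dv)
  qed
  define h where "h j = int (2 * n choose j) * e (int j - int n)" for j
  define h' where "h' i = int (2 * n choose (n + i)) * e (int i)" for i
  have S1: "int (card (confined (int c) (2 * n) 0)) = (\<Sum>j\<le>2*n. h j)"
  proof -
    have "int (card (confined (int c) (2 * n) 0)) = (\<Sum>A\<in>Pow {..<2*n}. reflect (int c) 0 (walk (2 * n) A))"
      using c by (intro card_confined) auto
    also have "\<dots> = (\<Sum>A\<in>Pow {..<2*n}. e (int (card A) - int n))"
      by (rule sum.cong[OF refl]) (simp only: Pow_iff walk_card refle)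
    finally show ?thesis unfolding h_def using sum_Pow_card[where h = "\<lambda>j. e (int j - int n)"] by simp
  qed
  have "{..2*n} = ({..<n} \<union> {n}) \<union> {n+1..2*n}" by auto
  then have "(\<Sum>j\<le>2*n. h j) = (\<Sum>j\<in>({..<n} \<union> {n}) \<union> {n+1..2*n}. h j)" by (rule arg_cong)
  also have "\<dots> = (\<Sum>j\<in>{..<n} \<union> {n}. h j) + (\<Sum>j\<in>{n+1..2*n}. h j)"
    by (rule sum.union_disjoint) auto
  also have "(\<Sum>j\<in>{..<n} \<union> {n}. h j) = (\<Sum>j<n. h j) + h n"
    by (subst sum.union_disjoint) auto
  finally have S2: "(\<Sum>j\<le>2*n. h j) = (\<Sum>j<n. h j) + h n + (\<Sum>j\<in>{n+1..2*n}. h j)" .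
  have S3: "(\<Sum>j<n. h j) = (\<Sum>i=1..n. h' i)"
  proof (rule sum.reindex_bij_witness[of _ "\<lambda>i. n - i" "\<lambda>j. n - j"])
    fix j assume j: "j \<in> {..<n}"
    have "2 * n - j = n + (n - j)" using j by auto
    then have "(2 * n choose (n + (n - j))) = (2 * n choose j)" using j binomial_symmetric[of j "2 * n"] by simp
    moreover have "e (int (n - j)) = e (int j - int n)" using j e_neg[of "int j - int n"] by (simp add: of_nat_diff)
    ultimately show "h' (n - j) = h j" by (simp add: h_def h'_def)
  qed auto
  have S4: "(\<Sum>j\<in>{n+1..2*n}. h j) = (\<Sum>i=1..n. h' i)"
    by (rule sum.reindex_bij_witness[of _ "\<lambda>i. n + i" "\<lambda>j. j - n"]) (auto simp: of_nat_diff h_def h'_def)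
  have S5: "(\<Sum>i=1..n. h' i) = (\<Sum>k=1..n. (- 1) ^ k * int (2 * n choose (n + k * c)))"
  proof -
    have e_mult: "e (int (k * c)) = (- 1) ^ k" for k
    proof -
      have dc: "2 * int c dvd int c * z \<longleftrightarrow> 2 dvd z" for z
        using dvd_times_left_cancel_iff[of "int c" 2 z] c by (simp add: mult.commute)
      have "int (k * c) = int c * int k" "int (k * c) - int c = int c * (int k - 1)" by (simp_all add: algebra_simps)
      then have "2 * int c dvd int (k * c) \<longleftrightarrow> even k" "2 * int c dvd int (k * c) - int c \<longleftrightarrow> odd k"
        by (simp_all only: dc) simp_all
      then show ?thesis by (auto simp: e_def)
    qed
    have e_zero: "e (int i) = 0" if "\<not> c dvd i" for i
    proof -
      have "\<not> int c dvd int i" using that by simp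
      moreover have "int c dvd int i" if "int c dvd int i - int c" using dvd_add[OF that dvd_refl] by simp
      ultimately have "\<not> 2 * int c dvd int i" "\<not> 2 * int c dvd int i - int c" by (auto dest: dvd_mult_right)
      then show ?thesis by (simp add: e_def)
    qed
    have "(\<Sum>k=1..n. (- 1) ^ k * int (2 * n choose (n + k * c))) = (\<Sum>k\<in>{k\<in>{1..n}. k * c \<le> n}. (- 1) ^ k * int (2 * n choose (n + k * c)))"
      by (rule sum.mono_neutral_right) auto
    also have "\<dots> = (\<Sum>i\<in>(\<lambda>k. k * c) ` {k\<in>{1..n}. k * c \<le> n}. h' i)"
      using c by (subst sum.reindex) (auto simp: inj_on_def e_mult h'_def mult.commute simp del: of_nat_mult)
    also have "\<dots> = (\<Sum>i=1..n. h' i)"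
    proof (rule sum.mono_neutral_left)
      show "\<forall>i\<in>{1..n} - (\<lambda>k. k * c) ` {k \<in> {1..n}. k * c \<le> n}. h' i = 0"
      proof
        fix i assume i: "i \<in> {1..n} - (\<lambda>k. k * c) ` {k \<in> {1..n}. k * c \<le> n}"
        have "\<not> c dvd i"
        proof
          assume "c dvd i" then obtain k where k: "i = k * c" by (metis dvdE mult.commute)
          then have "k \<le> i" "k \<ge> 1" using c i by (auto simp: Suc_le_eq)
          have "k \<le> n" using \<open>k \<le> i\<close> i by auto
          then have "k \<in> {k \<in> {1..n}. k * c \<le> n}" using i k \<open>k \<le> i\<close> \<open>k \<ge> 1\<close> by auto
          then show False using i k by blast
        qed
        then show "h' i = 0" unfolding h'_def using e_zero by simp
      qed
    qed (use c in auto)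
    finally show ?thesis by simp
  qed
  have "\<not> 2 * int c dvd - int c" using c by (auto dest: zdvd_imp_le)
  then have "h n = int (2 * n choose n)" by (simp add: h_def e_def)
  then show ?thesis unfolding S1 S2 S3 S4 S5 by simp
qed

section \<open>Gaussian asymptotics of binomial coefficients\<close>

lemma binomial_ratio_bounds:
  assumes "n > 0"
  shows "real (2 * n choose (n + j)) / real (2 * n choose n) \<le> exp (- (real j)\<^sup>2 / (2 * n))" (is ?A)
    and "j \<le> n \<Longrightarrow> real (2 * n choose (n + j)) / real (2 * n choose n) \<le> exp (- (real j)\<^sup>2 / (n + j))" (is "_ \<Longrightarrow> ?B")
    and "4 * j \<le> n \<Longrightarrow> real (2 * n choose (n + j)) / real (2 * n choose n) \<ge> exp (- (real j)\<^sup>2 / n - 8 * (real j) ^ 3 / (real n)\<^sup>2)" (is "_ \<Longrightarrow> ?C")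
proof -
  define R where "R j = real (2 * n choose (n + j)) / real (2 * n choose n)" for j
  have pos: "real (2 * n choose n) > 0" by (simp add: zero_less_binomial)
  have R0: "R 0 = 1" using pos by (simp add: R_def)
  \<comment> \<open>The quotient of neighbouring coefficients is 1 minus an odd number over
    \<open>n + Suc i\<close>; taking products leads to a sum of the first \<open>j\<close> odd
    numbers, hence the square of \<open>j\<close> in the exponents.\<close>
  have RSuc: "R (Suc i) = (1 - (2 * real i + 1) / (n + Suc i)) * R i" if "Suc i \<le> n" for i
  proof -
    have "Suc (n + i) * (2 * n choose Suc (n + i)) = (2 * n - (n + i)) * (2 * n choose (n + i))"
      using binomial_absorb_comp[of "2 * n" "n + i"] binomial_absorption[of "n + i" "2 * n"] by (simp add: mult.commute)
    then have "real (Suc (n + i)) * real (2 * n choose Suc (n + i)) = real (2 * n - (n + i)) * real (2 * n choose (n + i))"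
      by (metis of_nat_mult)
    also have "real (2 * n - (n + i)) = real n - real i" using that by (simp add: of_nat_diff)
    finally have eq1: "real (2 * n choose (n + Suc i)) = (real n - real i) / real (n + Suc i) * real (2 * n choose (n + i))"
      by (simp add: field_simps)
    have eq2: "(real n - real i) / real (n + Suc i) = 1 - (2 * real i + 1) / (n + Suc i)" by (simp add: field_simps)
    show ?thesis unfolding R_def eq1 eq2 by (rule times_divide_eq_right[symmetric])
  qed
  have Rpos: "R j \<ge> 0" for j by (simp add: R_def)
  have sumodd: "(\<Sum>i<j. 2 * real i + 1) = (real j)\<^sup>2" for j by (induction j) (auto simp: power2_eq_square algebra_simps)
  have le: "R i \<le> exp (- (\<Sum>i<i. 2 * real i + 1) / (n + j))" if "j \<le> n" "i \<le> j" for i j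
    using that(2)
  proof (induction i)
    case (Suc i)
    have "R (Suc i) = (1 - (2 * real i + 1) / (n + Suc i)) * R i" using Suc that by (intro RSuc) auto
    also have "\<dots> \<le> exp (- ((2 * real i + 1) / (n + j))) * R i"
    proof (rule mult_right_mono[OF _ Rpos])
      have "(2 * real i + 1) / (n + j) \<le> (2 * real i + 1) / (n + Suc i)" using Suc that by (intro divide_left_mono) auto
      then show "1 - (2 * real i + 1) / (n + Suc i) \<le> exp (- ((2 * real i + 1) / (n + j)))"
        using exp_ge_add_one_self[of "- ((2 * real i + 1) / (n + j))"] by linarith
    qed
    also have "\<dots> \<le> exp (- ((2 * real i + 1) / (n + j))) * exp (- (\<Sum>i<i. 2 * real i + 1) / (n + j))"
      using Suc by (intro mult_left_mono) auto
    also have "\<dots> = exp (- (\<Sum>i<Suc i. 2 * real i + 1) / (n + j))"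
      by (simp add: exp_add[symmetric] add_divide_distrib diff_divide_distrib)
    finally show ?case .
  qed (simp add: R0)
  have B: "R j \<le> exp (- (real j)\<^sup>2 / (n + j))" if "j \<le> n" for j
    using le[OF that order_refl] unfolding sumodd by simp
  then show "j \<le> n \<Longrightarrow> ?B" by (simp add: R_def)
  show ?A
  proof (cases "j \<le> n")
    case True
    have "R j \<le> exp (- (real j)\<^sup>2 / (n + j))" using B[OF True] .
    also have "\<dots> \<le> exp (- (real j)\<^sup>2 / (2 * n))" using True assms by (simp add: divide_left_mono)
    finally show ?thesis by (simp add: R_def)
  next
    case False
    then have z: "2 * n choose (n + j) = 0" by (intro binomial_eq_0) linarith
    show ?thesis unfolding z by simp
  qed
  \<comment> \<open>The lower bound uses \<open>ln (1 - y) \<ge> - y - 2 * y\<^sup>2\<close> for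
    \<open>y \<le> 1/2\<close>, which is where \<open>4 * j \<le> n\<close> enters; the quadratic
    corrections sum to the term cubic in \<open>j\<close>.\<close>
  have ge: "exp (- (\<Sum>i<i. (2 * real i + 1) / n + 8 * (real j)\<^sup>2 / (real n)\<^sup>2)) \<le> R i" if "4 * j \<le> n" "i \<le> j" for i j
    using that(2)
  proof (induction i)
    case (Suc i)
    define y where "y = (2 * real i + 1) / n"
    have ij: "2 * real i + 1 \<le> 2 * real j" using Suc.prems by linarith
    have y: "0 \<le> y" "y \<le> 1/2" using ij that assms Suc by (auto simp: y_def field_simps)
    have y2: "2 * y\<^sup>2 \<le> 8 * (real j)\<^sup>2 / (real n)\<^sup>2"
    proof -
      have "(2 * real i + 1)\<^sup>2 \<le> (2 * real j)\<^sup>2" using ij by (intro power_mono) auto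
      then show ?thesis by (simp add: y_def power_divide power_mult_distrib divide_right_mono)
    qed
    have "exp (- (y + 8 * (real j)\<^sup>2 / (real n)\<^sup>2)) \<le> exp (- y - 2 * y\<^sup>2)" using y2 by simp
    also have "\<dots> \<le> exp (ln (1 - y))" using y ln_one_minus_pos_lower_bound[of y] by (simp del: exp_ln)
    also have "\<dots> = 1 - y" using y by simp
    also have "\<dots> \<le> 1 - (2 * real i + 1) / (n + Suc i)"
      unfolding y_def using assms by (intro diff_left_mono divide_left_mono) auto
    finally have s: "exp (- (y + 8 * (real j)\<^sup>2 / (real n)\<^sup>2)) \<le> 1 - (2 * real i + 1) / (n + Suc i)" .
    have "exp (- (\<Sum>i<Suc i. (2 * real i + 1) / n + 8 * (real j)\<^sup>2 / (real n)\<^sup>2)) = 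
       exp (- (y + 8 * (real j)\<^sup>2 / (real n)\<^sup>2)) * exp (- (\<Sum>i<i. (2 * real i + 1) / n + 8 * (real j)\<^sup>2 / (real n)\<^sup>2))"
      by (simp add: y_def exp_add[symmetric] del: sum.distrib)
    also have "\<dots> \<le> (1 - (2 * real i + 1) / (n + Suc i)) * R i"
      using s Suc that by (intro mult_mono) (auto intro: order.trans[OF exp_ge_zero s])
    also have "\<dots> = R (Suc i)" using Suc that by (intro RSuc[symmetric]) auto
    finally show ?case .
  qed (simp add: R0)
  show "4 * j \<le> n \<Longrightarrow> ?C"
  proof -
    assume j: "4 * j \<le> n"
    have "(\<Sum>i<j. (2 * real i + 1) / n + 8 * (real j)\<^sup>2 / (real n)\<^sup>2) = (real j)\<^sup>2 / n + 8 * (real j) ^ 3 / (real n)\<^sup>2"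
      by (subst sum.distrib) (simp add: sumodd power2_eq_square power3_eq_cube flip: sum_divide_distrib)
    then show ?thesis using ge[OF j order_refl] by (simp add: R_def)
  qed
qed

text \<open>For \<open>j\<close> of order \<open>sqrt n\<close> the deviation of either bound from
  the Gaussian carries an extra factor \<open>1 / sqrt n\<close>, so both sides of the sandwich have
  the same limit.\<close>

lemma binomial_ratio_tendsto:
  fixes n j :: "nat \<Rightarrow> nat"
  assumes n: "filterlim n at_top sequentially" and y: "(\<lambda>i. real (j i) / sqrt (n i)) \<longlonglongrightarrow> y"
  shows "(\<lambda>i. real (2 * n i choose (n i + j i)) / real (2 * n i choose n i)) \<longlonglongrightarrow> exp (- y\<^sup>2)"
proof -
  define t where "t i = real (j i) / sqrt (n i)" for i
  have nr: "filterlim (\<lambda>i. real (n i)) at_top sequentially" by (rule filterlim_compose[OF filterlim_real_sequentially n])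
  have s0: "(\<lambda>i. 1 / sqrt (real (n i))) \<longlonglongrightarrow> 0"
    by (rule filterlim_compose[OF _ nr]) real_asymp
  have t: "t \<longlonglongrightarrow> y" using y by (simp add: t_def[abs_def])
  have jn: "(\<lambda>i. t i * (1 / sqrt (n i))) \<longlonglongrightarrow> y * 0" by (intro tendsto_intros t s0)
  have small: "eventually (\<lambda>i. t i * (1 / sqrt (n i)) < 1/4) sequentially"
    by (rule order_tendstoD(2)[OF jn]) simp
  have np: "eventually (\<lambda>i. n i > 0) sequentially" by (rule eventually_compose_filterlim[OF eventually_gt_at_top n])
  have jt: "real (j i) = t i * sqrt (n i)" if "n i > 0" for i using that by (simp add: t_def)
  have up: "(\<lambda>i. exp (- (t i)\<^sup>2 / (1 + t i * (1 / sqrt (n i))))) \<longlonglongrightarrow> exp (- y\<^sup>2 / (1 + y * 0))"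
    by (intro tendsto_intros t jn) simp
  have lo: "(\<lambda>i. exp (- (t i)\<^sup>2 - 8 * (t i) ^ 3 * (1 / sqrt (n i)))) \<longlonglongrightarrow> exp (- y\<^sup>2 - 8 * y ^ 3 * 0)"
    by (intro tendsto_intros t s0)
  show ?thesis
  proof (rule tendsto_sandwich)
    show "(\<lambda>i. exp (- (t i)\<^sup>2 - 8 * (t i) ^ 3 * (1 / sqrt (n i)))) \<longlonglongrightarrow> exp (- y\<^sup>2)" using lo by simp
    show "(\<lambda>i. exp (- (t i)\<^sup>2 / (1 + t i * (1 / sqrt (n i))))) \<longlonglongrightarrow> exp (- y\<^sup>2)" using up by simp
    show "eventually (\<lambda>i. real (2 * n i choose (n i + j i)) / real (2 * n i choose n i) \<le> exp (- (t i)\<^sup>2 / (1 + t i * (1 / sqrt (n i))))) sequentially"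
      using small np
    proof eventually_elim
      case (elim i)
      have sq: "sqrt (n i) > 0" "sqrt (n i) * sqrt (n i) = n i" using elim by auto
      have "t i * (1 / sqrt (n i)) = j i / n i" using sq by (simp add: t_def)
      then have "j i / real (n i) < 1 / 4" using elim(1) by simp
      then have "real (4 * j i) \<le> real (n i)" using elim(2) by (simp add: field_simps)
      then have j: "j i \<le> n i" by linarith
      have "- (t i)\<^sup>2 / (1 + t i * (1 / sqrt (n i))) = - (real (j i))\<^sup>2 / (n i + j i)"
        using sq elim by (simp add: t_def power_divide field_simps)
      then show ?case using binomial_ratio_bounds(2)[OF elim(2) j] by simp
    qed
    show "eventually (\<lambda>i. exp (- (t i)\<^sup>2 - 8 * (t i) ^ 3 * (1 / sqrt (n i))) \<le> real (2 * n i choose (n i + j i)) / real (2 * n i choose n i)) sequentially"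
      using small np
    proof eventually_elim
      case (elim i)
      have sq: "sqrt (n i) > 0" "sqrt (n i) * sqrt (n i) = n i" using elim by auto
      have "t i * (1 / sqrt (n i)) = j i / n i" using sq by (simp add: t_def)
      then have "j i / real (n i) < 1 / 4" using elim(1) by simp
      then have "real (4 * j i) \<le> real (n i)" using elim(2) by (simp add: field_simps)
      then have j: "4 * j i \<le> n i" by linarith
      have "(t i)\<^sup>2 = (real (j i))\<^sup>2 / n i" using elim by (simp add: t_def power_divide)
      moreover have "8 * (t i) ^ 3 * (1 / sqrt (n i)) = 8 * real (j i) ^ 3 / (real (n i))\<^sup>2"
        using sq elim by (simp add: t_def power_divide power3_eq_cube power2_eq_square)
      ultimately show ?case using binomial_ratio_bounds(3)[OF elim(2) j] by simp
    qed
  qed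
qed

text \<open>The theta series folded at its central term by the symmetry of \<open>k\<close> and
  \<open>- k\<close>. An ordinary series indexed from 0 is the form to which dominated convergence
  of series applies.\<close>

definition kolmogorov_series :: "real \<Rightarrow> real" where
  "kolmogorov_series x = 1 + 2 * (\<Sum>k. (- 1) ^ Suc k * exp (- 2 * (real (Suc k))\<^sup>2 * x\<^sup>2))"

text \<open>Termwise, \<open>k * c / sqrt n\<close> tends to \<open>sqrt 2 * k * x\<close>, so the
  binomial quotients tend to the Gaussians of the series. Once
  \<open>c / sqrt (2 * n) > x / 2\<close>, the binomial bound valid for all \<open>j\<close>
  dominates them by a geometric sequence, and limit and sum may be exchanged.\<close>

lemma confined_bridge_limit:
  fixes n c :: "nat \<Rightarrow> nat"
  assumes n: "filterlim n at_top sequentially" and x: "x > 0"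
    and c: "(\<lambda>i. real (c i) / sqrt (2 * n i)) \<longlonglongrightarrow> x"
  shows "(\<lambda>i. real (card (confined (int (c i)) (2 * n i) 0)) / real (2 * n i choose n i)) \<longlonglongrightarrow> kolmogorov_series x"
proof -
  define a where "a k i = (- 1) ^ Suc k * (real (2 * n i choose (n i + Suc k * c i)) / real (2 * n i choose n i))" for k i
  define b where "b k = (- 1) ^ Suc k * exp (- 2 * (real (Suc k))\<^sup>2 * x\<^sup>2)" for k
  have np: "eventually (\<lambda>i. n i > 0) sequentially" by (rule eventually_compose_filterlim[OF eventually_gt_at_top n])
  have cx: "eventually (\<lambda>i. real (c i) / sqrt (2 * n i) > x / 2) sequentially"
    by (rule order_tendstoD(1)[OF c]) (use x in auto)
  have lim: "(\<lambda>i. a k i) \<longlonglongrightarrow> b k" for k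
  proof -
    have "(\<lambda>i. sqrt 2 * real (Suc k) * (real (c i) / sqrt (2 * n i))) \<longlonglongrightarrow> sqrt 2 * real (Suc k) * x" by (intro tendsto_intros c)
    moreover have "sqrt 2 * real (Suc k) * (real (c i) / sqrt (2 * n i)) = real (Suc k * c i) / sqrt (n i)" for i
    proof -
      have "sqrt 2 * (real (c i) / sqrt (2 * n i)) = real (c i) / sqrt (n i)" by (simp add: real_sqrt_mult)
      then have "real (Suc k) * (sqrt 2 * (real (c i) / sqrt (2 * n i))) = real (Suc k) * (real (c i) / sqrt (n i))" by simp
      then show ?thesis by (simp only: of_nat_mult times_divide_eq_right mult_ac)
    qed
    ultimately have "(\<lambda>i. real (Suc k * c i) / sqrt (n i)) \<longlonglongrightarrow> sqrt 2 * real (Suc k) * x" by simp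
    from binomial_ratio_tendsto[OF n this] have "(\<lambda>i. a k i) \<longlonglongrightarrow> (- 1) ^ Suc k * exp (- (sqrt 2 * real (Suc k) * x)\<^sup>2)"
      unfolding a_def by (intro tendsto_intros)
    then show ?thesis by (simp add: b_def power_mult_distrib mult_ac)
  qed
  define M where "M k = exp (- (x\<^sup>2 / 4)) ^ k" for k
  have bound: "norm (a k i) \<le> M k" if "n i > 0" "real (c i) / sqrt (2 * n i) > x / 2" for k i
  proof -
    have "norm (a k i) = real (2 * n i choose (n i + Suc k * c i)) / real (2 * n i choose n i)"
      by (simp add: a_def abs_mult)
    also have "\<dots> \<le> exp (- (real (Suc k * c i))\<^sup>2 / (2 * n i))" by (rule binomial_ratio_bounds(1)[OF that(1)])
    also have "\<dots> \<le> exp (real k * (- (x\<^sup>2 / 4)))"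
    proof -
      have "x\<^sup>2 / 4 = (x / 2)\<^sup>2" by (simp add: power_divide)
      also have "\<dots> \<le> (real (c i) / sqrt (2 * n i))\<^sup>2" using that x by (intro power_mono) auto
      also have "\<dots> = (real (c i))\<^sup>2 / (2 * n i)" by (simp add: power_divide)
      finally have 1: "x\<^sup>2 / 4 \<le> (real (c i))\<^sup>2 / (2 * n i)" .
      have "real k * (x\<^sup>2 / 4) \<le> (real (Suc k))\<^sup>2 * ((real (c i))\<^sup>2 / (2 * n i))"
      proof (rule mult_mono[OF _ 1])
        have "real k \<le> real (Suc k) * real (Suc k)" by (simp add: algebra_simps)
        then show "real k \<le> (real (Suc k))\<^sup>2" by (simp add: power2_eq_square)
      qed auto
      also have "\<dots> = (real (Suc k * c i))\<^sup>2 / (2 * n i)" by (simp only: of_nat_mult power_mult_distrib times_divide_eq_right)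
      finally show ?thesis by simp
    qed
    also have "\<dots> = M k" unfolding M_def by (rule exp_of_nat_mult)
    finally show ?thesis .
  qed
  have "(\<lambda>i. suminf (\<lambda>k. a k i)) \<longlonglongrightarrow> suminf b"
  proof (rule tannerys_theorem[THEN conjunct2, THEN conjunct2])
    show "(\<lambda>i. a k i) \<longlonglongrightarrow> b k" for k by (rule lim)
    show "eventually (\<lambda>(k, i). norm (a k i) \<le> M k) (at_top \<times>\<^sub>F sequentially)"
    proof -
      have "eventually (\<lambda>i. \<forall>k. norm (a k i) \<le> M k) sequentially"
        using np cx by eventually_elim (use bound in blast)
      then show ?thesis unfolding eventually_prod_filter
        by (intro exI[of _ "\<lambda>_. True"] exI[of _ "\<lambda>i. \<forall>k. norm (a k i) \<le> M k"]) auto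
    qed
    show "summable M" unfolding M_def using x by (intro summable_geometric) auto
  qed simp
  then have "(\<lambda>i. 1 + 2 * suminf (\<lambda>k. a k i)) \<longlonglongrightarrow> 1 + 2 * suminf b" by (intro tendsto_intros)
  moreover have "eventually (\<lambda>i. 1 + 2 * suminf (\<lambda>k. a k i) = real (card (confined (int (c i)) (2 * n i) 0)) / real (2 * n i choose n i)) sequentially"
    using np cx
  proof eventually_elim
    case (elim i)
    have c0: "c i > 0"
    proof (rule ccontr)
      assume "\<not> 0 < c i" then show False using elim(2) x by simp
    qed
    have pos: "real (2 * n i choose n i) > 0" by (simp add: zero_less_binomial)
    have "suminf (\<lambda>k. a k i) = (\<Sum>k<n i. a k i)"
    proof (rule suminf_finite)
      fix k assume "k \<notin> {..<n i}"
      then have "n i < Suc k * 1" by simp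
      also have "\<dots> \<le> Suc k * c i" using c0 by (intro mult_left_mono) auto
      finally have "2 * n i choose (n i + Suc k * c i) = 0" by (intro binomial_eq_0) linarith
      then show "a k i = 0" by (simp add: a_def)
    qed simp
    also have "\<dots> = (\<Sum>k=1..n i. (- 1) ^ k * real (2 * n i choose (n i + k * c i))) / real (2 * n i choose n i)"
      unfolding sum_divide_distrib a_def
      by (rule sum.reindex_bij_witness[of _ "\<lambda>k. k - 1" Suc]) auto
    finally have s: "suminf (\<lambda>k. a k i) = (\<Sum>k=1..n i. (- 1) ^ k * real (2 * n i choose (n i + k * c i))) / real (2 * n i choose n i)" .
    have "real_of_int (int (card (confined (int (c i)) (2 * n i) 0))) = real_of_int (int (2 * n i choose n i) + 2 * (\<Sum>k=1..n i. (- 1) ^ k * int (2 * n i choose (n i + k * c i))))"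
      by (subst card_confined_bridge[OF c0]) (rule refl)
    then have "real (card (confined (int (c i)) (2 * n i) 0)) = real (2 * n i choose n i) + 2 * (\<Sum>k=1..n i. (- 1) ^ k * real (2 * n i choose (n i + k * c i)))"
      by simp
    then show ?case unfolding s using pos by (simp add: field_simps)
  qed
  ultimately show ?thesis unfolding kolmogorov_series_def b_def[symmetric] by (rule Lim_transform_eventually)
qed

section \<open>Bridges and their characteristic functions\<close>

definition bridges :: "nat \<Rightarrow> nat set set" where
  "bridges n = {A \<in> Pow {..<2 * n}. walk (2 * n) A = 0}"

lemma bridges_eq: "bridges n = {A \<in> Pow {..<2 * n}. card A = n}"
proof -
  have "walk (2 * n) A = 0 \<longleftrightarrow> card A = n" if "A \<in> Pow {..<2 * n}" for A
    using that by (simp add: walk_card)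
  then show ?thesis by (auto simp: bridges_def)
qed

lemma card_bridges: "card (bridges n) = 2 * n choose n"
  using n_subsets[of "{..<2 * n}" n] by (simp add: bridges_eq)

lemma finite_bridges [simp]: "finite (bridges n)"
  by (rule finite_subset[of _ "Pow {..<2 * n}"]) (auto simp: bridges_def)

lemma bridges_ne: "bridges n \<noteq> {}"
  using card_bridges[of n] by (metis card.empty less_irrefl zero_less_binomial le_add1 mult_2)

lemma sum_Pow_insert:
  assumes "finite S" "x \<notin> S"
  shows "(\<Sum>A\<in>Pow (insert x S). h A) = (\<Sum>A\<in>Pow S. h (insert x A) + (h A :: 'a::comm_monoid_add))"
proof -
  have "Pow S \<inter> insert x ` Pow S = {}" using assms by auto
  moreover have "inj_on (insert x) (Pow S)"
  proof (rule inj_onI)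
    fix A C assume "A \<in> Pow S" "C \<in> Pow S" "insert x A = insert x C"
    moreover from this have "x \<notin> A" "x \<notin> C" using assms by auto
    ultimately show "A = C" by (simp add: insert_ident)
  qed
  ultimately show ?thesis using assms by (simp add: Pow_insert sum.union_disjoint sum.reindex sum.distrib add.commute)
qed

text \<open>Each factor \<open>2 * cos (x i)\<close> stands for a choice of sign; adding one index
  uses \<open>cos (S + y) + cos (S - y) = 2 * cos S * cos y\<close>.\<close>

lemma prod_cos_expand:
  fixes x :: "nat \<Rightarrow> real"
  shows
  "(\<Prod>i<m. 2 * cos (x i)) = (\<Sum>A\<in>Pow {..<m}. cos (\<Sum>i<m. (if i \<in> A then x i else - x i)))"
proof (induction m)
  case (Suc m)
  have cc: "cos (S + y) + cos (S - y) = cos S * (2 * cos y)" for S y :: real by (simp add: cos_add cos_diff)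
  have "(\<Sum>A\<in>Pow {..<Suc m}. cos (\<Sum>i<Suc m. if i \<in> A then x i else - x i))
    = (\<Sum>A\<in>Pow {..<m}. cos (\<Sum>i<m. if i \<in> A then x i else - x i) * (2 * cos (x m)))"
    unfolding sum_Pow_Suc
  proof (rule sum.cong[OF refl])
    fix A assume A: "A \<in> Pow {..<m}"
    then have m: "m \<notin> A" by auto
    have "(\<Sum>i<m. if i \<in> insert m A then x i else - x i) = (\<Sum>i<m. if i \<in> A then x i else - x i)" by (rule sum.cong) auto
    then show "cos (\<Sum>i<Suc m. if i \<in> insert m A then x i else - x i) + cos (\<Sum>i<Suc m. if i \<in> A then x i else - x i)
      = cos (\<Sum>i<m. if i \<in> A then x i else - x i) * (2 * cos (x m))"
      using m cc[of "\<Sum>i<m. if i \<in> A then x i else - x i" "x m"] by simp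
  qed
  then show ?case using Suc by (simp add: sum_distrib_right)
qed simp

lemma integral_cos_even:
  fixes w :: int assumes "even w"
  shows "(LINT t:{-(pi/2)..pi/2}|lborel. cos (c + t * real_of_int w)) = (if w = 0 then pi * cos c else 0)"
proof (cases "w = 0")
  case True
  then show ?thesis by (simp add: set_lebesgue_integral_def)
next
  case False
  obtain v where v: "w = 2 * v" using assms by blast
  have "(LINT t|lborel. indicator {-(pi/2)..pi/2} t *\<^sub>R cos (c + t * real_of_int w)) = sin (c + pi/2 * w) / w - sin (c + -(pi/2) * w) / w"
    using False by (intro integral_FTC_atLeastAtMost)
      (auto intro!: derivative_eq_intros continuous_intros simp: has_real_derivative_iff_has_vector_derivative[symmetric])
  also have "\<dots> = 0" by (simp add: v sin_add sin_diff)
  finally show ?thesis using False by (simp add: set_lebesgue_integral_def)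
qed

text \<open>The condition that the walk returns to 0 is imposed by Fourier inversion: integrating in
  \<open>t\<close> keeps exactly the sign choices with vanishing total. At even times the walk is
  even, so an interval of length \<open>pi\<close> is a full period.\<close>

lemma sum_bridges_cos:
  "(\<Sum>A\<in>bridges n. cos (\<Sum>i<2 * n. if i \<in> A then x i else - x i)) = 4 ^ n / pi * (LINT t:{-(pi/2)..pi/2}|lborel. (\<Prod>i<2 * n. cos (x i + t)))"
proof -
  define y where "y A = (\<Sum>i<2 * n. if i \<in> A then x i else - x i)" for A
  have ev: "even (walk (2 * n) A)" for A
  proof -
    have "even (walk k A + int k)" for k by (induction k) (auto simp: walk_Suc)
    from this[of "2 * n"] show ?thesis by simp
  qed
  have int: "set_integrable lborel {-(pi/2)..pi/2} (\<lambda>t. cos (c + t * real_of_int w))" for c w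
    by (intro borel_integrable_atLeastAtMost' continuous_intros)
  have "4 ^ n * (\<Prod>i<2 * n. cos (x i + t)) = (\<Sum>A\<in>Pow {..<2 * n}. cos (y A + t * real_of_int (walk (2 * n) A)))" for t
  proof -
    have "(\<Sum>i<2 * n. if i \<in> A then x i + t else - (x i + t)) = y A + t * real_of_int (walk (2 * n) A)" for A
      unfolding y_def walk_def of_int_sum sum_distrib_left sum.distrib[symmetric] by (rule sum.cong) auto
    then have "(\<Prod>i<2 * n. 2 * cos (x i + t)) = (\<Sum>A\<in>Pow {..<2 * n}. cos (y A + t * real_of_int (walk (2 * n) A)))"
      by (simp add: prod_cos_expand)
    moreover have "(\<Prod>i<2 * n. 2 * cos (x i + t)) = 4 ^ n * (\<Prod>i<2 * n. cos (x i + t))"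
      by (simp add: prod.distrib power_mult)
    ultimately show ?thesis by simp
  qed
  then have "4 ^ n * (LINT t:{-(pi/2)..pi/2}|lborel. (\<Prod>i<2 * n. cos (x i + t)))
     = (LINT t:{-(pi/2)..pi/2}|lborel. (\<Sum>A\<in>Pow {..<2 * n}. cos (y A + t * real_of_int (walk (2 * n) A))))"
    by (simp flip: set_integral_mult_right)
  also have "\<dots> = (\<Sum>A\<in>Pow {..<2 * n}. LINT t:{-(pi/2)..pi/2}|lborel. cos (y A + t * real_of_int (walk (2 * n) A)))"
    unfolding set_lebesgue_integral_def scaleR_sum_right using int
    by (intro Bochner_Integration.integral_sum) (auto simp: set_integrable_def)
  also have "\<dots> = (\<Sum>A\<in>Pow {..<2 * n}. if walk (2 * n) A = 0 then pi * cos (y A) else 0)"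
    by (simp add: integral_cos_even ev)
  also have "\<dots> = (\<Sum>A\<in>bridges n. pi * cos (y A))" unfolding bridges_def by (simp add: sum.If_cases Int_def)
  also have "\<dots> = pi * (\<Sum>A\<in>bridges n. cos (y A))" by (simp add: sum_distrib_left)
  finally show ?thesis by (simp add: y_def)
qed

lemma sin_ge_third: "0 \<le> y \<Longrightarrow> y \<le> 2 \<Longrightarrow> y / 3 \<le> sin (y::real)"
proof -
  assume y: "0 \<le> y" "y \<le> 2"
  have "\<bar>sin y - (\<Sum>m<3. sin_coeff m * y ^ m)\<bar> \<le> inverse (fact 3) * \<bar>y\<bar> ^ 3" by (rule Maclaurin_sin_bound)
  then have "\<bar>sin y - y\<bar> \<le> y ^ 3 / 6" using y by (simp add: eval_nat_numeral sin_coeff_def fact_numeral)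
  then have "sin y \<ge> y - y ^ 3 / 6" by linarith
  moreover have "y ^ 3 \<le> 4 * y"
  proof -
    have "y * y \<le> 2 * 2" using y by (intro mult_mono) auto
    then have "(y * y) * y \<le> 4 * y" using y by (intro mult_right_mono) auto
    then show ?thesis by (simp add: power3_eq_cube)
  qed
  ultimately show ?thesis by simp
qed

text \<open>Provides the Gaussian majorant; the range up to 2 covers the integration variable, at
  most \<open>pi / 2\<close> in absolute value, plus a perturbation of at most
  \<open>1 / 3\<close>.\<close>

lemma cos_sq_le_exp: 
  fixes y :: real
  assumes "\<bar>y\<bar> \<le> 2" shows "(cos y)\<^sup>2 \<le> exp (- y\<^sup>2 / 9)"
proof -
  have "\<bar>y\<bar> / 3 \<le> sin \<bar>y\<bar>" using assms by (intro sin_ge_third) auto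
  then have "(\<bar>y\<bar> / 3)\<^sup>2 \<le> (sin \<bar>y\<bar>)\<^sup>2" by (intro power_mono) auto
  moreover have "(sin \<bar>y\<bar>)\<^sup>2 = (sin y)\<^sup>2" by (cases "y \<ge> 0") simp_all
  ultimately have "y\<^sup>2 / 9 \<le> (sin y)\<^sup>2" by (simp add: power_divide)
  then have "(cos y)\<^sup>2 \<le> 1 + (- y\<^sup>2 / 9)" by (simp add: cos_squared_eq)
  also have "\<dots> \<le> exp (- y\<^sup>2 / 9)" by (rule exp_ge_add_one_self)
  finally show ?thesis .
qed

lemma cos_power_limit:
  assumes m: "m > (0::real)"
  shows "(\<lambda>r::nat. cos (z / sqrt (2 * real r * m)) ^ (2 * r)) \<longlonglongrightarrow> exp (- z\<^sup>2 / (2 * m))"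
proof -
  have pos: "(\<lambda>r::nat. cos (z / sqrt (2 * real r * m)) ^ (2 * r)) \<longlonglongrightarrow> exp (- z\<^sup>2 / (2 * m))" if z: "z > 0" for z :: real
  proof (rule Lim_transform_eventually)
    define c where "c = z / sqrt (2 * m)"
    have c: "c > 0" "c\<^sup>2 = z\<^sup>2 / (2 * m)" using z m by (auto simp: c_def power_divide)
    have "((\<lambda>x. cos (c / sqrt x) powr (2 * x)) \<longlongrightarrow> exp (- (c * c))) at_top"
      using c(1) by real_asymp
    moreover have "c / sqrt x = z / sqrt (2 * x * m)" for x by (simp add: c_def real_sqrt_mult mult_ac)
    moreover have "- (c * c) = - z\<^sup>2 / (2 * m)" using c(2) by (simp add: power2_eq_square)
    ultimately have lim: "((\<lambda>x. cos (z / sqrt (2 * x * m)) powr (2 * x)) \<longlongrightarrow> exp (- z\<^sup>2 / (2 * m))) at_top"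
      by simp
    show "(\<lambda>r::nat. cos (z / sqrt (2 * real r * m)) powr (2 * real r)) \<longlonglongrightarrow> exp (- z\<^sup>2 / (2 * m))"
      by (rule filterlim_compose[OF lim filterlim_real_sequentially])
    have "((\<lambda>x. cos (z / sqrt (2 * x * m))) \<longlongrightarrow> 1) at_top" using m z by real_asymp
    from order_tendstoD(1)[OF filterlim_compose[OF this filterlim_real_sequentially], of 0]
    have "eventually (\<lambda>r. cos (z / sqrt (2 * real r * m)) > 0) sequentially" by simp
    then show "eventually (\<lambda>r. cos (z / sqrt (2 * real r * m)) powr (2 * real r) = cos (z / sqrt (2 * real r * m)) ^ (2 * r)) sequentially"
      by eventually_elim (metis of_nat_mult of_nat_numeral powr_realpow)
  qed
  show ?thesis
  proof (cases "z = 0")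
    case False
    have "cos (z / y) = cos (\<bar>z\<bar> / y)" for y by (simp add: abs_if)
    then show ?thesis using pos[of "\<bar>z\<bar>"] False by simp
  qed simp
qed

text \<open>Completing the square in \<open>s\<close>: the shift by the average of \<open>b\<close>
  disappears by translation invariance, and the variance of \<open>b\<close> over the
  \<open>m\<close> cells remains. This quadratic form is the variance of a linear functional of
  Brownian bridge increments.\<close>

lemma gaussian_integral_shift:
  fixes b :: "nat \<Rightarrow> real"
  assumes m: "m > (0::nat)"
  shows "(LINT s|lborel. exp (- (\<Sum>j<m. (b j + s)\<^sup>2) / (2 * real m)))
    = exp (- ((\<Sum>j<m. (b j)\<^sup>2) / m - ((\<Sum>j<m. b j) / m)\<^sup>2) / 2) * (LINT s|lborel. exp (- s\<^sup>2 / 2))"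
proof -
  define av where "av = (\<Sum>j<m. b j) / m"
  have e: "- (\<Sum>j<m. (b j + s)\<^sup>2) / (2 * real m) = - ((\<Sum>j<m. (b j)\<^sup>2) / m - av\<^sup>2) / 2 + - (av + 1 * s)\<^sup>2 / 2" for s
  proof -
    have "(\<Sum>j<m. (b j + s)\<^sup>2) = (\<Sum>j<m. (b j)\<^sup>2) + 2 * s * (\<Sum>j<m. b j) + m * s\<^sup>2"
      by (simp add: power2_sum sum.distrib sum_distrib_left mult_ac)
    also have "(\<Sum>j<m. b j) = m * av" using m by (simp add: av_def)
    finally show ?thesis using m by (simp add: field_simps power2_eq_square)
  qed
  have "(LINT s|lborel. exp (- (\<Sum>j<m. (b j + s)\<^sup>2) / (2 * real m))) = (LINT s|lborel. exp (- ((\<Sum>j<m. (b j)\<^sup>2) / m - av\<^sup>2) / 2) * exp (- (av + 1 * s)\<^sup>2 / 2))"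
    unfolding e exp_add ..
  also have "\<dots> = exp (- ((\<Sum>j<m. (b j)\<^sup>2) / m - av\<^sup>2) / 2) * (LINT s|lborel. exp (- (av + 1 * s)\<^sup>2 / 2))" by simp
  also have "(LINT s|lborel. exp (- (av + 1 * s)\<^sup>2 / 2)) = (LINT s|lborel. exp (- s\<^sup>2 / 2))"
    using lborel_integral_real_affine[of 1 "\<lambda>s. exp (- s\<^sup>2 / 2)" av] by simp
  finally show ?thesis by (simp add: av_def)
qed

lemma integrable_gauss: "c > 0 \<Longrightarrow> integrable lborel (\<lambda>s::real. exp (- s\<^sup>2 / c))"
proof -
  assume c: "c > 0"
  have "integrable lborel (\<lambda>s. sqrt (pi * c) * normal_density 0 (sqrt (c / 2)) s)"
    using c by (intro integrable_mult_right integrable_normal_density) auto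
  moreover have "sqrt (pi * c) * normal_density 0 (sqrt (c / 2)) s = exp (- s\<^sup>2 / c)" for s
    using c by (simp add: normal_density_def)
  ultimately show ?thesis by simp
qed

lemma integral_gauss_pos: "(LINT s|lborel. exp (- s\<^sup>2 / 2)) > (0::real)"
proof -
  have "(LINT s|lborel. exp (- s\<^sup>2 / 2)) = (LINT s|lborel. sqrt (2 * pi) * normal_density 0 1 s)"
    by (simp add: normal_density_def)
  also have "\<dots> = sqrt (2 * pi)" by (simp add: integral_normal_density)
  finally show ?thesis by simp
qed

lemma prod_blocks: "(\<Prod>i<m * k. g (i div k)) = (\<Prod>j<m. g j ^ k)" for g :: "nat \<Rightarrow> 'a::comm_monoid_mult"
proof (cases "k = 0")
  case False
  have "(\<Prod>i<m * k. g (i div k)) = (\<Prod>j<m. prod (\<lambda>i. g (i div k)) {j * k..<j * k + k})"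
    by (rule prod.nat_group[symmetric])
  also have "\<dots> = (\<Prod>j<m. g j ^ k)"
  proof (rule prod.cong[OF refl])
    fix j
    have "prod (\<lambda>i. g (i div k)) {j * k..<j * k + k} = prod (\<lambda>i. g j) {j * k..<j * k + k}"
    proof (rule prod.cong[OF refl])
      fix i assume "i \<in> {j * k..<j * k + k}"
      then have "i div k = j" using False by (intro div_nat_eqI) (auto simp: algebra_simps)
      then show "g (i div k) = g j" by simp
    qed
    then show "prod (\<lambda>i. g (i div k)) {j * k..<j * k + k} = g j ^ k" by simp
  qed
  finally show ?thesis .
qed simp

text \<open>Substituting \<open>t = s / sqrt (2 * r * m)\<close> turns the integral into one over a
  growing interval, on which each cosine power tends to a Gaussian; \<open>cos_sq_le_exp\<close>
  supplies the domination.\<close>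

lemma bridge_integral_limit:
  fixes b :: "nat \<Rightarrow> real"
  assumes m: "m > 0"
  shows "(\<lambda>r. sqrt (2 * r * m) * (LINT t:{-(pi/2)..pi/2}|lborel. (\<Prod>j<m. cos (b j / sqrt (2 * r * m) + t) ^ (2 * r))))
     \<longlonglongrightarrow> (LINT s|lborel. exp (- (\<Sum>j<m. (b j + s)\<^sup>2) / (2 * real m)))"
proof -
  define N where "N r = sqrt (2 * real r * real m)" for r
  define F where "F r s = indicator {-(pi/2)..pi/2} (s / N r) * (\<Prod>j<m. cos ((b j + s) / N r) ^ (2 * r))" for r and s :: real
  have N0: "N r > 0" if "r > 0" for r using that m by (simp add: N_def)
  have subst: "sqrt (2 * r * m) * (LINT t:{-(pi/2)..pi/2}|lborel. (\<Prod>j<m. cos (b j / sqrt (2 * r * m) + t) ^ (2 * r))) = (LINT s|lborel. F r s)" if r: "r > 0" for r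
  proof -
    have "(LINT t:{-(pi/2)..pi/2}|lborel. (\<Prod>j<m. cos (b j / N r + t) ^ (2 * r)))
      = (LINT t|lborel. indicator {-(pi/2)..pi/2} t *\<^sub>R (\<Prod>j<m. cos (b j / N r + t) ^ (2 * r)))" by (simp add: set_lebesgue_integral_def)
    also have "\<dots> = \<bar>1 / N r\<bar> *\<^sub>R (LINT s|lborel. indicator {-(pi/2)..pi/2} (0 + 1 / N r * s) *\<^sub>R (\<Prod>j<m. cos (b j / N r + (0 + 1 / N r * s)) ^ (2 * r)))"
      using N0[OF r] by (intro lborel_integral_real_affine) auto
    also have "\<dots> = 1 / N r * (LINT s|lborel. F r s)" using N0[OF r] by (simp add: F_def add_divide_distrib)
    finally have "N r * (LINT t:{-(pi/2)..pi/2}|lborel. (\<Prod>j<m. cos (b j / N r + t) ^ (2 * r))) = (LINT s|lborel. F r s)" using N0[OF r] by simp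
    then show ?thesis by (simp add: N_def)
  qed
  define Bm where "Bm = (\<Sum>j<m. \<bar>b j\<bar>)"
  have Bm: "\<bar>b j\<bar> \<le> Bm" if "j < m" for j unfolding Bm_def using that by (intro member_le_sum) auto
  have Bm0: "Bm \<ge> 0" by (simp add: Bm_def sum_nonneg)
  have Ninf: "filterlim N at_top sequentially"
  proof -
    have "filterlim (\<lambda>x. sqrt (2 * x * real m)) at_top at_top" using m by real_asymp
    from filterlim_compose[OF this filterlim_real_sequentially] show ?thesis by (simp add: N_def[abs_def])
  qed
  then have "eventually (\<lambda>r. N r \<ge> 3 * Bm) sequentially" by (simp add: filterlim_at_top)
  \<comment> \<open>From this index on the perturbation \<open>b j / N r\<close> is at most 1/3 in
    absolute value, which keeps the argument of the cosine in the range of the Gaussian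
    majorant.\<close>
  then obtain r0 where r0: "\<And>r. r \<ge> r0 \<Longrightarrow> N r \<ge> 3 * Bm" by (auto simp: eventually_sequentially)
  define w where "w s = exp (Bm\<^sup>2 / 18) * exp (- s\<^sup>2 / 36)" for s :: real
  have dom: "\<bar>F r s\<bar> \<le> w s" if r: "r \<ge> r0" "r > 0" for r s
  proof (cases "s / N r \<in> {-(pi/2)..pi/2}")
    case True
    have Nr: "N r > 0" using N0[OF r(2)] .
    have each: "\<bar>cos ((b j + s) / N r) ^ (2 * r)\<bar> \<le> exp ((Bm\<^sup>2 - s\<^sup>2 / 2) / (18 * real m))" if j: "j < m" for j
    proof -
      define y where "y = (b j + s) / N r"
      have "\<bar>b j / N r\<bar> \<le> 1/3" using Bm[OF j] r0[OF r(1)] Nr by (simp add: abs_divide field_simps)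
      moreover have "\<bar>s / N r\<bar> \<le> 1.6" using True pi_less_4 pi_approx by (auto simp: abs_le_iff)
      moreover have "y = b j / N r + s / N r" by (simp add: y_def add_divide_distrib)
      ultimately have y: "\<bar>y\<bar> \<le> 2" by linarith
      have "\<bar>cos y ^ (2 * r)\<bar> = ((cos y)\<^sup>2) ^ r" by (simp add: power_mult)
      also have "\<dots> \<le> exp (- y\<^sup>2 / 9) ^ r" by (intro power_mono cos_sq_le_exp y) auto
      also have "\<dots> = exp (- (real r * y\<^sup>2) / 9)" by (simp add: exp_of_nat_mult[symmetric])
      also have "real r * y\<^sup>2 = (b j + s)\<^sup>2 / (2 * real m)" using r(2) by (simp add: y_def N_def power_divide)
      also have "exp (- ((b j + s)\<^sup>2 / (2 * real m)) / 9) \<le> exp ((Bm\<^sup>2 - s\<^sup>2 / 2) / (18 * real m))"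
      proof -
        have "0 \<le> (2 * b j + s)\<^sup>2" by simp
        then have "s\<^sup>2 / 2 - (b j)\<^sup>2 \<le> (b j + s)\<^sup>2" by (simp add: power2_eq_square algebra_simps)
        moreover have "(b j)\<^sup>2 \<le> Bm\<^sup>2" using Bm[OF j] by (metis abs_le_square_iff abs_of_nonneg Bm0)
        ultimately have "- (b j + s)\<^sup>2 \<le> Bm\<^sup>2 - s\<^sup>2 / 2" by linarith
        then have "- (b j + s)\<^sup>2 / (18 * real m) \<le> (Bm\<^sup>2 - s\<^sup>2 / 2) / (18 * real m)" by (intro divide_right_mono) auto
        then show ?thesis by simp
      qed
      finally show ?thesis by (simp add: y_def)
    qed
    have "\<bar>F r s\<bar> = (\<Prod>j<m. \<bar>cos ((b j + s) / N r) ^ (2 * r)\<bar>)" using True by (simp add: F_def abs_prod)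
    also have "\<dots> \<le> (\<Prod>j<m. exp ((Bm\<^sup>2 - s\<^sup>2 / 2) / (18 * real m)))" using each by (intro prod_mono) auto
    also have "\<dots> = exp ((Bm\<^sup>2 - s\<^sup>2 / 2) / 18)" using m by (simp add: exp_of_nat_mult[symmetric])
    also have "\<dots> = w s" by (simp add: w_def exp_add[symmetric] field_simps)
    finally show ?thesis .
  next
    case False
    then have "F r s = 0" by (simp add: F_def)
    then show ?thesis by (simp add: w_def)
  qed
  have pw: "(\<lambda>r. F r s) \<longlonglongrightarrow> exp (- (\<Sum>j<m. (b j + s)\<^sup>2) / (2 * real m))" for s
  proof -
    have "(\<lambda>r. (\<Prod>j<m. cos ((b j + s) / N r) ^ (2 * r))) \<longlonglongrightarrow> (\<Prod>j<m. exp (- (b j + s)\<^sup>2 / (2 * real m)))"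
    proof (rule tendsto_prod)
      fix j show "(\<lambda>r. cos ((b j + s) / N r) ^ (2 * r)) \<longlonglongrightarrow> exp (- (b j + s)\<^sup>2 / (2 * real m))"
        unfolding N_def by (rule cos_power_limit) (use m in simp)
    qed
    also have "(\<Prod>j<m. exp (- (b j + s)\<^sup>2 / (2 * real m))) = exp (- (\<Sum>j<m. (b j + s)\<^sup>2) / (2 * real m))"
      by (simp add: exp_sum[symmetric] sum_negf sum_divide_distrib)
    finally have 1: "(\<lambda>r. (\<Prod>j<m. cos ((b j + s) / N r) ^ (2 * r))) \<longlonglongrightarrow> exp (- (\<Sum>j<m. (b j + s)\<^sup>2) / (2 * real m))" .
    have "(\<lambda>r. s / N r) \<longlonglongrightarrow> 0" by (rule real_tendsto_divide_at_top[OF tendsto_const Ninf])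
    from order_tendstoD(1)[OF this, of "-(pi/2)"] order_tendstoD(2)[OF this, of "pi/2"]
    have "eventually (\<lambda>r. s / N r > -(pi/2)) sequentially" "eventually (\<lambda>r. s / N r < pi/2) sequentially"
      by auto
    then have "eventually (\<lambda>r. (\<Prod>j<m. cos ((b j + s) / N r) ^ (2 * r)) = F r s) sequentially"
      by eventually_elim (simp add: F_def)
    with 1 show ?thesis by (rule Lim_transform_eventually)
  qed
  have "(\<lambda>r. LINT s|lborel. F (r + (r0 + 1)) s) \<longlonglongrightarrow> (LINT s|lborel. exp (- (\<Sum>j<m. (b j + s)\<^sup>2) / (2 * real m)))"
  proof (rule integral_dominated_convergence)
    show "integrable lborel w" unfolding w_def by (intro integrable_mult_right integrable_gauss) auto
    show "AE s in lborel. (\<lambda>r. F (r + (r0 + 1)) s) \<longlonglongrightarrow> exp (- (\<Sum>j<m. (b j + s)\<^sup>2) / (2 * real m))"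
      by (rule AE_I2) (rule LIMSEQ_ignore_initial_segment[OF pw])
    show "AE s in lborel. norm (F (r + (r0 + 1)) s) \<le> w s" for r
      using dom[of "r + (r0 + 1)"] by (intro AE_I2) auto
  qed (auto simp: F_def[abs_def])
  then have "(\<lambda>r. LINT s|lborel. F r s) \<longlonglongrightarrow> (LINT s|lborel. exp (- (\<Sum>j<m. (b j + s)\<^sup>2) / (2 * real m)))"
    by (rule LIMSEQ_offset)
  then show ?thesis
    by (rule Lim_transform_eventually) (rule eventually_mono[OF eventually_gt_at_top[of 0]], rule subst[symmetric])
qed

lemma walk_block_sum:
  "(\<Sum>i<m * k. if i \<in> A then g (i div k) else - g (i div k)) = (\<Sum>j<m. g j * real_of_int (walk ((j + 1) * k) A - walk (j * k) A))" 
  for g :: "nat \<Rightarrow> real"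
proof (cases "k = 0")
  case False
  have "(\<Sum>i<m * k. if i \<in> A then g (i div k) else - g (i div k)) = (\<Sum>j<m. \<Sum>i\<in>{j * k..<j * k + k}. if i \<in> A then g (i div k) else - g (i div k))"
    by (rule sum.nat_group[symmetric])
  also have "\<dots> = (\<Sum>j<m. g j * real_of_int (walk ((j + 1) * k) A - walk (j * k) A))"
  proof (rule sum.cong[OF refl])
    fix j
    have w: "walk ((j + 1) * k) A - walk (j * k) A = (\<Sum>i\<in>{j * k..<j * k + k}. if i \<in> A then 1 else - 1)"
    proof -
      have "walk ((j + 1) * k) A = walk (j * k) A + (\<Sum>i\<in>{j * k..<j * k + k}. if i \<in> A then 1 else - 1)"
        unfolding walk_def lessThan_atLeast0 by (subst sum.atLeastLessThan_concat) (auto simp: add.commute)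
      then show ?thesis by simp
    qed
    have "(\<Sum>i\<in>{j * k..<j * k + k}. if i \<in> A then g (i div k) else - g (i div k)) = (\<Sum>i\<in>{j * k..<j * k + k}. g j * real_of_int (if i \<in> A then 1 else - 1))"
    proof (rule sum.cong[OF refl])
      fix i assume "i \<in> {j * k..<j * k + k}"
      then have "i div k = j" using False by (intro div_nat_eqI) (auto simp: algebra_simps)
      then show "(if i \<in> A then g (i div k) else - g (i div k)) = g j * real_of_int (if i \<in> A then 1 else - 1)" by simp
    qed
    then show "(\<Sum>i\<in>{j * k..<j * k + k}. if i \<in> A then g (i div k) else - g (i div k)) = g j * real_of_int (walk ((j + 1) * k) A - walk (j * k) A)"
      unfolding w by (simp add: sum_distrib_left)
  qed
  finally show ?thesis .
qed simp

text \<open>The Fourier representation carries the prefactor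
  \<open>4 ^ (r * m) / pi / sqrt (2 * r * m)\<close>. For \<open>b = 0\<close> the same formula
  counts the bridges, so the prefactor cancels in the quotient and the ratio of two convergent
  integrals is left.\<close>

lemma bridge_charfun_limit:
  fixes b :: "nat \<Rightarrow> real"
  assumes m: "m > 0"
  shows "(\<lambda>r. (\<Sum>A\<in>bridges (r * m). cos (\<Sum>j<m. b j * (real_of_int (walk ((j + 1) * (2 * r)) A - walk (j * (2 * r)) A) / sqrt (2 * r * m)))) / card (bridges (r * m)))
    \<longlonglongrightarrow> exp (- ((\<Sum>j<m. (b j)\<^sup>2) / m - ((\<Sum>j<m. b j) / m)\<^sup>2) / 2)"
proof -
  define I where "I b r = sqrt (2 * r * m) * (LINT t:{-(pi/2)..pi/2}|lborel. (\<Prod>j<m. cos (b j / sqrt (2 * r * m) + t) ^ (2 * r)))" for b :: "nat \<Rightarrow> real" and r :: nat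
  define G :: real where "G = (LINT s|lborel. exp (- s\<^sup>2 / 2))"
  have G: "G > 0" unfolding G_def by (rule integral_gauss_pos)
  have I: "I b \<longlonglongrightarrow> exp (- ((\<Sum>j<m. (b j)\<^sup>2) / m - ((\<Sum>j<m. b j) / m)\<^sup>2) / 2) * G" for b
    using bridge_integral_limit[OF m, of b] unfolding gaussian_integral_shift[OF m] I_def G_def by simp
  have "(\<lambda>r. I b r / I (\<lambda>_. 0) r) \<longlonglongrightarrow> (exp (- ((\<Sum>j<m. (b j)\<^sup>2) / m - ((\<Sum>j<m. b j) / m)\<^sup>2) / 2) * G) / (exp 0 * G)"
    using I[of "\<lambda>_. 0"] G by (intro tendsto_divide I) auto
  moreover have "eventually (\<lambda>r. I b r / I (\<lambda>_. 0) r = (\<Sum>A\<in>bridges (r * m). cos (\<Sum>j<m. b j * (real_of_int (walk ((j + 1) * (2 * r)) A - walk (j * (2 * r)) A) / sqrt (2 * r * m)))) / card (bridges (r * m))) sequentially"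
    using eventually_gt_at_top[of 0]
  proof eventually_elim
    case (elim r)
    have N: "sqrt (2 * real r * real m) > 0" using elim m by simp
    have key: "(\<Sum>A\<in>bridges (r * m). cos (\<Sum>j<m. c j * (real_of_int (walk ((j + 1) * (2 * r)) A - walk (j * (2 * r)) A) / sqrt (2 * r * m)))) = 4 ^ (r * m) / pi / sqrt (2 * r * m) * I c r" for c
    proof -
      have eq: "2 * (r * m) = m * (2 * r)" by simp
      have "(\<Sum>j<m. c j * (real_of_int (walk ((j + 1) * (2 * r)) A - walk (j * (2 * r)) A) / sqrt (2 * r * m)))
         = (\<Sum>i<2 * (r * m). if i \<in> A then c (i div (2 * r)) / sqrt (2 * r * m) else - (c (i div (2 * r)) / sqrt (2 * r * m)))" for A
        unfolding eq walk_block_sum[where g = "\<lambda>j. c j / sqrt (2 * r * m)"] by (rule sum.cong) auto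
      then have "(\<Sum>A\<in>bridges (r * m). cos (\<Sum>j<m. c j * (real_of_int (walk ((j + 1) * (2 * r)) A - walk (j * (2 * r)) A) / sqrt (2 * r * m))))
         = 4 ^ (r * m) / pi * (LINT t:{-(pi/2)..pi/2}|lborel. (\<Prod>i<2 * (r * m). cos (c (i div (2 * r)) / sqrt (2 * r * m) + t)))"
        by (simp only: sum_bridges_cos)
      also have "(\<lambda>t. \<Prod>i<2 * (r * m). cos (c (i div (2 * r)) / sqrt (2 * r * m) + t)) = (\<lambda>t. \<Prod>j<m. cos (c j / sqrt (2 * r * m) + t) ^ (2 * r))"
        unfolding eq by (rule ext) (rule prod_blocks[where g = "\<lambda>j. cos (c j / sqrt (2 * r * m) + _)"])
      finally show ?thesis using N elim m by (simp add: I_def)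
    qed
    have "real (card (bridges (r * m))) = 4 ^ (r * m) / pi / sqrt (2 * r * m) * I (\<lambda>_. 0) r"
      using key[of "\<lambda>_. 0"] by simp
    then show ?case using key[of b] N elim m by simp
  qed
  ultimately show ?thesis using G by (simp add: Lim_transform_eventually)
qed

section \<open>Moments of bridge increments\<close>

lemma walk_diff: "walk (s + h) A - walk s A = (\<Sum>i\<in>{s..<s + h}. if i \<in> A then 1 else - 1)"
proof -
  have "walk (s + h) A = walk s A + (\<Sum>i\<in>{s..<s + h}. if i \<in> A then 1 else - 1)"
    unfolding walk_def lessThan_atLeast0 by (subst sum.atLeastLessThan_concat) auto
  then show ?thesis by simp
qed

definition incr :: "nat \<Rightarrow> nat \<Rightarrow> nat set \<Rightarrow> real" where
  "incr s h A = (\<Sum>i\<in>{s..<s + h}. if i \<in> A then 1 else - 1)"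

lemma incr_walk: "incr s h A = real_of_int (walk (s + h) A - walk s A)"
  unfolding incr_def walk_diff of_int_sum by (rule sum.cong) auto

lemma incr_cong: "A \<inter> {s..<s + h} = C \<inter> {s..<s + h} \<Longrightarrow> incr s h A = incr s h C"
  unfolding incr_def by (rule sum.cong[OF refl]) (metis IntI IntD1)

text \<open>Induction on \<open>h\<close> by adding one sign: odd powers cancel in
  \<open>g (x + 1) + g (x - 1)\<close>, so each moment satisfies a linear recursion involving the
  lower even ones.\<close>

lemma rademacher_moments:
  "(\<Sum>A\<in>Pow {s..<s + h}. (incr s h A)\<^sup>2) = 2 ^ h * real h" (is "?A h")
  "(\<Sum>A\<in>Pow {s..<s + h}. (incr s h A) ^ 4) = 2 ^ h * (3 * (real h)\<^sup>2 - 2 * real h)" (is "?B h")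
proof -
  have "?A h \<and> ?B h"
  proof (induction h)
    case 0
    have "incr s 0 A = 0" for A by (simp add: incr_def)
    then show ?case by simp
  next
    case (Suc h)
    have set: "{s..<s + Suc h} = insert (s + h) {s..<s + h}" by auto
    have step: "(\<Sum>A\<in>Pow {s..<s + Suc h}. g (incr s (Suc h) A)) = (\<Sum>A\<in>Pow {s..<s + h}. g (incr s h A + 1) + g (incr s h A - 1))" for g :: "real \<Rightarrow> real"
    proof -
      have "(\<Sum>A\<in>Pow {s..<s + Suc h}. g (incr s (Suc h) A)) = (\<Sum>A\<in>Pow {s..<s + h}. g (incr s (Suc h) (insert (s + h) A)) + g (incr s (Suc h) A))"
        unfolding set by (rule sum_Pow_insert) auto
      also have "\<dots> = (\<Sum>A\<in>Pow {s..<s + h}. g (incr s h A + 1) + g (incr s h A - 1))"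
      proof (rule sum.cong[OF refl])
        fix A assume "A \<in> Pow {s..<s + h}"
        then have "s + h \<notin> A" by auto
        moreover have "incr s h (insert (s + h) A) = incr s h A" by (rule incr_cong) auto
        moreover have "incr s (Suc h) C = incr s h C + (if s + h \<in> C then 1 else - 1)" for C by (simp add: incr_def)
        ultimately have "incr s (Suc h) (insert (s + h) A) = incr s h A + 1" "incr s (Suc h) A = incr s h A - 1"
          by simp_all
        then show "g (incr s (Suc h) (insert (s + h) A)) + g (incr s (Suc h) A) = g (incr s h A + 1) + g (incr s h A - 1)" by simp
      qed
      finally show ?thesis .
    qed
    have c: "(\<Sum>A\<in>Pow {s..<s + h}. (1::real)) = 2 ^ h" by (simp add: card_Pow)
    have "?A (Suc h)"
    proof -
      have "(x + 1)\<^sup>2 + (x - 1)\<^sup>2 = 2 * x\<^sup>2 + 2 * 1" for x :: real by (simp add: power2_eq_square algebra_simps)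
      then have "(\<Sum>A\<in>Pow {s..<s + Suc h}. (incr s (Suc h) A)\<^sup>2) = 2 * (\<Sum>A\<in>Pow {s..<s + h}. (incr s h A)\<^sup>2) + 2 * (\<Sum>A\<in>Pow {s..<s + h}. 1)"
        unfolding step[of "\<lambda>x. x\<^sup>2"] by (simp only: sum.distrib sum_distrib_left)
      also have "\<dots> = 2 * (2 ^ h * real h) + 2 * 2 ^ h" unfolding c using Suc by simp
      finally show ?thesis by (simp add: algebra_simps)
    qed
    moreover have "?B (Suc h)"
    proof -
      have "(x + 1) ^ 4 + (x - 1) ^ 4 = 2 * x ^ 4 + 12 * x\<^sup>2 + 2 * 1" for x :: real
        by (simp add: power4_eq_xxxx power2_eq_square algebra_simps)
      then have "(\<Sum>A\<in>Pow {s..<s + Suc h}. (incr s (Suc h) A) ^ 4) = 2 * (\<Sum>A\<in>Pow {s..<s + h}. (incr s h A) ^ 4) + 12 * (\<Sum>A\<in>Pow {s..<s + h}. (incr s h A)\<^sup>2) + 2 * (\<Sum>A\<in>Pow {s..<s + h}. 1)"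
        unfolding step[of "\<lambda>x. x ^ 4"] by (simp only: sum.distrib sum_distrib_left)
      also have "\<dots> = 2 * (2 ^ h * (3 * (real h)\<^sup>2 - 2 * real h)) + 12 * (2 ^ h * real h) + 2 * 2 ^ h" unfolding c using Suc by simp
      finally show ?thesis by (simp add: power2_eq_square algebra_simps)
    qed
    ultimately show ?case by (rule conjI)
  qed
  note AB = this
  show "?A h" by (rule conjunct1[OF AB])
  show "?B h" by (rule conjunct2[OF AB])
qed

lemma central_binomial_rec: "real (Suc n) * real (2 * Suc n choose Suc n) = 2 * (2 * real n + 1) * real (2 * n choose n)"
proof -
  have e1: "Suc n * (Suc (Suc (2 * n)) choose Suc n) = Suc (Suc (2 * n)) * (Suc (2 * n) choose n)"
    by (rule Suc_times_binomial)
  have e2: "Suc (2 * n) choose n = Suc (2 * n) choose Suc n"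
    using binomial_symmetric[of n "Suc (2 * n)"] by simp
  have e3: "Suc n * (Suc (2 * n) choose Suc n) = Suc (2 * n) * (2 * n choose n)"
    by (rule Suc_times_binomial)
  have "Suc n * (Suc (Suc (2 * n)) choose Suc n) = 2 * (Suc n * (Suc (2 * n) choose Suc n))" unfolding e1 e2 by simp
  also have "\<dots> = 2 * (2 * n + 1) * (2 * n choose n)" unfolding e3 by simp
  finally have "real (Suc n * (Suc (Suc (2 * n)) choose Suc n)) = real (2 * (2 * n + 1) * (2 * n choose n))" by (rule arg_cong)
  then have "real (Suc n) * real (Suc (Suc (2 * n)) choose Suc n) = real (2 * (2 * n + 1)) * real (2 * n choose n)"
    unfolding of_nat_mult .
  moreover have "2 * Suc n = Suc (Suc (2 * n))" "real (2 * (2 * n + 1)) = 2 * (2 * real n + 1)" by simp_all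
  ultimately show ?thesis by (simp only:)
qed

lemma central_binomial_rec_sq:
  "(real n + 1)\<^sup>2 * (real (2 * Suc n choose Suc n))\<^sup>2 = 4 * (2 * real n + 1)\<^sup>2 * (real (2 * n choose n))\<^sup>2"
proof -
  have "((real n + 1) * real (2 * Suc n choose Suc n))\<^sup>2 = (2 * (2 * real n + 1) * real (2 * n choose n))\<^sup>2"
    using central_binomial_rec[of n] by (simp add: add.commute)
  then show ?thesis by (simp only: power_mult_distrib) simp
qed

text \<open>A Wallis bound in squared form, which avoids square roots: by the recursion the left
  side divided by \<open>16 ^ n\<close> decreases.\<close>

lemma central_binomial_upper: "(real (2 * n choose n))\<^sup>2 * (2 * real n + 1) \<le> 16 ^ n"
proof (induction n)
  case (Suc n)
  define c where "c = real (2 * n choose n)"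
  define d where "d = real (2 * Suc n choose Suc n)"
  have r: "(real n + 1)\<^sup>2 * d\<^sup>2 = 4 * (2 * real n + 1)\<^sup>2 * c\<^sup>2" unfolding c_def d_def by (rule central_binomial_rec_sq)
  have "(real n + 1)\<^sup>2 * (d\<^sup>2 * (2 * real n + 3)) = ((real n + 1)\<^sup>2 * d\<^sup>2) * (2 * real n + 3)" by simp
  also have "\<dots> = (4 * (2 * real n + 1) * (2 * real n + 3)) * (c\<^sup>2 * (2 * real n + 1))" unfolding r by (simp add: power2_eq_square)
  also have "\<dots> \<le> (4 * (2 * real n + 1) * (2 * real n + 3)) * 16 ^ n" using Suc by (intro mult_left_mono) (auto simp: c_def)
  also have "\<dots> \<le> (16 * (real n + 1)\<^sup>2) * 16 ^ n"
  proof (rule mult_right_mono)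
    show "4 * (2 * real n + 1) * (2 * real n + 3) \<le> 16 * (real n + 1)\<^sup>2" by (simp add: power2_eq_square algebra_simps)
  qed simp
  also have "\<dots> = (real n + 1)\<^sup>2 * 16 ^ Suc n" by simp
  finally have "d\<^sup>2 * (2 * real n + 3) \<le> 16 ^ Suc n" by (rule mult_left_le_imp_le) simp
  then show ?case by (simp add: d_def add.commute add.left_commute)
qed simp

text \<open>The counterpart: here the quotient with \<open>16 ^ n\<close> increases, starting with
  equality at \<open>n = 1\<close>.\<close>

lemma central_binomial_lower: "n > 0 \<Longrightarrow> 16 ^ n \<le> (real (2 * n choose n))\<^sup>2 * (4 * real n)"
proof (induction n)
  case (Suc n)
  show ?case
  proof (cases "n = 0")
    case False
    define c where "c = real (2 * n choose n)"
    define d where "d = real (2 * Suc n choose Suc n)"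
    have r: "(real n + 1)\<^sup>2 * d\<^sup>2 = 4 * (2 * real n + 1)\<^sup>2 * c\<^sup>2" unfolding c_def d_def by (rule central_binomial_rec_sq)
    have n: "real n * (real n + 1) > 0" using False by simp
    have "16 * (real n * (real n + 1)) \<le> 4 * (2 * real n + 1)\<^sup>2" unfolding power2_eq_square by (simp add: algebra_simps)
    from mult_right_mono[OF this, of "16 ^ n"]
    have "real n * (real n + 1) * 16 ^ Suc n \<le> (4 * (2 * real n + 1)\<^sup>2) * 16 ^ n" by (simp only: power_Suc mult_ac) simp
    also have "\<dots> \<le> (4 * (2 * real n + 1)\<^sup>2) * (c\<^sup>2 * (4 * real n))" using Suc False by (intro mult_left_mono) (auto simp: c_def)
    also have "\<dots> = real n * (4 * ((real n + 1)\<^sup>2 * d\<^sup>2))" unfolding r by simp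
    also have "\<dots> = real n * (real n + 1) * (d\<^sup>2 * (4 * (real n + 1)))" by (simp add: power2_eq_square)
    finally have "16 ^ Suc n \<le> d\<^sup>2 * (4 * (real n + 1))" using n by (rule mult_left_le_imp_le)
    then show ?thesis by (simp add: d_def add.commute)
  qed simp
qed simp

text \<open>Bounded density of the bridge with respect to the free walk, on at most half of the time interval.\<close>

lemma bridge_sum_le_free:
  assumes "s + h \<le> 2 * n" "h \<le> n" "n > 0" "even h" and g: "\<And>A. g A \<ge> 0"
    and g_cong: "\<And>A. g (A \<inter> {s..<s + h}) = g A"
  shows "(\<Sum>A\<in>bridges n. g A) \<le> 2 * real (card (bridges n)) / 2 ^ h * (\<Sum>D\<in>Pow {s..<s + h}. g D)"
proof -
  let ?S = "{s..<s + h}"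
  obtain t where t: "h = 2 * t" using assms(4) by blast
  define k where "k = n - t"
  have k: "2 * n = 2 * k + h" using assms(2) t by (simp add: k_def)
  \<comment> \<open>As \<open>h \<le> n\<close>, the remaining length \<open>2 * k\<close> is at
    least \<open>n\<close>, so removing \<open>h\<close> steps divides the central binomial
    coefficient by \<open>2 ^ h\<close> up to a bounded factor; the squared Wallis bounds give at
    most 2.\<close>
  have ratio: "real (2 * k choose k) \<le> 2 * real (2 * n choose n) / 2 ^ h"
  proof -
    have kn: "real n \<le> 2 * real k + 1" using k assms(2) by linarith
    have "(2 * real k + 1) * (real (2 * k choose k) * 2 ^ h)\<^sup>2 = ((real (2 * k choose k))\<^sup>2 * (2 * real k + 1)) * 4 ^ h"
    proof -
      have "((2 :: real) ^ h)\<^sup>2 = 4 ^ h" by (simp add: power2_eq_square power_mult_distrib[symmetric])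
      then show ?thesis by (simp only: power_mult_distrib mult_ac)
    qed
    also have "\<dots> \<le> 16 ^ k * 4 ^ h" using central_binomial_upper by (intro mult_right_mono) auto
    also have "16 ^ k * 4 ^ h = (16 :: real) ^ n"
    proof -
      have "(16 :: real) ^ k = 4 ^ (2 * k)" "(16 :: real) ^ n = 4 ^ (2 * n)" by (simp_all add: power_mult)
      then show ?thesis using k by (simp add: power_add)
    qed
    also have "\<dots> \<le> (real (2 * n choose n))\<^sup>2 * (4 * real n)" by (rule central_binomial_lower[OF assms(3)])
    also have "\<dots> \<le> (real (2 * n choose n))\<^sup>2 * (4 * (2 * real k + 1))" using kn by (intro mult_left_mono) auto
    also have "\<dots> = (2 * real k + 1) * (2 * real (2 * n choose n))\<^sup>2" by (simp add: power_mult_distrib)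
    finally have "(real (2 * k choose k) * 2 ^ h)\<^sup>2 \<le> (2 * real (2 * n choose n))\<^sup>2" by (rule mult_left_le_imp_le) simp
    then have "real (2 * k choose k) * 2 ^ h \<le> 2 * real (2 * n choose n)" by (rule power2_le_imp_le) simp
    then show ?thesis by (simp add: field_simps)
  qed
  \<comment> \<open>Given the steps inside the window, the outside must contain
    \<open>n - card D\<close> up-steps; the number of ways to place them is largest for the central
    binomial coefficient.\<close>
  have fib: "card {A \<in> bridges n. A \<inter> ?S = D} \<le> 2 * k choose k" if D: "D \<in> Pow ?S" for D
  proof -
    have "card {A \<in> bridges n. A \<inter> ?S = D} = card ((\<lambda>A. A - ?S) ` {A \<in> bridges n. A \<inter> ?S = D})"
      by (rule card_image[symmetric], rule inj_onI) blast
    also have "\<dots> \<le> card {B. B \<subseteq> {..<2 * n} - ?S \<and> card B = n - card D}"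
    proof (rule card_mono)
      show "finite {B. B \<subseteq> {..<2 * n} - ?S \<and> card B = n - card D}" by (rule finite_subset[of _ "Pow {..<2 * n}"]) auto
      show "(\<lambda>A. A - ?S) ` {A \<in> bridges n. A \<inter> ?S = D} \<subseteq> {B. B \<subseteq> {..<2 * n} - ?S \<and> card B = n - card D}"
      proof (clarify, intro CollectI conjI)
        fix A assume A: "A \<in> bridges n" "D = A \<inter> ?S"
        then show "A - ?S \<subseteq> {..<2 * n} - ?S" by (auto simp: bridges_eq)
        have "finite A" using A finite_subset by (auto simp: bridges_eq)
        then have "card (A - ?S) = card A - card (A \<inter> ?S)" by (intro card_Diff_subset_Int) auto
        then show "card (A - ?S) = n - card (A \<inter> ?S)" using A by (simp add: bridges_eq)
      qed
    qed
    also have "\<dots> = card ({..<2 * n} - ?S) choose (n - card D)" by (rule n_subsets) simp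
    also have "card ({..<2 * n} - ?S) = 2 * k" using assms(1) k by (subst card_Diff_subset) auto
    also have "2 * k choose (n - card D) \<le> 2 * k choose k" using binomial_maximum[of "2 * k" "n - card D"] by simp
    finally show ?thesis .
  qed
  have "(\<Sum>A\<in>bridges n. g A) = (\<Sum>D\<in>Pow ?S. \<Sum>A\<in>{A \<in> bridges n. A \<inter> ?S = D}. g A)"
    by (rule sum.group[symmetric]) auto
  also have "\<dots> = (\<Sum>D\<in>Pow ?S. card {A \<in> bridges n. A \<inter> ?S = D} * g D)"
  proof (rule sum.cong[OF refl])
    fix D
    have "(\<Sum>A\<in>{A \<in> bridges n. A \<inter> ?S = D}. g A) = (\<Sum>A\<in>{A \<in> bridges n. A \<inter> ?S = D}. g D)"
      by (rule sum.cong) (use g_cong in auto)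
    then show "(\<Sum>A\<in>{A \<in> bridges n. A \<inter> ?S = D}. g A) = card {A \<in> bridges n. A \<inter> ?S = D} * g D" by simp
  qed
  also have "\<dots> \<le> (\<Sum>D\<in>Pow ?S. 2 * real (2 * n choose n) / 2 ^ h * g D)"
    using g by (intro sum_mono mult_right_mono order.trans[OF of_nat_mono[OF fib] ratio]) auto
  finally show ?thesis by (simp add: card_bridges sum_distrib_left)
qed

text \<open>The windows used later have lengths that are powers of two, so the comparison with the
  free walk covers all but length 1, where the increment is a single sign.\<close>

lemma bridge_fourth_moment:
  assumes "s + h \<le> 2 * n" "h \<le> n" "n > 0" "even h \<or> h = 1"
  shows "(\<Sum>A\<in>bridges n. (incr s h A) ^ 4) \<le> 6 * (real h)\<^sup>2 * card (bridges n)"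
proof (cases "even h")
  case True
  have c: "incr s h (A \<inter> {s..<s + h}) = incr s h A" for A by (rule incr_cong) auto
  have "(\<Sum>A\<in>bridges n. (incr s h A) ^ 4) \<le> 2 * real (card (bridges n)) / 2 ^ h * (\<Sum>D\<in>Pow {s..<s + h}. (incr s h D) ^ 4)"
    by (rule bridge_sum_le_free[OF assms(1-3) True]) (simp_all add: c)
  also have "\<dots> = 2 * real (card (bridges n)) * (3 * (real h)\<^sup>2 - 2 * real h)" by (simp add: rademacher_moments(2))
  also have "\<dots> \<le> 2 * real (card (bridges n)) * (3 * (real h)\<^sup>2)" by (intro mult_left_mono) auto
  finally show ?thesis by (simp add: mult_ac)
next
  case False
  then have h: "h = 1" using assms by simp
  then have "(incr s h A) ^ 4 = 1" for A by (simp add: incr_def)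
  then show ?thesis using h by simp
qed

section \<open>Chaining and comparison of maxima\<close>

text \<open>Refining the level by one either keeps the rounded position of \<open>k\<close> or moves
  it up by one cell of the finer level, so passing through the levels costs at most one increment
  per level.\<close>

lemma dyadic_chain:
  fixes Z :: "nat \<Rightarrow> real"
  assumes step: "\<And>l j. L < l \<Longrightarrow> l \<le> H \<Longrightarrow> j < 2 ^ l \<Longrightarrow> \<bar>Z ((j + 1) * 2 ^ (H - l)) - Z (j * 2 ^ (H - l))\<bar> \<le> \<delta> l"
    and \<delta>: "\<And>l. \<delta> l \<ge> 0" and k: "k < 2 ^ H" and LH: "L \<le> H"
  shows "\<bar>Z k - Z (k div 2 ^ (H - L) * 2 ^ (H - L))\<bar> \<le> (\<Sum>l\<in>{L<..H}. \<delta> l)"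
proof -
  define K where "K l = k div 2 ^ (H - l) * 2 ^ (H - l)" for l
  have "l \<le> H \<Longrightarrow> \<bar>Z (K l) - Z (K L)\<bar> \<le> (\<Sum>i\<in>{L<..l}. \<delta> i)" if "L \<le> l" for l
    using that
  proof (induction l rule: dec_induct)
    case (step l)
    define d where "d = (2::nat) ^ (H - Suc l)"
    have d2: "2 ^ (H - l) = 2 * d" using step.prems by (simp add: d_def Suc_diff_Suc flip: power_Suc)
    have d0: "d > 0" by (simp add: d_def)
    define j where "j = 2 * (k div (2 * d))"
    have kd: "k div d = j \<or> k div d = j + 1"
    proof -
      have "k div (2 * d) = k div d div 2" by (simp add: div_mult2_eq mult.commute)
      moreover have "e = 2 * (e div 2) \<or> e = 2 * (e div 2) + 1" for e :: nat by presburger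
      ultimately show ?thesis unfolding j_def by metis
    qed
    have "\<bar>Z (K (Suc l)) - Z (K l)\<bar> \<le> \<delta> (Suc l)"
    proof (cases "k div d = j")
      case True
      then have "K (Suc l) = K l" using step.prems by (simp add: K_def d2 d_def[symmetric] j_def)
      then show ?thesis using \<delta> by simp
    next
      case False
      then have kj: "k div d = j + 1" using kd by simp
      have "j * d \<le> k" using kj d0 by (metis add.commute div_times_less_eq_dividend le_add2 mult_le_mono1 order_trans)
      also have "k < 2 ^ H" by (rule k)
      also have "(2::nat) ^ H = 2 ^ Suc l * d" using step.prems by (simp add: d_def flip: power_add power_Suc)
      finally have "j < 2 ^ Suc l" using d0 by simp
      moreover have "K (Suc l) = (j + 1) * 2 ^ (H - Suc l)" "K l = j * 2 ^ (H - Suc l)"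
        using kj step.prems by (simp_all add: K_def d2 d_def[symmetric] j_def)
      ultimately show ?thesis using assms(1)[of "Suc l" j] step by simp
    qed
    moreover have "(\<Sum>i\<in>{L<..Suc l}. \<delta> i) = (\<Sum>i\<in>{L<..l}. \<delta> i) + \<delta> (Suc l)"
    proof -
      have "{L<..Suc l} = insert (Suc l) {L<..l}" using step by auto
      then show ?thesis by simp
    qed
    ultimately show ?case using step by (simp add: abs_le_iff)
  qed simp
  from this[OF LH order_refl] show ?thesis by (simp add: K_def)
qed

lemma geometric_tail_le:
  fixes x :: real assumes "0 \<le> x" "x < 1"
  shows "(\<Sum>l\<in>{L<..H}. x ^ l) \<le> x ^ L * (x / (1 - x))"
proof -
  have "(\<Sum>l\<in>{L<..H}. x ^ l) = (\<Sum>i\<in>(\<lambda>l. l - Suc L) ` {L<..H}. x ^ Suc L * x ^ i)"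
    by (subst sum.reindex) (auto simp: inj_on_def simp flip: power_add power_Suc intro!: sum.cong)
  also have "\<dots> = x ^ Suc L * (\<Sum>i\<in>(\<lambda>l. l - Suc L) ` {L<..H}. x ^ i)" by (simp add: sum_distrib_left)
  also have "\<dots> \<le> x ^ Suc L * (\<Sum>i. x ^ i)"
    using assms by (intro mult_left_mono sum_le_suminf summable_geometric) auto
  also have "\<dots> = x ^ L * (x / (1 - x))" using assms by (simp add: suminf_geometric)
  finally show ?thesis .
qed

context prob_space
begin

lemma markov_fourth:
  fixes X :: "'a \<Rightarrow> real"
  assumes "integrable M (\<lambda>\<omega>. X \<omega> ^ 4)" "expectation (\<lambda>\<omega>. X \<omega> ^ 4) \<le> C" "c > 0"
  shows "prob {\<omega> \<in> space M. \<bar>X \<omega>\<bar> \<ge> c} \<le> C / c ^ 4"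
proof -
  have eq: "\<bar>X \<omega>\<bar> \<ge> c \<longleftrightarrow> X \<omega> ^ 4 \<ge> c ^ 4" for \<omega>
    using power_mono_iff[of c "\<bar>X \<omega>\<bar>" 4] assms(3) by simp
  have "prob {\<omega> \<in> space M. \<bar>X \<omega>\<bar> \<ge> c} \<le> expectation (\<lambda>\<omega>. X \<omega> ^ 4) / c ^ 4"
    unfolding eq using assms by (intro integral_Markov_inequality_measure[where A = "space M"]) auto
  also have "\<dots> \<le> C / c ^ 4" using assms by (intro divide_right_mono) auto
  finally show ?thesis .
qed

text \<open>Level \<open>l\<close> is allowed increments up to \<open>(9/10) ^ l\<close>. By the
  fourth moment each of its \<open>2 ^ l\<close> cells violates this with probability at most
  \<open>C / 4 ^ l / ((9/10) ^ l) ^ 4\<close>; since \<open>2 / (4 * (9/10) ^ 4) < 4/5\<close>, the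
  union bound is geometric. Summing the two geometric tails yields the factor 9, rounded up to 10,
  and the factor 4.\<close>

lemma chaining:
  fixes Z :: "nat \<Rightarrow> 'a \<Rightarrow> real"
  assumes meas: "\<And>k. random_variable borel (Z k)"
    and int: "\<And>l j. L < l \<Longrightarrow> l \<le> H \<Longrightarrow> j < 2 ^ l \<Longrightarrow> integrable M (\<lambda>\<omega>. (Z ((j + 1) * 2 ^ (H - l)) \<omega> - Z (j * 2 ^ (H - l)) \<omega>) ^ 4)"
    and mom: "\<And>l j. L < l \<Longrightarrow> l \<le> H \<Longrightarrow> j < 2 ^ l \<Longrightarrow> expectation (\<lambda>\<omega>. (Z ((j + 1) * 2 ^ (H - l)) \<omega> - Z (j * 2 ^ (H - l)) \<omega>) ^ 4) \<le> C / 4 ^ l"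
    and LH: "L \<le> H" and C: "C \<ge> 0"
  shows "prob {\<omega> \<in> space M. \<exists>k<2 ^ H. \<bar>Z k \<omega> - Z (k div 2 ^ (H - L) * 2 ^ (H - L)) \<omega>\<bar> > 10 * (9/10) ^ L} \<le> 4 * C * (4/5) ^ L"
proof -
  define B where "B l j = {\<omega> \<in> space M. \<bar>Z ((j + 1) * 2 ^ (H - l)) \<omega> - Z (j * 2 ^ (H - l)) \<omega>\<bar> \<ge> (9/10) ^ l}" for l j
  have Bm: "B l j \<in> events" for l j
    using meas unfolding B_def by measurable
  have B: "prob (B l j) \<le> C / 4 ^ l / ((9/10) ^ l) ^ 4" if "L < l" "l \<le> H" "j < 2 ^ l" for l j
    unfolding B_def by (intro markov_fourth int mom that) auto
  have sub: "{\<omega> \<in> space M. \<exists>k<2 ^ H. \<bar>Z k \<omega> - Z (k div 2 ^ (H - L) * 2 ^ (H - L)) \<omega>\<bar> > 10 * (9/10) ^ L} \<subseteq> (\<Union>l\<in>{L<..H}. \<Union>j\<in>{..<2^l}. B l j)"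
  proof (rule subsetI, rule ccontr)
    fix \<omega> assume "\<omega> \<in> {\<omega> \<in> space M. \<exists>k<2 ^ H. \<bar>Z k \<omega> - Z (k div 2 ^ (H - L) * 2 ^ (H - L)) \<omega>\<bar> > 10 * (9/10) ^ L}"
    then obtain k where w: "\<omega> \<in> space M" "k < 2 ^ H" "\<bar>Z k \<omega> - Z (k div 2 ^ (H - L) * 2 ^ (H - L)) \<omega>\<bar> > 10 * (9/10) ^ L"
      by blast
    assume "\<omega> \<notin> (\<Union>l\<in>{L<..H}. \<Union>j\<in>{..<2^l}. B l j)"
    then have w4: "\<And>l j. L < l \<Longrightarrow> l \<le> H \<Longrightarrow> j < 2 ^ l \<Longrightarrow> \<omega> \<notin> B l j" by auto
    have "\<bar>Z k \<omega> - Z (k div 2 ^ (H - L) * 2 ^ (H - L)) \<omega>\<bar> \<le> (\<Sum>l\<in>{L<..H}. (9/10) ^ l)"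
    proof (rule dyadic_chain[of L H "\<lambda>k. Z k \<omega>" "\<lambda>l. (9/10) ^ l" k])
      fix l j :: nat assume "L < l" "l \<le> H" "j < 2 ^ l"
      then have "\<omega> \<notin> B l j" by (rule w4)
      then show "\<bar>Z ((j + 1) * 2 ^ (H - l)) \<omega> - Z (j * 2 ^ (H - l)) \<omega>\<bar> \<le> (9/10) ^ l" using w(1) by (simp add: B_def)
    qed (use w LH in auto)
    also have "\<dots> \<le> (9/10) ^ L * ((9/10) / (1 - 9/10))" by (rule geometric_tail_le) auto
    also have "\<dots> \<le> 10 * (9/10) ^ L" by simp
    finally show False using w(3) by simp
  qed
  have "prob {\<omega> \<in> space M. \<exists>k<2 ^ H. \<bar>Z k \<omega> - Z (k div 2 ^ (H - L) * 2 ^ (H - L)) \<omega>\<bar> > 10 * (9/10) ^ L} \<le> prob (\<Union>l\<in>{L<..H}. \<Union>j\<in>{..<2^l}. B l j)"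
    using Bm by (intro finite_measure_mono sub) auto
  also have "\<dots> \<le> (\<Sum>l\<in>{L<..H}. prob (\<Union>j\<in>{..<2^l}. B l j))"
    using Bm by (intro finite_measure_subadditive_finite) auto
  also have "\<dots> \<le> (\<Sum>l\<in>{L<..H}. C * (4/5) ^ l)"
  proof (rule sum_mono)
    fix l assume l: "l \<in> {L<..H}"
    have "prob (\<Union>j\<in>{..<2^l}. B l j) \<le> (\<Sum>j\<in>{..<2^l}. prob (B l j))"
      using Bm by (intro finite_measure_subadditive_finite) auto
    also have "\<dots> \<le> (\<Sum>j\<in>{..<(2::nat)^l}. C / 4 ^ l / ((9/10) ^ l) ^ 4)" using B l by (intro sum_mono) auto
    also have "\<dots> = C * (2 ^ l / (4 ^ l * ((9/10) ^ 4) ^ l))" by (simp add: power_mult[symmetric] mult.commute[of l])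
    also have "2 ^ l / (4 ^ l * ((9/10) ^ 4) ^ l :: real) = (2 / (4 * (9/10) ^ 4)) ^ l" by (simp only: power_divide power_mult_distrib)
    also have "\<dots> \<le> (4/5 :: real) ^ l" by (intro power_mono) (auto simp: power_divide)
    finally show "prob (\<Union>j\<in>{..<2^l}. B l j) \<le> C * (4/5) ^ l" using C by (simp add: mult_left_mono)
  qed
  also have "\<dots> = C * (\<Sum>l\<in>{L<..H}. (4/5) ^ l)" by (simp add: sum_distrib_left)
  also have "\<dots> \<le> C * ((4/5) ^ L * ((4/5) / (1 - 4/5)))" using C by (intro mult_left_mono geometric_tail_le) auto
  finally show ?thesis by (simp add: mult_ac)
qed

end

section \<open>Comparing maxima of partial sums of two processes\<close>

locale prob_pair =
  fixes M :: "nat \<Rightarrow> 'a measure" and M' :: "nat \<Rightarrow> 'b measure"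
    and X :: "nat \<Rightarrow> nat \<Rightarrow> 'a \<Rightarrow> real" and X' :: "nat \<Rightarrow> nat \<Rightarrow> 'b \<Rightarrow> real" and m :: nat
  assumes ps: "\<And>n. prob_space (M n)" and ps': "\<And>n. prob_space (M' n)"
    and meas [measurable]: "\<And>n i. X n i \<in> borel_measurable (M n)" and meas' [measurable]: "\<And>n i. X' n i \<in> borel_measurable (M' n)"
    and cos_lim: "\<And>b. (\<lambda>n. (LINT \<omega>|M n. cos (\<Sum>i<m. b i * X n i \<omega>)) - (LINT \<omega>|M' n. cos (\<Sum>i<m. b i * X' n i \<omega>))) \<longlonglongrightarrow> 0"
begin

text \<open>Only the difference of the two expectations is asked to vanish, so the processes are
  compared directly and no limiting vector appears.\<close>

definition same_limit :: "((nat \<Rightarrow> real) \<Rightarrow> real) \<Rightarrow> bool" where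
  "same_limit g \<longleftrightarrow> (\<forall>n. integrable (M n) (\<lambda>\<omega>. g (\<lambda>i. X n i \<omega>)) \<and> integrable (M' n) (\<lambda>\<omega>. g (\<lambda>i. X' n i \<omega>))) \<and>
     (\<lambda>n. (LINT \<omega>|M n. g (\<lambda>i. X n i \<omega>)) - (LINT \<omega>|M' n. g (\<lambda>i. X' n i \<omega>))) \<longlonglongrightarrow> 0"

lemma same_limit_add: "same_limit g \<Longrightarrow> same_limit h \<Longrightarrow> same_limit (\<lambda>x. g x + h x)"
  unfolding same_limit_def
proof (intro conjI allI; elim conjE)
  assume a: "\<forall>n. integrable (M n) (\<lambda>\<omega>. g (\<lambda>i. X n i \<omega>)) \<and> integrable (M' n) (\<lambda>\<omega>. g (\<lambda>i. X' n i \<omega>))"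
    "\<forall>n. integrable (M n) (\<lambda>\<omega>. h (\<lambda>i. X n i \<omega>)) \<and> integrable (M' n) (\<lambda>\<omega>. h (\<lambda>i. X' n i \<omega>))"
    "(\<lambda>n. (LINT \<omega>|M n. g (\<lambda>i. X n i \<omega>)) - (LINT \<omega>|M' n. g (\<lambda>i. X' n i \<omega>))) \<longlonglongrightarrow> 0"
    "(\<lambda>n. (LINT \<omega>|M n. h (\<lambda>i. X n i \<omega>)) - (LINT \<omega>|M' n. h (\<lambda>i. X' n i \<omega>))) \<longlonglongrightarrow> 0"
  show "(\<lambda>n. (LINT \<omega>|M n. g (\<lambda>i. X n i \<omega>) + h (\<lambda>i. X n i \<omega>)) - (LINT \<omega>|M' n. g (\<lambda>i. X' n i \<omega>) + h (\<lambda>i. X' n i \<omega>))) \<longlonglongrightarrow> 0"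
    using tendsto_add[OF a(3,4)] a(1,2) by (simp add: algebra_simps)
qed auto

lemma same_limit_scale: 
  assumes "same_limit g" shows "same_limit (\<lambda>x. c * g x)"
proof -
  have "(\<lambda>n. (LINT \<omega>|M n. g (\<lambda>i. X n i \<omega>)) - (LINT \<omega>|M' n. g (\<lambda>i. X' n i \<omega>))) \<longlonglongrightarrow> 0"
    using assms by (simp add: same_limit_def)
  from tendsto_mult_left[OF this, of c] show ?thesis
    using assms by (simp add: same_limit_def right_diff_distrib)
qed

lemma same_limit_sum: "finite I \<Longrightarrow> (\<And>i. i \<in> I \<Longrightarrow> same_limit (g i)) \<Longrightarrow> same_limit (\<lambda>x. \<Sum>i\<in>I. g i x)"
proof (induction I rule: finite_induct)
  case empty then show ?case by (simp add: same_limit_def)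
next
  case (insert i I) then show ?case using same_limit_add[of "g i" "\<lambda>x. \<Sum>i\<in>I. g i x"] by simp
qed

lemma same_limit_cos: "same_limit (\<lambda>x. cos (\<Sum>i<m. b i * x i))"
proof -
  interpret prob_space "M n" for n by (rule ps)
  interpret M': prob_space "M' n" for n by (rule ps')
  have "integrable (M n) (\<lambda>\<omega>. cos (\<Sum>i<m. b i * X n i \<omega>))" "integrable (M' n) (\<lambda>\<omega>. cos (\<Sum>i<m. b i * X' n i \<omega>))" for n
    by (rule integrable_const_bound[of _ 1] M'.integrable_const_bound[of _ 1]; simp)+
  then show ?thesis using cos_lim[of b] by (simp add: same_limit_def)
qed

lemma partial_sum_eq: "j \<le> m \<Longrightarrow> (\<Sum>i<j. x i) = (\<Sum>i<m. (if i < j then 1 else 0) * x i :: real)"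
proof -
  assume j: "j \<le> m"
  show ?thesis by (rule sum.mono_neutral_cong_left) (use j in auto)
qed

text \<open>A factor \<open>cos (s * S)\<close> with \<open>S\<close> a partial sum is again the
  cosine of a linear form, so the product formula merges it into the first factor at the price of
  two new coefficient vectors \<open>b + e\<close> and \<open>b - e\<close>. The induction on the
  list therefore runs with \<open>b\<close> arbitrary.\<close>

lemma same_limit_cos_prod:
  assumes "\<And>j. j \<in> set js \<Longrightarrow> j \<le> m"
  shows "same_limit (\<lambda>x. cos (\<Sum>i<m. b i * x i) * (\<Prod>j\<leftarrow>js. cos (s * (\<Sum>i<j. x i))))"
  using assms
proof (induction js arbitrary: b)
  case Nil then show ?case using same_limit_cos by simp
next
  case (Cons j js)
  define e where "e i = s * (if i < j then 1 else 0)" for i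
  have eq: "s * (\<Sum>i<j. x i) = (\<Sum>i<m. e i * x i)" for x
    using partial_sum_eq[of j x] Cons.prems by (simp add: e_def sum_distrib_left mult.assoc)
  have "same_limit (\<lambda>x. 1/2 * (cos (\<Sum>i<m. (b i + e i) * x i) * (\<Prod>j\<leftarrow>js. cos (s * (\<Sum>i<j. x i)))) 
       + 1/2 * (cos (\<Sum>i<m. (b i - e i) * x i) * (\<Prod>j\<leftarrow>js. cos (s * (\<Sum>i<j. x i)))))"
    using Cons by (intro same_limit_add same_limit_scale) auto
  moreover have "1/2 * (cos (\<Sum>i<m. (b i + e i) * x i) * R) + 1/2 * (cos (\<Sum>i<m. (b i - e i) * x i) * R)
     = cos (\<Sum>i<m. b i * x i) * (cos (s * (\<Sum>i<j. x i)) * R)" for x R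
    by (simp add: eq distrib_right left_diff_distrib sum.distrib sum_subtractf cos_add cos_diff algebra_simps)
  ultimately show ?case by simp
qed

text \<open>Expanding the polynomial in the last factor leaves powers of one cosine, recorded as
  repeated entries of the list \<open>js\<close>; for this reason the induction is over all
  lists.\<close>

lemma same_limit_poly_prod:
  assumes "\<And>j. j \<in> set js \<Longrightarrow> j \<le> m" "q \<le> Suc m"
  shows "same_limit (\<lambda>x. (\<Prod>j\<leftarrow>js. cos (s * (\<Sum>i<j. x i))) * (\<Prod>j<q. \<Sum>k\<le>d. c k * cos (s * (\<Sum>i<j. x i)) ^ k))"
  using assms
proof (induction q arbitrary: js)
  case 0
  then show ?case using same_limit_cos_prod[of js "\<lambda>_. 0"] by simp
next
  case (Suc q)
  have "same_limit (\<lambda>x. \<Sum>k\<le>d. c k * ((\<Prod>j\<leftarrow>replicate k q @ js. cos (s * (\<Sum>i<j. x i))) * (\<Prod>j<q. \<Sum>k\<le>d. c k * cos (s * (\<Sum>i<j. x i)) ^ k)))"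
    using Suc.prems by (intro same_limit_sum same_limit_scale Suc.IH) auto
  moreover have "(\<lambda>x. \<Sum>k\<le>d. c k * ((\<Prod>j\<leftarrow>replicate k q @ js. cos (s * (\<Sum>i<j. x i))) * (\<Prod>j<q. \<Sum>k\<le>d. c k * cos (s * (\<Sum>i<j. x i)) ^ k)))
    = (\<lambda>x. (\<Prod>j\<leftarrow>js. cos (s * (\<Sum>i<j. x i))) * (\<Prod>j<Suc q. \<Sum>k\<le>d. c k * cos (s * (\<Sum>i<j. x i)) ^ k))"
  proof
    fix x :: "nat \<Rightarrow> real"
    define g where "g j = cos (s * (\<Sum>i<j. x i))" for j
    define R where "R = (\<Prod>j<q. \<Sum>k\<le>d. c k * g j ^ k)"
    have "(\<Sum>k\<le>d. c k * ((\<Prod>j\<leftarrow>replicate k q @ js. g j) * R)) = (\<Prod>j\<leftarrow>js. g j) * (R * (\<Sum>k\<le>d. c k * g q ^ k))"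
      by (simp add: sum_distrib_left prod_list_replicate mult_ac)
    then show "(\<Sum>k\<le>d. c k * ((\<Prod>j\<leftarrow>replicate k q @ js. cos (s * (\<Sum>i<j. x i))) * (\<Prod>j<q. \<Sum>k\<le>d. c k * cos (s * (\<Sum>i<j. x i)) ^ k)))
      = (\<Prod>j\<leftarrow>js. cos (s * (\<Sum>i<j. x i))) * (\<Prod>j<Suc q. \<Sum>k\<le>d. c k * cos (s * (\<Sum>i<j. x i)) ^ k)"
      by (simp only: R_def g_def prod.lessThan_Suc)
  qed
  ultimately show ?case by (simp only:)
qed

text \<open>The frequency \<open>s\<close> makes \<open>cos (s * t)\<close> injective in
  \<open>\<bar>t\<bar>\<close> up to \<open>K\<close>, and a ramp \<open>\<psi>\<close> applied to
  it separates \<open>\<bar>t\<bar> \<le> x\<close> from \<open>\<bar>t\<bar> > x + \<eta>\<close>.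
  Beyond \<open>K\<close> periodicity produces spurious values, which the moment bound makes
  improbable. They matter when passing from the product of ramps back to the event, that is, on the
  side of \<open>M'\<close>.\<close>

lemma compare_max_partial_sums:
  assumes tight: "\<And>n i. i < m \<Longrightarrow> integrable (M' n) (\<lambda>\<omega>. X' n i \<omega> ^ 4)" "\<And>n i. i < m \<Longrightarrow> n \<ge> n0 \<Longrightarrow> (LINT \<omega>|M' n. X' n i \<omega> ^ 4) \<le> C"
    and x: "x > 0" "\<eta> > 0" and e: "\<epsilon> > 0" and m: "m > 0"
  shows "eventually (\<lambda>n. measure (M n) {\<omega> \<in> space (M n). \<forall>j\<le>m. \<bar>\<Sum>i<j. X n i \<omega>\<bar> \<le> x}
     \<le> measure (M' n) {\<omega> \<in> space (M' n). \<forall>j\<le>m. \<bar>\<Sum>i<j. X' n i \<omega>\<bar> \<le> x + \<eta>} + \<epsilon>) sequentially"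
proof -
  interpret prob_space "M n" for n by (rule ps)
  interpret M': prob_space "M' n" for n by (rule ps')
  have C0: "C \<ge> 0"
  proof -
    have "0 \<le> (LINT \<omega>|M' n0. X' n0 0 \<omega> ^ 4)" by (intro integral_nonneg_AE) auto
    also have "\<dots> \<le> C" using tight(2)[of 0 n0] m by simp
    finally show ?thesis .
  qed
  \<comment> \<open>If a partial sum exceeds \<open>K\<close> in absolute value, some increment
    exceeds \<open>K / m\<close>; the union bound with fourth moments makes the probability at most
    a quarter of \<open>\<epsilon>\<close>.\<close>
  obtain K where K: "K > x + \<eta>" "real m * (C / (K / m) ^ 4) \<le> \<epsilon> / 4"
  proof -
    have "((\<lambda>K. real m * (C / (K / m) ^ 4)) \<longlongrightarrow> 0) at_top"
    proof -
      have "filterlim (\<lambda>K. (K / real m) ^ 4) at_top at_top"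
        using m by (intro filterlim_pow_at_top filterlim_at_top_mult_tendsto_pos[where g = "\<lambda>x. x" and f = "\<lambda>_. 1 / real m", simplified] ) (auto simp: filterlim_ident)
      then have "((\<lambda>K. C / (K / m) ^ 4) \<longlongrightarrow> 0) at_top" by (intro real_tendsto_divide_at_top[OF tendsto_const])
      from tendsto_mult_left[OF this, of "real m"] show ?thesis by simp
    qed
    then have "eventually (\<lambda>K. real m * (C / (K / m) ^ 4) < \<epsilon> / 4) at_top" using e by (intro order_tendstoD(2)) auto
    then have "eventually (\<lambda>K. K > x + \<eta> \<and> real m * (C / (K / m) ^ 4) \<le> \<epsilon> / 4) at_top"
      using eventually_gt_at_top[of "x + \<eta>"] by eventually_elim auto
    then show ?thesis using that by (auto simp: eventually_at_top_linorder)
  qed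
  have K0: "K > 0" using K x by linarith
  define s where "s = pi / K"
  have s: "s > 0" using K0 by (simp add: s_def)
  define c1 where "c1 = cos (s * x)"
  define c2 where "c2 = cos (s * (x + \<eta>))"
  have sK: "s * y \<le> pi \<longleftrightarrow> y \<le> K" for y using K0 by (simp add: s_def field_simps)
  have c12: "c2 < c1" unfolding c1_def c2_def using s x K sK[of "x + \<eta>"] by (intro cos_monotone_0_pi) auto
  define \<psi> where "\<psi> c = max 0 (min 1 ((c - c2) / (c1 - c2)))" for c
  have \<psi>01: "0 \<le> \<psi> c" "\<psi> c \<le> 1" for c by (auto simp: \<psi>_def)
  have cos_abs: "cos (s * t) = cos (s * \<bar>t\<bar>)" for t by (cases "t \<ge> 0") (auto simp: abs_if)
  have \<psi>1: "\<psi> (cos (s * t)) = 1" if "\<bar>t\<bar> \<le> x" for t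
  proof -
    have "c1 \<le> cos (s * \<bar>t\<bar>)" unfolding c1_def using that s x K sK[of x] by (intro cos_monotone_0_pi_le mult_left_mono) auto
    then have "(cos (s * t) - c2) / (c1 - c2) \<ge> 1" using c12 by (simp add: cos_abs[of t])
    then show ?thesis by (simp add: \<psi>_def)
  qed
  have \<psi>0: "\<psi> (cos (s * t)) = 0" if "x + \<eta> < \<bar>t\<bar>" "\<bar>t\<bar> \<le> K" for t
  proof -
    have "cos (s * \<bar>t\<bar>) \<le> c2" unfolding c2_def using that s x K sK[of "\<bar>t\<bar>"] by (intro cos_monotone_0_pi_le mult_left_mono) auto
    then have "(cos (s * t) - c2) / (c1 - c2) \<le> 0" using c12 by (simp add: cos_abs[of t] divide_nonpos_pos)
    then show ?thesis by (simp add: \<psi>_def)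
  qed
  \<comment> \<open>There are \<open>m + 1\<close> factors with error at most
    \<open>2 * \<delta>\<close> each, so the products differ by at most
    \<open>\<epsilon> / 8\<close>.\<close>
  define \<delta> where "\<delta> = \<epsilon> / (16 * (real m + 1))"
  have \<delta>: "\<delta> > 0" using e by (simp add: \<delta>_def)
  have "continuous_on {-1..1} \<psi>" unfolding \<psi>_def using c12 by (intro continuous_intros) auto
  then obtain g where g: "real_polynomial_function g" "\<And>c. c \<in> {-1..1} \<Longrightarrow> \<bar>\<psi> c - g c\<bar> < \<delta>"
    using Stone_Weierstrass_real_polynomial_function[of "{-1..1}" \<psi> \<delta>] \<delta> by auto
  obtain a d where ad: "g = (\<lambda>c. \<Sum>k\<le>d. a k * c ^ k)" using g(1) real_polynomial_function_iff_sum by blast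
  \<comment> \<open>Dividing by \<open>1 + \<delta>\<close> brings the polynomial into
    \<open>[-1, 1]\<close> on the range of the cosine, as required by the bound for differences of
    products.\<close>
  define p where "p c = (\<Sum>k\<le>d. (a k / (1 + \<delta>)) * c ^ k)" for c
  have pg: "p c = g c / (1 + \<delta>)" for c by (simp add: p_def ad sum_divide_distrib)
  have p1: "\<bar>p c\<bar> \<le> 1" and pd: "\<bar>\<psi> c - p c\<bar> \<le> 2 * \<delta>" if "c \<in> {-1..1}" for c
  proof -
    have gd: "\<bar>\<psi> c - g c\<bar> < \<delta>" by (rule g(2)[OF that])
    have gb: "\<bar>g c\<bar> \<le> 1 + \<delta>" using gd \<psi>01[of c] by linarith
    then show p1: "\<bar>p c\<bar> \<le> 1" using \<delta> by (simp add: pg abs_divide)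
    have "g c - p c = \<delta> * p c" using \<delta> by (simp add: pg field_simps)
    then have "\<bar>g c - p c\<bar> \<le> \<delta> * 1" using p1 \<delta> by (simp add: abs_mult)
    then show "\<bar>\<psi> c - p c\<bar> \<le> 2 * \<delta>" using gd by linarith
  qed
  define F where "F q y = (\<Prod>j<Suc m. q (cos (s * (\<Sum>i<j. y i))))" for q :: "real \<Rightarrow> real" and y :: "nat \<Rightarrow> real"
  have Fd: "\<bar>F \<psi> y - F p y\<bar> \<le> \<epsilon> / 8" for y
  proof -
    have "norm (F \<psi> y - F p y) \<le> (\<Sum>j<Suc m. norm (\<psi> (cos (s * (\<Sum>i<j. y i))) - p (cos (s * (\<Sum>i<j. y i)))))"
      unfolding F_def using p1 \<psi>01 by (intro norm_prod_diff) auto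
    also have "\<dots> \<le> (\<Sum>j<Suc m. 2 * \<delta>)" using pd by (intro sum_mono) auto
    also have "\<dots> = \<epsilon> / 8" by (simp add: \<delta>_def field_simps)
    finally show ?thesis by simp
  qed
  have Fd1: "F \<psi> y \<le> F p y + \<epsilon> / 8" and Fd2: "F p y \<le> F \<psi> y + \<epsilon> / 8" for y
    using abs_le_D1[OF Fd[of y]] abs_le_D2[OF Fd[of y]] by linarith+
  have F01: "0 \<le> F \<psi> y" "F \<psi> y \<le> 1" for y
  proof -
    show "0 \<le> F \<psi> y" unfolding F_def by (rule prod_nonneg) (use \<psi>01 in auto)
    show "F \<psi> y \<le> 1" unfolding F_def by (rule prod_le_1) (use \<psi>01 in auto)
  qed
  have \<psi>m [measurable]: "\<psi> \<in> borel_measurable borel" unfolding \<psi>_def by measurable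
  have sl: "same_limit (F p)"
    using same_limit_poly_prod[where js = "[]" and q = "Suc m" and s = s and d = d and c = "\<lambda>k. a k / (1 + \<delta>)"] by (simp add: F_def[abs_def] p_def)
  then have lim: "(\<lambda>n. (LINT \<omega>|M n. F p (\<lambda>i. X n i \<omega>)) - (LINT \<omega>|M' n. F p (\<lambda>i. X' n i \<omega>))) \<longlonglongrightarrow> 0"
    and ip: "\<And>n. integrable (M n) (\<lambda>\<omega>. F p (\<lambda>i. X n i \<omega>))" "\<And>n. integrable (M' n) (\<lambda>\<omega>. F p (\<lambda>i. X' n i \<omega>))"
    by (auto simp: same_limit_def)
  have i\<psi>: "integrable (M n) (\<lambda>\<omega>. F \<psi> (\<lambda>i. X n i \<omega>))" for n
    by (rule integrable_const_bound[of _ 1]) (use F01 in \<open>auto simp: F_def\<close>)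
  have i\<psi>': "integrable (M' n) (\<lambda>\<omega>. F \<psi> (\<lambda>i. X' n i \<omega>))" for n
    by (rule M'.integrable_const_bound[of _ 1]) (use F01 in \<open>auto simp: F_def\<close>)
  have "eventually (\<lambda>n. (LINT \<omega>|M n. F p (\<lambda>i. X n i \<omega>)) - (LINT \<omega>|M' n. F p (\<lambda>i. X' n i \<omega>)) < \<epsilon> / 4) sequentially"
    using order_tendstoD(2)[OF lim, of "\<epsilon> / 4"] e by simp
  then show ?thesis using eventually_ge_at_top[of n0]
  proof eventually_elim
    case (elim n)
    let ?A = "{\<omega> \<in> space (M n). \<forall>j\<le>m. \<bar>\<Sum>i<j. X n i \<omega>\<bar> \<le> x}"
    let ?B = "{\<omega> \<in> space (M' n). \<forall>j\<le>m. \<bar>\<Sum>i<j. X' n i \<omega>\<bar> \<le> x + \<eta>}"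
    let ?D = "\<lambda>i. {\<omega> \<in> space (M' n). \<bar>X' n i \<omega>\<bar> \<ge> K / m}"
    have Am: "?A \<in> sets (M n)" and Bm: "?B \<in> sets (M' n)" and Dm: "\<And>i. ?D i \<in> sets (M' n)" by measurable
    have "measure (M n) ?A = (LINT \<omega>|M n. indicator ?A \<omega>)" using Am by simp
    also have "\<dots> \<le> (LINT \<omega>|M n. F \<psi> (\<lambda>i. X n i \<omega>))"
    proof (rule integral_mono)
      show "integrable (M n) (indicator ?A :: 'a \<Rightarrow> real)"
        by (rule integrable_real_indicator[OF Am]) (simp add: emeasure_eq_measure)
      fix \<omega> 
      show "indicator ?A \<omega> \<le> F \<psi> (\<lambda>i. X n i \<omega>)"
      proof (cases "\<omega> \<in> ?A")
        case True
        then have "F \<psi> (\<lambda>i. X n i \<omega>) = 1" unfolding F_def using \<psi>1 by (intro prod.neutral) auto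
        then show ?thesis using True by simp
      qed (use F01 in auto)
    qed (rule i\<psi>)
    also have "\<dots> \<le> (LINT \<omega>|M n. F p (\<lambda>i. X n i \<omega>) + \<epsilon> / 8)"
      using Fd1 ip i\<psi> by (intro integral_mono) auto
    also have "\<dots> = (LINT \<omega>|M n. F p (\<lambda>i. X n i \<omega>)) + \<epsilon> / 8" using ip by (simp add: prob_space)
    also have "\<dots> \<le> (LINT \<omega>|M' n. F p (\<lambda>i. X' n i \<omega>)) + \<epsilon> / 4 + \<epsilon> / 8" using elim(1) by linarith
    also have "(LINT \<omega>|M' n. F p (\<lambda>i. X' n i \<omega>)) \<le> (LINT \<omega>|M' n. F \<psi> (\<lambda>i. X' n i \<omega>) + \<epsilon> / 8)"
      using Fd2 ip i\<psi>' by (intro integral_mono) auto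
    also have "\<dots> = (LINT \<omega>|M' n. F \<psi> (\<lambda>i. X' n i \<omega>)) + \<epsilon> / 8" using i\<psi>' by (simp add: M'.prob_space)
    also have "(LINT \<omega>|M' n. F \<psi> (\<lambda>i. X' n i \<omega>)) \<le> (LINT \<omega>|M' n. indicator (?B \<union> (\<Union>i<m. ?D i)) \<omega>)"
    proof (rule integral_mono)
      show "integrable (M' n) (indicator (?B \<union> (\<Union>i<m. ?D i)) :: 'b \<Rightarrow> real)" using Bm Dm by (intro M'.integrable_const_bound[of _ 1]) (auto simp: indicator_def)
      fix \<omega> assume w: "\<omega> \<in> space (M' n)"
      show "F \<psi> (\<lambda>i. X' n i \<omega>) \<le> indicator (?B \<union> (\<Union>i<m. ?D i)) \<omega>"
      proof (cases "\<omega> \<in> ?B \<union> (\<Union>i<m. ?D i)")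
        case False
        then obtain j where j: "j \<le> m" "\<bar>\<Sum>i<j. X' n i \<omega>\<bar> > x + \<eta>" using w by auto
        have "\<bar>\<Sum>i<j. X' n i \<omega>\<bar> \<le> (\<Sum>i<j. \<bar>X' n i \<omega>\<bar>)" by (rule sum_abs)
        also have "\<dots> \<le> (\<Sum>i<j. K / m)" using False w j by (intro sum_mono) (auto simp: not_le intro: less_imp_le)
        also have "\<dots> \<le> K" using j m K0 by (simp add: field_simps mult_right_mono)
        finally have "\<psi> (cos (s * (\<Sum>i<j. X' n i \<omega>))) = 0" using j by (intro \<psi>0)
        then have "F \<psi> (\<lambda>i. X' n i \<omega>) = 0" unfolding F_def using j by (intro prod_zero) auto
        then show ?thesis by simp
      qed (use F01 in auto)
    qed (rule i\<psi>')
    also have "\<dots> = measure (M' n) (?B \<union> (\<Union>i<m. ?D i))" using Bm Dm by (subst Bochner_Integration.integral_indicator) (auto intro!: arg_cong[where f = "measure (M' n)"])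
    also have "\<dots> \<le> measure (M' n) ?B + measure (M' n) (\<Union>i<m. ?D i)" using Bm Dm by (intro measure_Un_le) auto
    also have "measure (M' n) (\<Union>i<m. ?D i) \<le> (\<Sum>i<m. measure (M' n) (?D i))" using Dm by (intro M'.finite_measure_subadditive_finite) auto
    also have "\<dots> \<le> (\<Sum>i<m. C / (K / m) ^ 4)"
      using tight elim(2) K0 m by (intro sum_mono M'.markov_fourth) auto
    also have "\<dots> = real m * (C / (K / m) ^ 4)" by simp
    also have "\<dots> \<le> \<epsilon> / 4" by (rule K)
    finally show ?case using e by linarith
  qed
qed

end

section \<open>The empirical process\<close>

text \<open>For \<open>0 \<le> s < t \<le> 1\<close> this is the indicator of \<open>frac y \<in> {s..<t}\<close> minus \<open>t - s\<close>.\<close>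

definition saw :: "real \<Rightarrow> real \<Rightarrow> real \<Rightarrow> real" where
  "saw s t y = frac (y - t) - frac (y - s)"

lemma saw_eq:
  assumes "0 \<le> s" "s < t" "t \<le> 1"
  shows "saw s t y = of_bool (s \<le> frac y \<and> frac y < t) - (t - s)"
proof -
  define z where "z = frac y"
  have z: "0 \<le> z" "z < 1" by (auto simp: z_def frac_lt_1)
  have sh: "frac (y - c) = frac (z - c)" for c
  proof -
    have "y - c = (z - c) + of_int \<lfloor>y\<rfloor>" by (simp add: z_def frac_def)
    then show ?thesis by (simp only: frac_add_of_int_right)
  qed
  have "frac (z - c) = (if z < c then z - c + 1 else z - c)" if "0 \<le> c" "c \<le> 1" for c
  proof (cases "z < c")
    case True
    have "frac (z - c) = frac (z - c + 1)" by (simp add: frac_1_eq)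
    also have "\<dots> = z - c + 1" using True z that by (subst frac_eq) auto
    finally show ?thesis using True by simp
  next
    case False
    then show ?thesis using z that by (simp add: frac_eq)
  qed
  then show ?thesis unfolding saw_def sh using assms by (auto simp: z_def[symmetric])
qed

lemma saw_floor: "saw s t y = (s - t) + of_int (\<lfloor>y - s\<rfloor> - \<lfloor>y - t\<rfloor>)"
  by (simp add: saw_def frac_def)

lemma saw_abs_le: "0 \<le> s \<Longrightarrow> s < t \<Longrightarrow> t \<le> 1 \<Longrightarrow> \<bar>saw s t y\<bar> \<le> 1"
  by (simp add: saw_eq)

lemma periodic_frac: "periodic_fun (\<lambda>y. frac (y - t :: real))"
proof
  show "bdd_borel (\<lambda>y. frac (y - t))"
    by (rule bdd_borelI[of _ 1]) (auto simp: frac_def[abs_def] intro: less_imp_le, linarith)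
  show "frac (x + 1 - t) = frac (x - t)" for x using frac_1_eq[of "x - t"] by (simp add: algebra_simps)
qed

lemma periodic_saw: "periodic_fun (saw s t)"
proof -
  interpret A: periodic_fun "\<lambda>y. frac (y - t)" by (rule periodic_frac)
  interpret B: periodic_fun "\<lambda>y. frac (y - s)" by (rule periodic_frac)
  show ?thesis
    unfolding saw_def[abs_def] by unfold_locales (auto intro!: bdd_borel_intros A.bdd B.bdd simp: A.per B.per)
qed

lemma bdd_borel_saw [bdd_borel_intros]: "bdd_borel (saw s t)"
  using periodic_saw periodic_fun.bdd by blast

lemma integral_saw: "(LINT y:{0..1}|lborel. saw s t y) = 0"
proof -
  have *: "(LINT y:{0..1}|lborel. frac (y - c)) = (LINT y:{0..1}|lborel. frac y)" for c :: real
  proof -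
    interpret P: periodic_fun "frac :: real \<Rightarrow> real" using periodic_frac[of 0] by simp
    have "(LINT y:{0..1}|lborel. frac (y - c)) = (LINT y:{-c..-c+1}|lborel. frac y)"
      using set_integral_affine[of 1 "-c" 0 1 frac] by (simp add: add.commute)
    then show ?thesis using P.integral_period[of "-c"] by simp
  qed
  have b: "bdd_borel (\<lambda>y. frac (y - c :: real))" for c using periodic_frac periodic_fun.bdd by blast
  show ?thesis unfolding saw_def
    by (subst set_integral_diff(2)[OF set_integrable_bdd_borel[OF b] set_integrable_bdd_borel[OF b]]) (simp add: *)
qed

lemma integral_abs_saw:
  assumes "0 \<le> s" "s < t" "t \<le> 1"
  shows "(LINT y:{0..1}|lborel. \<bar>saw s t y\<bar>) \<le> 2 * (t - s)"
proof -
  have "(LINT y:{0..1}|lborel. \<bar>saw s t y\<bar>) \<le> (LINT y:{0..1}|lborel. saw s t y + 2 * (t - s))"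
    using assms by (intro set_integral_le bdd_borel_intros) (auto simp: saw_eq)
  also have "\<dots> = (LINT y:{0..1}|lborel. saw s t y) + 2 * (t - s)"
    by (subst set_integral_add(2)) (auto simp: set_integral_const_Icc intro!: set_integrable_bdd_borel bdd_borel_intros)
  finally show ?thesis by (simp add: integral_saw)
qed

definition lattice :: "real \<Rightarrow> real set" where "lattice s = {v. v - s \<in> \<int>}"

lemma card_lattice:
  fixes c d :: real
  assumes "c \<le> d"
  shows "finite (lattice s \<inter> {c..d})" "card (lattice s \<inter> {c..d}) \<le> d - c + 1"
proof -
  let ?h = "\<lambda>v. \<lfloor>v - s\<rfloor>" and ?S = "lattice s \<inter> {c..d}"
  have inj: "inj_on ?h ?S" by (rule inj_onI) (auto simp: lattice_def elim!: Ints_cases)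
  have im: "?h ` ?S \<subseteq> {\<lceil>c - s\<rceil>..\<lfloor>d - s\<rfloor>}"
  proof clarify
    fix v :: real assume "v \<in> lattice s" "v \<in> {c..d}"
    moreover then obtain k where "v - s = of_int k" by (auto simp: lattice_def elim: Ints_cases)
    ultimately show "\<lfloor>v - s\<rfloor> \<in> {\<lceil>c - s\<rceil>..\<lfloor>d - s\<rfloor>}" by (auto simp: ceiling_le_iff le_floor_iff)
  qed
  show fin: "finite ?S" using inj im finite_subset by (metis finite_atLeastAtMost_int finite_imageD)
  have "card ?S = card (?h ` ?S)" by (rule card_image[symmetric, OF inj])
  also have "\<dots> \<le> card {\<lceil>c - s\<rceil>..\<lfloor>d - s\<rfloor>}" using im by (intro card_mono) auto
  finally have "real (card ?S) \<le> real (nat (\<lfloor>d - s\<rfloor> - \<lceil>c - s\<rceil> + 1))" by simp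
  also have "\<dots> \<le> d - c + 1" using assms by (cases "\<lfloor>d - s\<rfloor> - \<lceil>c - s\<rceil> + 1 \<ge> 0") (simp, linarith, simp)
  finally show "card ?S \<le> d - c + 1" .
qed

lemma floor_eq_lattice: "x \<le> y \<Longrightarrow> {x..y} \<inter> lattice s = {} \<Longrightarrow> \<lfloor>x - s\<rfloor> = \<lfloor>y - s\<rfloor>"
proof (rule ccontr)
  assume xy: "x \<le> y" "{x..y} \<inter> lattice s = {}" "\<lfloor>x - s\<rfloor> \<noteq> \<lfloor>y - s\<rfloor>"
  then have lt: "\<lfloor>x - s\<rfloor> < \<lfloor>y - s\<rfloor>" using floor_mono[of "x - s" "y - s"] by linarith
  define v where "v = of_int \<lfloor>y - s\<rfloor> + s"
  have "x \<le> v" "v \<le> y" using lt unfolding v_def by linarith+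
  moreover have "v \<in> lattice s" by (simp add: v_def lattice_def)
  ultimately show False using xy by auto
qed

lemma pc_saw: "piecewise_const (lattice s \<union> lattice t) (saw s t)"
  unfolding piecewise_const_def
proof (intro allI impI)
  fix x y assume "x \<le> y" "{x..y} \<inter> (lattice s \<union> lattice t) = {}"
  then have "\<lfloor>x - s\<rfloor> = \<lfloor>y - s\<rfloor>" "\<lfloor>x - t\<rfloor> = \<lfloor>y - t\<rfloor>" by (auto intro!: floor_eq_lattice)
  then show "saw s t x = saw s t y" by (simp add: saw_floor)
qed

text \<open>Two jumps per unit length, supremum at most 1, and an absolute mean of order
  \<open>t - s\<close>; the last is what makes the moment estimates small for short cells.\<close>

lemma geom_osc_saw:
  assumes "a > 1" "0 \<le> s" "s < t" "t \<le> 1"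
  shows "geom_osc (saw s t) a (2 * (t - s)) 2 1 (lattice s \<union> lattice t)"
proof -
  interpret periodic_fun "saw s t" by (rule periodic_saw)
  show ?thesis
  proof unfold_locales
    show "(LINT u:{0..1}|lborel. \<bar>saw s t u\<bar>) \<le> 2 * (t - s)" by (rule integral_abs_saw[OF assms(2-)])
    show "(LINT u:{0..1}|lborel. saw s t u) = 0" by (rule integral_saw)
    show "\<bar>saw s t u\<bar> \<le> 1" for u by (rule saw_abs_le[OF assms(2-)])
    show "piecewise_const (lattice s \<union> lattice t) (saw s t)" by (rule pc_saw)
    fix c d :: real assume cd: "c \<le> d"
    have eq: "(lattice s \<union> lattice t) \<inter> {c..d} = (lattice s \<inter> {c..d}) \<union> (lattice t \<inter> {c..d})" by auto
    have "card ((lattice s \<union> lattice t) \<inter> {c..d}) \<le> card (lattice s \<inter> {c..d}) + card (lattice t \<inter> {c..d})"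
      unfolding eq by (rule card_Un_le)
    then show "finite ((lattice s \<union> lattice t) \<inter> {c..d}) \<and> card ((lattice s \<union> lattice t) \<inter> {c..d}) \<le> 2 * (d - c + 1)"
      using card_lattice[OF cd, of s] card_lattice[OF cd, of t] unfolding eq by auto
  qed (use assms in auto)
qed

text \<open>A linear functional, with coefficients \<open>b\<close>, of the increments of the
  empirical process over \<open>m\<close> equal cells is a lacunary sum of this single function, so
  a one-dimensional limit theorem yields all finite-dimensional ones.\<close>

definition step :: "(nat \<Rightarrow> real) \<Rightarrow> nat \<Rightarrow> real \<Rightarrow> real" where
  "step b m y = (\<Sum>i<m. b i * saw (real i / real m) ((real i + 1) / real m) y)"

lemma cell_bounds:
  fixes i m :: nat
  shows "i < m \<Longrightarrow> 0 \<le> real i / real m \<and> real i / real m < (real i + 1) / real m \<and> (real i + 1) / real m \<le> 1"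
  by (auto simp: field_simps)

lemma periodic_step: "periodic_fun (step b m)"
proof
  show "bdd_borel (step b m)" unfolding step_def[abs_def] by (intro bdd_borel_intros)
  show "step b m (x + 1) = step b m x" for x
    unfolding step_def using periodic_fun.per[OF periodic_saw] by simp
qed

lemma integral_step: "(LINT y:{0..1}|lborel. step b m y) = 0"
  unfolding step_def by (subst set_integral_sum') (auto intro!: bdd_borel_intros simp: integral_saw)

text \<open>Up to the constant \<open>1 / m\<close> the factors are indicators of cells, disjoint
  for different indices, which leaves the covariance of multinomial cell counts.\<close>

lemma integral_saw_mult:
  fixes i j m :: nat
  assumes ij: "i < m" "j < m"
  shows "(LINT y:{0..1}|lborel. saw (real i / real m) ((real i + 1) / real m) y * saw (real j / real m) ((real j + 1) / real m) y) = (if i = j then 1 / m else 0) - 1 / (real m)\<^sup>2"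
proof -
  define S where "S i y = saw (real i / m) ((real i + 1) / m) y" for i y
  define Q where "Q i y = (of_bool (real i / m \<le> frac y \<and> frac y < (real i + 1) / m) :: real)" for i and y :: real
  have m: "real m > 0" using ij by auto
  have SQ: "S i y = Q i y - 1 / m" if "i < m" for i y
    unfolding S_def Q_def using cell_bounds[OF that] by (subst saw_eq) (auto simp: add_divide_distrib)
  have b [bdd_borel_intros]: "bdd_borel (S i)" for i unfolding S_def by (rule bdd_borel_saw)
  have iS: "(LINT y:{0..1}|lborel. S i y) = 0" for i unfolding S_def by (rule integral_saw)
  have QQ: "Q i y * Q j y = (if i = j then Q i y else 0)" for y
  proof (cases "i = j")
    case False
    have "\<not> (real i / m \<le> frac y \<and> frac y < (real i + 1) / m \<and> real j / m \<le> frac y \<and> frac y < (real j + 1) / m)"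
    proof
      assume "real i / m \<le> frac y \<and> frac y < (real i + 1) / m \<and> real j / m \<le> frac y \<and> frac y < (real j + 1) / m"
      then have "real i / m < (real j + 1) / m" "real j / m < (real i + 1) / m" by linarith+
      then have "real i < real j + 1" "real j < real i + 1" using m by (simp_all add: divide_less_cancel)
      then show False using False by linarith
    qed
    then show ?thesis using False by (auto simp: Q_def)
  qed (auto simp: Q_def)
  have pt: "S i y * S j y = (if i = j then 1 else 0) * S i y + (- (1 / m)) * S i y + (- (1 / m)) * S j y + ((if i = j then 1 / m else 0) - 1 / (real m)\<^sup>2)" for y
  proof -
    have e1: "S i y * S j y = Q i y * Q j y - (1 / m) * Q i y - (1 / m) * Q j y + 1 / (real m)\<^sup>2"
      using m by (simp add: SQ ij power2_eq_square algebra_simps)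
    have q1: "Q i y = S i y + 1 / m" "Q j y = S j y + 1 / m" by (simp_all add: SQ ij)
    show ?thesis unfolding e1 QQ unfolding q1 by (simp add: power2_eq_square algebra_simps)
  qed
  have "(LINT y:{0..1}|lborel. S i y * S j y) = (if i = j then 1 / m else 0) - 1 / (real m)\<^sup>2"
    unfolding pt by (simp only: set_integral_add(2) set_integral_mult_right iS set_integrable_bdd_borel bdd_borel_intros) (simp add: set_integral_const_Icc)
  then show ?thesis by (simp add: S_def)
qed

text \<open>The variance of \<open>b\<close> over the \<open>m\<close> cells, the same quadratic
  form as for the random walk bridge; this coincidence is why the two processes agree in the
  limit.\<close>

lemma integral_step_sq:
  assumes m: "m > 0"
  shows "(LINT y:{0..1}|lborel. (step b m y)\<^sup>2) = (\<Sum>j<m. (b j)\<^sup>2) / m - ((\<Sum>j<m. b j) / m)\<^sup>2"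
proof -
  let ?S = "\<lambda>i. saw (real i / m) ((real i + 1) / m)"
  have "(LINT y:{0..1}|lborel. (step b m y)\<^sup>2) = (LINT y:{0..1}|lborel. (\<Sum>i<m. \<Sum>j<m. (b i * b j) * (?S i y * ?S j y)))"
    by (simp add: step_def power2_eq_square sum_product mult_ac)
  also have "\<dots> = (\<Sum>i<m. \<Sum>j<m. (b i * b j) * (LINT y:{0..1}|lborel. ?S i y * ?S j y))"
    by (simp add: set_integral_sum' bdd_borel_intros)
  also have "\<dots> = (\<Sum>i<m. \<Sum>j<m. (b i * b j) * ((if i = j then 1 / m else 0) - 1 / (real m)\<^sup>2))"
    by (intro sum.cong refl) (simp add: integral_saw_mult)
  also have "\<dots> = (\<Sum>i<m. (b i)\<^sup>2 / m - b i * (\<Sum>j<m. b j) / (real m)\<^sup>2)"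
  proof (rule sum.cong[OF refl])
    fix i assume i: "i \<in> {..<m}"
    have "(\<Sum>j<m. (b i * b j) * ((if i = j then 1 / m else 0) - 1 / (real m)\<^sup>2)) = (\<Sum>j<m. (if i = j then b i * b j / m else 0) - b i * b j / (real m)\<^sup>2)"
      by (rule sum.cong) (auto simp: right_diff_distrib)
    also have "\<dots> = (\<Sum>j<m. (if i = j then b i * b j / m else 0)) - (\<Sum>j<m. b i * b j / (real m)\<^sup>2)" by (rule sum_subtractf)
    finally show "(\<Sum>j<m. (b i * b j) * ((if i = j then 1 / m else 0) - 1 / (real m)\<^sup>2)) = (b i)\<^sup>2 / m - b i * (\<Sum>j<m. b j) / (real m)\<^sup>2"
      using i by (simp add: power2_eq_square sum_distrib_left sum_divide_distrib)
  qed
  also have "\<dots> = (\<Sum>j<m. (b j)\<^sup>2) / m - ((\<Sum>j<m. b j) / m)\<^sup>2"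
    by (simp add: sum_subtractf sum_divide_distrib[symmetric] sum_distrib_right[symmetric] power2_eq_square)
  finally show ?thesis .
qed

section \<open>Decay of pair correlations and its consequences\<close>

lemma step_equidistributed:
  fixes \<beta> :: real assumes irr: "\<beta> \<notin> \<rat>" and e: "\<epsilon> > 0"
  shows "\<exists>C. \<forall>x M. \<bar>\<Sum>k<M. step b m (x + \<beta> * real k)\<bar> \<le> \<epsilon> * real M + C"
proof -
  \<comment> \<open>The added 1 keeps the division by \<open>A\<close> meaningful when all
    coefficients vanish.\<close>
  define A where "A = (\<Sum>i<m. \<bar>b i\<bar>) + 1"
  have A: "A > 0" by (simp add: A_def sum_nonneg add_nonneg_pos)
  obtain C where C: "\<And>x M. \<bar>\<Sum>k<M. (frac (x + \<beta> * real k) - 1/2)\<bar> \<le> \<epsilon> / (2 * A) * real M + C"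
    using rotation_equidistributed[OF irr, of "\<epsilon> / (2 * A)"] e A by auto
  have C0: "C \<ge> 0" using C[of 0 0] by simp
  have saw_le: "\<bar>\<Sum>k<M. saw s t (x + \<beta> * real k)\<bar> \<le> 2 * (\<epsilon> / (2 * A) * real M + C)" for s t x M
  proof -
    have "(\<Sum>k<M. saw s t (x + \<beta> * real k)) = (\<Sum>k<M. (frac ((x - t) + \<beta> * real k) - 1/2)) - (\<Sum>k<M. (frac ((x - s) + \<beta> * real k) - 1/2))"
      unfolding sum_subtractf[symmetric] by (rule sum.cong) (auto simp: saw_def algebra_simps)
    then have "\<bar>\<Sum>k<M. saw s t (x + \<beta> * real k)\<bar> \<le> \<bar>\<Sum>k<M. (frac ((x - t) + \<beta> * real k) - 1/2)\<bar> + \<bar>\<Sum>k<M. (frac ((x - s) + \<beta> * real k) - 1/2)\<bar>"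
      by (simp only: abs_triangle_ineq4)
    also have "\<dots> \<le> (\<epsilon> / (2 * A) * real M + C) + (\<epsilon> / (2 * A) * real M + C)" by (intro add_mono C)
    finally show ?thesis by (simp only: mult_2)
  qed
  have "\<bar>\<Sum>k<M. step b m (x + \<beta> * real k)\<bar> \<le> \<epsilon> * real M + 2 * A * C" for x M
  proof -
    have "(\<Sum>k<M. step b m (x + \<beta> * real k)) = (\<Sum>i<m. b i * (\<Sum>k<M. saw (real i / real m) ((real i + 1) / real m) (x + \<beta> * real k)))"
      unfolding step_def sum_distrib_left by (rule sum.swap)
    then have "\<bar>\<Sum>k<M. step b m (x + \<beta> * real k)\<bar> \<le> (\<Sum>i<m. \<bar>b i * (\<Sum>k<M. saw (real i / real m) ((real i + 1) / real m) (x + \<beta> * real k))\<bar>)"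
      by (simp only: sum_abs)
    also have "\<dots> \<le> (\<Sum>i<m. \<bar>b i\<bar> * (2 * (\<epsilon> / (2 * A) * real M + C)))"
      unfolding abs_mult by (intro sum_mono mult_left_mono saw_le) auto
    also have "\<dots> = (\<Sum>i<m. \<bar>b i\<bar>) * (2 * (\<epsilon> / (2 * A) * real M + C))" by (simp add: sum_distrib_right)
    also have "\<dots> \<le> A * (2 * (\<epsilon> / (2 * A) * real M + C))"
      using e A C0 by (intro mult_right_mono) (auto simp: A_def)
    also have "\<dots> = \<epsilon> * real M + 2 * A * C" using A by (simp add: field_simps)
    finally show ?thesis .
  qed
  then show ?thesis by blast
qed

text \<open>After cutting into unit intervals, period 1 of the first factor turns the integral into
  one over a single unit interval of \<open>f v\<close> times a sum of \<open>f\<close> along the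
  rotation by \<open>\<beta>\<close>; equidistribution uniform in the starting point finishes. The
  incomplete last interval costs at most \<open>B * B\<close>.\<close>

lemma (in periodic_fun) pair_correlation:
  assumes B: "\<And>x. \<bar>f x\<bar> \<le> B" and eq: "\<And>\<epsilon>. \<epsilon> > 0 \<Longrightarrow> \<exists>C. \<forall>x M. \<bar>\<Sum>k<M. f (x + \<beta> * real k)\<bar> \<le> \<epsilon> * real M + C"
    and e: "\<epsilon> > 0"
  shows "\<exists>C. \<forall>x y. x \<le> y \<longrightarrow> \<bar>LINT v:{x..y}|lborel. f v * f (\<beta> * v)\<bar> \<le> \<epsilon> * (y - x) + C"
proof -
  have B0: "B \<ge> 0" using B[of 0] by linarith
  have "\<epsilon> / (B + 1) > 0" using e B0 by simp
  then obtain C where C: "\<And>x M. \<bar>\<Sum>k<M. f (x + \<beta> * real k)\<bar> \<le> \<epsilon> / (B + 1) * real M + C" using eq by blast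
  have C0: "C \<ge> 0" using C[of 0 0] by simp
  have bdd' [bdd_borel_intros]: "bdd_borel (\<lambda>v. f (\<beta> * v))" by (rule bdd_borel_affine(1)[OF bdd])
  have "\<bar>LINT v:{x..y}|lborel. f v * f (\<beta> * v)\<bar> \<le> \<epsilon> * (y - x) + (B * C + B * B)" if xy: "x \<le> y" for x y
  proof -
    define M where "M = nat \<lfloor>y - x\<rfloor>"
    have M: "x + M \<le> y" "y \<le> x + M + 1" "real M \<le> y - x" using xy unfolding M_def by linarith+
    have full: "(LINT v:{x..x + real j}|lborel. f v * f (\<beta> * v)) = (LINT v:{x..x+1}|lborel. f v * (\<Sum>k<j. f (\<beta> * v + \<beta> * real k)))" for j
    proof (induction j)
      case 0
      show ?case using set_integral_split[of "\<lambda>v. f v * f (\<beta> * v)" x x x] by (simp add: bdd_borel_intros bdd)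
    next
      case (Suc j)
      have "(LINT v:{x..x + real (Suc j)}|lborel. f v * f (\<beta> * v)) = (LINT v:{x..x + real j}|lborel. f v * f (\<beta> * v)) + (LINT v:{x + real j..x + real (Suc j)}|lborel. f v * f (\<beta> * v))"
        by (intro set_integral_split bdd_borel_intros bdd) auto
      also have "(LINT v:{x + real j..x + real (Suc j)}|lborel. f v * f (\<beta> * v)) = (LINT v:{x..x+1}|lborel. f v * f (\<beta> * v + \<beta> * real j))"
        using set_integral_affine[of 1 "real j" x "x + 1" "\<lambda>v. f v * f (\<beta> * v)"] per_nat
        by (simp add: algebra_simps)
      finally show ?case unfolding Suc
        by (simp add: distrib_left set_integral_add(2) set_integrable_bdd_borel bdd_borel_intros bdd bdd_borel_affine(2)[OF bdd] add.commute[of _ "\<beta> * real _"])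
    qed
    have "\<bar>LINT v:{x..x+1}|lborel. f v * (\<Sum>k<M. f (\<beta> * v + \<beta> * real k))\<bar> \<le> (B * (\<epsilon> / (B + 1) * real M + C)) * (x + 1 - x)"
      using B B0 C e C0
      by (intro norm_set_integral_le_const[where 'a = real, simplified])
        (auto simp: abs_mult add.commute[of _ "\<beta> * real _"] intro!: bdd_borel_intros bdd bdd_borel_affine(2) mult_mono)
    also have "\<dots> \<le> \<epsilon> * (y - x) + B * C"
    proof -
      have "B * (\<epsilon> / (B + 1) * real M) = (B / (B + 1)) * (\<epsilon> * real M)" by simp
      also have "\<dots> \<le> 1 * (\<epsilon> * real M)" using B0 e by (intro mult_right_mono) auto
      also have "\<dots> \<le> \<epsilon> * (y - x)" using M e by (simp add: mult_left_mono)
      finally show ?thesis by (simp add: distrib_left)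
    qed
    finally have 1: "\<bar>LINT v:{x..x + real M}|lborel. f v * f (\<beta> * v)\<bar> \<le> \<epsilon> * (y - x) + B * C" unfolding full .
    have 2: "\<bar>LINT v:{x + real M..y}|lborel. f v * f (\<beta> * v)\<bar> \<le> B * B"
    proof -
      have "norm (LINT v:{x + real M..y}|lborel. f v * f (\<beta> * v)) \<le> (B * B) * (y - (x + M))"
      proof (rule norm_set_integral_le_const)
        show "bdd_borel (\<lambda>v. f v * f (\<beta> * v))" by (intro bdd_borel_intros bdd)
        show "norm (f u * f (\<beta> * u)) \<le> B * B" for u using B B0 by (simp add: abs_mult mult_mono)
      qed (use M in auto)
      also have "\<dots> \<le> (B * B) * 1" using M B0 by (intro mult_left_mono) auto
      finally show ?thesis by simp
    qed
    have "(LINT v:{x..y}|lborel. f v * f (\<beta> * v)) = (LINT v:{x..x + real M}|lborel. f v * f (\<beta> * v)) + (LINT v:{x + real M..y}|lborel. f v * f (\<beta> * v))"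
      using M by (intro set_integral_split bdd_borel_intros bdd) auto
    then show ?thesis using 1 2 by linarith
  qed
  then show ?thesis by blast
qed

lemma geom_osc_mixing_step:
  assumes a: "a > 1" and irr: "\<And>x::nat. x \<ge> 1 \<Longrightarrow> a ^ x \<notin> \<rat>" and m: "m > 0"
  shows "geom_osc_mixing (step b m) a (LINT u:{0..1}|lborel. \<bar>step b m u\<bar>) (2 * real m) (\<Sum>i<m. \<bar>b i\<bar>) (\<Union>i\<in>{..<m}. lattice (real i / real m) \<union> lattice ((real i + 1) / real m))"
proof -
  interpret periodic_fun "step b m" by (rule periodic_step)
  have B: "\<bar>step b m u\<bar> \<le> (\<Sum>i<m. \<bar>b i\<bar>)" for u
  proof -
    have "\<bar>b i * saw (real i / real m) ((real i + 1) / real m) u\<bar> \<le> \<bar>b i\<bar> * 1" if "i < m" for i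
      unfolding abs_mult using cell_bounds[OF that] by (intro mult_left_mono saw_abs_le) auto
    then show ?thesis unfolding step_def by (intro order.trans[OF sum_abs sum_mono]) auto
  qed
  show ?thesis
  proof unfold_locales
    show "\<bar>step b m u\<bar> \<le> (\<Sum>i<m. \<bar>b i\<bar>)" for u by (rule B)
    show "(LINT u:{0..1}|lborel. step b m u) = 0" by (rule integral_step)
    show "piecewise_const (\<Union>i\<in>{..<m}. lattice (real i / real m) \<union> lattice ((real i + 1) / real m)) (step b m)"
      unfolding step_def[abs_def] by (rule piecewise_const_sum) (rule piecewise_const_comp[OF pc_saw, where h = "\<lambda>x. _ * x"])
    show "finite ((\<Union>i\<in>{..<m}. lattice (real i / real m) \<union> lattice ((real i + 1) / real m)) \<inter> {c..d}) \<and>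
      card ((\<Union>i\<in>{..<m}. lattice (real i / real m) \<union> lattice ((real i + 1) / real m)) \<inter> {c..d}) \<le> 2 * real m * (d - c + 1)" if cd: "c \<le> d" for c d
    proof -
      let ?L = "\<lambda>i. (lattice (real i / m) \<inter> {c..d}) \<union> (lattice ((real i + 1) / m) \<inter> {c..d})"
      have eq: "(\<Union>i\<in>{..<m}. lattice (real i / real m) \<union> lattice ((real i + 1) / real m)) \<inter> {c..d} = (\<Union>i\<in>{..<m}. ?L i)" by (auto simp: add.commute)
      have fin: "finite (?L i)" for i using card_lattice[OF cd] by auto
      have "card (\<Union>i\<in>{..<m}. ?L i) \<le> (\<Sum>i<m. card (?L i))" by (rule card_UN_le) simp
      then have "real (card (\<Union>i\<in>{..<m}. ?L i)) \<le> (\<Sum>i<m. real (card (?L i)))"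
        unfolding of_nat_sum[symmetric] by (rule of_nat_mono)
      also have "\<dots> \<le> (\<Sum>i<m. 2 * (d - c + 1))"
      proof (rule sum_mono)
        fix i
        have "real (card (?L i)) \<le> real (card (lattice (real i / m) \<inter> {c..d}) + card (lattice ((real i + 1) / m) \<inter> {c..d}))"
          by (rule of_nat_mono[OF card_Un_le])
        also have "\<dots> = real (card (lattice (real i / m) \<inter> {c..d})) + real (card (lattice ((real i + 1) / m) \<inter> {c..d}))" by simp
        also have "\<dots> \<le> (d - c + 1) + (d - c + 1)" by (intro add_mono card_lattice(2)[OF cd])
        finally show "real (card (?L i)) \<le> 2 * (d - c + 1)" by (simp only: mult_2)
      qed
      finally show ?thesis unfolding eq using fin by (simp add: mult_ac)
    qed
    show "\<exists>C. \<forall>x y. x \<le> y \<longrightarrow> \<bar>LINT v:{x..y}|lborel. step b m v * step b m (a ^ d * v)\<bar> \<le> \<epsilon> * (y - x) + C" if "d \<ge> 1" "\<epsilon> > 0" for d and \<epsilon> :: real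
      by (rule pair_correlation[OF B step_equidistributed[OF irr[OF that(1)]] that(2)])
  qed (use a in auto)
qed

text \<open>The real part of the complex limit theorem; the variance is made explicit in terms of
  \<open>b\<close>, ready for comparison with the bridge.\<close>

lemma step_charfun_limit:
  assumes a: "a > 1" and irr: "\<And>x::nat. x \<ge> 1 \<Longrightarrow> a ^ x \<notin> \<rat>" and m: "m > 0"
  shows "(\<lambda>n. LINT u:{0..1}|lborel. cos ((\<Sum>k\<in>{1..n}. step b m (a ^ k * u)) / sqrt n))
     \<longlonglongrightarrow> exp (- ((\<Sum>j<m. (b j)\<^sup>2) / m - ((\<Sum>j<m. b j) / m)\<^sup>2) / 2)"
proof -
  interpret geom_osc_mixing "step b m" a "LINT u:{0..1}|lborel. \<bar>step b m u\<bar>" "2 * real m" "\<Sum>i<m. \<bar>b i\<bar>" "\<Union>i\<in>{..<m}. lattice (real i / real m) \<union> lattice ((real i + 1) / real m)"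
    by (rule geom_osc_mixing_step[OF assms])
  have re: "Re (LINT u:{0..1}|lborel. cis (T {1..n} u / sqrt n)) = (LINT u:{0..1}|lborel. cos ((\<Sum>k\<in>{1..n}. step b m (a ^ k * u)) / sqrt n))" for n
  proof -
    have "set_integrable lborel {0..1} (\<lambda>u. cis (T {1..n} u * (1 / sqrt n)))"
      by (intro set_integrable_bdd_borel bdd_borel_intros)
    then have "integrable lborel (\<lambda>u. indicator {0..1} u *\<^sub>R cis (T {1..n} u / sqrt n))" by (simp add: set_integrable_def)
    then show ?thesis unfolding set_lebesgue_integral_def by (simp add: integral_Re[symmetric] T_def fk_def)
  qed
  have e: "exp (- ((\<Sum>j<m. (b j)\<^sup>2) / m - ((\<Sum>j<m. b j) / m)\<^sup>2) / 2) = exp (- (\<sigma>2 / 2))"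
    by (simp only: \<sigma>2_def integral_step_sq[OF m] minus_divide_left)
  show ?thesis using tendsto_Re[OF charfun_limit] unfolding re e by simp
qed

text \<open>The restriction on \<open>t - s\<close> tames the two terms that are linear in it:
  eventually \<open>(q n)\<^sup>2 \<le> n powr (2/5)\<close>, hence
  \<open>(q n)\<^sup>2 / n \<le> t - s\<close>, and the coupling term is bounded in the same way.
  The constant 8 is \<open>4 + 2 + 2\<close>, where 4 is the square of the 2 in
  \<open>V = 2 * (t - s)\<close>.\<close>

lemma saw_fourth_moment:
  assumes a: "a > 1"
  shows "\<exists>C n0. C \<ge> 0 \<and> (\<forall>n\<ge>n0. \<forall>s t. 0 \<le> s \<longrightarrow> s < t \<longrightarrow> t \<le> 1 \<longrightarrow> 1 \<le> (t - s) * real n powr (3/5) \<longrightarrow>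
    (LINT u:{0..1}|lborel. ((\<Sum>k\<in>{1..n}. saw s t (a ^ k * u)) / sqrt n) ^ 4) \<le> C * (t - s)\<^sup>2)"
proof -
  define c where "c = 10 / ln a"
  have c: "c > 0" using a by (simp add: c_def)
  define q where "q n = nat \<lceil>c * ln (real n)\<rceil>" for n :: nat
  define \<kappa> where "\<kappa> = 2 * (2 + 1) / (1 - 1 / a)"
  have k0: "\<kappa> \<ge> 0" using a by (simp add: \<kappa>_def)
  define G where "G = 27 * (64 * \<kappa>\<^sup>2 + 58 * \<kappa> + 16)"
  have G: "G \<ge> 0" using k0 by (simp add: G_def)
  define large where "large n \<longleftrightarrow> (c * ln n + 1)\<^sup>2 \<le> real n powr (2/5) \<and> c * ln n + 1 \<le> real n \<and> c * ln n > 0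
     \<and> (real n)\<^sup>2 * (real n powr (-10) * (2 * 2 * real n + 1)) \<le> real n powr (-3/5) \<and> n \<ge> 1" for n :: nat
  have "eventually (\<lambda>n::nat. (c * ln n + 1)\<^sup>2 \<le> real n powr (2/5)) sequentially" using c by real_asymp
  moreover have "eventually (\<lambda>n::nat. c * ln n + 1 \<le> real n) sequentially" using c by real_asymp
  moreover have "eventually (\<lambda>n::nat. c * ln n > 0) sequentially" using c by real_asymp
  moreover have "eventually (\<lambda>n::nat. (real n)\<^sup>2 * (real n powr (-10) * (2 * 2 * real n + 1)) \<le> real n powr (-3/5)) sequentially" by real_asymp
  ultimately have "eventually large sequentially"
    using eventually_ge_at_top[of 1] by eventually_elim (simp add: large_def)
  then obtain n0 where n0: "\<And>n. n \<ge> n0 \<Longrightarrow> large n" unfolding eventually_sequentially by blast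
  have "(LINT u:{0..1}|lborel. ((\<Sum>k\<in>{1..n}. saw s t (a ^ k * u)) / sqrt n) ^ 4) \<le> 8 * G * (t - s)\<^sup>2"
    if n: "n \<ge> n0" and st: "0 \<le> s" "s < t" "t \<le> 1" and \<delta>: "1 \<le> (t - s) * real n powr (3/5)" for n s t
  proof -
    interpret geom_osc "saw s t" a "2 * (t - s)" 2 1 "lattice s \<union> lattice t" by (rule geom_osc_saw[OF a st])
    note N = n0[OF n, unfolded large_def]
    have n1: "real n > 0" using N by simp
    have q: "q n \<ge> 1" "real (q n) \<le> c * ln n + 1" "c * ln n \<le> real (q n)" using N unfolding q_def by linarith+
    have qn: "q n \<le> n" using q N by linarith
    have "real n powr (-3/5) * real n powr (3/5) = 1" using n1 by (simp flip: powr_add)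
    moreover have "real n powr (-3/5) * 1 \<le> real n powr (-3/5) * ((t - s) * real n powr (3/5))" using \<delta> by (rule mult_left_mono) simp
    ultimately have np: "real n powr (-3/5) \<le> t - s" by (simp add: mult.left_commute)
    have tau: "\<tau> n (q n) \<le> real n powr (-10) * (2 * 2 * real n + 1)"
    proof -
      have "\<rho> ^ q n = \<rho> powr (q n)" using rho by (simp add: powr_realpow)
      also have "\<dots> \<le> \<rho> powr (c * ln n)" using q rho by (intro powr_mono') auto
      also have "\<dots> = real n powr (-10)" using n1 a by (simp add: powr_def \<rho>_def ln_div c_def)
      finally show ?thesis unfolding \<tau>_def by (intro mult_right_mono) auto
    qed
    have e1: "(real (q n))\<^sup>2 \<le> real n * (t - s)"
    proof -
      have "(real (q n))\<^sup>2 \<le> (c * ln n + 1)\<^sup>2" using q by (intro power_mono) auto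
      also have "\<dots> \<le> real n powr (2/5)" using N by simp
      also have "\<dots> = real n * real n powr (-3/5)" using n1 by (simp add: powr_mult_base)
      also have "\<dots> \<le> real n * (t - s)" using np by (intro mult_left_mono) auto
      finally show ?thesis .
    qed
    have e2: "(real n)\<^sup>2 * \<tau> n (q n) \<le> t - s"
    proof -
      have "(real n)\<^sup>2 * \<tau> n (q n) \<le> (real n)\<^sup>2 * (real n powr (-10) * (2 * 2 * real n + 1))" using tau by (intro mult_left_mono) auto
      also have "\<dots> \<le> real n powr (-3/5)" using N by simp
      finally show ?thesis using np by linarith
    qed
    have "(LINT u:{0..1}|lborel. ((\<Sum>k\<in>{1..n}. saw s t (a ^ k * u)) / sqrt n) ^ 4) = (LINT u:{0..1}|lborel. (T {1..n} u) ^ 4) / (real n)\<^sup>2"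
      using n1 by (simp add: T_def fk_def power_divide flip: power_mult[of "sqrt n" 2 2, simplified])
    also have "\<dots> \<le> (G * ((2 * (t - s))\<^sup>2 * (real n)\<^sup>2 + 2 * (t - s) * n * (real (q n))\<^sup>2 + 2 * (t - s) * real n ^ 4 * \<tau> n (q n))) / (real n)\<^sup>2"
      unfolding G_def by (intro divide_right_mono fourth_moment[OF refl q(1) qn]) (auto simp: \<kappa>_def \<rho>_def)
    also have "\<dots> \<le> (G * ((2 * (t - s))\<^sup>2 * (real n)\<^sup>2 + 2 * (t - s) * n * (real n * (t - s)) + 2 * (t - s) * (real n)\<^sup>2 * (t - s))) / (real n)\<^sup>2"
    proof -
      have "2 * (t - s) * n * (real (q n))\<^sup>2 \<le> 2 * (t - s) * n * (real n * (t - s))" using e1 st by (intro mult_left_mono) auto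
      note m1 = this
      have "2 * (t - s) * (real n)\<^sup>2 * ((real n)\<^sup>2 * \<tau> n (q n)) \<le> 2 * (t - s) * (real n)\<^sup>2 * (t - s)" using e2 st by (intro mult_left_mono) auto
      moreover have "2 * (t - s) * real n ^ 4 * \<tau> n (q n) = 2 * (t - s) * (real n)\<^sup>2 * ((real n)\<^sup>2 * \<tau> n (q n))" by (simp add: power4_eq_xxxx power2_eq_square)
      ultimately have "2 * (t - s) * real n ^ 4 * \<tau> n (q n) \<le> 2 * (t - s) * (real n)\<^sup>2 * (t - s)" by (simp only:)
      then show ?thesis by (intro divide_right_mono mult_left_mono[OF _ G] add_mono m1 order_refl) simp_all
    qed
    also have "\<dots> = 8 * G * (t - s)\<^sup>2" using n1 by (simp add: power2_eq_square field_simps)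
    finally show ?thesis .
  qed
  then show ?thesis using G by (intro exI[of _ "8 * G"] exI[of _ n0]) auto
qed

section \<open>The Kolmogorov distribution function as a series\<close>

lemma kolmogorov_term_bound:
  assumes "0 < z" "z < y"
  shows "norm ((- 1) ^ Suc k * exp (- 2 * (real (Suc k))\<^sup>2 * y\<^sup>2)) \<le> exp (- 2 * z\<^sup>2) ^ k"
proof -
  have "real k \<le> real (Suc k) * real (Suc k)" by (simp add: algebra_simps)
  then have "real k \<le> (real (Suc k))\<^sup>2" by (simp only: power2_eq_square)
  moreover have "z\<^sup>2 \<le> y\<^sup>2" using assms by (intro power_mono) auto
  ultimately have "real k * z\<^sup>2 \<le> (real (Suc k))\<^sup>2 * y\<^sup>2" by (intro mult_mono) auto
  then have "exp (- 2 * (real (Suc k))\<^sup>2 * y\<^sup>2) \<le> exp (real k * (- 2 * z\<^sup>2))" by (simp add: mult_ac)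
  moreover have "norm ((- 1) ^ Suc k * exp (- 2 * (real (Suc k))\<^sup>2 * y\<^sup>2)) = exp (- 2 * (real (Suc k))\<^sup>2 * y\<^sup>2)"
    unfolding norm_mult norm_power by simp
  ultimately show ?thesis by (simp only: exp_of_nat_mult)
qed

lemma summable_kolmogorov_bound: "z > 0 \<Longrightarrow> summable (\<lambda>k. exp (- 2 * z\<^sup>2) ^ k :: real)"
  by (intro summable_geometric) auto

text \<open>The terms are absolutely summable and even in \<open>k\<close>, so the unordered sum
  over the integers splits into the central term and two equal halves.\<close>

lemma kolmogorov_cdf_eq: 
  assumes x: "x > 0" shows "kolmogorov_cdf x = kolmogorov_series x"
proof -
  define f where "f k = (- 1) powi k * exp (- 2 * (real_of_int k)\<^sup>2 * x\<^sup>2)" for k :: int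
  define g where "g k = (- 1) ^ Suc k * exp (- 2 * (real (Suc k))\<^sup>2 * x\<^sup>2)" for k
  have sg: "summable (\<lambda>k. norm (g k))"
    by (rule summable_comparison_test[OF _ summable_kolmogorov_bound[of "x / 2"]])
      (use x kolmogorov_term_bound[of "x / 2" x] in \<open>auto simp: g_def\<close>)
  have hg: "(g has_sum suminf g) UNIV" 
    by (rule norm_summable_imp_has_sum[OF sg summable_sums[OF summable_norm_cancel[OF sg]]])
  have fm: "f (int m) = (- 1) ^ m * exp (- 2 * (real m)\<^sup>2 * x\<^sup>2)" "f (- int m) = (- 1) ^ m * exp (- 2 * (real m)\<^sup>2 * x\<^sup>2)" for m
  proof -
    show "f (int m) = (- 1) ^ m * exp (- 2 * (real m)\<^sup>2 * x\<^sup>2)"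
      unfolding f_def by (simp only: power_int_of_nat of_int_of_nat_eq)
    have inv: "inverse ((- 1 :: real) ^ m) = (- 1) ^ m" by (cases "even m") auto
    show "f (- int m) = (- 1) ^ m * exp (- 2 * (real m)\<^sup>2 * x\<^sup>2)" 
      unfolding f_def power_int_minus by (simp only: power_int_of_nat of_int_minus of_int_of_nat_eq power2_minus inv)
  qed
  have f1: "f (int (Suc k)) = g k" "f (- int (Suc k)) = g k" for k
    unfolding g_def by (rule fm)+
  have "(f has_sum suminf g) {1..}"
    by (rule has_sum_reindex_bij_witness[THEN iffD1, OF _ _ _ _ _ refl hg, of "\<lambda>k. nat k - 1" "\<lambda>k. int (Suc k)"]) (use f1 in auto)
  moreover have "(f has_sum suminf g) {..-1}"
    by (rule has_sum_reindex_bij_witness[THEN iffD1, OF _ _ _ _ _ refl hg, of "\<lambda>k. nat (-k) - 1" "\<lambda>k. - int (Suc k)"]) (use f1 in auto)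
  moreover have "(f has_sum f 0) {0}" using has_sum_finite[of "{0}" f] by simp
  ultimately have "(f has_sum (f 0 + suminf g + suminf g)) ({0} \<union> {1..} \<union> {..-1})"
    by (intro has_sum_Un_disjoint) auto
  moreover have "{0} \<union> {1..} \<union> {..-1} = (UNIV :: int set)" by auto
  ultimately have "infsum f UNIV = f 0 + suminf g + suminf g" by (simp add: infsumI)
  moreover have "f 0 = 1" by (simp add: f_def)
  ultimately show ?thesis unfolding kolmogorov_cdf_def kolmogorov_series_def f_def[symmetric] g_def[symmetric]
    using x by simp
qed

text \<open>Continuity absorbs the slack in the comparison of maxima. Near \<open>x\<close> all
  arguments exceed \<open>x / 2\<close>, which supplies a common geometric majorant.\<close>

lemma isCont_kolmogorov_series:
  assumes x: "x > 0" shows "isCont kolmogorov_series x"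
proof -
  have ev: "eventually (\<lambda>y. y > x / 2) (at x)"
    by (rule order_tendstoD(1)[OF tendsto_ident_at]) (use x in auto)
  have "((\<lambda>y. suminf (\<lambda>k. (- 1) ^ Suc k * exp (- 2 * (real (Suc k))\<^sup>2 * y\<^sup>2))) \<longlongrightarrow> suminf (\<lambda>k. (- 1) ^ Suc k * exp (- 2 * (real (Suc k))\<^sup>2 * x\<^sup>2))) (at x)"
  proof (rule tannerys_theorem[THEN conjunct2, THEN conjunct2])
    show "((\<lambda>y. (- 1) ^ Suc k * exp (- 2 * (real (Suc k))\<^sup>2 * y\<^sup>2)) \<longlongrightarrow> (- 1) ^ Suc k * exp (- 2 * (real (Suc k))\<^sup>2 * x\<^sup>2)) (at x)" for k
      by (intro tendsto_intros)
    have "eventually (\<lambda>y. \<forall>k. norm ((- 1) ^ Suc k * exp (- 2 * (real (Suc k))\<^sup>2 * y\<^sup>2)) \<le> exp (- 2 * (x / 2)\<^sup>2) ^ k) (at x)"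
      using ev by (rule eventually_mono) (intro allI kolmogorov_term_bound, use x in auto)
    then show "eventually (\<lambda>(k, y). norm ((- 1) ^ Suc k * exp (- 2 * (real (Suc k))\<^sup>2 * y\<^sup>2)) \<le> exp (- 2 * (x / 2)\<^sup>2) ^ k) (at_top \<times>\<^sub>F at x)"
      unfolding eventually_prod_filter
      by (intro exI[of _ "\<lambda>_. True"] exI[of _ "\<lambda>y. \<forall>k. norm ((- 1) ^ Suc k * exp (- 2 * (real (Suc k))\<^sup>2 * y\<^sup>2)) \<le> exp (- 2 * (x / 2)\<^sup>2) ^ k"]) auto
    show "summable (\<lambda>k. exp (- 2 * (x / 2)\<^sup>2) ^ k)" using x by (intro summable_kolmogorov_bound) auto
  qed simp
  then show ?thesis unfolding isCont_def kolmogorov_series_def by (intro tendsto_intros)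
qed

text \<open>The length \<open>2 ^ n\<close> makes the dyadic grids nested; \<open>n = 0\<close> is junk.\<close>

definition bridge_pmf :: "nat \<Rightarrow> nat set pmf" where
  "bridge_pmf n = pmf_of_set (bridges (2 ^ (n - 1)))"

definition bridge_path :: "nat \<Rightarrow> nat \<Rightarrow> nat set \<Rightarrow> real" where
  "bridge_path n k A = real_of_int (walk k A) / sqrt (2 ^ n)"

section \<open>Limit law, characteristic functions and moments of the bridge paths\<close>

lemma expectation_bridge: "(LINT A|measure_pmf (bridge_pmf n). f A) = (\<Sum>A\<in>bridges (2 ^ (n - 1)). f A) / card (bridges (2 ^ (n - 1)))" for f :: "_ \<Rightarrow> real"
  unfolding bridge_pmf_def by (rule integral_pmf_of_set) (auto simp: bridges_ne)

lemma integrable_bridge [simp]: "integrable (measure_pmf (bridge_pmf n)) (f :: _ \<Rightarrow> real)"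
  by (rule integrable_measure_pmf_finite) (simp add: bridge_pmf_def bridges_ne)

lemma two_pow_pred: "n \<ge> 1 \<Longrightarrow> 2 * 2 ^ (n - 1) = (2 ^ n :: nat)"
  by (cases n) auto

lemma bridge_max_limit:
  assumes x: "x > 0"
  shows "(\<lambda>n. measure_pmf.prob (bridge_pmf n) {A. \<forall>k\<le>2 ^ n. \<bar>bridge_path n k A\<bar> \<le> x}) \<longlonglongrightarrow> kolmogorov_series x"
proof -
  \<comment> \<open>The smallest integer strictly above \<open>x * sqrt (2 ^ n)\<close>, so that the
    closed condition on the path becomes the strict barrier condition of
    \<open>confined\<close>.\<close>
  define c where "c n = nat \<lfloor>x * sqrt (2 ^ n)\<rfloor> + 1" for n :: nat
  have lim: "(\<lambda>n. real (card (confined (int (c n)) (2 * 2 ^ (n - 1)) 0)) / real (2 * 2 ^ (n - 1) choose 2 ^ (n - 1))) \<longlonglongrightarrow> kolmogorov_series x"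
  proof (rule confined_bridge_limit[OF _ x])
    show "filterlim (\<lambda>n. 2 ^ (n - 1) :: nat) at_top sequentially"
      by (rule filterlim_at_top_mono[OF filterlim_minus_const_nat_at_top[of 1]]) (rule always_eventually, intro allI less_imp_le less_exp)
    show "(\<lambda>n. real (c n) / sqrt (real (2 * 2 ^ (n - 1)))) \<longlonglongrightarrow> x"
    proof (rule Lim_transform_eventually)
      have inf: "filterlim (\<lambda>n::nat. sqrt (2 ^ n)) at_top sequentially" by real_asymp
      have "((\<lambda>y. (real_of_int \<lfloor>x * y\<rfloor> + 1) / y) \<longlongrightarrow> x) at_top" using x by real_asymp
      from filterlim_compose[OF this inf] show "(\<lambda>n. (real_of_int \<lfloor>x * sqrt (2 ^ n)\<rfloor> + 1) / sqrt (2 ^ n)) \<longlonglongrightarrow> x" .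
      show "eventually (\<lambda>n. (real_of_int \<lfloor>x * sqrt (2 ^ n)\<rfloor> + 1) / sqrt (2 ^ n) = real (c n) / sqrt (real (2 * 2 ^ (n - 1)))) sequentially"
        using eventually_ge_at_top[of 1]
      proof eventually_elim
        case (elim n)
        have "real (2 * 2 ^ (n - 1)) = 2 ^ n" unfolding two_pow_pred[OF elim] by simp
        then show ?case using x by (simp add: c_def)
      qed
    qed
  qed
  show ?thesis
  proof (rule Lim_transform_eventually[OF lim])
    show "eventually (\<lambda>n. real (card (confined (int (c n)) (2 * 2 ^ (n - 1)) 0)) / real (2 * 2 ^ (n - 1) choose 2 ^ (n - 1)) = measure_pmf.prob (bridge_pmf n) {A. \<forall>k\<le>2 ^ n. \<bar>bridge_path n k A\<bar> \<le> x}) sequentially"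
      using eventually_ge_at_top[of 1]
    proof eventually_elim
      case (elim n)
      have "\<bar>bridge_path n k A\<bar> \<le> x \<longleftrightarrow> \<bar>walk k A\<bar> < int (c n)" for k A
      proof -
        have "\<bar>bridge_path n k A\<bar> \<le> x \<longleftrightarrow> real_of_int \<bar>walk k A\<bar> \<le> x * sqrt (2 ^ n)"
          by (simp add: bridge_path_def abs_divide field_simps)
        also have "\<dots> \<longleftrightarrow> \<bar>walk k A\<bar> \<le> \<lfloor>x * sqrt (2 ^ n)\<rfloor>" by (simp only: le_floor_iff)
        also have "\<dots> \<longleftrightarrow> \<bar>walk k A\<bar> < \<lfloor>x * sqrt (2 ^ n)\<rfloor> + 1" by (rule zle_add1_eq_le[symmetric])
        also have "\<lfloor>x * sqrt (2 ^ n)\<rfloor> + 1 = int (c n)" using x by (simp add: c_def)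
        finally show ?thesis .
      qed
      then have "bridges (2 ^ (n - 1)) \<inter> {A. \<forall>k\<le>2 ^ n. \<bar>bridge_path n k A\<bar> \<le> x} = confined (int (c n)) (2 * 2 ^ (n - 1)) 0"
        unfolding two_pow_pred[OF elim, symmetric] by (auto simp: bridges_def confined_def)
      then show ?case unfolding bridge_pmf_def by (subst measure_pmf_of_set) (simp_all add: bridges_ne card_bridges)
    qed
  qed
qed

text \<open>The general limit along \<open>r = 2 ^ (n - (L + 1))\<close> with
  \<open>m = 2 ^ L\<close>: then \<open>2 * r\<close> is the number of walk steps per cell and
  \<open>2 * r * m\<close> the total length \<open>2 ^ n\<close>.\<close>

lemma bridge_grid_charfun:
  shows "(\<lambda>n. LINT A|measure_pmf (bridge_pmf n). cos (\<Sum>j<2 ^ L. b j * (bridge_path n ((j + 1) * 2 ^ (n - L)) A - bridge_path n (j * 2 ^ (n - L)) A)))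
    \<longlonglongrightarrow> exp (- ((\<Sum>j<2 ^ L. (b j)\<^sup>2) / real (2 ^ L) - ((\<Sum>j<2 ^ L. b j) / real (2 ^ L))\<^sup>2) / 2)"
proof -
  define m :: nat where "m = 2 ^ L"
  have m: "m > 0" by (simp add: m_def)
  have fl: "filterlim (\<lambda>n. 2 ^ (n - (L + 1)) :: nat) at_top sequentially"
    by (rule filterlim_at_top_mono[OF filterlim_minus_const_nat_at_top[of "L + 1"]]) (rule always_eventually, intro allI less_imp_le less_exp)
  from filterlim_compose[OF bridge_charfun_limit[OF m, of b] fl] show ?thesis unfolding m_def[symmetric]
  proof (rule Lim_transform_eventually)
    show "eventually (\<lambda>n. (\<Sum>A\<in>bridges (2 ^ (n - (L + 1)) * m). cos (\<Sum>j<m. b j * (real_of_int (walk ((j + 1) * (2 * 2 ^ (n - (L + 1)))) A - walk (j * (2 * 2 ^ (n - (L + 1)))) A) / sqrt (real (2 * 2 ^ (n - (L + 1)) * m))))) / real (card (bridges (2 ^ (n - (L + 1)) * m)))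
      = (LINT A|measure_pmf (bridge_pmf n). cos (\<Sum>j<m. b j * (bridge_path n ((j + 1) * 2 ^ (n - L)) A - bridge_path n (j * 2 ^ (n - L)) A)))) sequentially"
      using eventually_ge_at_top[of "L + 1"]
    proof eventually_elim
      case (elim n)
      obtain d where d: "n = L + 1 + d" using elim le_Suc_ex by blast
      have e: "2 ^ (n - (L + 1)) * m = 2 ^ (n - 1)" "2 * 2 ^ (n - (L + 1)) = (2 ^ (n - L) :: nat)" "real (2 * 2 ^ (n - (L + 1)) * m) = 2 ^ n"
        by (simp_all add: d m_def power_add Suc_diff_le)
      show ?case unfolding expectation_bridge e(1,3) unfolding e(2) by (simp add: bridge_path_def diff_divide_distrib)
    qed
  qed
qed

text \<open>The hypothesis \<open>1 \<le> l\<close> keeps a cell within half of the time interval,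
  where the bridge is comparable with the free walk.\<close>

lemma bridge_path_moment:
  assumes l: "1 \<le> l" "l \<le> n" and j: "j < 2 ^ l"
  shows "(LINT A|measure_pmf (bridge_pmf n). (bridge_path n ((j + 1) * 2 ^ (n - l)) A - bridge_path n (j * 2 ^ (n - l)) A) ^ 4) \<le> 6 / 4 ^ l"
proof -
  define h where "h = (2::nat) ^ (n - l)"
  have hn: "h * 2 ^ l = 2 ^ n" using l by (simp add: h_def flip: power_add)
  have "(bridge_path n ((j + 1) * h) A - bridge_path n (j * h) A) ^ 4 = incr (j * h) h A ^ 4 / (2 ^ n)\<^sup>2" for A
  proof -
    have "bridge_path n ((j + 1) * h) A - bridge_path n (j * h) A = incr (j * h) h A / sqrt (2 ^ n)"
      by (simp add: bridge_path_def incr_walk diff_divide_distrib add.commute)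
    moreover have "sqrt (2 ^ n) ^ 4 = (2 ^ n)\<^sup>2" 
    proof -
      have "sqrt (2 ^ n) ^ 4 = ((sqrt (2 ^ n))\<^sup>2)\<^sup>2" by (simp only: power_mult[symmetric]) simp
      then show ?thesis by simp
    qed
    ultimately show ?thesis by (simp add: power_divide)
  qed
  then have "(LINT A|measure_pmf (bridge_pmf n). (bridge_path n ((j + 1) * h) A - bridge_path n (j * h) A) ^ 4)
    = (\<Sum>A\<in>bridges (2 ^ (n - 1)). incr (j * h) h A ^ 4) / (2 ^ n)\<^sup>2 / card (bridges (2 ^ (n - 1)))"
    unfolding expectation_bridge by (simp add: sum_divide_distrib)
  also have "\<dots> \<le> (6 * (real h)\<^sup>2 * card (bridges (2 ^ (n - 1)))) / (2 ^ n)\<^sup>2 / card (bridges (2 ^ (n - 1)))"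
  proof (intro divide_right_mono bridge_fourth_moment)
    have "(j + 1) * h \<le> 2 ^ l * h" using j by (intro mult_right_mono) auto
    also have "\<dots> = 2 * 2 ^ (n - 1)" using hn l two_pow_pred[of n] by (simp add: mult.commute)
    finally show "j * h + h \<le> 2 * 2 ^ (n - 1)" by simp
    show "h \<le> 2 ^ (n - 1)" unfolding h_def using l by (intro power_increasing) auto
    show "even h \<or> h = 1" by (cases "n = l") (auto simp: h_def)
  qed auto
  also have "\<dots> = 6 * (real h)\<^sup>2 / (2 ^ n)\<^sup>2" using bridges_ne by (simp add: card_gt_0_iff)
  also have "(2 ^ n :: real)\<^sup>2 = (real h)\<^sup>2 * 4 ^ l"
  proof -
    have "(2 ^ n :: real) = real h * 2 ^ l" using arg_cong[OF hn, of real] by simp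
    moreover have "((2::real) ^ l)\<^sup>2 = 4 ^ l" by (simp add: power2_eq_square power_mult_distrib[symmetric])
    ultimately show ?thesis by (simp add: power_mult_distrib)
  qed
  finally show ?thesis by (simp add: h_def)
qed

lemma bridge_chaining:
  assumes "L \<le> n"
  shows "measure_pmf.prob (bridge_pmf n) {A. \<exists>k<2 ^ n. \<bar>bridge_path n k A - bridge_path n (k div 2 ^ (n - L) * 2 ^ (n - L)) A\<bar> > 10 * (9/10) ^ L} \<le> 24 * (4/5) ^ L"
  using measure_pmf.chaining[of "bridge_path n" "bridge_pmf n" L n 6] bridge_path_moment[of _ n] assms by simp

section \<open>The empirical process on the unit interval\<close>

definition emp :: "real \<Rightarrow> nat \<Rightarrow> real \<Rightarrow> real \<Rightarrow> real" where
  "emp a n u t = (real (card {k\<in>{1..n}. frac (a ^ k * u) < t}) - n * t) / sqrt n"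

definition unit_measure :: "real measure" where
  "unit_measure = restrict_space lborel {0..1}"

lemma space_unit_measure [simp]: "space unit_measure = {0..1}" by (simp add: unit_measure_def space_restrict_space)

lemma prob_space_unit_measure: "prob_space unit_measure"
  by (rule prob_spaceI) (simp add: unit_measure_def space_restrict_space emeasure_restrict_space)

lemma measurable_unit_measure: "f \<in> borel_measurable borel \<Longrightarrow> f \<in> borel_measurable unit_measure"
  unfolding unit_measure_def by (rule measurable_restrict_space1) simp

lemma integral_unit_measure: "(LINT u|unit_measure. g u) = (LINT u:{0..1}|lborel. g u)" for g :: "real \<Rightarrow> real"
  by (simp add: unit_measure_def integral_restrict_space set_lebesgue_integral_def)

lemma integrable_unit_measure: "bdd_borel g \<Longrightarrow> integrable unit_measure g" for g :: "real \<Rightarrow> real"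
  using set_integrable_bdd_borel[of g 0 1] by (simp add: unit_measure_def integrable_restrict_space set_integrable_def)

lemma card_eq_sum_of_bool: "finite S \<Longrightarrow> real (card {k\<in>S. Q k}) = (\<Sum>k\<in>S. of_bool (Q k))"
  by (simp add: of_bool_def sum.If_cases Int_def)

lemma emp_0 [simp]: "emp a n u 0 = 0"
proof -
  have "{k\<in>{1..n}. frac (a ^ k * u) < 0} = {}" using frac_ge_0 by (auto simp: not_less)
  then show ?thesis by (simp add: emp_def)
qed

text \<open>The strict inequality in \<open>emp\<close> matches the half-open cells of
  \<open>saw\<close>, so increments are exact lacunary sums, also for the cell ending at 1.\<close>

lemma emp_diff:
  assumes st: "0 \<le> s" "s < t" "t \<le> 1"
  shows "emp a n u t - emp a n u s = (\<Sum>k\<in>{1..n}. saw s t (a ^ k * u)) / sqrt n"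
proof -
  have "of_bool (frac y < t) - of_bool (frac y < s) = saw s t y + (t - s)" for y
    using st by (auto simp: saw_eq)
  then have eq: "(\<Sum>k\<in>{1..n}. of_bool (frac (a ^ k * u) < t) - of_bool (frac (a ^ k * u) < s)) = (\<Sum>k\<in>{1..n}. saw s t (a ^ k * u) + (t - s))"
    by (intro sum.cong) auto
  define A where "A = (\<Sum>k\<in>{1..n}. of_bool (frac (a ^ k * u) < t) :: real)"
  define C where "C = (\<Sum>k\<in>{1..n}. of_bool (frac (a ^ k * u) < s) :: real)"
  have "A - C = (\<Sum>k\<in>{1..n}. saw s t (a ^ k * u)) + n * (t - s)"
    unfolding A_def C_def sum_subtractf[symmetric] eq by (simp add: sum.distrib)
  then have S: "(\<Sum>k\<in>{1..n}. saw s t (a ^ k * u)) = (A - n * t) - (C - n * s)" by (simp add: algebra_simps)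
  show ?thesis unfolding emp_def card_eq_sum_of_bool[OF finite_atLeastAtMost] S A_def[symmetric] C_def[symmetric]
    by (rule diff_divide_distrib[symmetric])
qed

lemma emp_measurable [measurable]: "(\<lambda>u. emp a n u t) \<in> borel_measurable borel"
proof -
  have "(\<lambda>x::real. x - real_of_int \<lfloor>x\<rfloor>) \<in> borel_measurable borel"
    by (intro borel_measurable_diff borel_measurable_real_floor) simp
  then have fr: "(frac :: real \<Rightarrow> real) \<in> borel_measurable borel" by (simp only: frac_def[abs_def])
  have [measurable]: "(\<lambda>u. frac (a ^ k * u)) \<in> borel_measurable borel" for k
    by (rule measurable_compose[OF _ fr]) simp
  have "(\<lambda>u. of_bool (frac (a ^ k * u) < t) :: real) \<in> borel_measurable borel" for k
    unfolding of_bool_def by measurable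
  then show ?thesis unfolding emp_def card_eq_sum_of_bool[OF finite_atLeastAtMost]
    by (intro borel_measurable_divide borel_measurable_diff borel_measurable_sum borel_measurable_const)
qed

lemma emp_measurable_unit [measurable]: "(\<lambda>u. emp a n u t) \<in> borel_measurable unit_measure"
  by (rule measurable_unit_measure[OF emp_measurable])

lemma emp_bdd_borel [bdd_borel_intros]: "bdd_borel (\<lambda>u. emp a n u t)"
proof (rule bdd_borelI[OF emp_measurable])
  fix u
  have "card {k\<in>{1..n}. frac (a ^ k * u) < t} \<le> card {1..n}" by (intro card_mono) auto
  then show "norm (emp a n u t) \<le> (n + n * \<bar>t\<bar>) / sqrt n"
  proof (cases "n = 0")
    case False
    then show ?thesis using \<open>card _ \<le> card _\<close>
    unfolding emp_def real_norm_def abs_divide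
      by (intro frac_le order.trans[OF abs_triangle_ineq4] add_mono) (auto simp: abs_mult)
  qed (simp add: emp_def)
qed

lemma emp_grid_step:
  assumes m: "m > 0"
  shows "(\<Sum>i<m. b i * (emp a n u ((real i + 1) / m) - emp a n u (real i / m))) = (\<Sum>k\<in>{1..n}. step b m (a ^ k * u)) / sqrt n"
proof -
  have "(\<Sum>i<m. b i * (emp a n u ((real i + 1) / m) - emp a n u (real i / m)))
    = (\<Sum>i<m. \<Sum>k\<in>{1..n}. b i * saw (real i / m) ((real i + 1) / m) (a ^ k * u) / sqrt n)"
  proof (rule sum.cong[OF refl])
    fix i assume "i \<in> {..<m}"
    then have "emp a n u ((real i + 1) / m) - emp a n u (real i / m) = (\<Sum>k\<in>{1..n}. saw (real i / m) ((real i + 1) / m) (a ^ k * u)) / sqrt n"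
      using cell_bounds[of i m] by (intro emp_diff) auto
    then show "b i * (emp a n u ((real i + 1) / m) - emp a n u (real i / m)) = (\<Sum>k\<in>{1..n}. b i * saw (real i / m) ((real i + 1) / m) (a ^ k * u) / sqrt n)"
      by (simp add: sum_distrib_left sum_divide_distrib)
  qed
  also have "\<dots> = (\<Sum>k\<in>{1..n}. \<Sum>i<m. b i * saw (real i / m) ((real i + 1) / m) (a ^ k * u) / sqrt n)" by (rule sum.swap)
  finally show ?thesis by (simp add: step_def sum_divide_distrib)
qed

lemma emp_grid_charfun:
  assumes a: "a > 1" and irr: "\<And>x::nat. x \<ge> 1 \<Longrightarrow> a ^ x \<notin> \<rat>" and m: "m > 0"
  shows "(\<lambda>n. LINT u|unit_measure. cos (\<Sum>i<m. b i * (emp a n u ((real i + 1) / m) - emp a n u (real i / m))))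
    \<longlonglongrightarrow> exp (- ((\<Sum>j<m. (b j)\<^sup>2) / m - ((\<Sum>j<m. b j) / m)\<^sup>2) / 2)"
  unfolding integral_unit_measure emp_grid_step[OF m] by (rule step_charfun_limit[OF a irr m])

lemma emp_telescope:
  fixes m :: nat
  assumes "m > 0"
  shows "(\<Sum>i<j. emp a n u ((real i + 1) / m) - emp a n u (real i / m)) = emp a n u (real j / m)"
  using sum_lessThan_telescope[of "\<lambda>i. emp a n u (real i / m)" j] by (simp add: add.commute)

lemma emp_moment:
  assumes a: "a > 1"
  shows "\<exists>C n0. C \<ge> 0 \<and> (\<forall>n\<ge>n0. \<forall>l j. (2::real) ^ l \<le> real n powr (3/5) \<longrightarrow> j < 2 ^ l \<longrightarrow>
    (LINT u|unit_measure. (emp a n u ((real j + 1) / 2 ^ l) - emp a n u (real j / 2 ^ l)) ^ 4) \<le> C / 4 ^ l)"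
proof -
  obtain C n0 where C: "C \<ge> 0" "\<And>n s t. n \<ge> n0 \<Longrightarrow> 0 \<le> s \<Longrightarrow> s < t \<Longrightarrow> t \<le> 1 \<Longrightarrow> 1 \<le> (t - s) * real n powr (3/5) \<Longrightarrow>
    (LINT u:{0..1}|lborel. ((\<Sum>k\<in>{1..n}. saw s t (a ^ k * u)) / sqrt n) ^ 4) \<le> C * (t - s)\<^sup>2"
    using saw_fourth_moment[OF a] by blast
  have "(LINT u|unit_measure. (emp a n u ((real j + 1) / 2 ^ l) - emp a n u (real j / 2 ^ l)) ^ 4) \<le> C / 4 ^ l"
    if n: "n \<ge> n0" and l: "(2::real) ^ l \<le> real n powr (3/5)" and j: "j < 2 ^ l" for n l j
  proof -
    have jb: "0 \<le> real j / 2 ^ l" "real j / 2 ^ l < (real j + 1) / 2 ^ l" "(real j + 1) / 2 ^ l \<le> 1"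
      using cell_bounds[OF j] by auto
    have d: "(real j + 1) / 2 ^ l - real j / 2 ^ l = 1 / 2 ^ l" by (simp add: diff_divide_distrib[symmetric])
    have "(LINT u|unit_measure. (emp a n u ((real j + 1) / 2 ^ l) - emp a n u (real j / 2 ^ l)) ^ 4)
       = (LINT u:{0..1}|lborel. ((\<Sum>k\<in>{1..n}. saw (real j / 2 ^ l) ((real j + 1) / 2 ^ l) (a ^ k * u)) / sqrt n) ^ 4)"
      unfolding integral_unit_measure emp_diff[OF jb] ..
    also have "\<dots> \<le> C * ((real j + 1) / 2 ^ l - real j / 2 ^ l)\<^sup>2"
      by (rule C(2)[OF n jb]) (use l in \<open>simp add: d\<close>)
    also have "\<dots> = C / (2 ^ l)\<^sup>2" unfolding d by (simp add: power_divide)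
    also have "((2::real) ^ l)\<^sup>2 = 4 ^ l" by (simp add: power2_eq_square power_mult_distrib[symmetric])
    finally show ?thesis .
  qed
  then show ?thesis using C(1) by blast
qed

text \<open>For \<open>n \<ge> 1\<close>, the finest dyadic level whose cells still have length at
  least \<open>n powr (-3/5)\<close>, the range of the moment bound; its cells are short enough for
  \<open>sqrt n / 2 ^ dyadic_depth n\<close> to vanish in the limit.\<close>

definition dyadic_depth :: "nat \<Rightarrow> nat" where
  "dyadic_depth n = nat \<lfloor>3/5 * log 2 (real n)\<rfloor>"

lemma dyadic_depth_bounds:
  assumes "n \<ge> 1"
  shows "(2::real) ^ dyadic_depth n \<le> real n powr (3/5)" "real n powr (3/5) \<le> 2 * 2 ^ dyadic_depth n"
proof -
  define y where "y = 3/5 * log 2 (real n)"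
  have y: "y \<ge> 0" "2 powr y = real n powr (3/5)" using assms by (auto simp: y_def powr_def log_def)
  have e: "(2::real) ^ dyadic_depth n = 2 powr \<lfloor>y\<rfloor>" using y unfolding dyadic_depth_def y_def[symmetric] by (simp add: powr_real_of_int)
  show "(2::real) ^ dyadic_depth n \<le> real n powr (3/5)" unfolding e y(2)[symmetric] by (intro powr_mono) auto
  have "2 powr y \<le> 2 powr (1 + \<lfloor>y\<rfloor>)" by (intro powr_mono) (auto, linarith)
  then show "real n powr (3/5) \<le> 2 * 2 ^ dyadic_depth n" unfolding e y(2)[symmetric] by (simp add: powr_add)
qed

lemma dyadic_depth_at_top: "filterlim dyadic_depth at_top sequentially"
proof -
  have "filterlim (\<lambda>x. 3/5 * log 2 x) at_top at_top" by real_asymp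
  from filterlim_compose[OF this filterlim_real_sequentially]
  have "filterlim (\<lambda>n. nat \<lfloor>3/5 * log 2 (real n)\<rfloor>) at_top sequentially"
    by (intro filterlim_compose[OF filterlim_nat_sequentially] filterlim_compose[OF filterlim_floor_sequentially])
  then show ?thesis by (simp add: dyadic_depth_def[abs_def])
qed

text \<open>The constants precede \<open>L\<close>, so a level can be fixed afterwards that makes
  the fluctuation within its cells small uniformly in large \<open>n\<close>.\<close>

lemma emp_chaining:
  assumes a: "a > 1"
  shows "\<exists>C n0. C \<ge> 0 \<and> (\<forall>n\<ge>n0. \<forall>L. L \<le> dyadic_depth n \<longrightarrow>
    measure unit_measure {u \<in> {0..1}. \<exists>k<2 ^ dyadic_depth n. \<bar>emp a n u (real k / 2 ^ dyadic_depth n) - emp a n u (real (k div 2 ^ (dyadic_depth n - L)) / 2 ^ L)\<bar> > 10 * (9/10) ^ L} \<le> C * (4/5) ^ L)"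
proof -
  interpret prob_space unit_measure by (rule prob_space_unit_measure)
  obtain C n0 where C: "C \<ge> 0" "\<And>n l j. n \<ge> n0 \<Longrightarrow> (2::real) ^ l \<le> real n powr (3/5) \<Longrightarrow> j < 2 ^ l \<Longrightarrow>
    (LINT u|unit_measure. (emp a n u ((real j + 1) / 2 ^ l) - emp a n u (real j / 2 ^ l)) ^ 4) \<le> C / 4 ^ l"
    using emp_moment[OF a] by blast
  have "measure unit_measure {u \<in> {0..1}. \<exists>k<2 ^ dyadic_depth n. \<bar>emp a n u (real k / 2 ^ dyadic_depth n) - emp a n u (real (k div 2 ^ (dyadic_depth n - L)) / 2 ^ L)\<bar> > 10 * (9/10) ^ L} \<le> 4 * C * (4/5) ^ L"
    if n: "n \<ge> n0" "n \<ge> 1" and L: "L \<le> dyadic_depth n" for n L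
  proof -
    define H where "H = dyadic_depth n"
    define Z where "Z k u = emp a n u (real k / 2 ^ H)" for k u
    have Zl: "Z (j * 2 ^ (H - l)) u = emp a n u (real j / 2 ^ l)" if "l \<le> H" for j l u
    proof -
      have "(2::real) ^ H = 2 ^ (H - l) * 2 ^ l" using that by (simp flip: power_add)
      then show ?thesis by (simp add: Z_def)
    qed
    have inc: "Z ((j + 1) * 2 ^ (H - l)) u - Z (j * 2 ^ (H - l)) u = emp a n u ((real j + 1) / 2 ^ l) - emp a n u (real j / 2 ^ l)" if "l \<le> H" for j l u
      unfolding Zl[OF that] by (simp add: add.commute)
    have "prob {u \<in> space unit_measure. \<exists>k<2 ^ H. \<bar>Z k u - Z (k div 2 ^ (H - L) * 2 ^ (H - L)) u\<bar> > 10 * (9/10) ^ L} \<le> 4 * C * (4/5) ^ L"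
    proof (rule chaining)
      show "random_variable borel (Z k)" for k unfolding Z_def by (rule emp_measurable_unit)
      show "L \<le> H" "C \<ge> 0" using L C by (auto simp: H_def)
      fix l j :: nat assume lj: "L < l" "l \<le> H" "j < 2 ^ l"
      show "integrable unit_measure (\<lambda>u. (Z ((j + 1) * 2 ^ (H - l)) u - Z (j * 2 ^ (H - l)) u) ^ 4)"
        unfolding Z_def by (intro integrable_unit_measure bdd_borel_intros)
      have "(2::real) ^ l \<le> 2 ^ H" using lj by (intro power_increasing) auto
      also have "\<dots> \<le> real n powr (3/5)" unfolding H_def by (rule dyadic_depth_bounds(1)[OF n(2)])
      finally show "expectation (\<lambda>u. (Z ((j + 1) * 2 ^ (H - l)) u - Z (j * 2 ^ (H - l)) u) ^ 4) \<le> C / 4 ^ l"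
        unfolding inc[OF lj(2)] by (rule C(2)[OF n(1) _ lj(3)])
    qed
    then show ?thesis using L by (simp add: Zl H_def[symmetric]) (simp add: Z_def H_def)
  qed
  then show ?thesis using C(1) by (intro exI[of _ "4 * C"] exI[of _ "max n0 1"]) auto
qed

section \<open>From the stochasticity parameter to the empirical process\<close>

lemma eventually_count_le_at_right:
  fixes y :: "nat \<Rightarrow> real"
  assumes "finite S"
  shows "eventually (\<lambda>t'. {k\<in>S. y k < t'} = {k\<in>S. y k \<le> t}) (at_right t)"
proof -
  have "eventually (\<lambda>t'. y k < t' \<longleftrightarrow> y k \<le> t) (at_right t)" for k
  proof (cases "y k \<le> t")
    case True
    have "eventually (\<lambda>t'. t < t') (at_right t)" by (rule eventually_at_right_less)
    then show ?thesis by eventually_elim (use True in auto)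
  next
    case False
    have "eventually (\<lambda>t'. t' \<in> {t<..<y k}) (at_right t)" using False by (intro eventually_at_right_real) auto
    then show ?thesis by eventually_elim (use False in auto)
  qed
  then have "eventually (\<lambda>t'. \<forall>k\<in>S. y k < t' \<longleftrightarrow> y k \<le> t) (at_right t)" using assms by (intro eventually_ball_finite) auto
  then show ?thesis by eventually_elim auto
qed

lemma eventually_count_less_at_left:
  fixes y :: "nat \<Rightarrow> real"
  assumes "finite S"
  shows "eventually (\<lambda>t'. {k\<in>S. y k \<le> t'} = {k\<in>S. y k < t}) (at_left t)"
proof -
  have "eventually (\<lambda>t'. y k \<le> t' \<longleftrightarrow> y k < t) (at_left t)" for k
  proof (cases "y k < t")
    case False
    have "eventually (\<lambda>t'. t' \<in> {t - 1<..<t}) (at_left t)" by (intro eventually_at_left_real) simp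
    then show ?thesis by eventually_elim (use False in auto)
  next
    case True
    have "eventually (\<lambda>t'. t' \<in> {y k<..<t}) (at_left t)" using True by (intro eventually_at_left_real) auto
    then show ?thesis by eventually_elim (use True in auto)
  qed
  then have "eventually (\<lambda>t'. \<forall>k\<in>S. y k \<le> t' \<longleftrightarrow> y k < t) (at_left t)" using assms by (intro eventually_ball_finite) auto
  then show ?thesis by eventually_elim auto
qed

definition clamp01 :: "real \<Rightarrow> real" where "clamp01 t = (if t < 0 then 0 else if t \<le> 1 then t else 1)"

text \<open>As there are finitely many values, the closed count just to the left of \<open>t\<close>
  equals the open count at \<open>t\<close>; letting the point increase to \<open>t\<close>
  transfers the bound. At \<open>t = 0\<close> the open count is 0 by nonnegativity.\<close>

lemma discrepancy_closed_to_open: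
  fixes y :: "nat \<Rightarrow> real"
  assumes S: "finite S" and y: "\<And>k. 0 \<le> y k"
    and le: "\<And>t. \<bar>real (card {k\<in>S. y k \<le> t}) - c * clamp01 t\<bar> \<le> K" and t: "0 \<le> t" "t \<le> 1"
  shows "\<bar>real (card {k\<in>S. y k < t}) - c * t\<bar> \<le> K"
proof (cases "t = 0")
  case True
  have e: "{k\<in>S. y k < t} = {}" using True y by (auto simp: not_less)
  show ?thesis unfolding e using True order.trans[OF abs_ge_zero le[of 0]] by simp
next
  case False
  have "eventually (\<lambda>t'. t' \<in> {0<..<t}) (at_left t)" using False t by (intro eventually_at_left_real) auto
  then have ev: "eventually (\<lambda>t'. \<bar>real (card {k\<in>S. y k < t}) - c * t'\<bar> \<le> K) (at_left t)"
    using eventually_count_less_at_left[OF S, of y t]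
  proof eventually_elim
    case (elim t')
    then show ?case using le[of t'] t by (simp add: clamp01_def)
  qed
  have "((\<lambda>t'. \<bar>real (card {k\<in>S. y k < t}) - c * t'\<bar>) \<longlongrightarrow> \<bar>real (card {k\<in>S. y k < t}) - c * t\<bar>) (at_left t)"
    by (intro tendsto_intros)
  from tendsto_upperbound[OF this ev] show ?thesis by simp
qed

text \<open>The closed count at \<open>t\<close> equals the open count at all points slightly to the
  right, among which there are rational ones, while the linear term changes by less than any given
  \<open>e > 0\<close>. Stating the hypothesis for rational points is what later makes the event a
  countable intersection.\<close>

lemma discrepancy_open_to_closed:
  fixes y :: "nat \<Rightarrow> real"
  assumes S: "finite S" and y: "\<And>k. 0 \<le> y k" "\<And>k. y k < 1" and c: "c = card S"
    and le: "\<And>q. 0 \<le> q \<Longrightarrow> q \<le> 1 \<Longrightarrow> q \<in> \<rat> \<Longrightarrow> \<bar>real (card {k\<in>S. y k < q}) - c * q\<bar> \<le> K"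
  shows "\<bar>real (card {k\<in>S. y k \<le> t}) - c * clamp01 t\<bar> \<le> K"
proof -
  have K: "K \<ge> 0" using order.trans[OF abs_ge_zero le[of 0]] by simp
  consider "t < 0" | "t \<ge> 1" | "0 \<le> t" "t < 1" by linarith
  then show ?thesis
  proof cases
    case 1
    then have e: "{k\<in>S. y k \<le> t} = {}" using y(1) by (auto simp: not_le intro: less_le_trans)
    show ?thesis unfolding e using 1 K by (simp add: clamp01_def)
  next
    case 2
    then have e: "{k\<in>S. y k \<le> t} = S" using y(2) by (auto intro: less_imp_le less_le_trans)
    show ?thesis unfolding e using 2 K c by (simp add: clamp01_def)
  next
    case 3
    have "\<bar>real (card {k\<in>S. y k \<le> t}) - c * t\<bar> \<le> K + e" if e: "e > 0" for e
    proof -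
      obtain d where d: "d > t" "\<And>t'. t < t' \<Longrightarrow> t' < d \<Longrightarrow> {k\<in>S. y k < t'} = {k\<in>S. y k \<le> t}"
        using eventually_count_le_at_right[OF S, of y t] unfolding eventually_at_right_field by blast
      have "t < min (min d 1) (t + e / (real c + 1))" using d 3 e by auto
      then obtain q where q: "q \<in> \<rat>" "t < q" "q < min (min d 1) (t + e / (real c + 1))" using Rats_dense_in_real by blast
      have "\<bar>real (card {k\<in>S. y k \<le> t}) - c * q\<bar> \<le> K" using le[of q] q 3 d(2)[of q] by simp
      moreover have "real c * q - real c * t \<le> e"
      proof -
        have "q - t \<le> e / (real c + 1)" using q by simp
        then have "(real c + 1) * (q - t) \<le> e" by (simp add: field_simps)
        moreover have "real c * (q - t) \<le> (real c + 1) * (q - t)" using q by (intro mult_right_mono) auto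
        ultimately show ?thesis by (simp add: right_diff_distrib)
      qed
      moreover have "real c * q - real c * t \<ge> 0" using q by (simp add: mult_left_mono)
      ultimately show ?thesis by linarith
    qed
    then have "\<bar>real (card {k\<in>S. y k \<le> t}) - c * t\<bar> \<le> K" by (rule field_le_epsilon)
    then show ?thesis using 3 by (simp add: clamp01_def)
  qed
qed

text \<open>Rescaling by \<open>N\<close> turns residues into fractional parts. The supremum is over
  a bounded family, so bounding it is the same as bounding every member.\<close>

lemma geometric_lambda_le_iff:
  assumes N: "N > 0" and n: "n \<ge> 1"
  shows "geometric_lambda a N n (N * u) \<le> X \<longleftrightarrow> (\<forall>t. \<bar>real (card {k\<in>{1..n}. frac (a ^ k * u) \<le> t}) - n * clamp01 t\<bar> \<le> X * sqrt n)"
proof -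
  define y where "y k = reduce_mod N (a ^ k * (N * u))" for k
  have y: "y k = N * frac (a ^ k * u)" for k
  proof -
    have "a ^ k * (N * u) / N = a ^ k * u" using N by simp
    then show ?thesis by (simp add: y_def reduce_mod_def frac_def right_diff_distrib mult_ac)
  qed
  have summand: "\<bar>real (empirical_count y n (N * t)) - theoretical_count (uniform_on N) n (N * t)\<bar> = \<bar>real (card {k\<in>{1..n}. frac (a ^ k * u) \<le> t}) - n * clamp01 t\<bar>" for t
  proof -
    have "empirical_count y n (N * t) = card {k\<in>{1..n}. frac (a ^ k * u) \<le> t}"
      using N by (simp add: empirical_count_def y)
    moreover have "theoretical_count (uniform_on N) n (N * t) = n * clamp01 t"
      using N by (auto simp: theoretical_count_uniform_on[OF N] clamp01_def mult_less_0_iff)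
    ultimately show ?thesis by simp
  qed
  have "geometric_lambda a N n (N * u) \<le> X \<longleftrightarrow> (SUP x. \<bar>real (empirical_count y n x) - theoretical_count (uniform_on N) n x\<bar>) \<le> X * sqrt n"
    using n by (simp add: geometric_lambda_def stochasticity_parameter_def y_def[abs_def] divide_le_eq)
  also have "\<dots> \<longleftrightarrow> (\<forall>x. \<bar>real (empirical_count y n x) - theoretical_count (uniform_on N) n x\<bar> \<le> X * sqrt n)"
    using cSUP_le_iff[OF UNIV_not_empty bdd_above_count_diff[OF N]] by simp
  also have "\<dots> \<longleftrightarrow> (\<forall>t. \<bar>real (empirical_count y n (N * t)) - theoretical_count (uniform_on N) n (N * t)\<bar> \<le> X * sqrt n)"
  proof (intro iffI allI)
    fix x assume "\<forall>t. \<bar>real (empirical_count y n (N * t)) - theoretical_count (uniform_on N) n (N * t)\<bar> \<le> X * sqrt n"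
    from this[rule_format, of "x / N"] show "\<bar>real (empirical_count y n x) - theoretical_count (uniform_on N) n x\<bar> \<le> X * sqrt n" using N by simp
  qed auto
  finally show ?thesis unfolding summand .
qed

lemma emp_le_iff: "n \<ge> 1 \<Longrightarrow> \<bar>emp a n u t\<bar> \<le> X \<longleftrightarrow> \<bar>real (card {k\<in>{1..n}. frac (a ^ k * u) < t}) - n * t\<bar> \<le> X * sqrt n"
  by (simp add: emp_def abs_divide divide_le_eq)

lemma lambda_le_imp_emp_le:
  assumes N: "N > 0" and n: "n \<ge> 1" and le: "geometric_lambda a N n (N * u) \<le> X" and t: "0 \<le> t" "t \<le> 1"
  shows "\<bar>emp a n u t\<bar> \<le> X"
  unfolding emp_le_iff[OF n] 
  using le[unfolded geometric_lambda_le_iff[OF N n]] by (intro discrepancy_closed_to_open t) auto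

lemma emp_le_imp_lambda_le:
  assumes N: "N > 0" and n: "n \<ge> 1" and le: "\<And>q. 0 \<le> q \<Longrightarrow> q \<le> 1 \<Longrightarrow> q \<in> \<rat> \<Longrightarrow> \<bar>emp a n u q\<bar> \<le> X"
  shows "geometric_lambda a N n (N * u) \<le> X"
  unfolding geometric_lambda_le_iff[OF N n]
  using le[unfolded emp_le_iff[OF n]] by (intro allI discrepancy_open_to_closed) (auto simp: frac_lt_1)

text \<open>The count is monotone, hence squeezed between its values at neighbouring grid points,
  and its linear compensator moves by at most \<open>n / M\<close> there; dividing by
  \<open>sqrt n\<close> gives the extra term.\<close>

lemma emp_between_grid:
  assumes M: "M \<ge> 1" and n: "n \<ge> 1" and le: "\<And>k. k \<le> M \<Longrightarrow> \<bar>emp a n u (real k / M)\<bar> \<le> X" and t: "0 \<le> t" "t \<le> 1"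
  shows "\<bar>emp a n u t\<bar> \<le> X + sqrt n / M"
proof -
  define F where "F t = real (card {k\<in>{1..n}. frac (a ^ k * u) < t})" for t
  have Fmono: "F s \<le> F t" if "s \<le> t" for s t
    unfolding F_def using that by (intro of_nat_mono card_mono) auto
  have sq: "sqrt n > 0" "real n = sqrt n * sqrt n" using n by auto
  have eF: "\<bar>F (real k / M) - n * (real k / M)\<bar> \<le> X * sqrt n" if "k \<le> M" for k
    using le[OF that] unfolding emp_le_iff[OF n] F_def .
  have nM: "(X + sqrt n / M) * sqrt n = X * sqrt n + n / M" using sq(2) by (simp add: distrib_right)
  define k where "k = nat \<lfloor>t * M\<rfloor>"
  show ?thesis
  proof (cases "k < M")
    case True
    have k: "real k \<le> t * M" "t * M < real k + 1" using t unfolding k_def by (simp_all add: floor_less_iff)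
    have kt: "real k / M \<le> t" "t \<le> real (Suc k) / M" using k M by (simp_all add: field_simps)
    have d: "real (Suc k) / M = real k / M + 1 / M" by (simp add: add_divide_distrib)
    have "F t \<le> X * sqrt n + n * (real (Suc k) / M)" using eF[of "Suc k"] Fmono[OF kt(2)] True by (simp add: abs_le_iff)
    also have "n * (real (Suc k) / M) \<le> n * t + n / M" using mult_left_mono[OF kt(1), of "real n"] unfolding d distrib_left by simp
    finally have 1: "F t - n * t \<le> X * sqrt n + n / M" by simp
    have "n * (real k / M) - X * sqrt n \<le> F t" using eF[of k] Fmono[OF kt(1)] True by (simp add: abs_le_iff)
    moreover have "n * t \<le> n * (real (Suc k) / M)" using kt(2) by (intro mult_left_mono) auto
    ultimately have 2: "n * t - F t \<le> X * sqrt n + n / M" unfolding d by (simp add: distrib_left)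
    show ?thesis unfolding emp_le_iff[OF n] nM F_def[symmetric] using 1 2 by (simp add: abs_le_iff)
  next
    case False
    have "t * M \<le> M" using t M by (simp add: mult_left_le_one_le)
    moreover have "real k \<le> t * M" using t unfolding k_def by simp
    ultimately have "1 * real M \<le> t * real M" using False by simp
    then have "1 \<le> t" using M by (simp only: mult_le_cancel_right)
    then have "t = real M / real M" using M t by simp
    then have "\<bar>emp a n u t\<bar> \<le> X" using le[OF order_refl] by (simp only:)
    moreover have "0 \<le> sqrt n / M" by simp
    ultimately show ?thesis by (rule add_increasing2[rotated])
  qed
qed

text \<open>Rational times suffice by one-sided limits and keep the event Borel.\<close>

definition lambda_event :: "real \<Rightarrow> nat \<Rightarrow> real \<Rightarrow> real set" where
  "lambda_event a n X = {u \<in> {0..1}. \<forall>q::rat. 0 \<le> q \<longrightarrow> q \<le> 1 \<longrightarrow> \<bar>emp a n u (of_rat q)\<bar> \<le> X}"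

lemma lambda_event_sets [measurable]: "lambda_event a n X \<in> sets borel"
proof -
  have "{u. \<bar>emp a n u t\<bar> \<le> X} \<in> sets borel" for t
    using measurable_sets[OF borel_measurable_abs[OF emp_measurable[of a n t]], of "{..X}"] by (simp add: vimage_def)
  then have "{0..1} \<inter> (\<Inter>q\<in>{q::rat. 0 \<le> q \<and> q \<le> 1}. {u. \<bar>emp a n u (of_rat q)\<bar> \<le> X}) \<in> sets borel"
    by (intro sets.Int sets.countable_INT') (auto intro: exI[of _ 0])
  moreover have "{0..1} \<inter> (\<Inter>q\<in>{q::rat. 0 \<le> q \<and> q \<le> 1}. {u. \<bar>emp a n u (of_rat q)\<bar> \<le> X}) = lambda_event a n X"
    unfolding lambda_event_def by blast
  ultimately show ?thesis by (simp only:)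
qed

lemma lambda_event_iff:
  assumes N: "N > 0" and n: "n \<ge> 1" and u: "0 \<le> u" "u \<le> 1"
  shows "u \<in> lambda_event a n X \<longleftrightarrow> geometric_lambda a N n (N * u) \<le> X"
proof
  assume e: "u \<in> lambda_event a n X"
  show "geometric_lambda a N n (N * u) \<le> X"
  proof (rule emp_le_imp_lambda_le[OF N n])
    fix q :: real assume q: "0 \<le> q" "q \<le> 1" "q \<in> \<rat>"
    then obtain r where r: "q = of_rat r" by (auto elim: Rats_cases)
    then have "0 \<le> r" "r \<le> 1" using q by simp_all
    then show "\<bar>emp a n u q\<bar> \<le> X" using e r by (simp add: lambda_event_def)
  qed
next
  assume "geometric_lambda a N n (N * u) \<le> X"
  then show "u \<in> lambda_event a n X" using u lambda_le_imp_emp_le[OF N n] by (auto simp: lambda_event_def)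
qed

text \<open>The substitution \<open>A = N * u\<close>; the Jacobian \<open>N\<close> cancels against
  the normalisation of \<open>uniform_on N\<close>.\<close>

lemma measure_lambda_event:
  assumes N: "N > 0" and n: "n \<ge> 1"
  shows "measure (uniform_on N) {A \<in> {0..N}. geometric_lambda a N n A \<le> X} = measure unit_measure (lambda_event a n X)"
proof -
  define S where "S = {A \<in> {0..N}. geometric_lambda a N n A \<le> X}"
  have S: "S = {A. A / N \<in> lambda_event a n X}"
  proof (intro set_eqI iffI)
    fix A assume "A \<in> S"
    then show "A \<in> {A. A / N \<in> lambda_event a n X}"
      using lambda_event_iff[OF N n, of "A / N" a X] N by (simp add: S_def)
  next
    fix A assume A: "A \<in> {A. A / N \<in> lambda_event a n X}"
    then have "0 \<le> A / N" "A / N \<le> 1" by (auto simp: lambda_event_def)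
    then have "0 \<le> A" "A \<le> N" using N by (auto simp: field_simps zero_le_divide_iff)
    then show "A \<in> S" using lambda_event_iff[OF N n, of "A / N" a X] A N by (simp add: S_def)
  qed
  have Sm: "S \<in> sets borel"
  proof -
    have "(\<lambda>A. A / N) -` lambda_event a n X \<inter> space borel \<in> sets borel" by (rule measurable_sets[OF _ lambda_event_sets]) measurable
    then show ?thesis by (simp add: S vimage_def)
  qed
  have "measure (uniform_on N) S = measure lebesgue ({0..N} \<inter> S) / measure lebesgue {0..N}"
    unfolding uniform_on_def using N Sm by (intro measure_uniform_measure) (auto simp: emeasure_lborel_Icc)
  also have "{0..N} \<inter> S = S" by (auto simp: S_def)
  also have "measure lebesgue S = measure lborel S" using Sm by simp
  also have "measure lborel S = (LINT A|lborel. indicator S A)" using Sm by simp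
  also have "\<dots> = \<bar>N\<bar> *\<^sub>R (LINT u|lborel. indicator S (0 + N * u))" using N by (intro lborel_integral_real_affine) auto
  also have "(LINT u|lborel. indicator S (0 + N * u)) = (LINT u|lborel. indicator (lambda_event a n X) u :: real)"
    using N by (intro Bochner_Integration.integral_cong refl) (auto simp: S indicator_def)
  also have "\<dots> = measure lborel (lambda_event a n X)" by simp
  also have "measure lborel (lambda_event a n X) = measure unit_measure (lambda_event a n X)"
    unfolding unit_measure_def by (rule measure_restrict_space[symmetric]) (auto simp: lambda_event_def)
  finally show ?thesis using N by (simp add: S_def)
qed

text \<open>At \<open>t = 1 / (2 * n)\<close> the expected count is \<open>1/2\<close>, which no
  integer count can match. This settles all \<open>X \<le> 0\<close>.\<close>

lemma geometric_lambda_pos: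
  assumes N: "N > 0" and n: "n \<ge> 1" shows "geometric_lambda a N n (N * u) > 0"
proof (rule ccontr)
  assume "\<not> ?thesis"
  then have le: "geometric_lambda a N n (N * u) \<le> 0" by simp
  have "\<bar>emp a n u (1 / (2 * n))\<bar> \<le> 0" using n by (intro lambda_le_imp_emp_le[OF N n le]) auto
  then have "\<bar>real (card {k\<in>{1..n}. frac (a ^ k * u) < 1 / (2 * n)}) - n * (1 / (2 * n))\<bar> \<le> 0 * sqrt n"
    unfolding emp_le_iff[OF n] .
  moreover have "real n * (1 / (2 * n)) = 1 / 2" using n by simp
  ultimately have "real (card {k\<in>{1..n}. frac (a ^ k * u) < 1 / (2 * n)}) = 1 / 2" by (simp only: mult_zero_left abs_le_zero_iff right_minus_eq)
  then have "real (2 * card {k\<in>{1..n}. frac (a ^ k * u) < 1 / (2 * n)}) = real 1" by simp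
  then have "2 * card {k\<in>{1..n}. frac (a ^ k * u) < 1 / (2 * n)} = 1" by (simp only: of_nat_eq_iff)
  then show False by presburger
qed

section \<open>Comparison of the two processes and passage to the limit\<close>

lemma emp_bridge_pair:
  assumes a: "a > 1" and irr: "\<And>x::nat. x \<ge> 1 \<Longrightarrow> a ^ x \<notin> \<rat>"
  shows "prob_pair (\<lambda>_. unit_measure) (\<lambda>n. measure_pmf (bridge_pmf n))
      (\<lambda>n i u. emp a n u ((real i + 1) / real (2 ^ L)) - emp a n u (real i / real (2 ^ L)))
      (\<lambda>n i A. bridge_path n ((i + 1) * 2 ^ (n - L)) A - bridge_path n (i * 2 ^ (n - L)) A) (2 ^ L)"
    and "prob_pair (\<lambda>n. measure_pmf (bridge_pmf n)) (\<lambda>_. unit_measure)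
      (\<lambda>n i A. bridge_path n ((i + 1) * 2 ^ (n - L)) A - bridge_path n (i * 2 ^ (n - L)) A)
      (\<lambda>n i u. emp a n u ((real i + 1) / real (2 ^ L)) - emp a n u (real i / real (2 ^ L))) (2 ^ L)"
proof -
  have m: "(2::nat) ^ L > 0" by simp
  note l1 = emp_grid_charfun[OF a irr m] and l2 = bridge_grid_charfun[where L = L]
  have z: "(\<lambda>n. x n - y n) \<longlonglongrightarrow> 0" if "x \<longlonglongrightarrow> v" "y \<longlonglongrightarrow> v" for x y :: "nat \<Rightarrow> real" and v
    using tendsto_diff[OF that] by simp
  have meas: "(\<lambda>u. emp a n u s - emp a n u t) \<in> borel_measurable unit_measure" for n s t 
    by (intro borel_measurable_diff emp_measurable_unit)
  show "prob_pair (\<lambda>_. unit_measure) (\<lambda>n. measure_pmf (bridge_pmf n))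
      (\<lambda>n i u. emp a n u ((real i + 1) / real (2 ^ L)) - emp a n u (real i / real (2 ^ L)))
      (\<lambda>n i A. bridge_path n ((i + 1) * 2 ^ (n - L)) A - bridge_path n (i * 2 ^ (n - L)) A) (2 ^ L)"
    by (rule prob_pair.intro, rule prob_space_unit_measure, rule measure_pmf.prob_space_axioms, rule meas, simp, rule z[OF l1 l2])
  show "prob_pair (\<lambda>n. measure_pmf (bridge_pmf n)) (\<lambda>_. unit_measure)
      (\<lambda>n i A. bridge_path n ((i + 1) * 2 ^ (n - L)) A - bridge_path n (i * 2 ^ (n - L)) A)
      (\<lambda>n i u. emp a n u ((real i + 1) / real (2 ^ L)) - emp a n u (real i / real (2 ^ L))) (2 ^ L)"
    by (rule prob_pair.intro, rule measure_pmf.prob_space_axioms, rule prob_space_unit_measure, simp, rule meas, rule z[OF l2 l1])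
qed

lemma grid_sum_bridge: "(\<Sum>i<j. bridge_path n ((i + 1) * h) A - bridge_path n (i * h) A) = bridge_path n (j * h) A"
  using sum_lessThan_telescope[of "\<lambda>i. bridge_path n (i * h) A" j] by (simp add: bridge_path_def)

text \<open>The comparison of maxima is one-sided, so it is applied in both orders. The tightness it
  asks for comes from the moments of the bridge in the first case and of the empirical process in
  the second, there for \<open>n\<close> so large that
  \<open>2 ^ L \<le> n powr (3/5)\<close>.\<close>

lemma grid_compare:
  assumes a: "a > 1" and irr: "\<And>x::nat. x \<ge> 1 \<Longrightarrow> a ^ x \<notin> \<rat>" and L: "L \<ge> 1" and x: "x > 0" "\<eta> > 0" "\<epsilon> > 0"
  shows "eventually (\<lambda>n. measure unit_measure {u \<in> {0..1}. \<forall>j\<le>2 ^ L. \<bar>emp a n u (real j / real (2 ^ L))\<bar> \<le> x}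
      \<le> measure_pmf.prob (bridge_pmf n) {A. \<forall>j\<le>2 ^ L. \<bar>bridge_path n (j * 2 ^ (n - L)) A\<bar> \<le> x + \<eta>} + \<epsilon>) sequentially"
    and "eventually (\<lambda>n. measure_pmf.prob (bridge_pmf n) {A. \<forall>j\<le>2 ^ L. \<bar>bridge_path n (j * 2 ^ (n - L)) A\<bar> \<le> x}
      \<le> measure unit_measure {u \<in> {0..1}. \<forall>j\<le>2 ^ L. \<bar>emp a n u (real j / real (2 ^ L))\<bar> \<le> x + \<eta>} + \<epsilon>) sequentially"
proof -
  have m: "(2::nat) ^ L > 0" by simp
  note tele = emp_telescope[OF m] grid_sum_bridge
  show "eventually (\<lambda>n. measure unit_measure {u \<in> {0..1}. \<forall>j\<le>2 ^ L. \<bar>emp a n u (real j / real (2 ^ L))\<bar> \<le> x}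
      \<le> measure_pmf.prob (bridge_pmf n) {A. \<forall>j\<le>2 ^ L. \<bar>bridge_path n (j * 2 ^ (n - L)) A\<bar> \<le> x + \<eta>} + \<epsilon>) sequentially"
    using prob_pair.compare_max_partial_sums[OF emp_bridge_pair(1)[OF a irr, of L] integrable_bridge _ x m, of L "6 / 4 ^ L", OF _ bridge_path_moment[OF L]]
    unfolding tele space_unit_measure space_measure_pmf by simp
  obtain C n0 where C: "\<And>n l j. n \<ge> n0 \<Longrightarrow> (2::real) ^ l \<le> real n powr (3/5) \<Longrightarrow> j < 2 ^ l \<Longrightarrow>
    (LINT u|unit_measure. (emp a n u ((real j + 1) / 2 ^ l) - emp a n u (real j / 2 ^ l)) ^ 4) \<le> C / 4 ^ l"
    using emp_moment[OF a] by blast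
  have "eventually (\<lambda>n::nat. (2::real) ^ L \<le> real n powr (3/5)) sequentially"
  proof -
    have "filterlim (\<lambda>x::real. x powr (3/5)) at_top at_top" by real_asymp
    from filterlim_compose[OF this filterlim_real_sequentially] show ?thesis by (simp add: filterlim_at_top)
  qed
  then obtain n1 where n1: "\<And>n. n \<ge> n1 \<Longrightarrow> (2::real) ^ L \<le> real n powr (3/5)" by (auto simp: eventually_sequentially)
  have int: "integrable unit_measure (\<lambda>u. (emp a n u s - emp a n u t) ^ 4)" for n s t
    by (intro integrable_unit_measure bdd_borel_intros)
  have mom: "(LINT u|unit_measure. (emp a n u ((real j + 1) / real (2 ^ L)) - emp a n u (real j / real (2 ^ L))) ^ 4) \<le> C / 4 ^ L"
    if "j < 2 ^ L" "n \<ge> max n0 n1" for n j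
    using C[of n L j] n1[of n] that by simp
  from prob_pair.compare_max_partial_sums[OF emp_bridge_pair(2)[OF a irr, of L] int _ x m, of "max n0 n1" "C / 4 ^ L", OF _ mom]
  show "eventually (\<lambda>n. measure_pmf.prob (bridge_pmf n) {A. \<forall>j\<le>2 ^ L. \<bar>bridge_path n (j * 2 ^ (n - L)) A\<bar> \<le> x}
      \<le> measure unit_measure {u \<in> {0..1}. \<forall>j\<le>2 ^ L. \<bar>emp a n u (real j / real (2 ^ L))\<bar> \<le> x + \<eta>} + \<epsilon>) sequentially"
    unfolding tele by simp
qed

text \<open>Outside the chaining event every path value is within \<open>10 * (9/10) ^ L\<close> of
  the value at the coarse grid point below it; the right end \<open>2 ^ n\<close> lies on the grid
  itself.\<close>

lemma bridge_grid_le_path: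
  assumes Ln: "L \<le> n"
  shows "measure_pmf.prob (bridge_pmf n) {A. \<forall>j\<le>2 ^ L. \<bar>bridge_path n (j * 2 ^ (n - L)) A\<bar> \<le> x}
    \<le> measure_pmf.prob (bridge_pmf n) {A. \<forall>k\<le>2 ^ n. \<bar>bridge_path n k A\<bar> \<le> x + 10 * (9/10) ^ L} + 24 * (4/5) ^ L"
proof -
  let ?G = "{A. \<forall>j\<le>2 ^ L. \<bar>bridge_path n (j * 2 ^ (n - L)) A\<bar> \<le> x}"
  let ?P = "{A. \<forall>k\<le>2 ^ n. \<bar>bridge_path n k A\<bar> \<le> x + 10 * (9/10) ^ L}"
  let ?D = "{A. \<exists>k<2 ^ n. \<bar>bridge_path n k A - bridge_path n (k div 2 ^ (n - L) * 2 ^ (n - L)) A\<bar> > 10 * (9/10) ^ L}"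
  have pw: "(2::nat) ^ n = 2 ^ L * 2 ^ (n - L)" using Ln by (simp flip: power_add)
  have "?G \<subseteq> ?P \<union> ?D"
  proof
    fix A assume A: "A \<in> ?G"
    show "A \<in> ?P \<union> ?D"
    proof (rule ccontr)
      assume neg: "A \<notin> ?P \<union> ?D"
      then obtain k where k: "k \<le> 2 ^ n" "\<bar>bridge_path n k A\<bar> > x + 10 * (9/10) ^ L" by (auto simp: not_le)
      show False
      proof (cases "k = 2 ^ n")
        case True
        then have "\<bar>bridge_path n k A\<bar> \<le> x" using A pw by auto
        moreover have "(0::real) \<le> 10 * (9/10) ^ L" by simp
        ultimately show False using k(2) by linarith
      next
        case False
        then have kn: "k < 2 ^ n" using k by simp
        then have "k div 2 ^ (n - L) \<le> 2 ^ L" unfolding pw by (intro less_imp_le less_mult_imp_div_less)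
        then have 1: "\<bar>bridge_path n (k div 2 ^ (n - L) * 2 ^ (n - L)) A\<bar> \<le> x" using A by auto
        have 2: "\<bar>bridge_path n k A - bridge_path n (k div 2 ^ (n - L) * 2 ^ (n - L)) A\<bar> \<le> 10 * (9/10) ^ L"
        proof (rule ccontr)
          assume "\<not> ?thesis"
          then have "A \<in> ?D" using kn by (intro CollectI exI[of _ k] conjI) (auto simp: not_le)
          then show False using neg by blast
        qed
        show False using 1 2 k(2) by linarith
      qed
    qed
  qed
  then have "measure_pmf.prob (bridge_pmf n) ?G \<le> measure_pmf.prob (bridge_pmf n) (?P \<union> ?D)"
    by (intro measure_pmf.finite_measure_mono) auto
  also have "\<dots> \<le> measure_pmf.prob (bridge_pmf n) ?P + measure_pmf.prob (bridge_pmf n) ?D" by (intro measure_Un_le) auto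
  also have "measure_pmf.prob (bridge_pmf n) ?D \<le> 24 * (4/5) ^ L" by (rule bridge_chaining[OF Ln])
  finally show ?thesis by simp
qed

text \<open>Two passages: chaining leads from level \<open>L\<close> to level
  \<open>dyadic_depth n\<close>, and monotonicity covers the points between the finest grid points
  at cost \<open>sqrt n / 2 ^ dyadic_depth n\<close>.\<close>

lemma emp_grid_le_lambda:
  assumes n: "n \<ge> 1" and L: "L \<le> dyadic_depth n"
    and fl: "measure unit_measure {u \<in> {0..1}. \<exists>k<2 ^ dyadic_depth n. \<bar>emp a n u (real k / 2 ^ dyadic_depth n) - emp a n u (real (k div 2 ^ (dyadic_depth n - L)) / 2 ^ L)\<bar> > 10 * (9/10) ^ L} \<le> e"
  shows "measure unit_measure {u \<in> {0..1}. \<forall>j\<le>2 ^ L. \<bar>emp a n u (real j / real (2 ^ L))\<bar> \<le> x}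
    \<le> measure unit_measure (lambda_event a n (x + 10 * (9/10) ^ L + sqrt n / 2 ^ dyadic_depth n)) + e"
proof -
  interpret prob_space unit_measure by (rule prob_space_unit_measure)
  define H where "H = dyadic_depth n"
  let ?G = "{u \<in> {0..1}. \<forall>j\<le>2 ^ L. \<bar>emp a n u (real j / real (2 ^ L))\<bar> \<le> x}"
  let ?P = "lambda_event a n (x + 10 * (9/10) ^ L + sqrt n / 2 ^ H)"
  let ?D = "{u \<in> {0..1}. \<exists>k<2 ^ H. \<bar>emp a n u (real k / 2 ^ H) - emp a n u (real (k div 2 ^ (H - L)) / 2 ^ L)\<bar> > 10 * (9/10) ^ L}"
  have LH: "L \<le> H" using L by (simp add: H_def)
  have pw: "(2::nat) ^ H = 2 ^ L * 2 ^ (H - L)" using LH by (simp flip: power_add)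
  have "{u \<in> space unit_measure. \<exists>k<2 ^ H. \<bar>emp a n u (real k / 2 ^ H) - emp a n u (real (k div 2 ^ (H - L)) / 2 ^ L)\<bar> > 10 * (9/10) ^ L} \<in> events"
    by measurable
  then have Dm: "?D \<in> events" by simp
  have Pm: "?P \<in> events" unfolding unit_measure_def by (subst sets_restrict_space_iff) (auto simp: lambda_event_def)
  have "?G \<subseteq> ?P \<union> ?D"
  proof
    fix u assume u: "u \<in> ?G"
    show "u \<in> ?P \<union> ?D"
    proof (rule ccontr)
      assume neg: "u \<notin> ?P \<union> ?D"
      have grid: "\<bar>emp a n u (real k / real (2 ^ H))\<bar> \<le> x + 10 * (9/10) ^ L" if k: "k \<le> 2 ^ H" for k
      proof (cases "k = 2 ^ H")
        case True
        then have "real k / real (2 ^ H) = real (2 ^ L) / real (2 ^ L)" by simp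
        then have "\<bar>emp a n u (real k / real (2 ^ H))\<bar> \<le> x" using u by auto
        moreover have "(0::real) \<le> 10 * (9/10) ^ L" by simp
        ultimately show ?thesis by linarith
      next
        case False
        then have kn: "k < 2 ^ H" using k by simp
        then have "k div 2 ^ (H - L) \<le> 2 ^ L" unfolding pw by (intro less_imp_le less_mult_imp_div_less)
        then have "\<bar>emp a n u (real (k div 2 ^ (H - L)) / real (2 ^ L))\<bar> \<le> x" using u by blast
        then have 1: "\<bar>emp a n u (real (k div 2 ^ (H - L)) / 2 ^ L)\<bar> \<le> x" by simp
        have 2: "\<bar>emp a n u (real k / 2 ^ H) - emp a n u (real (k div 2 ^ (H - L)) / 2 ^ L)\<bar> \<le> 10 * (9/10) ^ L"
        proof (rule ccontr)
          assume "\<not> ?thesis"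
          then have "u \<in> ?D" using kn u by (intro CollectI exI[of _ k] conjI) (auto simp: not_le)
          then show False using neg by blast
        qed
        have "\<bar>emp a n u (real k / 2 ^ H)\<bar> \<le> x + 10 * (9/10) ^ L" using 1 2 by linarith
        then show ?thesis by simp
      qed
      have "\<bar>emp a n u t\<bar> \<le> x + 10 * (9/10) ^ L + sqrt n / real (2 ^ H)" if "0 \<le> t" "t \<le> 1" for t
        by (rule emp_between_grid[OF _ n grid that]) simp_all
      then have "u \<in> ?P" using u by (auto simp: lambda_event_def)
      then show False using neg by simp
    qed
  qed
  then have "prob ?G \<le> prob (?P \<union> ?D)" using Pm Dm by (intro finite_measure_mono) auto
  also have "\<dots> \<le> prob ?P + prob ?D" using Pm Dm by (intro measure_Un_le)
  finally show ?thesis using fl by (simp add: H_def)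
qed

lemma lambda_event_mono: "x \<le> y \<Longrightarrow> measure unit_measure (lambda_event a n x) \<le> measure unit_measure (lambda_event a n y)"
proof -
  assume xy: "x \<le> y"
  interpret prob_space unit_measure by (rule prob_space_unit_measure)
  have "lambda_event a n y \<in> events" unfolding unit_measure_def by (subst sets_restrict_space_iff) (auto simp: lambda_event_def)
  then show ?thesis using xy by (intro finite_measure_mono) (auto simp: lambda_event_def intro: order.trans)
qed

lemma lambda_event_le_grid:
  "measure unit_measure (lambda_event a n x) \<le> measure unit_measure {u \<in> {0..1}. \<forall>j\<le>2 ^ L. \<bar>emp a n u (real j / real (2 ^ L))\<bar> \<le> x}"
proof -
  interpret prob_space unit_measure by (rule prob_space_unit_measure)
  have "{u \<in> space unit_measure. \<forall>j\<le>2 ^ L. \<bar>emp a n u (real j / real (2 ^ L))\<bar> \<le> x} \<in> events" by measurable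
  moreover have "lambda_event a n x \<subseteq> {u \<in> {0..1}. \<forall>j\<le>2 ^ L. \<bar>emp a n u (real j / real (2 ^ L))\<bar> \<le> x}"
  proof
    fix u assume u: "u \<in> lambda_event a n x"
    have "\<bar>emp a n u (real j / real (2 ^ L))\<bar> \<le> x" if j: "j \<le> 2 ^ L" for j
    proof -
      have "rat_of_nat j \<le> of_nat (2 ^ L)" using j of_nat_mono by blast
      then have "0 \<le> rat_of_nat j / of_nat (2 ^ L)" "rat_of_nat j / of_nat (2 ^ L) \<le> 1" by simp_all
      then have "\<bar>emp a n u (of_rat (of_nat j / of_nat (2 ^ L)))\<bar> \<le> x" using u unfolding lambda_event_def by blast
      then show ?thesis by (simp add: of_rat_divide of_rat_power)
    qed
    moreover have "u \<in> {0..1}" using u by (simp add: lambda_event_def)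
    ultimately show "u \<in> {u \<in> {0..1}. \<forall>j\<le>2 ^ L. \<bar>emp a n u (real j / real (2 ^ L))\<bar> \<le> x}" by blast
  qed
  ultimately show ?thesis by (intro finite_measure_mono) auto
qed

text \<open>With \<open>L\<close> fixed first, chaining makes the discretisation error small
  uniformly in large \<open>n\<close>; for that \<open>L\<close> the finite-dimensional comparison
  holds eventually. Both bounds connect the empirical event with the bridge maximum, whose limit is
  known, through the grid of level \<open>L\<close>.\<close>

lemma lambda_event_limit:
  assumes a: "a > 1" and irr: "\<And>x::nat. x \<ge> 1 \<Longrightarrow> a ^ x \<notin> \<rat>" and X: "X > 0"
  shows "(\<lambda>n. measure unit_measure (lambda_event a n X)) \<longlonglongrightarrow> kolmogorov_series X"
proof (rule LIMSEQ_I)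
  fix r :: real assume r: "0 < r"
  \<comment> \<open>Each bound loses at most \<open>\<epsilon>\<close> four times: in the
    comparison, in chaining, in the limit of the bridge maximum and in the continuity of the
    series.\<close>
  define \<epsilon> where "\<epsilon> = r / 5"
  have e: "\<epsilon> > 0" using r by (simp add: \<epsilon>_def)
  obtain C n0 where C: "C \<ge> 0" "\<And>n L. n \<ge> n0 \<Longrightarrow> L \<le> dyadic_depth n \<Longrightarrow>
    measure unit_measure {u \<in> {0..1}. \<exists>k<2 ^ dyadic_depth n. \<bar>emp a n u (real k / 2 ^ dyadic_depth n) - emp a n u (real (k div 2 ^ (dyadic_depth n - L)) / 2 ^ L)\<bar> > 10 * (9/10) ^ L} \<le> C * (4/5) ^ L"
    using emp_chaining[OF a] by blast
  obtain \<gamma>0 where g0: "\<gamma>0 > 0" "\<And>y. \<bar>y - X\<bar> < \<gamma>0 \<Longrightarrow> \<bar>kolmogorov_series y - kolmogorov_series X\<bar> < \<epsilon>"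
    using isCont_kolmogorov_series[OF X] e unfolding continuous_at_eps_delta dist_real_def by blast
  \<comment> \<open>Below \<open>\<gamma>0\<close> for continuity and below \<open>X\<close> so that
    the lowered threshold \<open>X - \<gamma> / 2\<close> stays positive, where the limit of the
    bridge maximum is available.\<close>
  define \<gamma> where "\<gamma> = min \<gamma>0 X / 2"
  have g: "\<gamma> > 0" "\<gamma> < \<gamma>0" "\<gamma> < X" using g0 X by (auto simp: \<gamma>_def min_def)
  have small: "eventually (\<lambda>L. c * q ^ L < d) sequentially" if "0 \<le> q" "q < 1" "d > 0" for c q d :: real
  proof (rule order_tendstoD(2))
    show "(\<lambda>L. c * q ^ L) \<longlonglongrightarrow> c * 0" using that by (intro tendsto_mult tendsto_const LIMSEQ_power_zero) simp
  qed (use that in simp)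
  have "eventually (\<lambda>L. 10 * (9/10) ^ L < \<gamma> / 8) sequentially" "eventually (\<lambda>L. 24 * (4/5) ^ L < \<epsilon>) sequentially" "eventually (\<lambda>L. C * (4/5) ^ L < \<epsilon>) sequentially"
    by (intro small; use g e in simp)+
  then have "eventually (\<lambda>L. 10 * (9/10) ^ L < \<gamma> / 8 \<and> 24 * (4/5) ^ L < \<epsilon> \<and> C * (4/5) ^ L < \<epsilon> \<and> L \<ge> 1) sequentially"
    using eventually_ge_at_top[of 1] by eventually_elim blast
  then obtain L where L: "10 * (9/10) ^ L < \<gamma> / 8" "24 * (4/5) ^ L < \<epsilon>" "C * (4/5) ^ L < \<epsilon>" "L \<ge> 1"
    by (auto simp: eventually_sequentially)
  have x1: "X - \<gamma> / 2 > 0" "\<gamma> / 4 > 0" using g by auto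
  have P: "\<And>x. x > 0 \<Longrightarrow> eventually (\<lambda>n. \<bar>measure_pmf.prob (bridge_pmf n) {A. \<forall>k\<le>2 ^ n. \<bar>bridge_path n k A\<bar> \<le> x} - kolmogorov_series x\<bar> < \<epsilon>) sequentially"
    using bridge_max_limit[THEN tendstoD, OF _ e] by (simp add: dist_real_def)
  have s0: "eventually (\<lambda>n. sqrt n / 2 ^ dyadic_depth n < \<gamma> / 8) sequentially"
  proof -
    have "((\<lambda>x::real. 2 * sqrt x / x powr (3/5)) \<longlongrightarrow> 0) at_top" by real_asymp
    from order_tendstoD(2)[OF filterlim_compose[OF this filterlim_real_sequentially], of "\<gamma> / 8"]
    have "eventually (\<lambda>n. 2 * sqrt (real n) / real n powr (3/5) < \<gamma> / 8) sequentially" using g by simp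
    then show ?thesis using eventually_ge_at_top[of 1]
    proof eventually_elim
      case (elim n)
      have "sqrt n / 2 ^ dyadic_depth n = 2 * sqrt n / (2 * 2 ^ dyadic_depth n)" by simp
      also have "\<dots> \<le> 2 * sqrt n / real n powr (3/5)"
        using dyadic_depth_bounds(2)[OF elim(2)] elim(2) by (intro divide_left_mono) auto
      finally show ?case using elim(1) by (rule le_less_trans)
    qed
  qed
  have dd: "eventually (\<lambda>n. L \<le> dyadic_depth n) sequentially" using dyadic_depth_at_top by (simp add: filterlim_at_top)
  have y: "X + \<gamma> / 4 + 10 * (9/10) ^ L > 0" "\<bar>X + \<gamma> / 4 + 10 * (9/10) ^ L - X\<bar> < \<gamma>0" "\<bar>X - \<gamma> / 2 - X\<bar> < \<gamma>0" using g X L(1) by (auto simp: add_pos_nonneg)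
  have gc: "eventually (\<lambda>n. measure unit_measure {u \<in> {0..1}. \<forall>j\<le>2 ^ L. \<bar>emp a n u (real j / real (2 ^ L))\<bar> \<le> X}
      \<le> measure_pmf.prob (bridge_pmf n) {A. \<forall>j\<le>2 ^ L. \<bar>bridge_path n (j * 2 ^ (n - L)) A\<bar> \<le> X + \<gamma> / 4} + \<epsilon>) sequentially"
    "eventually (\<lambda>n. measure_pmf.prob (bridge_pmf n) {A. \<forall>j\<le>2 ^ L. \<bar>bridge_path n (j * 2 ^ (n - L)) A\<bar> \<le> X - \<gamma> / 2}
      \<le> measure unit_measure {u \<in> {0..1}. \<forall>j\<le>2 ^ L. \<bar>emp a n u (real j / real (2 ^ L))\<bar> \<le> X - \<gamma> / 2 + \<gamma> / 4} + \<epsilon>) sequentially"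
    by (rule grid_compare(1)[OF a irr L(4) X x1(2) e], assumption) (rule grid_compare(2)[OF a irr L(4) x1 e])
  have "eventually (\<lambda>n. norm (measure unit_measure (lambda_event a n X) - kolmogorov_series X) < r) sequentially"
    using gc P[OF y(1)] P[OF x1(1)]
      s0 dd eventually_ge_at_top[of "max 1 (max n0 L)"]
  proof eventually_elim
    case (elim n)
    have n: "n \<ge> 1" "n \<ge> n0" "L \<le> n" using elim(7) by auto
    let ?M = "\<lambda>x. measure unit_measure (lambda_event a n x)"
    let ?B = "\<lambda>x. measure_pmf.prob (bridge_pmf n) {A. \<forall>k\<le>2 ^ n. \<bar>bridge_path n k A\<bar> \<le> x}"
    have up: "?M X \<le> kolmogorov_series X + 4 * \<epsilon>"
      using lambda_event_le_grid[of a n X L] elim(1) bridge_grid_le_path[OF n(3), of "X + \<gamma> / 4"] L(2) elim(3) g0(2)[OF y(2)]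
      by linarith
    have "?B (X - \<gamma> / 2) \<le> measure_pmf.prob (bridge_pmf n) {A. \<forall>j\<le>2 ^ L. \<bar>bridge_path n (j * 2 ^ (n - L)) A\<bar> \<le> X - \<gamma> / 2}"
    proof (rule measure_pmf.finite_measure_mono)
      have "j * 2 ^ (n - L) \<le> 2 ^ n" if "j \<le> 2 ^ L" for j :: nat
      proof -
        have "j * 2 ^ (n - L) \<le> 2 ^ L * 2 ^ (n - L)" using that by (rule mult_right_mono) simp
        then show ?thesis using n(3) by (simp flip: power_add)
      qed
      then show "{A. \<forall>k\<le>2 ^ n. \<bar>bridge_path n k A\<bar> \<le> X - \<gamma> / 2} \<subseteq> {A. \<forall>j\<le>2 ^ L. \<bar>bridge_path n (j * 2 ^ (n - L)) A\<bar> \<le> X - \<gamma> / 2}" by blast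
    qed simp
    moreover note elim(2)
    moreover have "measure unit_measure {u \<in> {0..1}. \<forall>j\<le>2 ^ L. \<bar>emp a n u (real j / real (2 ^ L))\<bar> \<le> X - \<gamma> / 2 + \<gamma> / 4}
       \<le> ?M (X - \<gamma> / 2 + \<gamma> / 4 + 10 * (9/10) ^ L + sqrt n / 2 ^ dyadic_depth n) + C * (4/5) ^ L"
      by (rule emp_grid_le_lambda[OF n(1) elim(6) C(2)[OF n(2) elim(6)]])
    \<comment> \<open>The thresholds add up: \<open>- \<gamma> / 2 + \<gamma> / 4\<close> after the
      comparison, and less than \<open>\<gamma> / 8\<close> each for chaining and for the
      interpolation between grid points.\<close>
    moreover have "?M (X - \<gamma> / 2 + \<gamma> / 4 + 10 * (9/10) ^ L + sqrt n / 2 ^ dyadic_depth n) \<le> ?M X"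
      by (rule lambda_event_mono) (use L(1) elim(5) in linarith)
    ultimately have lo: "kolmogorov_series X - 4 * \<epsilon> \<le> ?M X" using elim(4) g0(2)[OF y(3)] L(3) by linarith
    show ?case using up lo r unfolding real_norm_def \<epsilon>_def by linarith
  qed
  then show "\<exists>no. \<forall>n\<ge>no. norm (measure unit_measure (lambda_event a n X) - kolmogorov_series X) < r"
    by (simp add: eventually_sequentially)
qed

theorem theorem1:
  fixes a N :: real
  assumes "a > 1"
    and "\<And>x::nat. x \<ge> 1 \<Longrightarrow> a ^ x \<notin> \<rat>"
    and "N > 0"
  shows "\<forall>X::real.
    (\<lambda>n. measure (uniform_on N) {A \<in> {0..N}. geometric_lambda a N n A \<le> X})
      \<longlonglongrightarrow> kolmogorov_cdf X"
proof
  fix X :: real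
  show "(\<lambda>n. measure (uniform_on N) {A \<in> {0..N}. geometric_lambda a N n A \<le> X}) \<longlonglongrightarrow> kolmogorov_cdf X"
  proof (cases "X > 0")
    case True
    have "eventually (\<lambda>n. measure unit_measure (lambda_event a n X) = measure (uniform_on N) {A \<in> {0..N}. geometric_lambda a N n A \<le> X}) sequentially"
      using eventually_ge_at_top[of 1] by eventually_elim (rule measure_lambda_event[OF assms(3), symmetric])
    with lambda_event_limit[OF assms(1,2) True] show ?thesis
      unfolding kolmogorov_cdf_eq[OF True, symmetric] by (rule Lim_transform_eventually)
  next
    case False
    have "eventually (\<lambda>n. 0 = measure (uniform_on N) {A \<in> {0..N}. geometric_lambda a N n A \<le> X}) sequentially"
      using eventually_ge_at_top[of 1]
    proof eventually_elim
      case (elim n)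
      have "\<not> geometric_lambda a N n A \<le> X" for A
        using geometric_lambda_pos[OF assms(3) elim, of a "A / N"] False assms(3) by simp
      then show ?case by simp
    qed
    then have "(\<lambda>n. measure (uniform_on N) {A \<in> {0..N}. geometric_lambda a N n A \<le> X}) \<longlonglongrightarrow> 0"
      by (rule Lim_transform_eventually[OF tendsto_const])
    moreover have "kolmogorov_cdf X = 0" using False by (simp add: kolmogorov_cdf_def)
    ultimately show ?thesis by (simp only:)
  qed
qed

end
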